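(* Let $\epsilon\in\{-1,1\}$ be fixed and let $\mathcal L$ be one of the classes $\bar{\mathcal K}$, $\mathcal K^\epsilon$, $\bar{\mathcal F}$ and $\mathcal F^\epsilon$. Set $\breve\epsilon=1$ for $\mathcal L\in\{\bar{\mathcal K},\mathcal K^\epsilon\}$ and $\breve\epsilon=-1$ for $\mathcal L\in\{\bar{\mathcal F},\mathcal F^\epsilon\}$. A complete list of $G^\sim_{\mathcal L}$-inequivalent essential Lie-symmetry extensions of the essential kernel algebra $\mathfrak g^{\cap\rm ess}_{\mathcal L}=\langle u\partial_u\rangle$ of $\mathcal L$ is exhausted by the cases with $A=\epsilon$ if $\mathcal L\in\{\bar{\mathcal K},\bar{\mathcal F}\}$ and \[ B=2\epsilon\breve\epsilon\,\frac{U_x}{U}, \] where the function $U$ of $(t,x)$ runs through a complete set of $G^{\rm ess}_{\mathcal P^{\epsilon\breve\epsilon}_{\breve\epsilon C}}$-inequivalent nonzero solutions of the equations $\mathcal P^{\epsilon\breve\epsilon}_{\breve\epsilon C}$: $U_t=\epsilon\breve\epsilon U_{xx}+\breve\epsilon CU$, and the potential $C$ runs through the following values: 1. $C=C(x)$, a general time-independent potential considered up to the transformations $\tilde x=c_1x+c_3$, $\tilde C=c_1^{-2}(C+c_5)$ with constants $c_1\ne0$, $c_3$, $c_5$; here "general" means that for any $\alpha,\beta,\gamma\in\mathbb R$ and $\mu\in\mathbb R\setminus\{0\}$, $C(x)\neq\mu(x+\beta)^{-2}+\alpha(x+\beta)^2+\gamma$ and $C(x)\neq\alpha x^2+\beta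 x+\gamma$; 2. $C=\mu x^{-2}$ with $\mu\in\mathbb R\setminus\{0\}$; 3. $C=0$. Depending on $C$, basis vector fields of the essential Lie invariance algebras besides $u\partial_u$ are the following: 1. $C=C(x)$: $\hat P^t_U$; 2. $C=\mu x^{-2}$: $\hat P^t_U$, $\hat D_U$, $\hat\Pi_U$; 3. $C=0$: $\hat P^t_U$, $\hat D_U$, $\hat\Pi_U$, $\hat P^x_U$, $\hat G_U$. Here \[ \hat P^t_U:=\partial_t-R(t,x)u\partial_u,\qquad \hat D_U:=2t\partial_t+x\partial_x-\big(2tR(t,x)+\tfrac12\epsilon xB(t,x)\big)u\partial_u, \] \[ \hat\Pi_U:=4t^2\partial_t+4tx\partial_x-\big(\epsilon x^2+2t+4t^2R(t,x)+2\epsilon txB(t,x)\big)u\partial_u, \] \[ \hat P^x_U:=\partial_x-\tfrac12\epsilon B(t,x)u\partial_u,\qquad \hat G_U:=2t\partial_x-\epsilon\big(x+tB(t,x)\big)u\partial_u, \] and $R:=\breve\epsilon U_t/U$.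
   Context: Everything is real, smooth and local; $f\ne0$ for a function $f$ means that $f$ vanishes nowhere on its domain. Classes of equations for $u(t,x)$: $\bar{\mathcal K}$: $u_t=A(t,x)u_{xx}+B(t,x)u_x$ with $A\neq0$ (Kolmogorov equations, arbitrary elements $(A,B)$); $\mathcal K^\epsilon$: $u_t=\epsilon u_{xx}+B(t,x)u_x$ (arbitrary element $B$); $\bar{\mathcal F}$: $u_t=(A(t,x)u)_{xx}+(B(t,x)u)_x$ with $A\ne0$ (Fokker--Planck equations, arbitrary elements $(A,B)$); $\mathcal F^\epsilon$: $u_t=\epsilon u_{xx}+(B(t,x)u)_x$ (arbitrary element $B$); $\mathcal P^{\epsilon}$: $\mathcal P^\epsilon_C$: $u_t=\epsilon u_{xx}+C(t,x)u$ (heat equations with potentials), for either sign $\epsilon$. Equivalence groups. $G^\sim_{\bar{\mathcal K}}$: $\tilde t=T(t)$, $\tilde x=X(t,x)$, $\tilde u=c_1u+c_2$, $\tilde A=\frac{X_x^2}{T_t}A$, $\tilde B=\frac{X_x}{T_t}B-\frac{X_t-X_{xx}A}{T_t}$, with $T_tX_x\ne0$, $c_1\neq0$. $G^\sim_{\bar{\mathcal F}}$: $\tilde t=T(t)$, $\tilde x=X(t,x)$, $\tilde u=\frac{c_1}{X_x}u$, $\tilde A=\frac{X_x^2}{T_t}A$, $\tilde B=\frac{X_x}{T_t}B-\frac{X_t+X_{xx}A}{T_t}$, with $T_tX_x\ne0$, $c_1\ne0$. $G^\sim_{\mathcal K^\epsilon}$ and $G^\sim_{\mathcal F^\epsilon}$: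 $\tilde t=T(t)$, $\tilde x=X^1(t)x+X^0(t)$, $\tilde B=\frac1{X^1}B-\frac{X^1_tx+X^0_t}{(X^1)^2}$ with $X^1\neq0$, $T_t=(X^1)^2$, and $\tilde u=c_1u+c_2$ for $\mathcal K^\epsilon$ and $\tilde u=\frac{c_1}{X^1}u$ for $\mathcal F^\epsilon$, $c_1\ne0$. Two values of the arbitrary-element tuple of $\mathcal L$ (or the corresponding equations) are $G^\sim_{\mathcal L}$-equivalent if an element of $G^\sim_{\mathcal L}$ maps one to the other. For a linear homogeneous equation $E$ from any of these classes, the maximal Lie invariance algebra is $\mathfrak g_E=\mathfrak g_E^{\rm ess}\oplus\mathfrak g_E^{\rm lin}$ (direct sum of vector spaces), where $\mathfrak g_E^{\rm lin}=\{f(t,x)\partial_u\mid f\text{ solves }E\}$ is an ideal and the essential Lie invariance algebra $\mathfrak g_E^{\rm ess}$ is the subalgebra of vector fields in $\mathfrak g_E$ of the form $\tau(t)\partial_t+\xi(t,x)\partial_x+\eta(t,x)u\partial_u$. The essential kernel algebra $\mathfrak g^{\cap\rm ess}_{\mathcal L}$ is the intersection of $\mathfrak g_E^{\rm ess}$ over all $E\in\mathcal L$. An essential Lie-symmetry extension in $\mathcal L$ is a value of the arbitrary-element tuple for which $\mathfrak g_E^{\rm ess}$ strictly contains $\mathfrak g^{\cap\rm ess}_{\mathcal L}$. $G^{\rm ess}_{\mathcal P^{\epsilon}_{C}}$ denotes the essential point symmetry group of $\mathcal P^\epsilon_C$: the point symmetry transformations of $\mathcal P^\epsilon_C$ of the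 form $\tilde t=T(t)$, $\tilde x=X^1(t)x+X^0(t)$, $\tilde u=V(t)\exp\left(-\frac{\epsilon X^1_t}{4X^1}x^2-\frac{\epsilon X^0_t}{2X^1}x\right)u$ with $T_t=(X^1)^2$, $X^1V\ne0$. Two solutions are equivalent with respect to this group if one of its elements maps one to the other. *)

theory Defs
  imports "HOL-Analysis.Analysis" "HOL-Library.Function_Algebras"
begin

instantiation "fun" :: (type, real_vector) real_vector
begin

definition scaleR_fun :: "real \<Rightarrow> ('a \<Rightarrow> 'b) \<Rightarrow> 'a \<Rightarrow> 'b"
  where "scaleR_fun c f = (\<lambda>x. c *\<^sub>R f x)"

instance
  by standard (auto simp: scaleR_fun_def fun_eq_iff scaleR_add_right scaleR_add_left)

end

primrec Ck_on :: "nat \<Rightarrow> 'a::real_normed_vector set \<Rightarrow> ('a \<Rightarrow> 'b::real_normed_vector) \<Rightarrow> bool"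
  where
    "Ck_on 0 S f \<longleftrightarrow> continuous_on S f"
  | "Ck_on (Suc k) S f \<longleftrightarrow> (\<forall>x\<in>S. f differentiable at x) \<and>
       (\<forall>v. Ck_on k S (\<lambda>x. frechet_derivative f (at x) v))"

text \<open>Intended for open sets only.\<close>
definition smooth_on :: "'a::real_normed_vector set \<Rightarrow> ('a \<Rightarrow> 'b::real_normed_vector) \<Rightarrow> bool"
  where "smooth_on S f \<longleftrightarrow> (\<forall>k. Ck_on k S f)"

type_synonym dom = "(real \<times> real) set"
type_synonym fld = "real \<times> real \<Rightarrow> real"

definition Dt :: "fld \<Rightarrow> fld"
  where "Dt f = (\<lambda>(t, x). deriv (\<lambda>s. f (s, x)) t)"

definition Dx :: "fld \<Rightarrow> fld"
  where "Dx f = (\<lambda>(t, x). deriv (\<lambda>y. f (t, y)) x)"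

text \<open>
  Functions are considered on these domains. A local transformation
  \<open>(t, x) \<mapsto> (T t, X (t, x))\<close> with \<open>T\<^sub>t X\<^sub>x \<noteq> 0\<close> on such a domain is injective, and its image is again such
  a domain (boxes, in contrast, are not preserved).
\<close>
definition is_domain :: "dom \<Rightarrow> bool"
  where "is_domain \<Omega> \<longleftrightarrow> open \<Omega> \<and> connected \<Omega> \<and> \<Omega> \<noteq> {} \<and> (\<forall>t. connected {x. (t, x) \<in> \<Omega>})"

text \<open>The triple \<open>(a, b, c)\<close> stands for the equation \<open>u\<^sub>t = a u\<^sub>x\<^sub>x + b u\<^sub>x + c u\<close>.\<close>
type_synonym lineq = "fld \<times> fld \<times> fld"

fun holds_at :: "lineq \<Rightarrow> fld \<Rightarrow> real \<times> real \<Rightarrow> bool"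
  where "holds_at (a, b, c) u z \<longleftrightarrow> Dt u z = a z * Dx (Dx u) z + b z * Dx u z + c z * u z"

datatype eqclass = Kbar | Keps | Fbar | Feps

text \<open>
  Elements of the two narrower classes are also given by pairs \<open>(A, B)\<close>, with the constant value
  \<open>A = \<epsilon>\<close>; their actual arbitrary element is \<open>B\<close>.
\<close>
type_synonym arb = "fld \<times> fld"

fun members :: "eqclass \<Rightarrow> real \<Rightarrow> dom \<Rightarrow> arb set"
  where
    "members Kbar \<epsilon> \<Omega> = {(A, B). smooth_on \<Omega> A \<and> smooth_on \<Omega> B \<and> (\<forall>z\<in>\<Omega>. A z \<noteq> 0)}"
  | "members Fbar \<epsilon> \<Omega> = {(A, B). smooth_on \<Omega> A \<and> smooth_on \<Omega> B \<and> (\<forall>z\<in>\<Omega>. A z \<noteq> 0)}"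
  | "members Keps \<epsilon> \<Omega> = {(A, B). smooth_on \<Omega> B \<and> (\<forall>z\<in>\<Omega>. A z = \<epsilon>)}"
  | "members Feps \<epsilon> \<Omega> = {(A, B). smooth_on \<Omega> B \<and> (\<forall>z\<in>\<Omega>. A z = \<epsilon>)}"

text \<open>
  For the Fokker--Planck classes the right-hand side \<open>(A u)\<^sub>x\<^sub>x + (B u)\<^sub>x\<close> is expanded, see
  \<open>fokker_planck_expand\<close> below.
\<close>
fun equation :: "eqclass \<Rightarrow> arb \<Rightarrow> lineq"
  where
    "equation Kbar (A, B) = (A, B, \<lambda>_. 0)"
  | "equation Keps (A, B) = (A, B, \<lambda>_. 0)"
  | "equation Fbar (A, B) = (A, \<lambda>z. 2 * Dx A z + B z, \<lambda>z. Dx (Dx A) z + Dx B z)"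
  | "equation Feps (A, B) = (A, \<lambda>z. 2 * Dx A z + B z, \<lambda>z. Dx (Dx A) z + Dx B z)"

fun breve :: "eqclass \<Rightarrow> real"
  where "breve Kbar = 1" | "breve Keps = 1" | "breve Fbar = -1" | "breve Feps = -1"

lemma smooth_on_differentiable: "smooth_on S f \<Longrightarrow> x \<in> S \<Longrightarrow> f differentiable at x"
  unfolding smooth_on_def using Ck_on.simps(2) by blast

lemma Dx_eq_frechet:
  assumes "f differentiable at (t, x)"
  shows "((\<lambda>y. f (t, y)) has_real_derivative frechet_derivative f (at (t, x)) (0, 1)) (at x)"
    and "Dx f (t, x) = frechet_derivative f (at (t, x)) (0, 1)"
proof -
  let ?L = "frechet_derivative f (at (t, x))"
  have L: "(f has_derivative ?L) (at (t, x))"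
    using assms frechet_derivative_works by blast
  have "((\<lambda>y. (t, y)) has_derivative (\<lambda>h. (0, h))) (at x)"
    by (auto intro!: derivative_eq_intros)
  from has_derivative_compose[OF this L]
  have 1: "((\<lambda>y. f (t, y)) has_derivative (\<lambda>h. ?L (0, h))) (at x)" .
  have "(\<lambda>h. ?L (0, h)) = (*) (?L (0, 1))"
  proof
    fix h :: real
    show "?L (0, h) = ?L (0, 1) * h"
      using linear_scale[OF has_derivative_linear[OF L], of h "(0, 1)"] by simp
  qed
  with 1 show *: "((\<lambda>y. f (t, y)) has_real_derivative ?L (0, 1)) (at x)"
    by (simp only: has_field_derivative_def)
  show "Dx f (t, x) = ?L (0, 1)"
    using DERIV_imp_deriv[OF *] by (simp add: Dx_def)
qed

lemma Dx_has_derivative: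
  assumes "f differentiable at (t, x)"
  shows "((\<lambda>y. f (t, y)) has_real_derivative Dx f (t, x)) (at x)"
  using Dx_eq_frechet[OF assms] by simp

lemma Dx_has_derivative2:
  assumes "open S" "smooth_on S f" "(t, x) \<in> S"
  shows "((\<lambda>y. Dx f (t, y)) has_real_derivative Dx (Dx f) (t, x)) (at x)"
proof -
  let ?g = "\<lambda>z. frechet_derivative f (at z) (0, 1)"
  have "Ck_on (Suc (Suc 0)) S f"
    using assms(2) by (simp only: smooth_on_def)
  then have "?g differentiable at (t, x)"
    using assms(3) by auto
  moreover have eq: "?g z = Dx f z" if "z \<in> S" for z
    using Dx_eq_frechet(2)[of f "fst z" "snd z"] smooth_on_differentiable[OF assms(2) that] by simp
  ultimately have "Dx f differentiable at (t, x)"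
    unfolding differentiable_def
    using has_derivative_transform_within_open[OF _ assms(1,3)] by blast
  then show ?thesis
    by (rule Dx_has_derivative)
qed

lemma fokker_planck_expand:
  assumes S: "open S" and A: "smooth_on S A" and B: "smooth_on S B" and u: "smooth_on S u"
    and z: "z \<in> S"
  shows "Dx (Dx (\<lambda>z. A z * u z)) z + Dx (\<lambda>z. B z * u z) z
    = A z * Dx (Dx u) z + (2 * Dx A z + B z) * Dx u z + (Dx (Dx A) z + Dx B z) * u z"
proof -
  obtain t x where tx: "z = (t, x)" by force
  have zS: "(t, x) \<in> S" using z tx by simp
  have d: "((\<lambda>y. f (t, y)) has_real_derivative Dx f (t, y)) (at y)"
    if "smooth_on S f" "(t, y) \<in> S" for f y
    using Dx_has_derivative[OF smooth_on_differentiable[OF that]] .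
  have p: "Dx (\<lambda>z. f z * g z) (t, y) = Dx f (t, y) * g (t, y) + Dx g (t, y) * f (t, y)"
    if "smooth_on S f" "smooth_on S g" "(t, y) \<in> S" for f g y
    using DERIV_imp_deriv[OF DERIV_mult[OF d[OF that(1,3)] d[OF that(2,3)]]]
    by (simp add: Dx_def)
  have op: "open {y. (t, y) \<in> S}"
    using open_vimage[OF S, of "\<lambda>y. (t, y)"] by (simp add: vimage_def continuous_on_Pair)
  have "((\<lambda>y. Dx A (t, y) * u (t, y) + Dx u (t, y) * A (t, y)) has_real_derivative
      (Dx (Dx A) (t, x) * u (t, x) + Dx u (t, x) * Dx A (t, x))
      + (Dx (Dx u) (t, x) * A (t, x) + Dx A (t, x) * Dx u (t, x))) (at x)"
    by (intro DERIV_add DERIV_mult Dx_has_derivative2[OF S A zS] Dx_has_derivative2[OF S u zS]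
        d[OF A zS] d[OF u zS])
  then have "((\<lambda>y. Dx (\<lambda>z. A z * u z) (t, y)) has_real_derivative
      (Dx (Dx A) (t, x) * u (t, x) + Dx u (t, x) * Dx A (t, x))
      + (Dx (Dx u) (t, x) * A (t, x) + Dx A (t, x) * Dx u (t, x))) (at x)"
    by (rule has_field_derivative_transform_within_open[OF _ op]) (use zS p[OF A u] in auto)
  from DERIV_imp_deriv[OF this] p[OF B u zS] show ?thesis
    by (simp add: tx Dx_def[of "Dx _"] algebra_simps)
qed

text \<open>
  A vector field \<open>\<tau> \<partial>\<^sub>t + \<xi> \<partial>\<^sub>x + \<eta> \<partial>\<^sub>u\<close> on \<open>\<Omega> \<times> \<real>\<close> is the map \<open>(t, x, u) \<mapsto> (\<tau>, \<xi>, \<eta>)\<close>, extended by zero outside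
  \<open>\<Omega> \<times> \<real>\<close> so that equality of vector fields on \<open>\<Omega> \<times> \<real>\<close> is equality of functions.
\<close>
type_synonym vfield = "real \<times> real \<times> real \<Rightarrow> real \<times> real \<times> real"

text \<open>
  Total derivatives of functions on the jet spaces of order zero and one, with the coordinates
  \<open>(t, x, u)\<close> and \<open>(t, x, u, p, q)\<close>, where \<open>p = u\<^sub>t\<close>, \<open>q = u\<^sub>x\<close>, \<open>r = u\<^sub>t\<^sub>x\<close> and \<open>s = u\<^sub>x\<^sub>x\<close>.
\<close>
fun tot_t0 :: "(real \<times> real \<times> real \<Rightarrow> real) \<Rightarrow> real \<times> real \<times> real \<times> real \<times> real \<Rightarrow> real"
  where "tot_t0 f (t, x, u, p, q) =
    deriv (\<lambda>t. f (t, x, u)) t + p * deriv (\<lambda>u. f (t, x, u)) u"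

fun tot_x0 :: "(real \<times> real \<times> real \<Rightarrow> real) \<Rightarrow> real \<times> real \<times> real \<times> real \<times> real \<Rightarrow> real"
  where "tot_x0 f (t, x, u, p, q) =
    deriv (\<lambda>x. f (t, x, u)) x + q * deriv (\<lambda>u. f (t, x, u)) u"

definition tot_x1 ::
    "(real \<times> real \<times> real \<times> real \<times> real \<Rightarrow> real)
     \<Rightarrow> real \<Rightarrow> real \<Rightarrow> real \<Rightarrow> real \<Rightarrow> real \<Rightarrow> real \<Rightarrow> real \<Rightarrow> real"
  where "tot_x1 f t x u p q r s =
    deriv (\<lambda>x. f (t, x, u, p, q)) x + q * deriv (\<lambda>u. f (t, x, u, p, q)) u
    + r * deriv (\<lambda>p. f (t, x, u, p, q)) p + s * deriv (\<lambda>q. f (t, x, u, p, q)) q"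

abbreviation tau_of :: "vfield \<Rightarrow> real \<times> real \<times> real \<Rightarrow> real"
  where "tau_of Q \<equiv> \<lambda>z. fst (Q z)"
abbreviation xi_of :: "vfield \<Rightarrow> real \<times> real \<times> real \<Rightarrow> real"
  where "xi_of Q \<equiv> \<lambda>z. fst (snd (Q z))"
abbreviation eta_of :: "vfield \<Rightarrow> real \<times> real \<times> real \<Rightarrow> real"
  where "eta_of Q \<equiv> \<lambda>z. snd (snd (Q z))"

text \<open>Coefficients of the second prolongation of a vector field (those of \<open>\<partial>/\<partial>u\<^sub>t\<close>, \<open>\<partial>/\<partial>u\<^sub>x\<close>, \<open>\<partial>/\<partial>u\<^sub>x\<^sub>x\<close>).\<close>
fun prol_t :: "vfield \<Rightarrow> real \<times> real \<times> real \<times> real \<times> real \<Rightarrow> real"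
  where "prol_t Q (t, x, u, p, q) = tot_t0 (eta_of Q) (t, x, u, p, q)
    - p * tot_t0 (tau_of Q) (t, x, u, p, q) - q * tot_t0 (xi_of Q) (t, x, u, p, q)"

fun prol_x :: "vfield \<Rightarrow> real \<times> real \<times> real \<times> real \<times> real \<Rightarrow> real"
  where "prol_x Q (t, x, u, p, q) = tot_x0 (eta_of Q) (t, x, u, p, q)
    - p * tot_x0 (tau_of Q) (t, x, u, p, q) - q * tot_x0 (xi_of Q) (t, x, u, p, q)"

definition prol_xx ::
    "vfield \<Rightarrow> real \<Rightarrow> real \<Rightarrow> real \<Rightarrow> real \<Rightarrow> real \<Rightarrow> real \<Rightarrow> real \<Rightarrow> real"
  where "prol_xx Q t x u p q r s = tot_x1 (prol_x Q) t x u p q r s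
    - r * tot_x0 (tau_of Q) (t, x, u, p, q) - s * tot_x0 (xi_of Q) (t, x, u, p, q)"

text \<open>
  The maximal Lie invariance algebra by the infinitesimal criterion: the prolonged vector field
  annihilates \<open>p - a s - b q - c u\<close> on the manifold in the jet space defined by the equation.
\<close>
fun lie_algebra :: "dom \<Rightarrow> lineq \<Rightarrow> vfield set"
  where "lie_algebra \<Omega> (a, b, c) = {Q.
    smooth_on {(t, x, u). (t, x) \<in> \<Omega>} Q \<and>
    (\<forall>t x u. (t, x) \<notin> \<Omega> \<longrightarrow> Q (t, x, u) = 0) \<and>
    (\<forall>t x u p q r s. (t, x) \<in> \<Omega> \<and> p = a (t, x) * s + b (t, x) * q + c (t, x) * u \<longrightarrow>
       prol_t Q (t, x, u, p, q)
       - a (t, x) * prol_xx Q t x u p q r s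
       - b (t, x) * prol_x Q (t, x, u, p, q)
       - c (t, x) * eta_of Q (t, x, u)
       - tau_of Q (t, x, u) * (Dt a (t, x) * s + Dt b (t, x) * q + Dt c (t, x) * u)
       - xi_of Q (t, x, u) * (Dx a (t, x) * s + Dx b (t, x) * q + Dx c (t, x) * u) = 0)}"

definition ess_field :: "dom \<Rightarrow> (real \<Rightarrow> real) \<Rightarrow> fld \<Rightarrow> fld \<Rightarrow> vfield"
  where "ess_field \<Omega> \<tau> \<xi> \<eta> =
    (\<lambda>(t, x, u). if (t, x) \<in> \<Omega> then (\<tau> t, \<xi> (t, x), \<eta> (t, x) * u) else 0)"

definition ess_algebra :: "dom \<Rightarrow> lineq \<Rightarrow> vfield set"
  where "ess_algebra \<Omega> E = {Q \<in> lie_algebra \<Omega> E. \<exists>\<tau> \<xi> \<eta>. Q = ess_field \<Omega> \<tau> \<xi> \<eta>}"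

definition ess_kernel :: "eqclass \<Rightarrow> real \<Rightarrow> dom \<Rightarrow> vfield set"
  where "ess_kernel L \<epsilon> \<Omega> = (\<Inter>AB\<in>members L \<epsilon> \<Omega>. ess_algebra \<Omega> (equation L AB))"

definition is_ess_extension :: "eqclass \<Rightarrow> real \<Rightarrow> dom \<Rightarrow> arb \<Rightarrow> bool"
  where "is_ess_extension L \<epsilon> \<Omega> AB \<longleftrightarrow>
    AB \<in> members L \<epsilon> \<Omega> \<and> ess_kernel L \<epsilon> \<Omega> \<subset> ess_algebra \<Omega> (equation L AB)"

definition u_du :: "dom \<Rightarrow> vfield"
  where "u_du \<Omega> = ess_field \<Omega> (\<lambda>_. 0) (\<lambda>_. 0) (\<lambda>_. 1)"

definition is_basis :: "'a::real_vector list \<Rightarrow> 'a set \<Rightarrow> bool"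
  where "is_basis vs V \<longleftrightarrow> distinct vs \<and> independent (set vs) \<and> span (set vs) = V"

text \<open>
  Equivalence transformations act on the space with the coordinates \<open>(t, x, u, A, B)\<close>. In the
  narrower classes, \<open>A\<close> is the constant \<open>\<epsilon>\<close> and is kept.
\<close>
type_synonym arb_trafo =
  "real \<times> real \<times> real \<times> real \<times> real \<Rightarrow> real \<times> real \<times> real \<times> real \<times> real"

fun equiv_group :: "eqclass \<Rightarrow> dom \<Rightarrow> arb_trafo set"
  where
    "equiv_group Kbar \<Omega> = {\<Phi>. \<exists>T X c\<^sub>1 c\<^sub>2.
       smooth_on (fst ` \<Omega>) T \<and> smooth_on \<Omega> X \<and> c\<^sub>1 \<noteq> 0 \<and>
       (\<forall>t x. (t, x) \<in> \<Omega> \<longrightarrow> deriv T t \<noteq> 0 \<and> Dx X (t, x) \<noteq> 0 \<and>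
         (\<forall>u a b. \<Phi> (t, x, u, a, b) =
           (T t, X (t, x), c\<^sub>1 * u + c\<^sub>2,
            (Dx X (t, x))\<^sup>2 / deriv T t * a,
            Dx X (t, x) / deriv T t * b - (Dt X (t, x) - Dx (Dx X) (t, x) * a) / deriv T t)))}"
  | "equiv_group Fbar \<Omega> = {\<Phi>. \<exists>T X c\<^sub>1.
       smooth_on (fst ` \<Omega>) T \<and> smooth_on \<Omega> X \<and> c\<^sub>1 \<noteq> 0 \<and>
       (\<forall>t x. (t, x) \<in> \<Omega> \<longrightarrow> deriv T t \<noteq> 0 \<and> Dx X (t, x) \<noteq> 0 \<and>
         (\<forall>u a b. \<Phi> (t, x, u, a, b) =
           (T t, X (t, x), c\<^sub>1 / Dx X (t, x) * u,
            (Dx X (t, x))\<^sup>2 / deriv T t * a,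
            Dx X (t, x) / deriv T t * b - (Dt X (t, x) + Dx (Dx X) (t, x) * a) / deriv T t)))}"
  | "equiv_group Keps \<Omega> = {\<Phi>. \<exists>T X\<^sub>1 X\<^sub>0 c\<^sub>1 c\<^sub>2.
       smooth_on (fst ` \<Omega>) T \<and> smooth_on (fst ` \<Omega>) X\<^sub>1 \<and> smooth_on (fst ` \<Omega>) X\<^sub>0 \<and> c\<^sub>1 \<noteq> 0 \<and>
       (\<forall>t x. (t, x) \<in> \<Omega> \<longrightarrow> X\<^sub>1 t \<noteq> 0 \<and> deriv T t = (X\<^sub>1 t)\<^sup>2 \<and>
         (\<forall>u a b. \<Phi> (t, x, u, a, b) =
           (T t, X\<^sub>1 t * x + X\<^sub>0 t, c\<^sub>1 * u + c\<^sub>2, a,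
            1 / X\<^sub>1 t * b - (deriv X\<^sub>1 t * x + deriv X\<^sub>0 t) / (X\<^sub>1 t)\<^sup>2)))}"
  | "equiv_group Feps \<Omega> = {\<Phi>. \<exists>T X\<^sub>1 X\<^sub>0 c\<^sub>1.
       smooth_on (fst ` \<Omega>) T \<and> smooth_on (fst ` \<Omega>) X\<^sub>1 \<and> smooth_on (fst ` \<Omega>) X\<^sub>0 \<and> c\<^sub>1 \<noteq> 0 \<and>
       (\<forall>t x. (t, x) \<in> \<Omega> \<longrightarrow> X\<^sub>1 t \<noteq> 0 \<and> deriv T t = (X\<^sub>1 t)\<^sup>2 \<and>
         (\<forall>u a b. \<Phi> (t, x, u, a, b) =
           (T t, X\<^sub>1 t * x + X\<^sub>0 t, c\<^sub>1 / X\<^sub>1 t * u, a,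
            1 / X\<^sub>1 t * b - (deriv X\<^sub>1 t * x + deriv X\<^sub>0 t) / (X\<^sub>1 t)\<^sup>2)))}"

fun arb_graph :: "dom \<Rightarrow> arb \<Rightarrow> (real \<times> real \<times> real \<times> real \<times> real) set"
  where "arb_graph \<Omega> (A, B) = {(t, x, u, A (t, x), B (t, x)) | t x u. (t, x) \<in> \<Omega>}"

definition arb_equiv :: "eqclass \<Rightarrow> dom \<Rightarrow> arb \<Rightarrow> dom \<Rightarrow> arb \<Rightarrow> bool"
  where "arb_equiv L \<Omega> AB \<Omega>' AB' \<longleftrightarrow>
    (\<exists>\<Phi>\<in>equiv_group L \<Omega>. \<Phi> ` arb_graph \<Omega> AB = arb_graph \<Omega>' AB')"

text \<open>
  A general potential comes with the open interval \<open>J\<close> on which it is considered; for the other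
  two kinds the domain is only required to avoid the singularity.
\<close>
datatype potential = General "real set" "real \<Rightarrow> real" | Inv_Square real | Zero

fun pot :: "potential \<Rightarrow> real \<Rightarrow> real"
  where
    "pot (General J C) x = C x"
  | "pot (Inv_Square \<mu>) x = \<mu> / x\<^sup>2"
  | "pot Zero x = 0"

fun admissible_domain :: "potential \<Rightarrow> dom \<Rightarrow> bool"
  where
    "admissible_domain (General J C) \<Omega> \<longleftrightarrow> snd ` \<Omega> = J"
  | "admissible_domain (Inv_Square \<mu>) \<Omega> \<longleftrightarrow> 0 \<notin> snd ` \<Omega>"
  | "admissible_domain Zero \<Omega> \<longleftrightarrow> True"

definition general_potentials :: "(real set \<times> (real \<Rightarrow> real)) set"
  where "general_potentials = {(J, C).
    open J \<and> connected J \<and> J \<noteq> {} \<and> smooth_on J C \<and>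
    (\<forall>\<alpha> \<beta> \<gamma> \<mu>. \<mu> \<noteq> 0 \<longrightarrow> \<not> (\<forall>x\<in>J. C x = \<mu> / (x + \<beta>)\<^sup>2 + \<alpha> * (x + \<beta>)\<^sup>2 + \<gamma>)) \<and>
    (\<forall>\<alpha> \<beta> \<gamma>. \<not> (\<forall>x\<in>J. C x = \<alpha> * x\<^sup>2 + \<beta> * x + \<gamma>))}"

fun potential_equiv :: "real set \<times> (real \<Rightarrow> real) \<Rightarrow> real set \<times> (real \<Rightarrow> real) \<Rightarrow> bool"
  where "potential_equiv (J, C) (J', C') \<longleftrightarrow> (\<exists>c\<^sub>1 c\<^sub>3 c\<^sub>5. c\<^sub>1 \<noteq> 0 \<and>
    (\<lambda>x. c\<^sub>1 * x + c\<^sub>3) ` J = J' \<and> (\<forall>x\<in>J. C' (c\<^sub>1 * x + c\<^sub>3) = (C x + c\<^sub>5) / c\<^sub>1\<^sup>2))"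

definition complete_inequivalent :: "('a \<Rightarrow> 'a \<Rightarrow> bool) \<Rightarrow> 'a set \<Rightarrow> 'a set \<Rightarrow> bool"
  where "complete_inequivalent R Z S \<longleftrightarrow>
    S \<subseteq> Z \<and> (\<forall>z\<in>Z. \<exists>s\<in>S. R z s) \<and> (\<forall>s\<in>S. \<forall>s'\<in>S. R s s' \<longrightarrow> s = s')"

definition listed_potentials :: "(real set \<times> (real \<Rightarrow> real)) set \<Rightarrow> potential set"
  where "listed_potentials \<C> =
    {General J C | J C. (J, C) \<in> \<C>} \<union> {Inv_Square \<mu> | \<mu>. \<mu> \<noteq> 0} \<union> {Zero}"

definition heat_with_potential :: "real \<Rightarrow> (real \<Rightarrow> real) \<Rightarrow> lineq"
  where "heat_with_potential e C = (\<lambda>_. e, \<lambda>_. 0, \<lambda>(t, x). C x)"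

definition nonzero_solutions :: "eqclass \<Rightarrow> real \<Rightarrow> potential \<Rightarrow> (dom \<times> fld) set"
  where "nonzero_solutions L \<epsilon> p = {(\<Omega>, U).
    is_domain \<Omega> \<and> admissible_domain p \<Omega> \<and> smooth_on \<Omega> U \<and>
    (\<forall>z\<in>\<Omega>. U z \<noteq> 0 \<and>
      holds_at (heat_with_potential (\<epsilon> * breve L) (\<lambda>x. breve L * pot p x)) U z)}"

type_synonym point_trafo = "real \<times> real \<times> real \<Rightarrow> real \<times> real \<times> real"

definition graph_of :: "dom \<Rightarrow> fld \<Rightarrow> (real \<times> real \<times> real) set"
  where "graph_of \<Omega> w = {(t, x, w (t, x)) | t x. (t, x) \<in> \<Omega>}"

text \<open>
  Preservation of the manifold in the jet space defined by the equation; jets are represented by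
  functions, so \<open>w\<close> and \<open>w'\<close> are not required to solve the equation except at the point considered.
\<close>
definition point_symmetry :: "lineq \<Rightarrow> dom \<Rightarrow> dom \<Rightarrow> point_trafo \<Rightarrow> bool"
  where "point_symmetry E \<Omega> \<Omega>' \<Phi> \<longleftrightarrow>
    (\<forall>w w'. smooth_on \<Omega> w \<and> smooth_on \<Omega>' w' \<and> \<Phi> ` graph_of \<Omega> w = graph_of \<Omega>' w' \<longrightarrow>
      (\<forall>t x t' x' u'. (t, x) \<in> \<Omega> \<and> \<Phi> (t, x, w (t, x)) = (t', x', u') \<longrightarrow>
        (holds_at E w (t, x) \<longleftrightarrow> holds_at E w' (t', x'))))"

definition ess_symmetry_group :: "real \<Rightarrow> (real \<Rightarrow> real) \<Rightarrow> dom \<Rightarrow> dom \<Rightarrow> point_trafo set"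
  where "ess_symmetry_group e C \<Omega> \<Omega>' = {\<Phi>.
    point_symmetry (heat_with_potential e C) \<Omega> \<Omega>' \<Phi> \<and>
    (\<exists>T X\<^sub>1 X\<^sub>0 V.
       smooth_on (fst ` \<Omega>) T \<and> smooth_on (fst ` \<Omega>) X\<^sub>1 \<and> smooth_on (fst ` \<Omega>) X\<^sub>0 \<and>
       smooth_on (fst ` \<Omega>) V \<and>
       (\<forall>t x. (t, x) \<in> \<Omega> \<longrightarrow> deriv T t = (X\<^sub>1 t)\<^sup>2 \<and> X\<^sub>1 t \<noteq> 0 \<and> V t \<noteq> 0 \<and>
         (\<forall>u. \<Phi> (t, x, u) =
           (T t, X\<^sub>1 t * x + X\<^sub>0 t,
            V t * exp (- (e * deriv X\<^sub>1 t / (4 * X\<^sub>1 t)) * x\<^sup>2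
                       - e * deriv X\<^sub>0 t / (2 * X\<^sub>1 t) * x) * u))))}"

fun solution_equiv ::
    "eqclass \<Rightarrow> real \<Rightarrow> potential \<Rightarrow> dom \<times> fld \<Rightarrow> dom \<times> fld \<Rightarrow> bool"
  where "solution_equiv L \<epsilon> p (\<Omega>, U) (\<Omega>', U') \<longleftrightarrow>
    (\<exists>\<Phi>\<in>ess_symmetry_group (\<epsilon> * breve L) (\<lambda>x. breve L * pot p x) \<Omega> \<Omega>'.
       \<Phi> ` graph_of \<Omega> U = graph_of \<Omega>' U')"

definition B_of :: "eqclass \<Rightarrow> real \<Rightarrow> fld \<Rightarrow> fld"
  where "B_of L \<epsilon> U = (\<lambda>z. 2 * \<epsilon> * breve L * (Dx U z / U z))"

definition R_of :: "eqclass \<Rightarrow> fld \<Rightarrow> fld"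
  where "R_of L U = (\<lambda>z. breve L * Dt U z / U z)"

definition case_elements :: "eqclass \<Rightarrow> real \<Rightarrow> fld \<Rightarrow> arb"
  where "case_elements L \<epsilon> U = (\<lambda>_. \<epsilon>, B_of L \<epsilon> U)"

context
  fixes L :: eqclass and \<epsilon> :: real and \<Omega> :: dom and U :: fld
begin

definition Pt_hat :: vfield
  where "Pt_hat = ess_field \<Omega> (\<lambda>t. 1) (\<lambda>(t, x). 0) (\<lambda>(t, x). - R_of L U (t, x))"

definition D_hat :: vfield
  where "D_hat = ess_field \<Omega> (\<lambda>t. 2 * t) (\<lambda>(t, x). x)
    (\<lambda>(t, x). - (2 * t * R_of L U (t, x) + 1/2 * \<epsilon> * x * B_of L \<epsilon> U (t, x)))"

definition Pi_hat :: vfield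
  where "Pi_hat = ess_field \<Omega> (\<lambda>t. 4 * t\<^sup>2) (\<lambda>(t, x). 4 * t * x)
    (\<lambda>(t, x). - (\<epsilon> * x\<^sup>2 + 2 * t + 4 * t\<^sup>2 * R_of L U (t, x) + 2 * \<epsilon> * t * x * B_of L \<epsilon> U (t, x)))"

definition Px_hat :: vfield
  where "Px_hat = ess_field \<Omega> (\<lambda>t. 0) (\<lambda>(t, x). 1)
    (\<lambda>(t, x). - (1/2 * \<epsilon> * B_of L \<epsilon> U (t, x)))"

definition G_hat :: vfield
  where "G_hat = ess_field \<Omega> (\<lambda>t. 0) (\<lambda>(t, x). 2 * t)
    (\<lambda>(t, x). - \<epsilon> * (x + t * B_of L \<epsilon> U (t, x)))"

fun case_fields :: "potential \<Rightarrow> vfield list"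
  where
    "case_fields (General J C) = [Pt_hat]"
  | "case_fields (Inv_Square \<mu>) = [Pt_hat, D_hat, Pi_hat]"
  | "case_fields Zero = [Pt_hat, D_hat, Pi_hat, Px_hat, G_hat]"

end

end

theory Submission
  imports Defs "HOL-Computational_Algebra.Polynomial"
begin

text \<open>
  Up to equivalence \<open>A = \<epsilon>\<close>. Locally, \<open>B\<close> is a multiple of \<open>U\<^sub>x / U\<close> for some nonvanishing \<open>U\<close>, which then
  solves a heat equation with the potential read off from \<open>U\<close> itself, and a gauge transformation
  by \<open>U\<close> carries the essential symmetries of that heat equation to those of the given equation.
  A nontrivial symmetry can be straightened to \<open>\<partial>\<^sub>t\<close> or \<open>\<partial>\<^sub>x\<close>; this makes the potential a sum of a
  function of \<open>x\<close> and a function of \<open>t\<close>, or affine in \<open>x\<close>. Maps \<open>X = X\<^sup>1(t) x + X\<^sup>0(t)\<close> then bring it to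
  one of the listed forms.

  For the inequivalence, a map between two cases is affine in \<open>x\<close> and relates the solutions up to a
  factor \<open>V(t)\<close>. It transports the symmetry algebra, and the potentials which admit more than time
  translations are exactly the excluded ones, so it relates cases of the same type only; a general
  potential admits only the listed potential equivalences.
\<close>

section \<open>Smooth functions\<close>

text \<open>The data are smooth, not analytic, and live on domains that are connected with connected
  time slices but need not be boxes. Two difficulties follow. A symmetry might vanish on one time
  interval and not on another, and a potential might have an excluded form near every point with
  parameters that vary from place to place. Uniqueness rules out both: once the potential has an
  excluded form on a box, the coefficients of a symmetry satisfy linear second-order equations in t,
  and two excluded forms that agree on an open interval agree as rational functions. Completeness is
  claimed only after shrinking the domain, so boxes, on which primitives exist, suffice there;
  inequivalence and the bases concern whole domains.

  The sign \<open>breve L\<close> reflects duality: U solves the target heat equation in the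
  Kolmogorov case and its adjoint in the Fokker-Planck case. The symmetry condition sees a gauge
  factor only through its logarithmic derivatives, so all four classes share one
  computation.\<close>

lemma Ck_on_cong:
  assumes "open S" "\<And>x. x \<in> S \<Longrightarrow> f x = g x" "Ck_on k S f"
  shows "Ck_on k S g"
  using assms(2,3)
proof (induction k arbitrary: f g)
  case 0
  then show ?case by (simp cong: continuous_on_cong)
next
  case (Suc k)
  have eq: "frechet_derivative f (at x) = frechet_derivative g (at x)"
    and d: "g differentiable at x" if x: "x \<in> S" for x
  proof -
    have f: "f differentiable at x" using Suc.prems(2) x by simp
    show "frechet_derivative f (at x) = frechet_derivative g (at x)"
      by (rule frechet_derivative_transform_within_open[OF f assms(1) x]) (use Suc.prems(1) in auto)
    show "g differentiable at x"
      using f Suc.prems(1) has_derivative_transform_within_open[OF _ assms(1) x]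
      unfolding differentiable_def by metis
  qed
  show ?case
  proof -
    have "Ck_on k S (\<lambda>x. frechet_derivative g (at x) v)" for v
      by (rule Suc.IH[of "\<lambda>x. frechet_derivative f (at x) v"]) (use Suc.prems eq in simp_all)
    then show ?thesis using d by simp
  qed
qed

text \<open>\<open>Ck_on\<close> is stated with \<open>frechet_derivative\<close>, a choice
  operator. Derivatives at interior points are unique, so on an open set any explicit candidate
  \<open>f'\<close> may replace it in the recursion.\<close>

lemma Ck_on_SucI:
  assumes "open S" "\<And>x. x \<in> S \<Longrightarrow> (f has_derivative f' x) (at x)" "\<And>v. Ck_on k S (\<lambda>x. f' x v)"
  shows "Ck_on (Suc k) S f"
proof -
  have "frechet_derivative f (at x) = f' x" if "x \<in> S" for x
    using frechet_derivative_at[OF assms(2)[OF that]] by simp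
  then have "Ck_on k S (\<lambda>x. frechet_derivative f (at x) v)" for v
    using Ck_on_cong[OF assms(1) _ assms(3)[of v]] by simp
  then show ?thesis using assms(2) by (auto simp: differentiable_def)
qed

lemma Ck_on_SucD:
  assumes "Ck_on (Suc k) S f"
  shows "x \<in> S \<Longrightarrow> (f has_derivative frechet_derivative f (at x)) (at x)"
    and "Ck_on k S (\<lambda>x. frechet_derivative f (at x) v)"
  using assms frechet_derivative_works by auto

lemma Ck_on_lower: "Ck_on (Suc k) S f \<Longrightarrow> Ck_on k S f"
proof (induction k arbitrary: f)
  case 0
  then have "f differentiable_on S"
    by (auto simp: differentiable_on_def intro: differentiable_at_withinI)
  then show ?case by (simp add: differentiable_imp_continuous_on)
next
  case (Suc k)
  then show ?case by (meson Ck_on.simps(2))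
qed

lemma Ck_on_subset: "Ck_on k S f \<Longrightarrow> S' \<subseteq> S \<Longrightarrow> Ck_on k S' f"
  by (induction k arbitrary: f) (auto intro: continuous_on_subset)

lemma Ck_on_const: "Ck_on k S (\<lambda>_. c)"
  by (induction k arbitrary: c) auto

lemma Ck_on_bounded_linear:
  assumes "open S" "bounded_linear f"
  shows "Ck_on k S f"
proof (cases k)
  case 0
  then show ?thesis using assms linear_continuous_on by auto
next
  case (Suc j)
  show ?thesis unfolding Suc
    by (rule Ck_on_SucI[where f' = "\<lambda>_. f"])
      (use assms bounded_linear_imp_has_derivative Ck_on_const in auto)
qed

lemma Ck_on_linear_compose:
  assumes "open S" "bounded_linear h" "Ck_on k S f"
  shows "Ck_on k S (\<lambda>x. h (f x))"
  using assms(3)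
proof (induction k arbitrary: f)
  case 0
  then show ?case using assms bounded_linear.continuous_on by auto
next
  case (Suc k)
  show ?case
  proof (rule Ck_on_SucI[OF assms(1), where f' = "\<lambda>x v. h (frechet_derivative f (at x) v)"], goal_cases)
    case (1 x)
    show ?case
      by (rule bounded_linear.has_derivative[OF assms(2) Ck_on_SucD(1)[OF Suc.prems 1]])
  next
    case (2 v)
    show ?case by (rule Suc.IH[OF Ck_on_SucD(2)[OF Suc.prems]])
  qed
qed

lemma Ck_on_add:
  assumes "open S" "Ck_on k S f" "Ck_on k S g"
  shows "Ck_on k S (\<lambda>x. f x + g x)"
  using assms(2,3)
proof (induction k arbitrary: f g)
  case 0
  then show ?case by (auto intro: continuous_intros)
next
  case (Suc k)
  show ?case
  proof (rule Ck_on_SucI[OF assms(1), where f' = "\<lambda>x v. frechet_derivative f (at x) v + frechet_derivative g (at x) v"], goal_cases)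
    case (1 x)
    show ?case
      by (rule has_derivative_add[OF Ck_on_SucD(1)[OF Suc.prems(1) 1] Ck_on_SucD(1)[OF Suc.prems(2) 1]])
  next
    case (2 v)
    show ?case by (rule Suc.IH[OF Ck_on_SucD(2)[OF Suc.prems(1)] Ck_on_SucD(2)[OF Suc.prems(2)]])
  qed
qed

lemma Ck_on_bilinear:
  assumes "open S" "bounded_bilinear pr" "Ck_on k S f" "Ck_on k S g"
  shows "Ck_on k S (\<lambda>x. pr (f x) (g x))"
  using assms(3,4)
proof (induction k arbitrary: f g)
  case 0
  then show ?case using bounded_bilinear.continuous_on[OF assms(2)] by auto
next
  case (Suc k)
  show ?case
  proof (rule Ck_on_SucI[OF assms(1), where f' = "\<lambda>x v. pr (f x) (frechet_derivative g (at x) v)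
      + pr (frechet_derivative f (at x) v) (g x)"], goal_cases)
    case (1 x)
    show ?case
      by (rule bounded_bilinear.FDERIV[OF assms(2) Ck_on_SucD(1)[OF Suc.prems(1) 1]
            Ck_on_SucD(1)[OF Suc.prems(2) 1]])
  next
    case (2 v)
    show ?case
      by (intro Ck_on_add[OF assms(1)] Suc.IH Ck_on_SucD(2)[OF Suc.prems(1)]
          Ck_on_SucD(2)[OF Suc.prems(2)] Ck_on_lower[OF Suc.prems(1)] Ck_on_lower[OF Suc.prems(2)])
  qed
qed

lemma Ck_on_sum:
  assumes "open S" "\<And>i. i \<in> I \<Longrightarrow> Ck_on k S (f i)"
  shows "Ck_on k S (\<lambda>x. \<Sum>i\<in>I. f i x)"
  using assms(2)
  by (induction I rule: infinite_finite_induct) (auto intro: Ck_on_const Ck_on_add[OF assms(1)])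

text \<open>The chain rule produces the derivative of \<open>g\<close> at \<open>f x\<close> in a
  direction that moves with \<open>x\<close>, whereas \<open>Ck_on\<close> controls derivatives in
  fixed directions. Expanding the direction in \<open>Basis\<close> separates the two dependences;
  hence the Euclidean type in the middle.\<close>

lemma Ck_on_compose:
  fixes f :: "'a::real_normed_vector \<Rightarrow> 'b::euclidean_space" and g :: "'b \<Rightarrow> 'c::real_normed_vector"
  assumes S: "open S" and T: "open T" and fST: "f ` S \<subseteq> T" and "Ck_on k T g" "Ck_on k S f"
  shows "Ck_on k S (\<lambda>x. g (f x))"
  using assms(4,5)
proof (induction k arbitrary: g)
  case 0
  then show ?case using continuous_on_compose2[of T g S f] fST by auto
next
  case (Suc k)
  let ?g = "\<lambda>y. frechet_derivative g (at y)" and ?f = "\<lambda>x. frechet_derivative f (at x)"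
  show ?case
  proof (rule Ck_on_SucI[OF S, where f' = "\<lambda>x v. \<Sum>i\<in>Basis. (?f x v \<bullet> i) *\<^sub>R ?g (f x) i"])
    fix x assume x: "x \<in> S"
    have g: "(g has_derivative ?g (f x)) (at (f x))"
      using Ck_on_SucD(1)[OF Suc.prems(1)] x fST by auto
    have eq: "(\<lambda>v. \<Sum>i\<in>Basis. (?f x v \<bullet> i) *\<^sub>R ?g (f x) i) = (\<lambda>v. ?g (f x) (?f x v))"
    proof
      fix v
      have l: "linear (?g (f x))" using has_derivative_linear[OF g] .
      have "?g (f x) (?f x v) = ?g (f x) (\<Sum>i\<in>Basis. (?f x v \<bullet> i) *\<^sub>R i)"
        by (simp add: euclidean_representation)
      then show "(\<Sum>i\<in>Basis. (?f x v \<bullet> i) *\<^sub>R ?g (f x) i) = ?g (f x) (?f x v)"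
        by (simp add: linear_sum[OF l] linear_scale[OF l])
    qed
    show "((\<lambda>x. g (f x)) has_derivative (\<lambda>v. \<Sum>i\<in>Basis. (?f x v \<bullet> i) *\<^sub>R ?g (f x) i)) (at x)"
      unfolding eq using has_derivative_compose[OF Ck_on_SucD(1)[OF Suc.prems(2) x] g] .
  next
    fix v
    show "Ck_on k S (\<lambda>x. \<Sum>i\<in>Basis. (?f x v \<bullet> i) *\<^sub>R ?g (f x) i)"
      by (intro Ck_on_sum[OF S] Ck_on_bilinear[OF S bounded_bilinear_scaleR] Suc.IH
          Ck_on_lower[OF Suc.prems(2)] Ck_on_SucD(2)[OF Suc.prems(1)]
          Ck_on_linear_compose[OF S bounded_linear_inner_left Ck_on_SucD(2)[OF Suc.prems(2)]])
  qed
qed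

lemma smooth_on_cong: "open S \<Longrightarrow> (\<And>x. x \<in> S \<Longrightarrow> f x = g x) \<Longrightarrow> smooth_on S f \<Longrightarrow> smooth_on S g"
  unfolding smooth_on_def using Ck_on_cong by blast

lemma smooth_on_subset: "smooth_on S f \<Longrightarrow> S' \<subseteq> S \<Longrightarrow> smooth_on S' f"
  unfolding smooth_on_def using Ck_on_subset by blast

lemma smooth_on_const: "smooth_on S (\<lambda>_. c)"
  unfolding smooth_on_def using Ck_on_const by blast

lemma smooth_on_linear: "open S \<Longrightarrow> bounded_linear f \<Longrightarrow> smooth_on S f"
  unfolding smooth_on_def using Ck_on_bounded_linear by blast

lemma smooth_on_linear_compose:
  "open S \<Longrightarrow> bounded_linear h \<Longrightarrow> smooth_on S f \<Longrightarrow> smooth_on S (\<lambda>x. h (f x))"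
  unfolding smooth_on_def using Ck_on_linear_compose by blast

lemma smooth_on_add: "open S \<Longrightarrow> smooth_on S f \<Longrightarrow> smooth_on S g \<Longrightarrow> smooth_on S (\<lambda>x. f x + g x)"
  unfolding smooth_on_def using Ck_on_add by blast

lemma smooth_on_mult:
  fixes f g :: "'a::real_normed_vector \<Rightarrow> real"
  shows "open S \<Longrightarrow> smooth_on S f \<Longrightarrow> smooth_on S g \<Longrightarrow> smooth_on S (\<lambda>x. f x * g x)"
  unfolding smooth_on_def using Ck_on_bilinear[OF _ bounded_bilinear_mult] by blast

lemma smooth_on_minus: "open S \<Longrightarrow> smooth_on S f \<Longrightarrow> smooth_on S (\<lambda>x. - f x)"
  using smooth_on_linear_compose[OF _ bounded_linear_minus[OF bounded_linear_ident]] .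

lemma smooth_on_diff: "open S \<Longrightarrow> smooth_on S f \<Longrightarrow> smooth_on S g \<Longrightarrow> smooth_on S (\<lambda>x. f x - g x)"
  using smooth_on_add[of S f "\<lambda>x. - g x"] smooth_on_minus[of S g] by simp

lemma smooth_on_power:
  fixes f :: "'a::real_normed_vector \<Rightarrow> real"
  shows "open S \<Longrightarrow> smooth_on S f \<Longrightarrow> smooth_on S (\<lambda>x. f x ^ n)"
  by (induction n) (auto intro: smooth_on_const smooth_on_mult)

lemma smooth_on_compose:
  fixes f :: "'a::real_normed_vector \<Rightarrow> 'b::euclidean_space"
  shows "smooth_on T g \<Longrightarrow> open S \<Longrightarrow> open T \<Longrightarrow> f ` S \<subseteq> T \<Longrightarrow> smooth_on S f
    \<Longrightarrow> smooth_on S (\<lambda>x. g (f x))"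
  unfolding smooth_on_def using Ck_on_compose[of S T f _ g] by blast

lemma Ck_on_Pair:
  assumes "open S" "Ck_on k S f" "Ck_on k S g"
  shows "Ck_on k S (\<lambda>x. (f x, g x))"
proof -
  have "bounded_linear (\<lambda>x. (x, 0))" "bounded_linear (\<lambda>x. (0, x))"
    by (auto intro: bounded_linear_Pair bounded_linear_ident bounded_linear_zero)
  from Ck_on_add[OF assms(1) Ck_on_linear_compose[OF assms(1) this(1) assms(2)]
      Ck_on_linear_compose[OF assms(1) this(2) assms(3)]]
  show ?thesis by simp
qed

lemma smooth_on_Pair: "open S \<Longrightarrow> smooth_on S f \<Longrightarrow> smooth_on S g \<Longrightarrow> smooth_on S (\<lambda>x. (f x, g x))"
  unfolding smooth_on_def using Ck_on_Pair by blast

lemma smooth_on_fst: "open S \<Longrightarrow> smooth_on S f \<Longrightarrow> smooth_on S (\<lambda>x. fst (f x))"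
  using smooth_on_linear_compose[OF _ bounded_linear_fst] .

lemma smooth_on_snd: "open S \<Longrightarrow> smooth_on S f \<Longrightarrow> smooth_on S (\<lambda>x. snd (f x))"
  using smooth_on_linear_compose[OF _ bounded_linear_snd] .

lemma smooth_on_id: "open S \<Longrightarrow> smooth_on S (\<lambda>x. x)"
  using smooth_on_linear[OF _ bounded_linear_ident] .

lemma smooth_on_local:
  assumes "open S" "\<And>x. x \<in> S \<Longrightarrow> \<exists>S'. open S' \<and> x \<in> S' \<and> smooth_on S' f"
  shows "smooth_on S f"
proof -
  have "Ck_on k S f" if "\<And>x. x \<in> S \<Longrightarrow> \<exists>S'. open S' \<and> x \<in> S' \<and> Ck_on k S' f" for k
    using that
  proof (induction k arbitrary: f)
    case 0
    have "continuous (at x) f" if x: "x \<in> S" for x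
    proof -
      obtain S' where "open S'" "x \<in> S'" "continuous_on S' f" using 0[OF x] by auto
      then show ?thesis by (simp add: continuous_on_eq_continuous_at)
    qed
    then show ?case by (simp add: continuous_at_imp_continuous_on)
  next
    case (Suc k)
    have "Ck_on k S (\<lambda>x. frechet_derivative f (at x) v)" for v
    proof (rule Suc.IH)
      fix x assume "x \<in> S"
      then obtain S' where "open S'" "x \<in> S'" "Ck_on (Suc k) S' f" using Suc.prems by blast
      then show "\<exists>S'. open S' \<and> x \<in> S' \<and> Ck_on k S' (\<lambda>x. frechet_derivative f (at x) v)"
        using Ck_on_SucD(2) by blast
    qed
    moreover have "f differentiable at x" if "x \<in> S" for x
      using Suc.prems[OF that] by auto
    ultimately show ?case by simp
  qed
  then show ?thesis using assms(2) unfolding smooth_on_def by metis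
qed

lemma smooth_on_continuous: "smooth_on S f \<Longrightarrow> continuous_on S f"
  unfolding smooth_on_def using Ck_on.simps(1) by blast

lemma Ck_on_real_SucI:
  fixes f :: "real \<Rightarrow> real"
  assumes "open S" "\<And>x. x \<in> S \<Longrightarrow> (f has_real_derivative g x) (at x)" "Ck_on k S g"
  shows "Ck_on (Suc k) S f"
proof (rule Ck_on_SucI[OF assms(1), where f' = "\<lambda>x v. g x * v"])
  show "(f has_derivative (*) (g x)) (at x)" if "x \<in> S" for x
    using assms(2)[OF that] by (simp only: has_field_derivative_def)
  show "Ck_on k S (\<lambda>x. g x * v)" for v
    using Ck_on_bilinear[OF assms(1) bounded_bilinear_mult assms(3) Ck_on_const] .
qed

lemma smooth_on_realI:
  fixes f :: "real \<Rightarrow> real"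
  assumes "open S" "\<And>x. x \<in> S \<Longrightarrow> (f has_real_derivative g x) (at x)" "smooth_on S g"
  shows "smooth_on S f"
  unfolding smooth_on_def
proof
  fix k show "Ck_on k S f"
    using Ck_on_lower Ck_on_real_SucI[OF assms(1,2)] assms(3) unfolding smooth_on_def by blast
qed

lemma smooth_on_deriv:
  fixes f :: "real \<Rightarrow> real"
  assumes "open S" "smooth_on S f"
  shows "x \<in> S \<Longrightarrow> (f has_real_derivative deriv f x) (at x)" and "smooth_on S (deriv f)"
proof -
  have d: "(f has_real_derivative frechet_derivative f (at x) 1) (at x)" if "x \<in> S" for x
  proof -
    let ?L = "frechet_derivative f (at x)"
    have L: "(f has_derivative ?L) (at x)"
      using smooth_on_differentiable[OF assms(2) that] frechet_derivative_works by blast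
    have "?L = (*) (?L 1)"
    proof
      fix h :: real
      show "?L h = ?L 1 * h"
        using linear_scale[OF has_derivative_linear[OF L], of h 1] by simp
    qed
    with L show ?thesis by (simp only: has_field_derivative_def)
  qed
  then show "x \<in> S \<Longrightarrow> (f has_real_derivative deriv f x) (at x)"
    using DERIV_imp_deriv by metis
  have "Ck_on k S (\<lambda>x. frechet_derivative f (at x) 1)" for k
    using assms(2) unfolding smooth_on_def using Ck_on_SucD(2) by blast
  then show "smooth_on S (deriv f)"
    unfolding smooth_on_def
    using Ck_on_cong[OF assms(1), of "\<lambda>x. frechet_derivative f (at x) 1"] DERIV_imp_deriv[OF d] by metis
qed

section \<open>Smoothness of elementary functions, quotients and square roots\<close>

lemma smooth_on_exp: "smooth_on UNIV (exp :: real \<Rightarrow> real)"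
  unfolding smooth_on_def
proof
  fix k show "Ck_on k UNIV (exp :: real \<Rightarrow> real)"
  proof (induction k)
    case (Suc k)
    then show ?case by (intro Ck_on_real_SucI[where g = exp]) (auto intro: DERIV_exp)
  qed (auto intro: continuous_intros)
qed

text \<open>The induction has to treat both functions at once, each being the derivative of the
  other up to sign.\<close>

lemma smooth_on_sin_cos: "smooth_on UNIV (sin :: real \<Rightarrow> real)" "smooth_on UNIV (cos :: real \<Rightarrow> real)"
proof -
  have "Ck_on k UNIV (sin :: real \<Rightarrow> real) \<and> Ck_on k UNIV (cos :: real \<Rightarrow> real)" for k
  proof (induction k)
    case (Suc k)
    have "Ck_on k UNIV (\<lambda>x::real. - sin x)"
      using Suc Ck_on_linear_compose[OF _ bounded_linear_minus[OF bounded_linear_ident]] by blast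
    then show ?case
      using Suc Ck_on_real_SucI[of UNIV sin cos k] Ck_on_real_SucI[of UNIV cos "\<lambda>x. - sin x" k]
        DERIV_sin DERIV_cos by blast
  qed (auto intro: continuous_intros)
  then show "smooth_on UNIV (sin :: real \<Rightarrow> real)" "smooth_on UNIV (cos :: real \<Rightarrow> real)"
    unfolding smooth_on_def by auto
qed

lemma smooth_on_inverse_real: "smooth_on {x::real. x \<noteq> 0} inverse"
proof -
  have o: "open {x::real. x \<noteq> 0}" by (auto intro: open_Collect_neq continuous_intros)
  have "Ck_on k {x::real. x \<noteq> 0} inverse" for k
  proof (induction k)
    case (Suc k)
    have "Ck_on k {x::real. x \<noteq> 0} (\<lambda>x. - (inverse x * inverse x))"
      using Ck_on_linear_compose[OF o bounded_linear_minus[OF bounded_linear_ident]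
          Ck_on_bilinear[OF o bounded_bilinear_mult Suc Suc]] .
    then show ?case
      by (rule Ck_on_real_SucI[OF o, rotated]) (auto intro!: derivative_eq_intros)
  qed (auto intro: continuous_intros)
  then show ?thesis unfolding smooth_on_def by auto
qed

lemma smooth_on_ln: "smooth_on {0<..} (ln :: real \<Rightarrow> real)"
  by (rule smooth_on_realI[where g = inverse])
    (auto intro!: derivative_eq_intros smooth_on_subset[OF smooth_on_inverse_real] simp: field_simps)

lemma smooth_on_exp_compose:
  fixes f :: "'a::real_normed_vector \<Rightarrow> real"
  shows "open S \<Longrightarrow> smooth_on S f \<Longrightarrow> smooth_on S (\<lambda>x. exp (f x))"
  by (rule smooth_on_compose[OF smooth_on_exp]) auto

lemma smooth_on_divide:
  fixes f g :: "'a::real_normed_vector \<Rightarrow> real"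
  assumes "open S" "smooth_on S f" "smooth_on S g" "\<And>x. x \<in> S \<Longrightarrow> g x \<noteq> 0"
  shows "smooth_on S (\<lambda>x. f x / g x)"
proof -
  have o: "open {x::real. x \<noteq> 0}" by (auto intro: open_Collect_neq continuous_intros)
  have "smooth_on S (\<lambda>x. inverse (g x))"
    by (rule smooth_on_compose[OF smooth_on_inverse_real assms(1) o _ assms(3)]) (use assms(4) in auto)
  from smooth_on_mult[OF assms(1,2) this] show ?thesis by (simp add: divide_inverse)
qed

lemma smooth_on_sqrt:
  fixes f :: "'a::real_normed_vector \<Rightarrow> real"
  assumes "open S" "smooth_on S f" "\<And>x. x \<in> S \<Longrightarrow> f x > 0"
  shows "smooth_on S (\<lambda>x. sqrt (f x))"
proof -
  have "smooth_on S (\<lambda>x. ln (f x))"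
    by (rule smooth_on_compose[OF smooth_on_ln assms(1) _ _ assms(2)]) (use assms(3) in auto)
  then have "smooth_on S (\<lambda>x. exp (1/2 * ln (f x)))"
    by (intro smooth_on_exp_compose smooth_on_mult smooth_on_const assms(1))
  moreover have "exp (1/2 * ln (f x)) = sqrt (f x)" if "x \<in> S" for x
    using assms(3)[OF that] by (simp add: ln_sqrt[symmetric] exp_ln mult.commute[of _ "1/2"])
  ultimately show ?thesis
    by (rule smooth_on_cong[OF assms(1), rotated])
qed

lemmas smooth_intros = smooth_on_const smooth_on_add smooth_on_mult smooth_on_minus smooth_on_diff
  smooth_on_power smooth_on_divide smooth_on_exp_compose smooth_on_id smooth_on_fst smooth_on_snd
  smooth_on_Pair

subsection \<open>Partial derivatives\<close>

lemma Dt_eq_frechet: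
  assumes "f differentiable at (t, x)"
  shows "((\<lambda>s. f (s, x)) has_real_derivative frechet_derivative f (at (t, x)) (1, 0)) (at t)"
    and "Dt f (t, x) = frechet_derivative f (at (t, x)) (1, 0)"
proof -
  let ?L = "frechet_derivative f (at (t, x))"
  have L: "(f has_derivative ?L) (at (t, x))"
    using assms frechet_derivative_works by blast
  have "((\<lambda>s. (s, x)) has_derivative (\<lambda>h. (h, 0))) (at t)"
    by (auto intro!: derivative_eq_intros)
  from has_derivative_compose[OF this L]
  have 1: "((\<lambda>s. f (s, x)) has_derivative (\<lambda>h. ?L (h, 0))) (at t)" .
  have "(\<lambda>h. ?L (h, 0)) = (*) (?L (1, 0))"
  proof
    fix h :: real
    show "?L (h, 0) = ?L (1, 0) * h"
      using linear_scale[OF has_derivative_linear[OF L], of h "(1, 0)"] by simp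
  qed
  with 1 show *: "((\<lambda>s. f (s, x)) has_real_derivative ?L (1, 0)) (at t)"
    by (simp only: has_field_derivative_def)
  show "Dt f (t, x) = ?L (1, 0)"
    using DERIV_imp_deriv[OF *] by (simp add: Dt_def)
qed

lemma partial_deriv:
  assumes "smooth_on \<Omega> f" "(t, x) \<in> \<Omega>"
  shows "((\<lambda>s. f (s, x)) has_real_derivative Dt f (t, x)) (at t)"
    and "((\<lambda>y. f (t, y)) has_real_derivative Dx f (t, x)) (at x)"
  using Dt_eq_frechet Dx_has_derivative smooth_on_differentiable[OF assms] by auto

lemma smooth_on_partials:
  assumes "open \<Omega>" "smooth_on \<Omega> f"
  shows "smooth_on \<Omega> (Dt f)" "smooth_on \<Omega> (Dx f)"
proof -
  have c: "Ck_on k \<Omega> (\<lambda>x. frechet_derivative f (at x) v)" for k v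
    using assms(2) unfolding smooth_on_def using Ck_on_SucD(2) by blast
  have d: "f differentiable at z" if "z \<in> \<Omega>" for z
    using smooth_on_differentiable[OF assms(2) that] .
  have "frechet_derivative f (at z) (1, 0) = Dt f z" if "z \<in> \<Omega>" for z
    using Dt_eq_frechet(2)[of f "fst z" "snd z"] d[OF that] by simp
  from Ck_on_cong[OF assms(1) this c] show "smooth_on \<Omega> (Dt f)" unfolding smooth_on_def by blast
  have "frechet_derivative f (at z) (0, 1) = Dx f z" if "z \<in> \<Omega>" for z
    using Dx_eq_frechet(2)[of f "fst z" "snd z"] d[OF that] by simp
  from Ck_on_cong[OF assms(1) this c] show "smooth_on \<Omega> (Dx f)" unfolding smooth_on_def by blast
qed

lemma open_slices:
  assumes "open \<Omega>"
  shows "open {x. (t, x) \<in> \<Omega>}" "open {t. (t, x) \<in> \<Omega>}"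
  using open_vimage[OF assms, of "\<lambda>y. (t, y)"] open_vimage[OF assms, of "\<lambda>s. (s, x)"]
  by (auto simp: vimage_def continuous_on_Pair)

lemma open_box_in:
  fixes \<Omega> :: dom
  assumes "open \<Omega>" "(t, x) \<in> \<Omega>"
  obtains r where "r > 0" "{t-r<..<t+r} \<times> {x-r<..<x+r} \<subseteq> \<Omega>"
proof -
  from open_prod_elim[OF assms] obtain A B where AB: "open A" "open B" "t \<in> A" "x \<in> B" "A \<times> B \<subseteq> \<Omega>"
    by (metis mem_Sigma_iff)
  obtain r1 where r1: "r1 > 0" "ball t r1 \<subseteq> A" using AB open_contains_ball by blast
  obtain r2 where r2: "r2 > 0" "ball x r2 \<subseteq> B" using AB open_contains_ball by blast
  have "{t - min r1 r2<..<t + min r1 r2} \<times> {x - min r1 r2<..<x + min r1 r2} \<subseteq> \<Omega>"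
    using AB(5) r1(2) r2(2) by (fastforce simp: ball_eq_greaterThanLessThan)
  then show ?thesis using that[of "min r1 r2"] r1(1) r2(1) by simp
qed

text \<open>Continuity of \<open>fx\<close> controls the increments in x uniformly near the point;
  the increment in t is taken on the single line through it, where the existence of the derivative
  is enough.\<close>

lemma has_derivative_of_partials:
  fixes f :: fld
  assumes "open \<Omega>" "z \<in> \<Omega>"
    and t: "\<And>t x. (t, x) \<in> \<Omega> \<Longrightarrow> ((\<lambda>s. f (s, x)) has_real_derivative ft (t, x)) (at t)"
    and x: "\<And>t x. (t, x) \<in> \<Omega> \<Longrightarrow> ((\<lambda>y. f (t, y)) has_real_derivative fx (t, x)) (at x)"
    and c: "continuous_on \<Omega> fx"
  shows "(f has_derivative (\<lambda>(v, w). ft z * v + fx z * w)) (at z)"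
proof -
  obtain t0 x0 where z: "z = (t0, x0)" by force
  obtain r where r: "r > 0" "{t0-r<..<t0+r} \<times> {x0-r<..<x0+r} \<subseteq> \<Omega>"
    using open_box_in assms(1,2) z by metis
  let ?N = "{t0-r<..<t0+r}" and ?K = "{x0-r<..<x0+r}"
  have "((\<lambda>(t, x). f (t, x)) has_derivative
      (\<lambda>(v, w). (\<lambda>v. ft (t0, x0) * v) v + blinfun_apply (blinfun_scaleR_left (fx (t0, x0))) w))
      (at (t0, x0) within ?N \<times> ?K)"
  proof (rule has_derivative_partialsI)
    show "((\<lambda>t. f (t, x0)) has_derivative (\<lambda>v. ft (t0, x0) * v)) (at t0 within ?N)"
      using t[of t0 x0] assms(2) z has_field_derivative_at_within
      by (fastforce simp: has_field_derivative_def)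
    show "((\<lambda>x. f (t, x)) has_derivative blinfun_apply (blinfun_scaleR_left (fx (t, x)))) (at x within ?K)"
      if "t \<in> ?N" "x \<in> ?K" for t x
    proof -
      have "(t, x) \<in> \<Omega>" using that r(2) by blast
      from has_field_derivative_at_within[OF x[OF this], of ?K] show ?thesis
        by (auto simp: has_field_derivative_def mult.commute[of "fx _"] elim!: has_derivative_eq_rhs)
    qed
    have "continuous (at (t0, x0) within ?N \<times> ?K) fx"
      using c assms(1,2) z by (auto simp: continuous_on_eq_continuous_at continuous_at_imp_continuous_at_within)
    then show "continuous (at (t0, x0) within ?N \<times> ?K) (\<lambda>(t, x). blinfun_scaleR_left (fx (t, x)))"
      using bounded_linear.continuous[OF bounded_linear_blinfun_scaleR_left] by (simp add: case_prod_unfold)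
  qed (use r in auto)
  moreover have "at (t0, x0) within ?N \<times> ?K = at (t0, x0)"
    by (rule at_within_open) (use r in \<open>auto intro: open_Times\<close>)
  ultimately show ?thesis
    unfolding z by (auto simp: case_prod_unfold mult.commute[of "fx _"] elim!: has_derivative_eq_rhs)
qed

lemma Ck_on_Suc_partialsI:
  fixes f :: fld
  assumes "open \<Omega>"
    and "\<And>t x. (t, x) \<in> \<Omega> \<Longrightarrow> ((\<lambda>s. f (s, x)) has_real_derivative ft (t, x)) (at t)"
    and "\<And>t x. (t, x) \<in> \<Omega> \<Longrightarrow> ((\<lambda>y. f (t, y)) has_real_derivative fx (t, x)) (at x)"
    and ft: "Ck_on k \<Omega> ft" and fx: "Ck_on k \<Omega> fx"
  shows "Ck_on (Suc k) \<Omega> f"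
proof (rule Ck_on_SucI[OF assms(1), where f' = "\<lambda>z (v, w). ft z * v + fx z * w"])
  have "continuous_on \<Omega> fx"
    using fx by (induction k) (auto dest: Ck_on_lower simp del: Ck_on.simps(2))
  then show "(f has_derivative (\<lambda>(v, w). ft z * v + fx z * w)) (at z)" if "z \<in> \<Omega>" for z
    using has_derivative_of_partials[OF assms(1) that assms(2,3)] by blast
  show "Ck_on k \<Omega> (\<lambda>z. case v of (v, w) \<Rightarrow> ft z * v + fx z * w)" for v
    unfolding case_prod_unfold
    by (intro Ck_on_add Ck_on_bilinear[OF _ bounded_bilinear_mult] Ck_on_const assms)
qed

lemma Dt_imp_eq: "((\<lambda>s. f (s, x)) has_real_derivative D) (at t) \<Longrightarrow> Dt f (t, x) = D"
  by (simp add: Dt_def DERIV_imp_deriv)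

lemma Dx_imp_eq: "((\<lambda>y. f (t, y)) has_real_derivative D) (at x) \<Longrightarrow> Dx f (t, x) = D"
  by (simp add: Dx_def DERIV_imp_deriv)

lemma partials_cong:
  assumes "open \<Omega>" "\<And>z. z \<in> \<Omega> \<Longrightarrow> f z = g z" "z \<in> \<Omega>"
  shows "Dt f z = Dt g z" "Dx f z = Dx g z"
proof -
  obtain t x where z: "z = (t, x)" by force
  have "eventually (\<lambda>s. s \<in> {s. (s, x) \<in> \<Omega>}) (nhds t)"
    by (rule eventually_nhds_in_open[OF open_slices(2)[OF assms(1)]]) (use assms(3) z in simp)
  moreover have "eventually (\<lambda>y. y \<in> {y. (t, y) \<in> \<Omega>}) (nhds x)"
    by (rule eventually_nhds_in_open[OF open_slices(1)[OF assms(1)]]) (use assms(3) z in simp)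
  ultimately  have "eventually (\<lambda>s. f (s, x) = g (s, x)) (nhds t)" "eventually (\<lambda>y. f (t, y) = g (t, y)) (nhds x)"
    using assms(2) by (auto elim: eventually_mono)
  then show "Dt f z = Dt g z" "Dx f z = Dx g z"
    by (simp_all add: z Dt_def Dx_def deriv_cong_ev)
qed

text \<open>The second difference of \<open>f\<close> over a small square of side h equals h^2 times
  either mixed derivative at some point of the square, by the mean value theorem applied in either
  order. If the two derivatives differed at \<open>z\<close>, continuity would keep their values
  near \<open>z\<close> apart.\<close>

lemma mixed_partials:
  assumes \<Omega>: "open \<Omega>" and f: "smooth_on \<Omega> f" and z: "z \<in> \<Omega>"
  shows "Dt (Dx f) z = Dx (Dt f) z"
proof (rule ccontr)
  assume ne: "Dt (Dx f) z \<noteq> Dx (Dt f) z"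
  obtain t x where tx: "z = (t, x)" by force
  \<comment> \<open>Half the gap: on the box chosen below each mixed derivative stays within
    \<open>e\<close> of its value at \<open>z\<close>, so the two can have no value in
    common.\<close>
  define e where "e = \<bar>Dt (Dx f) z - Dx (Dt f) z\<bar> / 2"
  have e: "e > 0" using ne by (simp add: e_def)
  note s = smooth_on_partials[OF \<Omega> f]
  have c: "continuous_on \<Omega> (Dt (Dx f))" "continuous_on \<Omega> (Dx (Dt f))"
    using s smooth_on_partials[OF \<Omega>] smooth_on_continuous by blast+
  have o: "open {w \<in> \<Omega>. dist (g w) (g z) < e}" if "continuous_on \<Omega> g" for g :: fld
  proof -
    have "{w \<in> \<Omega>. dist (g w) (g z) < e} = \<Omega> \<inter> g -` ball (g z) e"
      by (auto simp: dist_commute)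
    then show ?thesis using continuous_open_preimage[OF that \<Omega>] by simp
  qed
  have "open (\<Omega> \<inter> {w \<in> \<Omega>. dist (Dt (Dx f) w) (Dt (Dx f) z) < e} \<inter> {w \<in> \<Omega>. dist (Dx (Dt f) w) (Dx (Dt f) z) < e})"
    by (intro open_Int \<Omega> o c)
  then obtain r where r: "r > 0" "{t-r<..<t+r} \<times> {x-r<..<x+r}
      \<subseteq> \<Omega> \<inter> {w \<in> \<Omega>. dist (Dt (Dx f) w) (Dt (Dx f) z) < e} \<inter> {w \<in> \<Omega>. dist (Dx (Dt f) w) (Dx (Dt f) z) < e}"
    by (rule open_box_in[where t = t and x = x]) (use z e tx in auto)
  define h where "h = r / 2"
  have h: "h > 0" "h < r" using r(1) by (auto simp: h_def)
  have in\<Omega>: "(s, y) \<in> \<Omega>" "dist (Dt (Dx f) (s, y)) (Dt (Dx f) z) < e" "dist (Dx (Dt f) (s, y)) (Dx (Dt f) z) < e"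
    if "t \<le> s" "s \<le> t + h" "x \<le> y" "y \<le> x + h" for s y
    using that h r by (auto 0 3 dest!: subsetD[where c = "(s, y)"])
  define \<Delta> where "\<Delta> = f (t + h, x + h) - f (t + h, x) - f (t, x + h) + f (t, x)"
  have "\<exists>y>x. y < x + h \<and> (f (t + h, x + h) - f (t, x + h)) - (f (t + h, x) - f (t, x))
      = (x + h - x) * (Dx f (t + h, y) - Dx f (t, y))"
    by (rule MVT2[where f = "\<lambda>y. f (t + h, y) - f (t, y)"])
      (use h in \<open>auto intro!: derivative_intros partial_deriv(2)[OF f] in\<Omega>\<close>)
  then obtain y where y: "x < y" "y < x + h" "\<Delta> = h * (Dx f (t + h, y) - Dx f (t, y))"
    by (auto simp: \<Delta>_def)
  have "\<exists>s>t. s < t + h \<and> Dx f (t + h, y) - Dx f (t, y) = (t + h - t) * Dt (Dx f) (s, y)"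
    by (rule MVT2) (use h y in \<open>auto intro!: partial_deriv(1)[OF s(2)] in\<Omega>\<close>)
  then obtain s1 where s1: "t < s1" "s1 < t + h" "\<Delta> = h * (h * Dt (Dx f) (s1, y))"
    using y by auto
  have "\<exists>s>t. s < t + h \<and> (f (t + h, x + h) - f (t + h, x)) - (f (t, x + h) - f (t, x))
      = (t + h - t) * (Dt f (s, x + h) - Dt f (s, x))"
    by (rule MVT2[where f = "\<lambda>s. f (s, x + h) - f (s, x)"])
      (use h in \<open>auto intro!: derivative_intros partial_deriv(1)[OF f] in\<Omega>\<close>)
  then obtain s2 where s2: "t < s2" "s2 < t + h" "\<Delta> = h * (Dt f (s2, x + h) - Dt f (s2, x))"
    by (auto simp: \<Delta>_def)
  have "\<exists>y>x. y < x + h \<and> Dt f (s2, x + h) - Dt f (s2, x) = (x + h - x) * Dx (Dt f) (s2, y)"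
    by (rule MVT2) (use h s2 in \<open>auto intro!: partial_deriv(2)[OF s(1)] in\<Omega>\<close>)
  then obtain y2 where y2: "x < y2" "y2 < x + h" "\<Delta> = h * (h * Dx (Dt f) (s2, y2))"
    using s2 by auto
  have "Dt (Dx f) (s1, y) = Dx (Dt f) (s2, y2)"
    using s1(3) y2(3) h by simp
  then show False
  proof -
    assume eq: "Dt (Dx f) (s1, y) = Dx (Dt f) (s2, y2)"
    have "dist (Dt (Dx f) (s1, y)) (Dt (Dx f) z) < e" "dist (Dx (Dt f) (s2, y2)) (Dx (Dt f) z) < e"
      using in\<Omega>(2)[of s1 y] in\<Omega>(3)[of s2 y2] s1(1,2) s2(1,2) y(1,2) y2(1,2) by linarith+
    then have "\<bar>Dt (Dx f) z - Dx (Dt f) z\<bar> < 2 * e"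
      unfolding eq dist_real_def by linarith
    then show False by (simp add: e_def)
  qed
qed

section \<open>Integration along slices and lines\<close>

lemma connected_open_derivative_zero:
  fixes f :: "real \<Rightarrow> real"
  assumes "connected S" "\<And>x. x \<in> S \<Longrightarrow> (f has_real_derivative 0) (at x)" "x \<in> S" "y \<in> S"
  shows "f x = f y"
proof -
  have "convex S" using assms(1) is_interval_connected_1 is_interval_convex_1 by blast
  moreover have "(f has_derivative (\<lambda>h. 0)) (at x within S)" if "x \<in> S" for x
    using has_field_derivative_at_within[OF assms(2)[OF that], of S]
    by (simp add: has_field_derivative_def lambda_zero)
  ultimately show ?thesis
    using has_derivative_zero_constant[of S f] assms(3,4) by force
qed

lemma is_domainD:
  assumes "is_domain \<Omega>"
  shows "open \<Omega>" "connected {x. (t, x) \<in> \<Omega>}" "open (fst ` \<Omega>)" "connected (fst ` \<Omega>)" "fst ` \<Omega> \<noteq> {}"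
    "open (snd ` \<Omega>)" "connected (snd ` \<Omega>)" "connected \<Omega>" "\<Omega> \<noteq> {}"
  using assms unfolding is_domain_def
  by (auto intro!: open_map_fst open_map_snd connected_continuous_image continuous_intros
      simp: open_image_fst open_image_snd)

lemma deriv_zero_slice:
  assumes "is_domain \<Omega>" "\<And>t x. (t, x) \<in> \<Omega> \<Longrightarrow> ((\<lambda>y. f (t, y)) has_real_derivative 0) (at x)"
    "(t, x) \<in> \<Omega>" "(t, y) \<in> \<Omega>"
  shows "f (t, x) = f (t, y)"
  using connected_open_derivative_zero[OF is_domainD(2)[OF assms(1), of t], of "\<lambda>y. f (t, y)" x y] assms
  by auto

text \<open>No single x need belong to all slices. Smoothness of \<open>h\<close> is therefore
  proved near each time along a horizontal line through one point of its slice, and the local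
  statements are glued.\<close>

lemma smooth_on_slice_function:
  fixes f :: fld
  assumes \<Omega>: "open \<Omega>" and f: "smooth_on \<Omega> f" and h: "\<And>t x. (t, x) \<in> \<Omega> \<Longrightarrow> f (t, x) = h t"
  shows "smooth_on (fst ` \<Omega>) h"
proof (rule smooth_on_local)
  show "open (fst ` \<Omega>)" using \<Omega> open_image_fst by blast
  fix t assume "t \<in> fst ` \<Omega>"
  then obtain x where x: "(t, x) \<in> \<Omega>" by force
  let ?S = "{s. (s, x) \<in> \<Omega>}"
  have o: "open ?S" using open_slices[OF \<Omega>] by blast
  have "smooth_on ?S (\<lambda>s. f (s, x))"
    by (rule smooth_on_compose[OF f o \<Omega>]) (auto intro!: smooth_intros o)
  then have "smooth_on ?S h" by (rule smooth_on_cong[OF o, rotated]) (simp add: h)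
  then show "\<exists>S'. open S' \<and> t \<in> S' \<and> smooth_on S' h" using o x by blast
qed

text \<open>Integration in x: on a connected slice a vanishing x-derivative leaves one constant, so
  the constant of integration is a function of t on the whole domain. This is how the determining
  equations are integrated.\<close>

lemma x_independent:
  assumes \<Omega>: "is_domain \<Omega>" and f: "smooth_on \<Omega> f" and "\<And>z. z \<in> \<Omega> \<Longrightarrow> Dx f z = 0"
  obtains h where "smooth_on (fst ` \<Omega>) h" "\<And>t x. (t, x) \<in> \<Omega> \<Longrightarrow> f (t, x) = h t"
proof -
  \<comment> \<open>Any point of the slice will do; off the time projection the value is
    arbitrary.\<close>
  define h where "h t = f (t, SOME x. (t, x) \<in> \<Omega>)" for t
  have "f (t, x) = h t" if "(t, x) \<in> \<Omega>" for t x
    unfolding h_def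
  proof (rule deriv_zero_slice[OF \<Omega> _ that])
    show "(t, SOME x. (t, x) \<in> \<Omega>) \<in> \<Omega>" using someI[of "\<lambda>x. (t, x) \<in> \<Omega>"] that by blast
  qed (use partial_deriv(2)[OF f] assms(3) in force)
  then show ?thesis using that[of h] smooth_on_slice_function[OF is_domainD(1)[OF \<Omega>] f] by blast
qed

lemma smooth_on_of_time:
  fixes h :: "real \<Rightarrow> real" and \<Omega> :: dom
  assumes "open \<Omega>" "smooth_on (fst ` \<Omega>) h"
  shows "smooth_on \<Omega> (\<lambda>z. h (fst z))"
  by (rule smooth_on_compose[OF assms(2,1) open_image_fst[OF assms(1)]])
    (auto intro: smooth_on_linear bounded_linear_fst assms)

lemma smooth_on_of_space:
  fixes h :: "real \<Rightarrow> real" and \<Omega> :: dom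
  assumes "open \<Omega>" "smooth_on (snd ` \<Omega>) h"
  shows "smooth_on \<Omega> (\<lambda>z. h (snd z))"
  by (rule smooth_on_compose[OF assms(2,1) open_image_snd[OF assms(1)]])
    (auto intro: smooth_on_linear bounded_linear_snd assms)

lemma antiderivative:
  fixes g :: "real \<Rightarrow> real"
  assumes "smooth_on {a<..<b} g"
  obtains G where "smooth_on {a<..<b} G" "\<And>t. t \<in> {a<..<b} \<Longrightarrow> (G has_real_derivative g t) (at t)"
proof (cases "a < b")
  case True
  have "\<exists>F. \<forall>x. ereal a < ereal x \<longrightarrow> ereal x < ereal b \<longrightarrow> (F has_vector_derivative g x) (at x)"
    by (rule einterval_antiderivative)
      (use True smooth_on_continuous[OF assms] in \<open>auto simp: continuous_on_eq_continuous_at\<close>)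
  then obtain F where F: "\<And>x. x \<in> {a<..<b} \<Longrightarrow> (F has_real_derivative g x) (at x)"
    by (auto simp: has_real_derivative_iff_has_vector_derivative)
  show ?thesis using that[OF smooth_on_realI[OF _ F assms] F] by simp
next
  case False
  then show ?thesis using that[of g] assms by auto
qed

text \<open>The primitive has to be smooth in both variables. Rescaling the path from
  \<open>x0\<close> to x to the unit interval fixes the range of integration, so that the integral
  may be differentiated in the parameter t. Since \<open>P\<close> commutes with \<open>Dt\<close>
  and \<open>Dx\<close> takes \<open>P g\<close> back to \<open>g\<close>, smoothness follows by
  induction on the order.\<close>

lemma x_antiderivative:
  fixes f :: fld
  assumes f: "smooth_on ({a<..<b} \<times> {c<..<d}) f" and x0: "c < x0" "x0 < d"
  obtains X where "smooth_on ({a<..<b} \<times> {c<..<d}) X"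
    "\<And>z. z \<in> {a<..<b} \<times> {c<..<d} \<Longrightarrow> Dx X z = f z"
proof -
  let ?K = "{c<..<d}" and ?N = "{a<..<b}"
  let ?\<Omega> = "?N \<times> ?K"
  have o: "open ?\<Omega>" by (intro open_Times) auto
  define P where "P g z = (snd z - x0) * integral (cbox 0 1) (\<lambda>s. g (fst z, x0 + s * (snd z - x0)))"
    for g :: fld and z
  have seg: "x0 + s * (x - x0) \<in> ?K" if "x \<in> ?K" "s \<in> cbox 0 1" for x s
  proof -
    have "x0 + s * (x - x0) = (1 - s) *\<^sub>R x0 + s *\<^sub>R x" by (simp add: algebra_simps)
    moreover have "convex ?K" by simp
    ultimately show ?thesis using convexD_alt[of ?K x0 x s] that x0 by auto
  qed
  have cont: "continuous_on (?\<Omega> \<times> cbox 0 1) (\<lambda>(z, s). g (fst z, x0 + s * (snd z - x0)))"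
    if "smooth_on ?\<Omega> g" for g
    unfolding case_prod_unfold
    by (rule continuous_on_compose2[OF smooth_on_continuous[OF that]])
      (use seg in \<open>auto intro!: continuous_intros\<close>)
  have Pcont: "continuous_on ?\<Omega> (P g)" if "smooth_on ?\<Omega> g" for g
    unfolding P_def
    by (intro continuous_intros integral_continuous_on_param cont that)
  have Px: "((\<lambda>y. P g (t, y)) has_real_derivative g (t, x)) (at x)"
    if g: "smooth_on ?\<Omega> g" and tx: "t \<in> ?N" "x \<in> ?K" for g t x
  proof -
    have "smooth_on ?K (\<lambda>y. g (t, y))"
      by (rule smooth_on_compose[OF g _ o]) (use tx in \<open>auto intro!: smooth_intros\<close>)
    then obtain G where G: "\<And>y. y \<in> ?K \<Longrightarrow> (G has_real_derivative g (t, y)) (at y)"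
      by (rule antiderivative) blast
    have "P g (t, y) = G y - G x0" if y: "y \<in> ?K" for y
    proof -
      have "((\<lambda>s. (y - x0) * g (t, x0 + s * (y - x0))) has_integral
          G (x0 + 1 * (y - x0)) - G (x0 + 0 * (y - x0))) {0..1}"
      proof (rule fundamental_theorem_of_calculus)
        fix s :: real assume s: "s \<in> {0..1}"
        have "((\<lambda>s. G (x0 + s * (y - x0))) has_real_derivative g (t, x0 + s * (y - x0)) * (y - x0)) (at s)"
          by (rule DERIV_chain2[OF G]) (use s seg[OF y] in \<open>auto intro!: derivative_eq_intros\<close>)
        then show "((\<lambda>s. G (x0 + s * (y - x0))) has_vector_derivative (y - x0) * g (t, x0 + s * (y - x0)))
            (at s within {0..1})"
          by (simp add: has_real_derivative_iff_has_vector_derivative[symmetric] mult.commute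
              has_field_derivative_at_within)
      qed simp
      from integral_unique[OF this] show ?thesis by (simp add: P_def)
    qed
    then show ?thesis
      using has_field_derivative_transform_within_open[of "\<lambda>y. G y - G x0" "g (t, x)" x ?K "\<lambda>y. P g (t, y)"]
        DERIV_diff[OF G[OF tx(2)] DERIV_const] tx(2) by auto
  qed
  have Pt: "((\<lambda>s. P g (s, x)) has_real_derivative P (Dt g) (t, x)) (at t)"
    if g: "smooth_on ?\<Omega> g" and tx: "t \<in> ?N" "x \<in> ?K" for g t x
  proof -
    have slice: "continuous_on (?N \<times> cbox 0 1) (\<lambda>(t, s). h (t, x0 + s * (x - x0)))"
      if "smooth_on ?\<Omega> h" for h
      unfolding case_prod_unfold
      by (rule continuous_on_compose2[OF smooth_on_continuous[OF that]])
        (use seg tx in \<open>auto intro!: continuous_intros\<close>)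
    have "((\<lambda>t. integral (cbox 0 1) (\<lambda>s. g (t, x0 + s * (x - x0)))) has_field_derivative
        integral (cbox 0 1) (\<lambda>s. Dt g (t, x0 + s * (x - x0)))) (at t within ?N)"
    proof (rule leibniz_rule_field_derivative)
      show "((\<lambda>t. g (t, x0 + s * (x - x0))) has_field_derivative Dt g (t, x0 + s * (x - x0))) (at t within ?N)"
        if "t \<in> ?N" "s \<in> cbox 0 1" for t s
        by (rule has_field_derivative_at_within, rule partial_deriv(1)[OF g]) (use that seg tx in auto)
      show "(\<lambda>s. g (t, x0 + s * (x - x0))) integrable_on cbox 0 1" if "t \<in> ?N" for t
        by (rule integrable_continuous, rule continuous_on_compose2[OF slice[OF g], where f = "\<lambda>s. (t, s)", simplified])
          (use that in \<open>auto intro!: continuous_intros\<close>)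
      show "continuous_on (?N \<times> cbox 0 1) (\<lambda>(t, s). Dt g (t, x0 + s * (x - x0)))"
        by (rule slice[OF smooth_on_partials(1)[OF o g]])
    qed (use tx in auto)
    moreover have "at t within ?N = at t" using at_within_open[OF tx(1)] by simp
    ultimately show ?thesis
      unfolding P_def using DERIV_cmult by force
  qed
  have "Ck_on k ?\<Omega> (P g)" if "smooth_on ?\<Omega> g" for k g
    using that
  proof (induction k arbitrary: g)
    case 0
    then show ?case using Pcont by simp
  next
    case (Suc k)
    show ?case
    proof (rule Ck_on_Suc_partialsI[OF o, where ft = "P (Dt g)" and fx = g])
      show "Ck_on k ?\<Omega> (P (Dt g))" by (rule Suc.IH[OF smooth_on_partials(1)[OF o Suc.prems]])
      show "Ck_on k ?\<Omega> g" using Suc.prems by (simp only: smooth_on_def)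
    qed (use Px[OF Suc.prems] Pt[OF Suc.prems] in auto)
  qed
  then have "smooth_on ?\<Omega> (P f)" using f by (simp add: smooth_on_def)
  moreover have "Dx (P f) z = f z" if "z \<in> ?\<Omega>" for z
    using Dx_imp_eq[OF Px[OF f, of "fst z" "snd z"]] that by auto
  ultimately show ?thesis using that by blast
qed


section \<open>Changes of the independent variables\<close>

abbreviation fibre_map :: "(real \<Rightarrow> real) \<Rightarrow> fld \<Rightarrow> real \<times> real \<Rightarrow> real \<times> real"
  where "fibre_map T X \<equiv> \<lambda>(t, x). (T t, X (t, x))"

lemma real_derivative_inj_on:
  fixes f :: "real \<Rightarrow> real"
  assumes "connected S" "\<And>x. x \<in> S \<Longrightarrow> (f has_real_derivative f' x) (at x)" "\<And>x. x \<in> S \<Longrightarrow> f' x \<noteq> 0"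
  shows "inj_on f S"
proof -
  have "f x \<noteq> f y" if "x \<in> S" "y \<in> S" "x < y" for x y
  proof
    assume eq: "f x = f y"
    have sub: "{x..y} \<subseteq> S"
      using assms(1) that mem_is_interval_1_I[of S x y] by (auto simp: is_interval_connected_1)
    have "\<exists>z>x. z < y \<and> f y - f x = (y - x) * f' z"
      by (rule MVT2) (use that sub assms(2) in auto)
    then obtain z where "x < z" "z < y" "f' z = 0" using eq by auto
    moreover from this have "z \<in> {x..y}" by simp
    ultimately show False using sub assms(3)[of z] by blast
  qed
  then show ?thesis unfolding inj_on_def by (metis linorder_neqE)
qed

text \<open>Injectivity and smoothness of the inverse are consequences, not assumptions:
  nonvanishing derivatives on the connected time projection and on the connected slices make
  \<open>T\<close> and each X(t, .) injective.\<close>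

locale fibre_diffeo =
  fixes \<Omega> :: dom and T :: "real \<Rightarrow> real" and X :: fld
  assumes dom: "is_domain \<Omega>" and T: "smooth_on (fst ` \<Omega>) T" and X: "smooth_on \<Omega> X"
    and T_ne: "t \<in> fst ` \<Omega> \<Longrightarrow> deriv T t \<noteq> 0" and X_ne: "z \<in> \<Omega> \<Longrightarrow> Dx X z \<noteq> 0"
begin

lemma opens: "open \<Omega>" "open (fst ` \<Omega>)"
  using is_domainD[OF dom] by auto

lemma T_deriv: "t \<in> fst ` \<Omega> \<Longrightarrow> (T has_real_derivative deriv T t) (at t)"
  using smooth_on_deriv(1)[OF opens(2) T] .

lemma T_inj: "inj_on T (fst ` \<Omega>)"
  using real_derivative_inj_on[OF is_domainD(4)[OF dom] T_deriv T_ne] .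

lemma F_inj: "inj_on (fibre_map T X) \<Omega>"
proof (rule inj_onI, clarsimp)
  fix t x s y assume *: "(t, x) \<in> \<Omega>" "(s, y) \<in> \<Omega>" "T t = T s" "X (t, x) = X (s, y)"
  then have "t = s" using inj_onD[OF T_inj] by force
  moreover have "inj_on (\<lambda>x. X (t, x)) {x. (t, x) \<in> \<Omega>}"
    by (rule real_derivative_inj_on[OF is_domainD(2)[OF dom], where f' = "\<lambda>x. Dx X (t, x)"]) (simp_all add: partial_deriv(2)[OF X] X_ne)
  ultimately show "t = s \<and> x = y" using * by (auto dest: inj_onD)
qed

lemma F_smooth: "smooth_on \<Omega> (fibre_map T X)"
  unfolding case_prod_unfold
  using smooth_on_Pair[OF opens(1) smooth_on_of_time[OF opens(1) T] X] by simp

text \<open>Invariance of domain makes the image open. A slice of the image over \<open>T t\<close>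
  comes from the single slice over \<open>t\<close>, because \<open>T\<close> is injective, and is
  connected as its continuous image.\<close>

lemma image_domain: "is_domain (fibre_map T X ` \<Omega>)"
proof -
  have c: "continuous_on \<Omega> (fibre_map T X)" using smooth_on_continuous[OF F_smooth] .
  have "open (fibre_map T X ` \<Omega>)"
    by (rule invariance_of_domain[OF c opens(1) F_inj])
  moreover have "connected (fibre_map T X ` \<Omega>)"
    by (rule connected_continuous_image[OF c is_domainD(8)[OF dom]])
  moreover have "connected {x. (s, x) \<in> fibre_map T X ` \<Omega>}" for s
  proof (cases "s \<in> T ` fst ` \<Omega>")
    case True
    then obtain t where t: "t \<in> fst ` \<Omega>" "s = T t" by auto
    have "{x. (s, x) \<in> fibre_map T X ` \<Omega>} = (\<lambda>x. X (t, x)) ` {x. (t, x) \<in> \<Omega>}"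
    proof -
      have "t' = t" if "(t', x) \<in> \<Omega>" "T t' = T t" for t' x
        using inj_onD[OF T_inj that(2)] that(1) t(1) by force
      then show ?thesis using t(2) by (force simp: image_iff)
    qed
    moreover have "continuous_on {x. (t, x) \<in> \<Omega>} (\<lambda>x. X (t, x))"
      by (rule continuous_on_compose2[OF smooth_on_continuous[OF X]]) (auto intro: continuous_intros)
    ultimately show ?thesis
      using connected_continuous_image is_domainD(2)[OF dom] by metis
  next
    case False
    then have "{x. (s, x) \<in> fibre_map T X ` \<Omega>} = {}" by force
    then show ?thesis by simp
  qed
  ultimately show ?thesis using is_domainD(9)[OF dom] by (auto simp: is_domain_def)
qed

lemma F_derivative:
  assumes "(t, x) \<in> \<Omega>"
  shows "(fibre_map T X has_derivative (\<lambda>(v, w). (deriv T t * v, Dt X (t, x) * v + Dx X (t, x) * w))) (at (t, x))"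
proof -
  have "((\<lambda>z. T (fst z)) has_derivative (\<lambda>v. deriv T t * fst v)) (at (t, x))"
  proof (rule has_derivative_compose[of fst fst])
    show "(fst has_derivative fst) (at (t, x))" by (simp add: has_derivative_fst)
    show "(T has_derivative (*) (deriv T t)) (at (fst (t, x)))"
      using T_deriv[of t] assms by (force simp: has_field_derivative_def)
  qed
  moreover have "(X has_derivative (\<lambda>(v, w). Dt X (t, x) * v + Dx X (t, x) * w)) (at (t, x))"
    by (rule has_derivative_of_partials[OF opens(1) assms])
      (use partial_deriv[OF X] smooth_on_continuous[OF smooth_on_partials(2)[OF opens(1) X]] in auto)
  ultimately have "((\<lambda>z. (T (fst z), X z)) has_derivative
      (\<lambda>v. (deriv T t * fst v, (\<lambda>(v, w). Dt X (t, x) * v + Dx X (t, x) * w) v))) (at (t, x))"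
    by (rule has_derivative_Pair)
  then show ?thesis by (simp add: case_prod_unfold)
qed

definition G :: "real \<times> real \<Rightarrow> real \<times> real"
  where "G = inv_into \<Omega> (fibre_map T X)"

lemma GF: "z \<in> \<Omega> \<Longrightarrow> G (fibre_map T X z) = z"
  using inv_into_f_f[OF F_inj] unfolding G_def .

lemma FG: "z \<in> fibre_map T X ` \<Omega> \<Longrightarrow> fibre_map T X (G z) = z" "z \<in> fibre_map T X ` \<Omega> \<Longrightarrow> G z \<in> \<Omega>"
  unfolding G_def by (rule f_inv_into_f, assumption, rule inv_into_into, assumption)

text \<open>The derivative of the inverse is the inverse of a triangular Jacobian, a smooth
  expression \<open>q\<close> evaluated at \<open>G\<close>. Each order of differentiability of
  \<open>G\<close> thus yields the next, starting from continuity.\<close>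

lemma G_smooth: "smooth_on (fibre_map T X ` \<Omega>) G"
proof -
  let ?\<Omega>' = "fibre_map T X ` \<Omega>"
  have o: "open ?\<Omega>'" using image_domain is_domainD by blast
  have cont: "continuous_on ?\<Omega>' G"
    unfolding G_def
    by (rule continuous_on_inverse_open[OF opens(1) smooth_on_continuous[OF F_smooth]])
      (use F_inj inv_into_f_f in auto)
  define q where "q v z = (fst v / deriv T (fst z), (snd v - Dt X z * (fst v / deriv T (fst z))) / Dx X z)"
    for v z
  have q: "smooth_on \<Omega> (q v)" for v
    unfolding q_def using T_ne X_ne
    by (intro smooth_intros opens smooth_on_partials[OF opens(1) X]
        smooth_on_of_time[OF opens(1) smooth_on_deriv(2)[OF opens(2) T]]) auto
  have d: "(G has_derivative (\<lambda>v. q v (G y))) (at y)" if y: "y \<in> ?\<Omega>'" for y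
  proof -
    obtain t x where tx: "G y = (t, x)" by force
    then have \<Omega>: "(t, x) \<in> \<Omega>" using FG(2)[OF y] by simp
    have ne: "deriv T t \<noteq> 0" "Dx X (t, x) \<noteq> 0" using \<Omega> T_ne[of t] X_ne by force+
    show ?thesis
    proof (rule has_derivative_inverse_basic[OF _ _ _ _ o y])
      show "(fibre_map T X has_derivative (\<lambda>(v, w). (deriv T t * v, Dt X (t, x) * v + Dx X (t, x) * w))) (at (G y))"
        using F_derivative[OF \<Omega>] tx by simp
      show "bounded_linear (\<lambda>v. q v (G y))"
        unfolding q_def by (rule linear_linear[THEN iffD2])
          (auto intro!: linearI simp: add_divide_distrib diff_divide_distrib ring_distribs)
      show "(\<lambda>v. q v (G y)) \<circ> (\<lambda>(v, w). (deriv T t * v, Dt X (t, x) * v + Dx X (t, x) * w)) = id"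
        using ne by (auto simp: q_def tx fun_eq_iff field_simps)
      show "continuous (at y) G" using cont o y continuous_on_eq_continuous_at by blast
    qed (use FG in auto)
  qed
  have "Ck_on k ?\<Omega>' G" for k
  proof (induction k)
    case 0
    then show ?case using cont by simp
  next
    case (Suc k)
    show ?case
    proof (rule Ck_on_SucI[OF o d])
      show "Ck_on k ?\<Omega>' (\<lambda>y. q v (G y))" for v
        by (rule Ck_on_compose[OF o opens(1) _ _ Suc]) (use FG(2) q smooth_on_def in blast)+
    qed
  qed
  then show ?thesis by (simp add: smooth_on_def)
qed

lemma push_smooth:
  assumes "smooth_on \<Omega> f"
  shows "smooth_on (fibre_map T X ` \<Omega>) (\<lambda>z. f (G z))"
  using smooth_on_compose[OF assms is_domainD(1)[OF image_domain] opens(1) _ G_smooth] FG(2)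
  by (meson image_subsetI)

lemma pull_smooth: "smooth_on (fibre_map T X ` \<Omega>) f \<Longrightarrow> smooth_on \<Omega> (\<lambda>(t, x). f (T t, X (t, x)))"
  using smooth_on_compose[OF _ opens(1) _ _ F_smooth, of "fibre_map T X ` \<Omega>" f]
    image_domain is_domainD by (simp add: case_prod_unfold)

lemma time_image: "fst ` fibre_map T X ` \<Omega> = T ` fst ` \<Omega>"
  by force

lemma G_time: "(s, y) \<in> fibre_map T X ` \<Omega> \<Longrightarrow> fst (G (s, y)) = inv_into (fst ` \<Omega>) T s"
  using GF inv_into_f_f[OF T_inj] by force

text \<open>The inverse of \<open>T\<close> is the time component of \<open>G\<close>, which depends
  on the new time alone, so its smoothness is inherited from the planar inverse.\<close>

lemma time_inverse:
  shows "smooth_on (T ` fst ` \<Omega>) (inv_into (fst ` \<Omega>) T)"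
    and "t \<in> fst ` \<Omega> \<Longrightarrow> inv_into (fst ` \<Omega>) T (T t) = t"
proof -
  have o: "open (fibre_map T X ` \<Omega>)" using image_domain is_domainD by blast
  show "smooth_on (T ` fst ` \<Omega>) (inv_into (fst ` \<Omega>) T)"
    using smooth_on_slice_function[OF o smooth_on_fst[OF o G_smooth] G_time] time_image by simp
  show "t \<in> fst ` \<Omega> \<Longrightarrow> inv_into (fst ` \<Omega>) T (T t) = t"
    using inv_into_f_f[OF T_inj] .
qed

end

section \<open>Determining equations of essential Lie symmetries\<close>

lemma smooth_on_fst_snd: "open S \<Longrightarrow> smooth_on S fst" "open S \<Longrightarrow> smooth_on S snd"
  using smooth_on_linear[OF _ bounded_linear_fst] smooth_on_linear[OF _ bounded_linear_snd] by auto

lemma partials_imp_eq: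
  "((\<lambda>s. f (s, snd z)) has_real_derivative D) (at (fst z)) \<Longrightarrow> Dt f z = D"
  "((\<lambda>y. f (fst z, y)) has_real_derivative D) (at (snd z)) \<Longrightarrow> Dx f z = D"
  using Dt_imp_eq[of f "snd z" D "fst z"] Dx_imp_eq[of f "fst z" D "snd z"] by auto

lemma partial_deriv':
  assumes "smooth_on \<Omega> f" "z \<in> \<Omega>"
  shows "((\<lambda>s. f (s, snd z)) has_real_derivative Dt f z) (at (fst z))"
    and "((\<lambda>y. f (fst z, y)) has_real_derivative Dx f z) (at (snd z))"
  using partial_deriv[of \<Omega> f "fst z" "snd z"] assms by auto

lemma partials_eqI:
  assumes "open \<Omega>" "\<And>z. z \<in> \<Omega> \<Longrightarrow> f z = g z" "z \<in> \<Omega>"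
  shows "((\<lambda>s. g (s, snd z)) has_real_derivative D) (at (fst z)) \<Longrightarrow> Dt f z = D"
    and "((\<lambda>y. g (fst z, y)) has_real_derivative D) (at (snd z)) \<Longrightarrow> Dx f z = D"
  using partials_imp_eq partials_cong[OF assms] by simp_all

text \<open>
  The coefficients of \<open>u\<^sub>x\<^sub>x\<close>, \<open>u\<^sub>x\<close> and \<open>u\<close> in the infinitesimal invariance criterion for
  \<open>\<tau> \<partial>\<^sub>t + \<xi> \<partial>\<^sub>x + \<eta> u \<partial>\<^sub>u\<close>.
\<close>
definition det2 :: "fld \<Rightarrow> (real \<Rightarrow> real) \<Rightarrow> fld \<Rightarrow> fld"
  where "det2 a \<tau> \<xi> z = a z * (2 * Dx \<xi> z - deriv \<tau> (fst z)) - \<tau> (fst z) * Dt a z - \<xi> z * Dx a z"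

definition det1 :: "fld \<Rightarrow> fld \<Rightarrow> (real \<Rightarrow> real) \<Rightarrow> fld \<Rightarrow> fld \<Rightarrow> fld"
  where "det1 a b \<tau> \<xi> \<eta> z = b z * (Dx \<xi> z - deriv \<tau> (fst z)) - Dt \<xi> z - a z * (2 * Dx \<eta> z - Dx (Dx \<xi>) z)
    - \<tau> (fst z) * Dt b z - \<xi> z * Dx b z"

definition det0 :: "fld \<Rightarrow> fld \<Rightarrow> fld \<Rightarrow> (real \<Rightarrow> real) \<Rightarrow> fld \<Rightarrow> fld \<Rightarrow> fld"
  where "det0 a b c \<tau> \<xi> \<eta> z = Dt \<eta> z - a z * Dx (Dx \<eta>) z - b z * Dx \<eta> z - c z * deriv \<tau> (fst z)
    - \<tau> (fst z) * Dt c z - \<xi> z * Dx c z"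

fun determining :: "dom \<Rightarrow> lineq \<Rightarrow> (real \<Rightarrow> real) \<Rightarrow> fld \<Rightarrow> fld \<Rightarrow> bool"
  where "determining \<Omega> (a, b, c) \<tau> \<xi> \<eta> \<longleftrightarrow>
    smooth_on (fst ` \<Omega>) \<tau> \<and> smooth_on \<Omega> \<xi> \<and> smooth_on \<Omega> \<eta> \<and>
    (\<forall>z\<in>\<Omega>. det2 a \<tau> \<xi> z = 0 \<and> det1 a b \<tau> \<xi> \<eta> z = 0 \<and> det0 a b c \<tau> \<xi> \<eta> z = 0)"

lemma ess_field_smooth:
  assumes \<Omega>: "open \<Omega>"
  shows "smooth_on {(t, x, u). (t, x) \<in> \<Omega>} (ess_field \<Omega> \<tau> \<xi> \<eta>) \<longleftrightarrow>
    smooth_on (fst ` \<Omega>) \<tau> \<and> smooth_on \<Omega> \<xi> \<and> smooth_on \<Omega> \<eta>" (is "?l \<longleftrightarrow> ?r")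
proof
  let ?S = "{(t, x, u). (t, x) \<in> \<Omega>} :: (real \<times> real \<times> real) set"
  have S: "?S = (\<lambda>z. (fst z, fst (snd z))) -` \<Omega>" by auto
  have oS: "open ?S"
    unfolding S by (rule open_vimage[OF \<Omega>]) (auto intro!: continuous_intros)
  {
    assume ?l
    have "smooth_on \<Omega> (\<lambda>z. ess_field \<Omega> \<tau> \<xi> \<eta> (fst z, snd z, 1))"
      by (rule smooth_on_compose[OF \<open>?l\<close> \<Omega> oS])
        (auto intro!: smooth_intros smooth_on_fst_snd \<Omega>)
    then have "smooth_on \<Omega> (\<lambda>z. (\<tau> (fst z), \<xi> z, \<eta> z))"
      by (rule smooth_on_cong[OF \<Omega>, rotated]) (auto simp: ess_field_def)
    from smooth_on_fst[OF \<Omega> this] smooth_on_snd[OF \<Omega> this]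
    have "smooth_on \<Omega> (\<lambda>z. \<tau> (fst z))" and 1: "smooth_on \<Omega> (\<lambda>z. (\<xi> z, \<eta> z))"
      by simp_all
    from smooth_on_slice_function[OF \<Omega> this(1)] smooth_on_fst[OF \<Omega> 1] smooth_on_snd[OF \<Omega> 1]
    show ?r by simp
  next
    assume ?r
    have "smooth_on ?S (\<lambda>z. (fst z, fst (snd z)))"
      by (intro smooth_intros smooth_on_fst_snd oS)
    then have c: "smooth_on ?S (\<lambda>z. f (fst z, fst (snd z)))" if "smooth_on \<Omega> f" for f :: fld
      by (rule smooth_on_compose[OF that oS \<Omega>, rotated]) auto
    have "smooth_on \<Omega> (\<lambda>z. \<tau> (fst z))"
      using smooth_on_of_time[OF \<Omega>] \<open>?r\<close> by blast
    from c[OF this] have "smooth_on ?S (\<lambda>z. (\<tau> (fst z), \<xi> (fst z, fst (snd z)), \<eta> (fst z, fst (snd z)) * snd (snd z)))"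
      using \<open>?r\<close> by (intro smooth_intros smooth_on_fst_snd oS c) auto
    then show ?l
      by (rule smooth_on_cong[OF oS, rotated]) (auto simp: ess_field_def)
  }
qed

lemma linear_form_zero_iff:
  "(\<forall>q u s. s * A + q * B + u * C = (0::real)) \<longleftrightarrow> A = 0 \<and> B = 0 \<and> C = 0"
proof
  assume *: "\<forall>q u s. s * A + q * B + u * C = 0"
  show "A = 0 \<and> B = 0 \<and> C = 0"
    using *[rule_format, of 1 0 0] *[rule_format, of 0 1 0] *[rule_format, of 0 0 1] by simp
qed simp

text \<open>Since \<tau> depends on t only and the last component is linear in u, the jet variable
  \<open>r\<close> drops out, and substituting \<open>p\<close> from the equation cancels the
  undifferentiated terms in \<eta>. What remains is linear in the free variables \<open>s\<close>,
  \<open>q\<close> and \<open>u\<close> with the coefficients \<open>det2\<close>,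
  \<open>det1\<close> and \<open>det0\<close>, so each of these has to vanish.\<close>

lemma ess_field_in_lie_algebra:
  assumes \<Omega>: "open \<Omega>"
  shows "ess_field \<Omega> \<tau> \<xi> \<eta> \<in> lie_algebra \<Omega> E \<longleftrightarrow> determining \<Omega> E \<tau> \<xi> \<eta>"
proof (cases E)
  case (fields a b c)
  let ?Q = "ess_field \<Omega> \<tau> \<xi> \<eta>"
  have crit: "(\<forall>u p q r s. p = a (t, x) * s + b (t, x) * q + c (t, x) * u \<longrightarrow>
       prol_t ?Q (t, x, u, p, q) - a (t, x) * prol_xx ?Q t x u p q r s - b (t, x) * prol_x ?Q (t, x, u, p, q)
       - c (t, x) * eta_of ?Q (t, x, u)
       - tau_of ?Q (t, x, u) * (Dt a (t, x) * s + Dt b (t, x) * q + Dt c (t, x) * u)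
       - xi_of ?Q (t, x, u) * (Dx a (t, x) * s + Dx b (t, x) * q + Dx c (t, x) * u) = 0)
     \<longleftrightarrow> det2 a \<tau> \<xi> (t, x) = 0 \<and> det1 a b \<tau> \<xi> \<eta> (t, x) = 0 \<and> det0 a b c \<tau> \<xi> \<eta> (t, x) = 0"
    if s\<tau>: "smooth_on (fst ` \<Omega>) \<tau>" and s\<xi>: "smooth_on \<Omega> \<xi>" and s\<eta>: "smooth_on \<Omega> \<eta>" and z: "(t, x) \<in> \<Omega>" for t x
  proof -
    have ev_x: "eventually (\<lambda>y. y \<in> {y. (t, y) \<in> \<Omega>}) (nhds x)" if "(t, x) \<in> \<Omega>" for t x
      by (rule eventually_nhds_in_open[OF open_slices(1)[OF \<Omega>]]) (use that in simp)
    have ev_t: "eventually (\<lambda>s. s \<in> {s. (s, x) \<in> \<Omega>}) (nhds t)" if "(t, x) \<in> \<Omega>" for t x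
      by (rule eventually_nhds_in_open[OF open_slices(2)[OF \<Omega>]]) (use that in simp)
    have o: "open (fst ` \<Omega>)" using open_image_fst[OF \<Omega>] .
    have t: "deriv (\<lambda>s. tau_of ?Q (s, x, u)) t = deriv \<tau> t"
        "deriv (\<lambda>s. xi_of ?Q (s, x, u)) t = Dt \<xi> (t, x)"
        "deriv (\<lambda>s. eta_of ?Q (s, x, u)) t = Dt \<eta> (t, x) * u" if z: "(t, x) \<in> \<Omega>" for t x u
    proof -
      have "deriv (\<lambda>s. tau_of ?Q (s, x, u)) t = deriv \<tau> t"
        by (rule deriv_cong_ev[OF eventually_mono[OF ev_t[OF z]] refl]) (auto simp: ess_field_def)
      moreover have "deriv (\<lambda>s. xi_of ?Q (s, x, u)) t = deriv (\<lambda>s. \<xi> (s, x)) t"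
        by (rule deriv_cong_ev[OF eventually_mono[OF ev_t[OF z]] refl]) (auto simp: ess_field_def)
      moreover have "deriv (\<lambda>s. eta_of ?Q (s, x, u)) t = deriv (\<lambda>s. \<eta> (s, x) * u) t"
        by (rule deriv_cong_ev[OF eventually_mono[OF ev_t[OF z]] refl]) (auto simp: ess_field_def)
      moreover have "deriv (\<lambda>s. \<eta> (s, x) * u) t = Dt \<eta> (t, x) * u"
        by (rule DERIV_imp_deriv[OF DERIV_cmult_right[OF partial_deriv(1)[OF s\<eta> z]]])
      ultimately show "deriv (\<lambda>s. tau_of ?Q (s, x, u)) t = deriv \<tau> t"
        "deriv (\<lambda>s. xi_of ?Q (s, x, u)) t = Dt \<xi> (t, x)"
        "deriv (\<lambda>s. eta_of ?Q (s, x, u)) t = Dt \<eta> (t, x) * u" by (simp_all add: Dt_def)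
    qed
    have x: "deriv (\<lambda>y. tau_of ?Q (t, y, u)) x = 0"
        "deriv (\<lambda>y. xi_of ?Q (t, y, u)) x = Dx \<xi> (t, x)"
        "deriv (\<lambda>y. eta_of ?Q (t, y, u)) x = Dx \<eta> (t, x) * u" if z: "(t, x) \<in> \<Omega>" for t x u
    proof -
      have "deriv (\<lambda>y. tau_of ?Q (t, y, u)) x = deriv (\<lambda>y. \<tau> t) x"
        by (rule deriv_cong_ev[OF eventually_mono[OF ev_x[OF z]] refl]) (auto simp: ess_field_def)
      moreover have "deriv (\<lambda>y. xi_of ?Q (t, y, u)) x = deriv (\<lambda>y. \<xi> (t, y)) x"
        by (rule deriv_cong_ev[OF eventually_mono[OF ev_x[OF z]] refl]) (auto simp: ess_field_def)
      moreover have "deriv (\<lambda>y. eta_of ?Q (t, y, u)) x = deriv (\<lambda>y. \<eta> (t, y) * u) x"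
        by (rule deriv_cong_ev[OF eventually_mono[OF ev_x[OF z]] refl]) (auto simp: ess_field_def)
      moreover have "deriv (\<lambda>y. \<eta> (t, y) * u) x = Dx \<eta> (t, x) * u"
        by (rule DERIV_imp_deriv[OF DERIV_cmult_right[OF partial_deriv(2)[OF s\<eta> z]]])
      ultimately show "deriv (\<lambda>y. tau_of ?Q (t, y, u)) x = 0"
        "deriv (\<lambda>y. xi_of ?Q (t, y, u)) x = Dx \<xi> (t, x)"
        "deriv (\<lambda>y. eta_of ?Q (t, y, u)) x = Dx \<eta> (t, x) * u" by (simp_all add: Dx_def)
    qed
    have u: "deriv (\<lambda>u. tau_of ?Q (t, x, u)) u = 0"
        "deriv (\<lambda>u. xi_of ?Q (t, x, u)) u = 0"
        "deriv (\<lambda>u. eta_of ?Q (t, x, u)) u = \<eta> (t, x)" if z: "(t, x) \<in> \<Omega>" for t x u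
    proof -
      have "deriv (\<lambda>u. \<eta> (t, x) * u) u = \<eta> (t, x)"
        by (rule DERIV_imp_deriv) (auto intro!: derivative_eq_intros)
      then show "deriv (\<lambda>u. tau_of ?Q (t, x, u)) u = 0" "deriv (\<lambda>u. xi_of ?Q (t, x, u)) u = 0"
        "deriv (\<lambda>u. eta_of ?Q (t, x, u)) u = \<eta> (t, x)" using z by (simp_all add: ess_field_def)
    qed
    have px: "prol_x ?Q (t, x, u, p, q) = Dx \<eta> (t, x) * u + q * \<eta> (t, x) - q * Dx \<xi> (t, x)"
      if "(t, x) \<in> \<Omega>" for t x u p q
      using x[OF that] u[OF that] by simp
    have pt: "prol_t ?Q (t, x, u, p, q) = Dt \<eta> (t, x) * u + p * \<eta> (t, x) - p * deriv \<tau> t - q * Dt \<xi> (t, x)" for u p q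
      using t[OF z] u[OF z] by simp
    have pxx: "prol_xx ?Q t x u p q r s = Dx (Dx \<eta>) (t, x) * u + q * (2 * Dx \<eta> (t, x) - Dx (Dx \<xi>) (t, x))
        + s * (\<eta> (t, x) - 2 * Dx \<xi> (t, x))" for u p q r s
    proof -
      have "deriv (\<lambda>y. prol_x ?Q (t, y, u, p, q)) x
          = deriv (\<lambda>y. Dx \<eta> (t, y) * u + q * \<eta> (t, y) - q * Dx \<xi> (t, y)) x"
        by (rule deriv_cong_ev[OF eventually_mono[OF ev_x[OF z]] refl]) (auto simp only: px mem_Collect_eq)
      also have "\<dots> = Dx (Dx \<eta>) (t, x) * u + q * Dx \<eta> (t, x) - q * Dx (Dx \<xi>) (t, x)"
        by (rule DERIV_imp_deriv)
          (auto intro!: derivative_eq_intros partial_deriv(2)[OF _ z] smooth_on_partials[OF \<Omega>] s\<eta> s\<xi>)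
      finally have 1: "deriv (\<lambda>y. prol_x ?Q (t, y, u, p, q)) x = \<dots>" .
      have 2: "deriv (\<lambda>u. prol_x ?Q (t, x, u, p, q)) u = Dx \<eta> (t, x)"
        unfolding px[OF z] by (rule DERIV_imp_deriv) (auto intro!: derivative_eq_intros)
      have 3: "deriv (\<lambda>p. prol_x ?Q (t, x, u, p, q)) p = 0"
        unfolding px[OF z] by (rule DERIV_imp_deriv) (auto intro!: derivative_eq_intros)
      have 4: "deriv (\<lambda>q. prol_x ?Q (t, x, u, p, q)) q = \<eta> (t, x) - Dx \<xi> (t, x)"
        unfolding px[OF z] by (rule DERIV_imp_deriv) (auto intro!: derivative_eq_intros)
      show ?thesis
        unfolding prol_xx_def tot_x1_def 1 2 3 4 tot_x0.simps x[OF z] u[OF z]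
        by (simp add: algebra_simps)
    qed
    have comp: "tau_of ?Q (t, x, u) = \<tau> t" "xi_of ?Q (t, x, u) = \<xi> (t, x)" "eta_of ?Q (t, x, u) = \<eta> (t, x) * u" for u
      using z by (simp_all add: ess_field_def)
    have "prol_t ?Q (t, x, u, p, q) - a (t, x) * prol_xx ?Q t x u p q r s - b (t, x) * prol_x ?Q (t, x, u, p, q)
       - c (t, x) * eta_of ?Q (t, x, u)
       - tau_of ?Q (t, x, u) * (Dt a (t, x) * s + Dt b (t, x) * q + Dt c (t, x) * u)
       - xi_of ?Q (t, x, u) * (Dx a (t, x) * s + Dx b (t, x) * q + Dx c (t, x) * u)
       = s * det2 a \<tau> \<xi> (t, x) + q * det1 a b \<tau> \<xi> \<eta> (t, x) + u * det0 a b c \<tau> \<xi> \<eta> (t, x)"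
      if "p = a (t, x) * s + b (t, x) * q + c (t, x) * u" for u p q r s
      unfolding that pt pxx px[OF z] comp det2_def det1_def det0_def fst_conv
      by (simp add: algebra_simps)
    then show ?thesis unfolding linear_form_zero_iff[symmetric] by metis
  qed
  have out: "(t, x) \<notin> \<Omega> \<longrightarrow> ?Q (t, x, u) = 0" for t x u by (simp add: ess_field_def)
  show ?thesis
    unfolding fields lie_algebra.simps mem_Collect_eq ess_field_smooth[OF \<Omega>] determining.simps
    using crit out by auto
qed

lemma ess_field_cong:
  assumes "\<And>t x. (t, x) \<in> \<Omega> \<Longrightarrow> \<tau> t = \<tau>' t \<and> \<xi> (t, x) = \<xi>' (t, x) \<and> \<eta> (t, x) = \<eta>' (t, x)"
  shows "ess_field \<Omega> \<tau> \<xi> \<eta> = ess_field \<Omega> \<tau>' \<xi>' \<eta>'"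
  using assms by (auto simp: ess_field_def fun_eq_iff)

lemma ess_field_eqD:
  assumes "ess_field \<Omega> \<tau> \<xi> \<eta> = ess_field \<Omega> \<tau>' \<xi>' \<eta>'" "(t, x) \<in> \<Omega>"
  shows "\<tau> t = \<tau>' t" "\<xi> (t, x) = \<xi>' (t, x)" "\<eta> (t, x) = \<eta>' (t, x)"
  using fun_cong[OF assms(1), of "(t, x, 1)"] assms(2) by (auto simp: ess_field_def)

lemma ess_algebra_eq:
  assumes "open \<Omega>"
  shows "ess_algebra \<Omega> E = {ess_field \<Omega> \<tau> \<xi> \<eta> | \<tau> \<xi> \<eta>. determining \<Omega> E \<tau> \<xi> \<eta>}"
  unfolding ess_algebra_def using ess_field_in_lie_algebra[OF assms] by blast

subsection \<open>Gauge transformations\<close>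

text \<open>
  The substitution \<open>u = W v\<close> enters only through \<open>N = W\<^sub>x / W\<close> and \<open>P = W\<^sub>t / W\<close>.
\<close>
lemma determining_gauge:
  assumes \<Omega>: "open \<Omega>" and a: "smooth_on \<Omega> a" and b: "smooth_on \<Omega> b" and c: "smooth_on \<Omega> c"
    and N: "smooth_on \<Omega> N" and P: "smooth_on \<Omega> P" and NP: "\<And>z. z \<in> \<Omega> \<Longrightarrow> Dt N z = Dx P z"
    and b': "\<And>z. z \<in> \<Omega> \<Longrightarrow> b' z = b z + 2 * a z * N z"
    and c': "\<And>z. z \<in> \<Omega> \<Longrightarrow> c' z = a z * (Dx N z + (N z)\<^sup>2) + b z * N z + c z - P z"
    and det: "determining \<Omega> (a, b, c) \<tau> \<xi> \<eta>"
  shows "determining \<Omega> (a, b', c') \<tau> \<xi> (\<lambda>z. \<eta> z - (\<tau> (fst z) * P z + \<xi> z * N z))"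
proof -
  have \<tau>: "smooth_on (fst ` \<Omega>) \<tau>" and \<xi>: "smooth_on \<Omega> \<xi>" and \<eta>: "smooth_on \<Omega> \<eta>"
    using det by auto
  have o: "open (fst ` \<Omega>)" using open_image_fst[OF \<Omega>] .
  note sp = smooth_on_partials[OF \<Omega>]
  define \<eta>' where "\<eta>' z = \<eta> z - (\<tau> (fst z) * P z + \<xi> z * N z)" for z
  have s\<eta>': "smooth_on \<Omega> \<eta>'"
    unfolding \<eta>'_def by (intro smooth_intros smooth_on_of_time[OF \<Omega> \<tau>] \<Omega> \<eta> \<xi> P N)
  have d\<tau>: "(\<tau> has_real_derivative deriv \<tau> (fst z)) (at (fst z))" if "z \<in> \<Omega>" for z
    using smooth_on_deriv(1)[OF o \<tau>] that by auto
  have "det2 a \<tau> \<xi> z = 0 \<and> det1 a b' \<tau> \<xi> \<eta>' z = 0 \<and> det0 a b' c' \<tau> \<xi> \<eta>' z = 0" if z: "z \<in> \<Omega>" for z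
  proof -
    note pd0 = partial_deriv'[OF _ z]
    note pd = pd0[OF a] pd0[OF b] pd0[OF c] pd0[OF N] pd0[OF P] pd0[OF \<xi>] pd0[OF \<eta>]
      pd0[OF sp(2)[OF N]] pd0[OF sp(2)[OF P]] pd0[OF sp(2)[OF \<xi>]] pd0[OF sp(2)[OF \<eta>]]
    have \<eta>'x: "Dx \<eta>' w = Dx \<eta> w - (\<tau> (fst w) * Dx P w + (Dx \<xi> w * N w + \<xi> w * Dx N w))" if "w \<in> \<Omega>" for w
      unfolding \<eta>'_def by (rule partials_imp_eq(2))
        (auto intro!: derivative_eq_intros partial_deriv'(2)[OF \<eta> that] partial_deriv'(2)[OF \<xi> that]
          partial_deriv'(2)[OF P that] partial_deriv'(2)[OF N that])
    have \<eta>'t: "Dt \<eta>' z = Dt \<eta> z - (deriv \<tau> (fst z) * P z + \<tau> (fst z) * Dt P z + (Dt \<xi> z * N z + \<xi> z * Dt N z))"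
      unfolding \<eta>'_def by (rule partials_imp_eq(1))
        (auto intro!: derivative_eq_intros d\<tau>[OF z] pd)
    have \<eta>'xx: "Dx (Dx \<eta>') z = Dx (Dx \<eta>) z - (\<tau> (fst z) * Dx (Dx P) z
        + (Dx (Dx \<xi>) z * N z + 2 * Dx \<xi> z * Dx N z + \<xi> z * Dx (Dx N) z))"
      by (rule partials_eqI(2)[OF \<Omega> \<eta>'x z]) (auto intro!: derivative_eq_intros pd)
    have b'x: "Dx b' z = Dx b z + 2 * (Dx a z * N z + a z * Dx N z)"
      by (rule partials_eqI(2)[OF \<Omega> b' z]) (auto intro!: derivative_eq_intros pd)
    have b't: "Dt b' z = Dt b z + 2 * (Dt a z * N z + a z * Dt N z)"
      by (rule partials_eqI(1)[OF \<Omega> b' z]) (auto intro!: derivative_eq_intros pd)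
    have c'x: "Dx c' z = Dx a z * (Dx N z + (N z)\<^sup>2) + a z * (Dx (Dx N) z + 2 * N z * Dx N z)
        + Dx b z * N z + b z * Dx N z + Dx c z - Dx P z"
      by (rule partials_eqI(2)[OF \<Omega> c' z]) (auto intro!: derivative_eq_intros pd)
    have c't: "Dt c' z = Dt a z * (Dx N z + (N z)\<^sup>2) + a z * (Dt (Dx N) z + 2 * N z * Dt N z)
        + Dt b z * N z + b z * Dt N z + Dt c z - Dt P z"
      by (rule partials_eqI(1)[OF \<Omega> c' z]) (auto intro!: derivative_eq_intros pd)
    have Px: "Dx P z = Dt N z" using NP[OF z] by simp
    have Pxx: "Dx (Dx P) z = Dt (Dx N) z"
      using partials_cong(2)[OF \<Omega> NP z] mixed_partials[OF \<Omega> N z] by simp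
    have d: "det2 a \<tau> \<xi> z = 0" "det1 a b \<tau> \<xi> \<eta> z = 0" "det0 a b c \<tau> \<xi> \<eta> z = 0" using det z by auto
    \<comment> \<open>Regard the three expressions as coefficients of a second-order operator in x.
      Conjugation with the gauge factor replaces the x-derivative by the x-derivative plus
      \<open>N\<close>, and expanding its square gives these combinations.\<close>
    have "det1 a b' \<tau> \<xi> \<eta>' z = det1 a b \<tau> \<xi> \<eta> z + 2 * N z * det2 a \<tau> \<xi> z"
      unfolding det1_def det2_def \<eta>'x[OF z] b'x b't b'[OF z] Px by (simp add: algebra_simps)
    moreover have "det0 a b' c' \<tau> \<xi> \<eta>' z = det0 a b c \<tau> \<xi> \<eta> z + N z * det1 a b \<tau> \<xi> \<eta> z
        + (Dx N z + (N z)\<^sup>2) * det2 a \<tau> \<xi> z"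
      unfolding det0_def det1_def det2_def \<eta>'x[OF z] \<eta>'t \<eta>'xx c'x c't b'[OF z] c'[OF z] Px Pxx
      by (simp add: algebra_simps power2_eq_square)
    ultimately show ?thesis using d by simp
  qed
  then show ?thesis
    using \<tau> \<xi> s\<eta>' by (auto simp: \<eta>'_def[abs_def])
qed

subsection \<open>Changes of the independent variables\<close>

text \<open>All derivative values are replaced by independent real variables, so that covariance of
  the determining equations becomes membership in a polynomial ideal. The hypotheses are the chain
  rule for the components of the vector field and the transformation laws of the coefficients
  together with their first derivatives.\<close>

lemma det_transformation_algebra:
  fixes a b c :: real
  assumes "T \<noteq> 0" "Xx \<noteq> 0"
    and "tau' = T * tau" "tau't * T = T2 * tau + T * taut"
    and "xi' = tau * Xt + xi * Xx" "xi'x * Xx = tau * Xtx + xix * Xx + xi * Xxx"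
      "xi't * T + xi'x * Xt = taut * Xt + tau * Xtt + xit * Xx + xi * Xtx"
      "xi'xx * Xx\<^sup>2 + xi'x * Xxx = tau * Xtxx + xixx * Xx + 2 * xix * Xxx + xi * Xxxx"
    and "a' * T = a * Xx\<^sup>2" "a'x * Xx * T = ax * Xx\<^sup>2 + 2 * a * Xx * Xxx"
      "(a't * T + a'x * Xt) * T + a' * T2 = adt * Xx\<^sup>2 + 2 * a * Xx * Xtx"
    and "b' * T = b * Xx - Xt + a * Xxx" "b'x * Xx * T = bx * Xx + b * Xxx - Xtx + ax * Xxx + a * Xxxx"
      "(b't * T + b'x * Xt) * T + b' * T2 = bt * Xx + b * Xtx - Xtt + adt * Xxx + a * Xtxx"
    and "c' * T = c" "c'x * Xx * T = cx" "(c't * T + c'x * Xt) * T + c' * T2 = ct"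
    and "etax = eta'x * Xx" "etat = eta't * T + eta'x * Xt" "etaxx = eta'xx * Xx\<^sup>2 + eta'x * Xxx"
  shows "(a' * (2 * xi'x - tau't) - tau' * a't - xi' * a'x) * T = Xx\<^sup>2 * (a * (2 * xix - taut) - tau * adt - xi * ax)"
      (is ?A)
    and "(b' * (xi'x - tau't) - xi't - a' * (2 * eta'x - xi'xx) - tau' * b't - xi' * b'x) * T =
       Xx * (b * (xix - taut) - xit - a * (2 * etax - xixx) - tau * bt - xi * bx)
       + Xxx * (a * (2 * xix - taut) - tau * adt - xi * ax)" (is ?B)
    and "(eta't - a' * eta'xx - b' * eta'x - c' * tau't - tau' * c't - xi' * c'x) * T
       = etat - a * etaxx - b * etax - c * taut - tau * ct - xi * cx" (is ?C)
proof -
  \<comment> \<open>The hypotheses give the derivatives in the new variables only with the factors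
    \<open>Xx\<close> and \<open>T\<close>, so each identity is proved after multiplication by both
    and divided afterwards.\<close>
  have "Xx * T * ((a' * (2 * xi'x - tau't) - tau' * a't - xi' * a'x) * T - Xx\<^sup>2 * (a * (2 * xix - taut) - tau * adt - xi * ax)) = 0"
    using assms(3-6,9-11) by algebra
  then show ?A using assms(1,2) by simp
  have "Xx * T * ((b' * (xi'x - tau't) - xi't - a' * (2 * eta'x - xi'xx) - tau' * b't - xi' * b'x) * T -
     (Xx * (b * (xix - taut) - xit - a * (2 * etax - xixx) - tau * bt - xi * bx)
      + Xxx * (a * (2 * xix - taut) - tau * adt - xi * ax))) = 0"
    using assms(3-9,12-14,18) by algebra
  then show ?B using assms(1,2) by simp
  have "Xx * T * ((eta't - a' * eta'xx - b' * eta'x - c' * tau't - tau' * c't - xi' * c'x) * T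
       - (etat - a * etaxx - b * etax - c * taut - tau * ct - xi * cx)) = 0"
    using assms(3-5,9,12,15-20) by algebra
  then show ?C using assms(1,2) by simp
qed

context fibre_diffeo
begin

abbreviation pull :: "fld \<Rightarrow> fld"
  where "pull f \<equiv> \<lambda>z. f (fibre_map T X z)"

lemma image_open: "open (fibre_map T X ` \<Omega>)"
  using is_domainD(1)[OF image_domain] .

lemma pull_smooth': "smooth_on (fibre_map T X ` \<Omega>) f \<Longrightarrow> smooth_on \<Omega> (pull f)"
  using pull_smooth by (simp add: case_prod_unfold)

lemma pull_partials:
  assumes f: "smooth_on (fibre_map T X ` \<Omega>) f" and z: "z \<in> \<Omega>"
  shows "Dt (pull f) z = Dt f (fibre_map T X z) * deriv T (fst z) + Dx f (fibre_map T X z) * Dt X z" (is ?t)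
    and "Dx (pull f) z = Dx f (fibre_map T X z) * Dx X z" (is ?x)
proof -
  obtain t x where tx: "z = (t, x)" by force
  let ?\<Omega>' = "fibre_map T X ` \<Omega>"
  have y: "(T t, X (t, x)) \<in> ?\<Omega>'" using z tx by force
  have zt: "(t, x) \<in> \<Omega>" using z tx by simp
  have "(f has_derivative (\<lambda>(v, w). Dt f (T t, X (t, x)) * v + Dx f (T t, X (t, x)) * w)) (at (fibre_map T X (t, x)))"
    using has_derivative_of_partials[OF image_open y partial_deriv[OF f]
        smooth_on_continuous[OF smooth_on_partials(2)[OF image_open f]]] by simp
  from has_derivative_compose[OF F_derivative[OF zt] this]
  have d: "(pull f has_derivative (\<lambda>(v, w). Dt f (T t, X (t, x)) * (deriv T t * v)
      + Dx f (T t, X (t, x)) * (Dt X (t, x) * v + Dx X (t, x) * w))) (at (t, x))"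
    by (simp add: case_prod_unfold)
  have "frechet_derivative (pull f) (at (t, x)) = (\<lambda>(v, w). Dt f (T t, X (t, x)) * (deriv T t * v)
      + Dx f (T t, X (t, x)) * (Dt X (t, x) * v + Dx X (t, x) * w))"
    by (rule frechet_derivative_at[OF d, symmetric])
  moreover have "pull f differentiable at (t, x)" using d differentiable_def by blast
  ultimately show ?t ?x
    using Dt_eq_frechet(2)[of "pull f" t x] Dx_eq_frechet(2)[of "pull f" t x] tx
    by (auto simp: algebra_simps)
qed

lemma pull_partials_xx:
  assumes f: "smooth_on (fibre_map T X ` \<Omega>) f" and z: "z \<in> \<Omega>"
  shows "Dx (Dx (pull f)) z = Dx (Dx f) (fibre_map T X z) * (Dx X z)\<^sup>2 + Dx f (fibre_map T X z) * Dx (Dx X) z"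
proof -
  note f' = smooth_on_partials(2)[OF image_open f]
  have "Dx (Dx (pull f)) z = Dx (\<lambda>z. pull (Dx f) z * Dx X z) z"
    by (rule partials_cong(2)[OF opens(1) pull_partials(2)[OF f] z])
  also have "\<dots> = Dx (pull (Dx f)) z * Dx X z + Dx (Dx X) z * pull (Dx f) z"
  proof (rule partials_imp_eq(2))
    show "((\<lambda>y. pull (Dx f) (fst z, y) * Dx X (fst z, y)) has_real_derivative
        Dx (pull (Dx f)) z * Dx X z + Dx (Dx X) z * pull (Dx f) z) (at (snd z))"
      using DERIV_mult[OF partial_deriv'(2)[OF pull_smooth'[OF f'] z]
          partial_deriv'(2)[OF smooth_on_partials(2)[OF opens(1) X] z]] by simp
  qed
  finally show ?thesis
    unfolding pull_partials(2)[OF f' z] by (simp add: power2_eq_square algebra_simps)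
qed

end

lemma triangular_zero_iff:
  fixes A B C A' B' C' :: real
  assumes "k \<noteq> 0" "l \<noteq> 0" "A' * k = l\<^sup>2 * A" "B' * k = l * B + m * A" "C' * k = C"
  shows "(A = 0 \<and> B = 0 \<and> C = 0) \<longleftrightarrow> (A' = 0 \<and> B' = 0 \<and> C' = 0)"
proof
  assume "A = 0 \<and> B = 0 \<and> C = 0"
  then show "A' = 0 \<and> B' = 0 \<and> C' = 0" using assms by simp
next
  assume 0: "A' = 0 \<and> B' = 0 \<and> C' = 0"
  then have "A = 0" using assms by simp
  then show "A = 0 \<and> B = 0 \<and> C = 0" using assms 0 by simp
qed

context fibre_diffeo
begin

lemma in_image: "z \<in> \<Omega> \<Longrightarrow> fibre_map T X z \<in> fibre_map T X ` \<Omega>" "t \<in> fst ` \<Omega> \<Longrightarrow> T t \<in> fst ` fibre_map T X ` \<Omega>"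
  by force+

lemma time_image_open: "open (fst ` fibre_map T X ` \<Omega>)"
  using open_image_fst[OF image_open] .

text \<open>The transformation laws of all three coefficients have the shape of \<open>eq\<close>.
  They are differentiated here once for all, including the term in T_tt that comes from the factor
  T_t.\<close>

lemma partials_of_identity:
  assumes f': "smooth_on (fibre_map T X ` \<Omega>) f'" and f: "smooth_on \<Omega> f"
    and eq: "\<And>z. z \<in> \<Omega> \<Longrightarrow> f' (fibre_map T X z) * deriv T (fst z) = f z" and z: "z \<in> \<Omega>"
  shows "Dx f' (fibre_map T X z) * Dx X z * deriv T (fst z) = Dx f z"
    and "(Dt f' (fibre_map T X z) * deriv T (fst z) + Dx f' (fibre_map T X z) * Dt X z) * deriv T (fst z)
      + f' (fibre_map T X z) * deriv (deriv T) (fst z) = Dt f z"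
proof -
  note dT = smooth_on_deriv[OF opens(2) smooth_on_deriv(2)[OF opens(2) T]]
  have p: "((\<lambda>s. pull f' (s, snd z)) has_real_derivative Dt (pull f') z) (at (fst z))"
    "((\<lambda>y. pull f' (fst z, y)) has_real_derivative Dx (pull f') z) (at (snd z))"
    using partial_deriv'[OF pull_smooth'[OF f'] z] by auto
  have "((\<lambda>y. pull f' (fst z, y) * deriv T (fst z)) has_real_derivative Dx (pull f') z * deriv T (fst z)) (at (snd z))"
    by (rule DERIV_cmult_right[OF p(2)])
  then have "Dx (\<lambda>z. pull f' z * deriv T (fst z)) z = Dx (pull f') z * deriv T (fst z)"
    by (intro partials_imp_eq(2)) simp
  moreover have "Dx (\<lambda>z. pull f' z * deriv T (fst z)) z = Dx f z"
    by (rule partials_cong(2)[OF opens(1) eq z])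
  ultimately show "Dx f' (fibre_map T X z) * Dx X z * deriv T (fst z) = Dx f z"
    using pull_partials(2)[OF f' z] by simp
  have "fst z \<in> fst ` \<Omega>" using z by simp
  from DERIV_mult[OF p(1) dT(1)[OF this]]
  have "Dt (\<lambda>z. pull f' z * deriv T (fst z)) z
      = Dt (pull f') z * deriv T (fst z) + deriv (deriv T) (fst z) * pull f' z"
    by (intro partials_imp_eq(1)) simp
  moreover have "Dt (\<lambda>z. pull f' z * deriv T (fst z)) z = Dt f z"
    by (rule partials_cong(1)[OF opens(1) eq z])
  ultimately show "(Dt f' (fibre_map T X z) * deriv T (fst z) + Dx f' (fibre_map T X z) * Dt X z) * deriv T (fst z)
      + f' (fibre_map T X z) * deriv (deriv T) (fst z) = Dt f z"
    using pull_partials(1)[OF f' z] by (simp add: mult.commute)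
qed

text \<open>\<open>\<tau>'\<close> and \<open>\<xi>'\<close> are the components of the
  pushed-forward field. Up to the factor T_t, the expressions \<open>det2\<close>,
  \<open>det1\<close>, \<open>det0\<close> transform by a triangular matrix with diagonal entries
  (X_x)^2, X_x and 1, so they vanish together in either system of coordinates.\<close>

lemma determining_coordinates:
  assumes abc: "smooth_on \<Omega> a" "smooth_on \<Omega> b" "smooth_on \<Omega> c"
    and abc': "smooth_on (fibre_map T X ` \<Omega>) a'" "smooth_on (fibre_map T X ` \<Omega>) b'" "smooth_on (fibre_map T X ` \<Omega>) c'"
    and a: "\<And>z. z \<in> \<Omega> \<Longrightarrow> a' (fibre_map T X z) * deriv T (fst z) = a z * (Dx X z)\<^sup>2"
    and b: "\<And>z. z \<in> \<Omega> \<Longrightarrow> b' (fibre_map T X z) * deriv T (fst z) = b z * Dx X z - Dt X z + a z * Dx (Dx X) z"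
    and c: "\<And>z. z \<in> \<Omega> \<Longrightarrow> c' (fibre_map T X z) * deriv T (fst z) = c z"
    and s: "smooth_on (fst ` \<Omega>) \<tau>" "smooth_on \<Omega> \<xi>" "smooth_on \<Omega> \<eta>"
    and s': "smooth_on (fst ` fibre_map T X ` \<Omega>) \<tau>'" "smooth_on (fibre_map T X ` \<Omega>) \<xi>'" "smooth_on (fibre_map T X ` \<Omega>) \<eta>'"
    and \<tau>: "\<And>t. t \<in> fst ` \<Omega> \<Longrightarrow> \<tau>' (T t) = deriv T t * \<tau> t"
    and \<xi>: "\<And>z. z \<in> \<Omega> \<Longrightarrow> \<xi>' (fibre_map T X z) = \<tau> (fst z) * Dt X z + \<xi> z * Dx X z"
    and \<eta>: "\<And>z. z \<in> \<Omega> \<Longrightarrow> \<eta>' (fibre_map T X z) = \<eta> z"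
  shows "determining \<Omega> (a, b, c) \<tau> \<xi> \<eta> \<longleftrightarrow> determining (fibre_map T X ` \<Omega>) (a', b', c') \<tau>' \<xi>' \<eta>'"
proof -
  let ?F = "fibre_map T X"
  note sp = smooth_on_partials[OF opens(1)]
  note dT = smooth_on_deriv[OF opens(2) smooth_on_deriv(2)[OF opens(2) T]]
  note X1 = sp[OF X] note X2 = sp[OF X1(1)] sp[OF X1(2)]
  have main: "det2 a' \<tau>' \<xi>' (?F z) * deriv T (fst z) = (Dx X z)\<^sup>2 * det2 a \<tau> \<xi> z \<and>
    det1 a' b' \<tau>' \<xi>' \<eta>' (?F z) * deriv T (fst z) = Dx X z * det1 a b \<tau> \<xi> \<eta> z + Dx (Dx X) z * det2 a \<tau> \<xi> z \<and>
    det0 a' b' c' \<tau>' \<xi>' \<eta>' (?F z) * deriv T (fst z) = det0 a b c \<tau> \<xi> \<eta> z" if z: "z \<in> \<Omega>" for z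
  proof -
    have ft: "fst z \<in> fst ` \<Omega>" using z by simp
    have fF: "fst (?F z) = T (fst z)" by (simp add: case_prod_unfold)
    note pd0 = partial_deriv'[OF _ z]
    note pd = pd0[OF abc(1)] pd0[OF abc(2)] pd0[OF abc(3)] pd0[OF s(2)] pd0[OF s(3)]
      pd0[OF X1(1)] pd0[OF X1(2)] pd0[OF X2(1)] pd0[OF X2(2)] pd0[OF X2(3)] pd0[OF X2(4)] pd0[OF sp(2)[OF s(2)]]
    have mx: "Dt (Dx X) z = Dx (Dt X) z" "Dt (Dx (Dx X)) z = Dx (Dx (Dt X)) z"
    proof -
      have "Dt (Dx X) z = Dx (Dt X) z" if "z \<in> \<Omega>" for z by (rule mixed_partials[OF opens(1) X that])
      from partials_cong(2)[OF opens(1) this z] this[OF z] mixed_partials[OF opens(1) X1(2) z]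
      show "Dt (Dx X) z = Dx (Dt X) z" "Dt (Dx (Dx X)) z = Dx (Dx (Dt X)) z" by auto
    qed
    have \<tau>t: "deriv \<tau>' (T (fst z)) * deriv T (fst z) = deriv (deriv T) (fst z) * \<tau> (fst z) + deriv T (fst z) * deriv \<tau> (fst z)"
    proof -
      have 1: "((\<lambda>t. \<tau>' (T t)) has_real_derivative deriv \<tau>' (T (fst z)) * deriv T (fst z)) (at (fst z))"
        by (rule DERIV_chain2[OF smooth_on_deriv(1)[OF time_image_open s'(1) in_image(2)[OF ft]] T_deriv[OF ft]])
      have 2: "((\<lambda>t. deriv T t * \<tau> t) has_real_derivative deriv (deriv T) (fst z) * \<tau> (fst z) + deriv \<tau> (fst z) * deriv T (fst z)) (at (fst z))"
        by (rule DERIV_mult[OF dT(1)[OF ft] smooth_on_deriv(1)[OF opens(2) s(1) ft]])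
      have "((\<lambda>t. \<tau>' (T t)) has_real_derivative deriv (deriv T) (fst z) * \<tau> (fst z) + deriv \<tau> (fst z) * deriv T (fst z)) (at (fst z))"
        by (rule has_field_derivative_transform_within_open[OF 2 opens(2) ft]) (simp add: \<tau>)
      from DERIV_unique[OF 1 this] show ?thesis by simp
    qed
    have \<xi>x: "Dx (pull \<xi>') w = \<tau> (fst w) * Dx (Dt X) w + Dx \<xi> w * Dx X w + \<xi> w * Dx (Dx X) w" if "w \<in> \<Omega>" for w
      by (rule partials_eqI(2)[OF opens(1) \<xi> that])
        (auto intro!: derivative_eq_intros partial_deriv'(2)[OF X1(1) that] partial_deriv'(2)[OF X1(2) that] partial_deriv'(2)[OF s(2) that])
    have \<xi>t: "Dt (pull \<xi>') z = deriv \<tau> (fst z) * Dt X z + \<tau> (fst z) * Dt (Dt X) z + Dt \<xi> z * Dx X z + \<xi> z * Dx (Dt X) z"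
      unfolding mx(1)[symmetric]
      by (rule partials_eqI(1)[OF opens(1) \<xi> z])
        (auto intro!: derivative_eq_intros pd smooth_on_deriv(1)[OF opens(2) s(1) ft])
    have \<xi>xx: "Dx (Dx (pull \<xi>')) z = \<tau> (fst z) * Dx (Dx (Dt X)) z + Dx (Dx \<xi>) z * Dx X z + 2 * Dx \<xi> z * Dx (Dx X) z + \<xi> z * Dx (Dx (Dx X)) z"
      by (rule partials_eqI(2)[OF opens(1) \<xi>x z]) (auto intro!: derivative_eq_intros pd)
    have \<xi>xe: "Dx \<xi>' (?F z) * Dx X z = \<tau> (fst z) * Dx (Dt X) z + Dx \<xi> z * Dx X z + \<xi> z * Dx (Dx X) z"
      using pull_partials(2)[OF s'(2) z] \<xi>x[OF z] by (rule trans[OF sym])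
    have \<xi>te: "Dt \<xi>' (?F z) * deriv T (fst z) + Dx \<xi>' (?F z) * Dt X z
        = deriv \<tau> (fst z) * Dt X z + \<tau> (fst z) * Dt (Dt X) z + Dt \<xi> z * Dx X z + \<xi> z * Dx (Dt X) z"
      using pull_partials(1)[OF s'(2) z] \<xi>t by (rule trans[OF sym])
    have \<xi>xxe: "Dx (Dx \<xi>') (?F z) * (Dx X z)\<^sup>2 + Dx \<xi>' (?F z) * Dx (Dx X) z
        = \<tau> (fst z) * Dx (Dx (Dt X)) z + Dx (Dx \<xi>) z * Dx X z + 2 * Dx \<xi> z * Dx (Dx X) z + \<xi> z * Dx (Dx (Dx X)) z"
      using pull_partials_xx[OF s'(2) z] \<xi>xx by (rule trans[OF sym])
    have \<eta>x: "Dx (pull \<eta>') w = Dx \<eta> w" if "w \<in> \<Omega>" for w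
      by (rule partials_cong(2)[OF opens(1) \<eta> that])
    note \<eta>xe = trans[OF sym[OF \<eta>x[OF z]] pull_partials(2)[OF s'(3) z]]
    note \<eta>te = trans[OF sym[OF partials_cong(1)[OF opens(1) \<eta> z]] pull_partials(1)[OF s'(3) z]]
    note \<eta>xxe = trans[OF sym[OF partials_cong(2)[OF opens(1) \<eta>x z]] pull_partials_xx[OF s'(3) z]]
    have sa: "smooth_on \<Omega> (\<lambda>z. a z * (Dx X z)\<^sup>2)"
      by (intro smooth_intros opens abc X1)
    have ax: "Dx (\<lambda>z. a z * (Dx X z)\<^sup>2) z = Dx a z * (Dx X z)\<^sup>2 + 2 * a z * Dx X z * Dx (Dx X) z"
      by (rule partials_imp_eq(2)) (auto intro!: derivative_eq_intros pd)
    have adt: "Dt (\<lambda>z. a z * (Dx X z)\<^sup>2) z = Dt a z * (Dx X z)\<^sup>2 + 2 * a z * Dx X z * Dx (Dt X) z"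
      unfolding mx(1)[symmetric]
      by (rule partials_imp_eq(1)) (auto intro!: derivative_eq_intros pd)
    have sb: "smooth_on \<Omega> (\<lambda>z. b z * Dx X z - Dt X z + a z * Dx (Dx X) z)"
      by (intro smooth_intros opens abc X1 X2)
    have bx: "Dx (\<lambda>z. b z * Dx X z - Dt X z + a z * Dx (Dx X) z) z
        = Dx b z * Dx X z + b z * Dx (Dx X) z - Dx (Dt X) z + Dx a z * Dx (Dx X) z + a z * Dx (Dx (Dx X)) z"
      by (rule partials_imp_eq(2)) (auto intro!: derivative_eq_intros pd)
    have bt: "Dt (\<lambda>z. b z * Dx X z - Dt X z + a z * Dx (Dx X) z) z
        = Dt b z * Dx X z + b z * Dx (Dt X) z - Dt (Dt X) z + Dt a z * Dx (Dx X) z + a z * Dx (Dx (Dt X)) z"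
      unfolding mx[symmetric]
      by (rule partials_imp_eq(1)) (auto intro!: derivative_eq_intros pd)
    have ne: "deriv T (fst z) \<noteq> 0" "Dx X z \<noteq> 0" using T_ne[OF ft] X_ne[OF z] by auto
    show ?thesis
      unfolding det2_def det1_def det0_def fF
      by (intro conjI det_transformation_algebra[OF ne \<tau>[OF ft] \<tau>t \<xi>[OF z] \<xi>xe \<xi>te \<xi>xxe a[OF z]
          partials_of_identity(1)[OF abc'(1) sa a z, unfolded ax] partials_of_identity(2)[OF abc'(1) sa a z, unfolded adt]
          b[OF z] partials_of_identity(1)[OF abc'(2) sb b z, unfolded bx] partials_of_identity(2)[OF abc'(2) sb b z, unfolded bt]
          c[OF z] partials_of_identity[OF abc'(3) abc(3) c z] \<eta>xe \<eta>te \<eta>xxe])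
  qed
  have "(\<forall>z\<in>\<Omega>. det2 a \<tau> \<xi> z = 0 \<and> det1 a b \<tau> \<xi> \<eta> z = 0 \<and> det0 a b c \<tau> \<xi> \<eta> z = 0) \<longleftrightarrow>
    (\<forall>z\<in>\<Omega>. det2 a' \<tau>' \<xi>' (?F z) = 0 \<and> det1 a' b' \<tau>' \<xi>' \<eta>' (?F z) = 0 \<and> det0 a' b' c' \<tau>' \<xi>' \<eta>' (?F z) = 0)"
  proof (rule ball_cong[OF refl])
    fix z assume z: "z \<in> \<Omega>"
    have ne: "deriv T (fst z) \<noteq> 0" "Dx X z \<noteq> 0" using T_ne[of "fst z"] X_ne[OF z] z by auto
    from main[OF z] show "(det2 a \<tau> \<xi> z = 0 \<and> det1 a b \<tau> \<xi> \<eta> z = 0 \<and> det0 a b c \<tau> \<xi> \<eta> z = 0) \<longleftrightarrow>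
      (det2 a' \<tau>' \<xi>' (?F z) = 0 \<and> det1 a' b' \<tau>' \<xi>' \<eta>' (?F z) = 0 \<and> det0 a' b' c' \<tau>' \<xi>' \<eta>' (?F z) = 0)"
      by (intro triangular_zero_iff[OF ne]) blast+
  qed
  then show ?thesis using s s' by simp
qed

lemma push_ess:
  assumes "smooth_on (fst ` \<Omega>) \<tau>" "smooth_on \<Omega> \<xi>"
  shows "smooth_on (fst ` fibre_map T X ` \<Omega>) (\<lambda>s. deriv T (inv_into (fst ` \<Omega>) T s) * \<tau> (inv_into (fst ` \<Omega>) T s))"
    and "smooth_on (fibre_map T X ` \<Omega>) (\<lambda>z. \<tau> (fst (G z)) * Dt X (G z) + \<xi> (G z) * Dx X (G z))"
proof -
  have "smooth_on (fst ` \<Omega>) (\<lambda>t. deriv T t * \<tau> t)"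
    by (intro smooth_intros opens assms smooth_on_deriv(2)[OF opens(2) T])
  from smooth_on_compose[OF this time_image_open opens(2) _ time_inverse(1)[folded time_image]]
  show "smooth_on (fst ` fibre_map T X ` \<Omega>) (\<lambda>s. deriv T (inv_into (fst ` \<Omega>) T s) * \<tau> (inv_into (fst ` \<Omega>) T s))"
    using time_image inv_into_into[of _ T "fst ` \<Omega>"] by blast
  have "smooth_on \<Omega> (\<lambda>z. \<tau> (fst z) * Dt X z + \<xi> z * Dx X z)"
    by (intro smooth_intros opens assms smooth_on_of_time smooth_on_partials X)
  from push_smooth[OF this]
  show "smooth_on (fibre_map T X ` \<Omega>) (\<lambda>z. \<tau> (fst (G z)) * Dt X (G z) + \<xi> (G z) * Dx X (G z))" .
qed

end

subsection \<open>Equivalence transformations\<close>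

text \<open>
  With \<open>b = 1\<close> for Kolmogorov and \<open>b = -1\<close> for Fokker--Planck equations, this is the action of all
  four equivalence groups on the arbitrary elements; for the narrower classes, \<open>A = A' = \<epsilon>\<close> forces \<open>X\<close>
  to be affine in \<open>x\<close>.
\<close>
fun arb_map :: "real \<Rightarrow> dom \<Rightarrow> arb \<Rightarrow> dom \<Rightarrow> arb \<Rightarrow> (real \<Rightarrow> real) \<Rightarrow> fld \<Rightarrow> bool"
  where "arb_map b \<Omega> (A, B) \<Omega>' (A', B') T X \<longleftrightarrow> fibre_diffeo \<Omega> T X \<and> \<Omega>' = fibre_map T X ` \<Omega> \<and>
    (\<forall>z\<in>\<Omega>. A' (fibre_map T X z) * deriv T (fst z) = (Dx X z)\<^sup>2 * A z \<and>
      B' (fibre_map T X z) * deriv T (fst z) = Dx X z * B z - Dt X z + b * Dx (Dx X) z * A z)"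

lemma equation_smooth:
  assumes "open \<Omega>" "smooth_on \<Omega> A" "smooth_on \<Omega> B" "equation L (A, B) = (a, b, c)"
  shows "a = A" "smooth_on \<Omega> b" "smooth_on \<Omega> c"
  using assms by (cases L; auto intro!: smooth_intros smooth_on_partials)+

text \<open>An equivalence transformation is split into a gauge and a change of (t, x). For
  Fokker-Planck equations the new unknown is u / X_x up to a constant, which corresponds to the
  gauge factor W = X_x with logarithmic derivatives X_xx / X_x and X_tx / X_x; for Kolmogorov
  equations the gauge is trivial.\<close>

lemma gauged_equation:
  assumes map: "arb_map (breve L) \<Omega> (A, B) \<Omega>' (A', B') T X"
    and AB: "smooth_on \<Omega> A" "smooth_on \<Omega> B" and AB': "smooth_on \<Omega>' A'" "smooth_on \<Omega>' B'"
    and E: "equation L (A, B) = (A, b, c)" and E': "equation L (A', B') = (A', b', c')"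
  obtains N P b1 c1 where "smooth_on \<Omega> N" "smooth_on \<Omega> P" "smooth_on \<Omega> b1" "smooth_on \<Omega> c1"
    "\<And>z. z \<in> \<Omega> \<Longrightarrow> Dt N z = Dx P z"
    "\<And>z. z \<in> \<Omega> \<Longrightarrow> b1 z = b z + 2 * A z * N z"
    "\<And>z. z \<in> \<Omega> \<Longrightarrow> c1 z = A z * (Dx N z + (N z)\<^sup>2) + b z * N z + c z - P z"
    "\<And>z. z \<in> \<Omega> \<Longrightarrow> b' (fibre_map T X z) * deriv T (fst z) = b1 z * Dx X z - Dt X z + A z * Dx (Dx X) z"
    "\<And>z. z \<in> \<Omega> \<Longrightarrow> c' (fibre_map T X z) * deriv T (fst z) = c1 z"
proof -
  interpret fibre_diffeo \<Omega> T X using map by simp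
  have \<Omega>': "\<Omega>' = fibre_map T X ` \<Omega>" using map by simp
  have A: "A' (fibre_map T X z) * deriv T (fst z) = (Dx X z)\<^sup>2 * A z"
    and B: "B' (fibre_map T X z) * deriv T (fst z) = Dx X z * B z - Dt X z + breve L * Dx (Dx X) z * A z"
    if "z \<in> \<Omega>" for z using map that by auto
  note sp = smooth_on_partials[OF opens(1)]
  show ?thesis
  proof (cases "breve L = 1")
    case True
    then have K: "b = B" "c = (\<lambda>_. 0)" "b' = B'" "c' = (\<lambda>_. 0)" using E E' by (cases L; simp)+
    have "Dt (\<lambda>_. 0) z = 0" "Dx (\<lambda>_. 0) z = 0" for z by (simp_all add: Dt_def Dx_def case_prod_unfold)
    then show ?thesis
      using B True K AB by (intro that[of "\<lambda>_. 0" "\<lambda>_. 0" B "\<lambda>_. 0"]) (auto intro: smooth_on_const)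
  next
    case False
    then have br: "breve L = -1" by (cases L) auto
    have F: "b = (\<lambda>z. 2 * Dx A z + B z)" "c = (\<lambda>z. Dx (Dx A) z + Dx B z)"
      "b' = (\<lambda>z. 2 * Dx A' z + B' z)" "c' = (\<lambda>z. Dx (Dx A') z + Dx B' z)"
      using E E' False by (cases L; simp)+
    define N where "N z = Dx (Dx X) z / Dx X z" for z
    define P where "P z = Dt (Dx X) z / Dx X z" for z
    define b1 where "b1 z = b z + 2 * A z * N z" for z
    define c1 where "c1 z = A z * (Dx N z + (N z)\<^sup>2) + b z * N z + c z - P z" for z
    note X1 = sp[OF X] note X2 = sp[OF X1(2)]
    have sN: "smooth_on \<Omega> N"
      unfolding N_def by (intro smooth_on_divide opens X1 X2 X_ne)
    have sP: "smooth_on \<Omega> P"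
      unfolding P_def by (intro smooth_on_divide opens X1 X2 X_ne)
    have sb: "smooth_on \<Omega> b" "smooth_on \<Omega> c"
      using equation_smooth[OF opens(1) AB E] by auto
    show ?thesis
    proof (rule that[OF sN sP _ _ _ b1_def c1_def])
      show "smooth_on \<Omega> b1" "smooth_on \<Omega> c1"
        unfolding b1_def c1_def by (intro smooth_intros opens sN sP sb AB sp)+
      fix z assume z: "z \<in> \<Omega>"
      note pd0 = partial_deriv'[OF _ z]
      note pd = pd0[OF X1(1)] pd0[OF X1(2)] pd0[OF X2(1)] pd0[OF X2(2)] pd0[OF AB(1)] pd0[OF AB(2)]
        pd0[OF sp(2)[OF AB(1)]]
      have ne: "Dx X z \<noteq> 0" "deriv T (fst z) \<noteq> 0" using X_ne[OF z] T_ne[of "fst z"] z by auto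
      have Nx: "Dx N z = (Dx (Dx (Dx X)) z * Dx X z - Dx (Dx X) z * Dx (Dx X) z) / (Dx X z * Dx X z)"
        unfolding N_def[abs_def] by (rule partials_imp_eq(2)) (auto intro!: derivative_eq_intros pd simp: ne)
      have Nt: "Dt N z = (Dt (Dx (Dx X)) z * Dx X z - Dx (Dx X) z * Dt (Dx X) z) / (Dx X z * Dx X z)"
        unfolding N_def[abs_def] by (rule partials_imp_eq(1)) (auto intro!: derivative_eq_intros pd simp: ne)
      have Px: "Dx P z = (Dx (Dt (Dx X)) z * Dx X z - Dt (Dx X) z * Dx (Dx X) z) / (Dx X z * Dx X z)"
        unfolding P_def[abs_def] by (rule partials_imp_eq(2)) (auto intro!: derivative_eq_intros pd simp: ne)
      show "Dt N z = Dx P z"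
        unfolding Nt Px mixed_partials[OF opens(1) X1(2) z] by (simp add: mult.commute)
      have Ax: "Dx A' (fibre_map T X w) * deriv T (fst w) = Dx A w * Dx X w + 2 * A w * Dx (Dx X) w" if w: "w \<in> \<Omega>" for w
      proof -
        note pw = partial_deriv'(2)[OF X1(2) w] partial_deriv'(2)[OF AB(1) w]
        have "Dx A' (fibre_map T X w) * Dx X w * deriv T (fst w) = Dx (\<lambda>z. (Dx X z)\<^sup>2 * A z) w"
          by (rule partials_of_identity(1)[OF AB'(1)[unfolded \<Omega>'] _ A w]) (intro smooth_intros opens X1 AB)
        also have "\<dots> = 2 * Dx X w * Dx (Dx X) w * A w + (Dx X w)\<^sup>2 * Dx A w"
          by (rule partials_imp_eq(2)) (auto intro!: derivative_eq_intros pw)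
        finally have "Dx X w * (Dx A' (fibre_map T X w) * deriv T (fst w) - (Dx A w * Dx X w + 2 * A w * Dx (Dx X) w)) = 0"
          by (simp add: algebra_simps power2_eq_square)
        then show ?thesis using X_ne[OF w] by simp
      qed
      have Axx: "Dx (Dx A') (fibre_map T X z) * Dx X z * deriv T (fst z)
          = Dx (Dx A) z * Dx X z + 3 * Dx A z * Dx (Dx X) z + 2 * A z * Dx (Dx (Dx X)) z"
      proof -
        have "Dx (Dx A') (fibre_map T X z) * Dx X z * deriv T (fst z) = Dx (\<lambda>w. Dx A w * Dx X w + 2 * A w * Dx (Dx X) w) z"
          by (rule partials_of_identity(1)[OF smooth_on_partials(2)[OF image_open AB'(1)[unfolded \<Omega>']] _ Ax z])
            (intro smooth_intros opens X1 X2 AB sp)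
        also have "\<dots> = Dx (Dx A) z * Dx X z + 3 * Dx A z * Dx (Dx X) z + 2 * A z * Dx (Dx (Dx X)) z"
          by (rule partials_imp_eq(2)) (auto intro!: derivative_eq_intros pd)
        finally show ?thesis .
      qed
      have Bx: "Dx B' (fibre_map T X z) * Dx X z * deriv T (fst z)
          = Dx (Dx X) z * B z + Dx X z * Dx B z - Dt (Dx X) z - Dx (Dx (Dx X)) z * A z - Dx (Dx X) z * Dx A z"
      proof -
        have "Dx B' (fibre_map T X z) * Dx X z * deriv T (fst z) = Dx (\<lambda>z. Dx X z * B z - Dt X z + breve L * Dx (Dx X) z * A z) z"
          by (rule partials_of_identity(1)[OF AB'(2)[unfolded \<Omega>'] _ B z]) (intro smooth_intros opens X1 X2 AB sp)
        also have "\<dots> = Dx (Dx X) z * B z + Dx X z * Dx B z - Dx (Dt X) z - Dx (Dx (Dx X)) z * A z - Dx (Dx X) z * Dx A z"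
          unfolding br by (rule partials_imp_eq(2)) (auto intro!: derivative_eq_intros pd)
        finally show ?thesis unfolding mixed_partials[OF opens(1) X z] .
      qed
      show "b' (fibre_map T X z) * deriv T (fst z) = b1 z * Dx X z - Dt X z + A z * Dx (Dx X) z"
      proof -
        have "b1 z * Dx X z = b z * Dx X z + 2 * A z * Dx (Dx X) z"
          unfolding b1_def N_def using ne by (simp add: field_simps)
        moreover have "b' (fibre_map T X z) * deriv T (fst z)
            = 2 * (Dx A' (fibre_map T X z) * deriv T (fst z)) + B' (fibre_map T X z) * deriv T (fst z)"
          unfolding F by (simp add: algebra_simps)
        ultimately show ?thesis
          unfolding Ax[OF z] B[OF z] br unfolding F by (simp add: algebra_simps)
      qed
      \<comment> \<open>This is W_xx / W for W = X_x.\<close>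
      have NN: "Dx N z + (N z)\<^sup>2 = Dx (Dx (Dx X)) z / Dx X z"
        unfolding Nx N_def using ne by (simp add: field_simps power2_eq_square)
      have "Dx X z * (c' (fibre_map T X z) * deriv T (fst z)) = Dx X z * c1 z"
      proof -
        have "Dx X z * c1 z = A z * Dx (Dx (Dx X)) z + b z * Dx (Dx X) z + c z * Dx X z - Dt (Dx X) z"
          unfolding c1_def NN unfolding N_def P_def using ne by (simp add: field_simps)
        moreover have "Dx X z * (c' (fibre_map T X z) * deriv T (fst z))
            = Dx (Dx A') (fibre_map T X z) * Dx X z * deriv T (fst z) + Dx B' (fibre_map T X z) * Dx X z * deriv T (fst z)"
          unfolding F by (simp add: algebra_simps)
        ultimately show ?thesis
          unfolding Axx Bx unfolding F by (simp add: algebra_simps)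
      qed
      then show "c' (fibre_map T X z) * deriv T (fst z) = c1 z" using ne by simp
    qed
  qed
qed

text \<open>The gauge followed by the change of variables. The conclusion records the action on (t,
  x), which is what tells a nontrivial symmetry from a multiple of the scaling of u.\<close>

lemma push_symmetry:
  assumes map: "arb_map (breve L) \<Omega> (A, B) \<Omega>' (A', B') T X"
    and AB: "smooth_on \<Omega> A" "smooth_on \<Omega> B" and AB': "smooth_on \<Omega>' A'" "smooth_on \<Omega>' B'"
    and det: "determining \<Omega> (equation L (A, B)) \<tau> \<xi> \<eta>"
  obtains \<tau>' \<xi>' \<eta>' where "determining \<Omega>' (equation L (A', B')) \<tau>' \<xi>' \<eta>'"
    "\<And>t. t \<in> fst ` \<Omega> \<Longrightarrow> \<tau>' (T t) = deriv T t * \<tau> t"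
    "\<And>z. z \<in> \<Omega> \<Longrightarrow> \<xi>' (fibre_map T X z) = \<tau> (fst z) * Dt X z + \<xi> z * Dx X z"
proof -
  interpret fibre_diffeo \<Omega> T X using map by simp
  have \<Omega>': "\<Omega>' = fibre_map T X ` \<Omega>" using map by simp
  obtain b c where E: "equation L (A, B) = (A, b, c)"
    by (metis equation_smooth(1)[OF opens(1) AB] prod_cases3)
  obtain b' c' where E': "equation L (A', B') = (A', b', c')"
    by (metis equation_smooth(1)[OF image_open[folded \<Omega>'] AB'] prod_cases3)
  note s = equation_smooth[OF opens(1) AB E] note s' = equation_smooth[OF image_open[folded \<Omega>'] AB' E']
  obtain N P b1 c1 where g: "smooth_on \<Omega> N" "smooth_on \<Omega> P" "smooth_on \<Omega> b1" "smooth_on \<Omega> c1"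
    "\<And>z. z \<in> \<Omega> \<Longrightarrow> Dt N z = Dx P z"
    "\<And>z. z \<in> \<Omega> \<Longrightarrow> b1 z = b z + 2 * A z * N z"
    "\<And>z. z \<in> \<Omega> \<Longrightarrow> c1 z = A z * (Dx N z + (N z)\<^sup>2) + b z * N z + c z - P z"
    "\<And>z. z \<in> \<Omega> \<Longrightarrow> b' (fibre_map T X z) * deriv T (fst z) = b1 z * Dx X z - Dt X z + A z * Dx (Dx X) z"
    "\<And>z. z \<in> \<Omega> \<Longrightarrow> c' (fibre_map T X z) * deriv T (fst z) = c1 z"
    using gauged_equation[OF map AB AB' E E'] by blast
  have det1: "determining \<Omega> (A, b1, c1) \<tau> \<xi> (\<lambda>z. \<eta> z - (\<tau> (fst z) * P z + \<xi> z * N z))"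
    by (rule determining_gauge[OF opens(1) AB(1) s(2,3) g(1,2,5,6,7)]) (use det E in simp_all)
  then have sm: "smooth_on (fst ` \<Omega>) \<tau>" "smooth_on \<Omega> \<xi>" "smooth_on \<Omega> (\<lambda>z. \<eta> z - (\<tau> (fst z) * P z + \<xi> z * N z))"
    by auto
  have A: "A' (fibre_map T X z) * deriv T (fst z) = A z * (Dx X z)\<^sup>2" if "z \<in> \<Omega>" for z
    using map that by simp
  define \<tau>' where "\<tau>' s = deriv T (inv_into (fst ` \<Omega>) T s) * \<tau> (inv_into (fst ` \<Omega>) T s)" for s
  define \<xi>' where "\<xi>' z = \<tau> (fst (G z)) * Dt X (G z) + \<xi> (G z) * Dx X (G z)" for z
  define \<eta>' where "\<eta>' z = (\<lambda>z. \<eta> z - (\<tau> (fst z) * P z + \<xi> z * N z)) (G z)" for z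
  have 1: "\<tau>' (T t) = deriv T t * \<tau> t" if "t \<in> fst ` \<Omega>" for t
    by (simp only: \<tau>'_def time_inverse(2)[OF that])
  have 2: "\<xi>' (fibre_map T X z) = \<tau> (fst z) * Dt X z + \<xi> z * Dx X z" if "z \<in> \<Omega>" for z
    by (simp only: \<xi>'_def GF[OF that])
  have 3: "\<eta>' (fibre_map T X z) = \<eta> z - (\<tau> (fst z) * P z + \<xi> z * N z)" if "z \<in> \<Omega>" for z
    by (simp only: \<eta>'_def GF[OF that])
  have "determining \<Omega>' (A', b', c') \<tau>' \<xi>' \<eta>'"
    unfolding \<Omega>'
    using determining_coordinates[OF AB(1) g(3,4) AB'(1)[unfolded \<Omega>'] s'(2,3)[unfolded \<Omega>'] A g(8,9) sm
      push_ess[OF sm(1,2), folded \<tau>'_def \<xi>'_def] push_smooth[OF sm(3), folded \<eta>'_def] 1 2 3] det1 by simp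
  then show ?thesis using that 1 2 E' by simp
qed

text \<open>The components are solved for explicitly, because T_t and X_t are to be read off them
  when the source has a general potential.\<close>

lemma pull_symmetry:
  assumes map: "arb_map (breve L) \<Omega> (A, B) \<Omega>' (A', B') T X"
    and AB: "smooth_on \<Omega> A" "smooth_on \<Omega> B" and AB': "smooth_on \<Omega>' A'" "smooth_on \<Omega>' B'"
    and det: "determining \<Omega>' (equation L (A', B')) \<tau>' \<xi>' \<eta>'"
  obtains \<eta> where "determining \<Omega> (equation L (A, B)) (\<lambda>t. \<tau>' (T t) / deriv T t)
    (\<lambda>z. (\<xi>' (fibre_map T X z) - \<tau>' (T (fst z)) / deriv T (fst z) * Dt X z) / Dx X z) \<eta>"
proof -
  interpret fibre_diffeo \<Omega> T X using map by simp
  have \<Omega>': "\<Omega>' = fibre_map T X ` \<Omega>" using map by simp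
  obtain b c where E: "equation L (A, B) = (A, b, c)"
    by (metis equation_smooth(1)[OF opens(1) AB] prod_cases3)
  obtain b' c' where E': "equation L (A', B') = (A', b', c')"
    by (metis equation_smooth(1)[OF image_open[folded \<Omega>'] AB'] prod_cases3)
  note s = equation_smooth[OF opens(1) AB E] note s' = equation_smooth[OF image_open[folded \<Omega>'] AB' E']
  obtain N P b1 c1 where g: "smooth_on \<Omega> N" "smooth_on \<Omega> P" "smooth_on \<Omega> b1" "smooth_on \<Omega> c1"
    "\<And>z. z \<in> \<Omega> \<Longrightarrow> Dt N z = Dx P z"
    "\<And>z. z \<in> \<Omega> \<Longrightarrow> b1 z = b z + 2 * A z * N z"
    "\<And>z. z \<in> \<Omega> \<Longrightarrow> c1 z = A z * (Dx N z + (N z)\<^sup>2) + b z * N z + c z - P z"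
    "\<And>z. z \<in> \<Omega> \<Longrightarrow> b' (fibre_map T X z) * deriv T (fst z) = b1 z * Dx X z - Dt X z + A z * Dx (Dx X) z"
    "\<And>z. z \<in> \<Omega> \<Longrightarrow> c' (fibre_map T X z) * deriv T (fst z) = c1 z"
    using gauged_equation[OF map AB AB' E E'] by blast
  have sm': "smooth_on (fst ` fibre_map T X ` \<Omega>) \<tau>'" "smooth_on (fibre_map T X ` \<Omega>) \<xi>'" "smooth_on (fibre_map T X ` \<Omega>) \<eta>'"
    using det E' \<Omega>' by auto
  define \<tau> where "\<tau> t = \<tau>' (T t) / deriv T t" for t
  define \<xi> where "\<xi> z = (\<xi>' (fibre_map T X z) - \<tau> (fst z) * Dt X z) / Dx X z" for z
  have "smooth_on (fst ` \<Omega>) (\<lambda>t. \<tau>' (T t))"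
    by (rule smooth_on_compose[OF sm'(1) opens(2) time_image_open _ T]) (use time_image in auto)
  then have s\<tau>: "smooth_on (fst ` \<Omega>) \<tau>"
    unfolding \<tau>_def by (intro smooth_on_divide opens smooth_on_deriv(2)[OF opens(2) T] T_ne)
  have s\<xi>: "smooth_on \<Omega> \<xi>"
    unfolding \<xi>_def
    by (intro smooth_on_divide smooth_on_diff smooth_on_mult opens pull_smooth'[OF sm'(2)]
        smooth_on_of_time[OF opens(1) s\<tau>] smooth_on_partials[OF opens(1) X] X_ne)
  have A: "A' (fibre_map T X z) * deriv T (fst z) = A z * (Dx X z)\<^sup>2" if "z \<in> \<Omega>" for z
    using map that by simp
  have 1: "\<tau>' (T t) = deriv T t * \<tau> t" if "t \<in> fst ` \<Omega>" for t
    using T_ne[OF that] by (simp add: \<tau>_def)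
  have 2: "\<xi>' (fibre_map T X z) = \<tau> (fst z) * Dt X z + \<xi> z * Dx X z" if "z \<in> \<Omega>" for z
    using X_ne[OF that] by (simp add: \<xi>_def)
  have det1: "determining \<Omega> (A, b1, c1) \<tau> \<xi> (pull \<eta>')"
    using determining_coordinates[OF AB(1) g(3,4) AB'(1)[unfolded \<Omega>'] s'(2,3)[unfolded \<Omega>'] A g(8,9) s\<tau> s\<xi>
      pull_smooth'[OF sm'(3)] sm' 1 2 refl] det E' \<Omega>' by simp
  \<comment> \<open>The gauge is undone with the reciprocal factor, whose logarithmic derivatives
    are the negatives.\<close>
  have n: "smooth_on \<Omega> (\<lambda>z. - N z)" "smooth_on \<Omega> (\<lambda>z. - P z)"
    by (intro smooth_intros opens g)+
  have nx: "Dx (\<lambda>z. - N z) z = - Dx N z" "Dx (\<lambda>z. - P z) z = - Dx P z" "Dt (\<lambda>z. - N z) z = - Dt N z" if "z \<in> \<Omega>" for z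
    using DERIV_minus[OF partial_deriv'(2)[OF g(1) that]] DERIV_minus[OF partial_deriv'(2)[OF g(2) that]]
      DERIV_minus[OF partial_deriv'(1)[OF g(1) that]]
    by (auto intro!: partials_imp_eq)
  have "determining \<Omega> (A, b, c) \<tau> \<xi> (\<lambda>z. pull \<eta>' z - (\<tau> (fst z) * - P z + \<xi> z * - N z))"
    by (rule determining_gauge[OF opens(1) AB(1) g(3,4) n _ _ _ det1])
      (use nx g(5,6,7) in \<open>simp_all add: algebra_simps power2_eq_square\<close>)
  then have *: "determining \<Omega> (equation L (A, B)) \<tau> \<xi> (\<lambda>z. pull \<eta>' z - (\<tau> (fst z) * - P z + \<xi> z * - N z))"
    by (simp only: E)
  have "(\<lambda>t. \<tau>' (T t) / deriv T t) = \<tau>"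
    "(\<lambda>z. (\<xi>' (fibre_map T X z) - \<tau>' (T (fst z)) / deriv T (fst z) * Dt X z) / Dx X z) = \<xi>"
    by (simp_all add: \<tau>_def \<xi>_def fun_eq_iff)
  with * show ?thesis by (intro that) simp
qed

section \<open>Rigidity of general potentials\<close>

text \<open>The device that splits an identity in x, valid on an open slice, into equations for its
  coefficients.\<close>

lemma poly_zero_on_open:
  fixes p :: "real poly"
  assumes "open A" "A \<noteq> {}" "\<And>x. x \<in> A \<Longrightarrow> poly p x = 0"
  shows "p = 0"
proof (rule ccontr)
  assume "p \<noteq> 0"
  then have "finite {x. poly p x = 0}" by (rule poly_roots_finite)
  moreover have "A \<subseteq> {x. poly p x = 0}" using assms(3) by auto
  ultimately show False using finite_imp_not_open[of A] assms(1,2) finite_subset by blast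
qed

lemma continuous_zero_off_point:
  fixes f :: "real \<Rightarrow> real"
  assumes "open S" "continuous_on S f" "x \<in> S" "\<And>y. y \<in> S \<Longrightarrow> y \<noteq> x \<Longrightarrow> f y = 0"
  shows "f x = 0"
proof -
  have "isCont f x" using assms(1-3) continuous_on_eq_continuous_at by blast
  then have "f \<midarrow>x\<rightarrow> f x" by (simp add: isCont_def)
  moreover have "eventually (\<lambda>y. f y = 0) (at x)"
    using assms unfolding eventually_at_topological by blast
  then have "f \<midarrow>x\<rightarrow> 0" by (rule tendsto_eventually)
  ultimately show ?thesis by (rule LIM_unique)
qed

text \<open>The energy E = y^2 + y'^2 satisfies |E'| \<le> K E. Hence exp(-K t) E does not increase
  to the right of t1, and exp(K t) E does not decrease up to t1 from the left. A nonnegative E that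
  vanishes at t1 therefore vanishes throughout.\<close>

lemma linear_ode_zero:
  fixes y :: "real \<Rightarrow> real"
  assumes N: "connected N" and t1: "t1 \<in> N" "y t1 = 0" "y' t1 = 0"
    and y: "\<And>t. t \<in> N \<Longrightarrow> (y has_real_derivative y' t) (at t)"
    and y': "\<And>t. t \<in> N \<Longrightarrow> (y' has_real_derivative \<kappa> * y t) (at t)" and t: "t \<in> N"
  shows "y t = 0"
proof -
  define E where "E t = (y t)\<^sup>2 + (y' t)\<^sup>2" for t
  define K where "K = 1 + \<bar>\<kappa>\<bar>"
  have E': "(E has_real_derivative 2 * (1 + \<kappa>) * (y t * y' t)) (at t)" if "t \<in> N" for t
    unfolding E_def[abs_def] by (auto intro!: derivative_eq_intros y[OF that] y'[OF that] simp: algebra_simps)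
  have bound: "\<bar>2 * (1 + \<kappa>) * (y t * y' t)\<bar> \<le> K * E t" for t
  proof -
    have "0 \<le> (\<bar>y t\<bar> - \<bar>y' t\<bar>)\<^sup>2" by simp
    then have "2 * \<bar>y t * y' t\<bar> \<le> E t" by (simp add: E_def power2_diff abs_mult)
    moreover have "\<bar>1 + \<kappa>\<bar> \<le> K" by (simp add: K_def)
    ultimately have "\<bar>1 + \<kappa>\<bar> * (2 * \<bar>y t * y' t\<bar>) \<le> K * E t" by (intro mult_mono) auto
    also have "\<bar>1 + \<kappa>\<bar> * (2 * \<bar>y t * y' t\<bar>) = \<bar>2 * (1 + \<kappa>) * (y t * y' t)\<bar>"
      by (simp only: abs_mult abs_numeral mult_ac)
    finally show ?thesis .
  qed
  have sub: "s \<in> N" if "a \<in> N" "b \<in> N" "a \<le> s" "s \<le> b" for a b s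
    by (rule mem_is_interval_1_I[OF _ that]) (simp add: N is_interval_connected_1)
  have E1: "E t1 = 0" using t1 by (simp add: E_def)
  have "E t \<le> 0"
  proof (cases "t1 \<le> t")
    case True
    have "exp (- K * t) * E t \<le> exp (- K * t1) * E t1"
    proof (rule DERIV_nonpos_imp_nonincreasing[OF True])
      fix s assume s: "t1 \<le> s" "s \<le> t"
      let ?d = "exp (- K * s) * (2 * (1 + \<kappa>) * (y s * y' s) - K * E s)"
      have "((\<lambda>t. exp (- K * t) * E t) has_real_derivative ?d) (at s)"
        by (auto intro!: derivative_eq_intros E' sub[OF t1(1) t s] simp: algebra_simps)
      moreover have "?d \<le> 0" using bound[of s] by (intro mult_nonneg_nonpos) auto
      ultimately show "\<exists>d. ((\<lambda>t. exp (- K * t) * E t) has_real_derivative d) (at s) \<and> d \<le> 0" by blast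
    qed
    then show ?thesis using E1 by (simp add: mult_le_0_iff)
  next
    case False
    then have le: "t \<le> t1" by simp
    have "exp (K * t) * E t \<le> exp (K * t1) * E t1"
    proof (rule DERIV_nonneg_imp_nondecreasing[OF le])
      fix s assume s: "t \<le> s" "s \<le> t1"
      let ?d = "exp (K * s) * (2 * (1 + \<kappa>) * (y s * y' s) + K * E s)"
      have "((\<lambda>t. exp (K * t) * E t) has_real_derivative ?d) (at s)"
        by (auto intro!: derivative_eq_intros E' sub[OF t t1(1) s] simp: algebra_simps)
      moreover have "?d \<ge> 0" using bound[of s] by (intro mult_nonneg_nonneg) auto
      ultimately show "\<exists>d. ((\<lambda>t. exp (K * t) * E t) has_real_derivative d) (at s) \<and> 0 \<le> d" by blast
    qed
    then show ?thesis using E1 by (simp add: mult_le_0_iff)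
  qed
  then show ?thesis by (simp add: E_def sum_power2_le_zero_iff)
qed

text \<open>
  The two excluded kinds of potentials in a common form without division; the shift \<open>\<beta>\<close> is
  irrelevant for \<open>\<mu> = 0\<close>.
\<close>
definition special_form :: "real \<Rightarrow> real \<Rightarrow> real \<Rightarrow> real \<Rightarrow> real \<Rightarrow> real set \<Rightarrow> (real \<Rightarrow> real) \<Rightarrow> bool"
  where "special_form \<beta> \<mu> \<alpha> \<delta> \<gamma> K C \<longleftrightarrow>
    (\<forall>x\<in>K. (x + \<beta>)\<^sup>2 * C x = \<mu> + (x + \<beta>)\<^sup>2 * (\<alpha> * (x + \<beta>)\<^sup>2 + \<delta> * (x + \<beta>) + \<gamma>))"

definition special :: "real set \<Rightarrow> (real \<Rightarrow> real) \<Rightarrow> bool"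
  where "special K C \<longleftrightarrow> (\<exists>\<beta> \<mu> \<alpha> \<delta> \<gamma>. (\<mu> = 0 \<or> \<delta> = 0) \<and> special_form \<beta> \<mu> \<alpha> \<delta> \<gamma> K C)"

text \<open>For \<mu> \<noteq> 0 the cleared form at x = -\<beta> would read 0 = \<mu>, so the pole
  lies outside \<open>J\<close> and division is allowed. For \<mu> = 0 division fails at that one
  point, where continuity supplies the value.\<close>

lemma special_cases:
  assumes J: "open J" and C: "continuous_on J C" and "special J C"
  obtains \<mu> \<alpha> \<beta> \<gamma> where "\<mu> \<noteq> 0" "\<And>x. x \<in> J \<Longrightarrow> x + \<beta> \<noteq> 0"
      "\<And>x. x \<in> J \<Longrightarrow> C x = \<mu> / (x + \<beta>)\<^sup>2 + \<alpha> * (x + \<beta>)\<^sup>2 + \<gamma>"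
  | \<alpha> \<beta> \<gamma> where "\<And>x. x \<in> J \<Longrightarrow> C x = \<alpha> * x\<^sup>2 + \<beta> * x + \<gamma>"
proof -
  obtain \<beta> \<mu> \<alpha> \<delta> \<gamma> where d: "\<mu> = 0 \<or> \<delta> = 0"
    and f: "\<And>x. x \<in> J \<Longrightarrow> (x + \<beta>)\<^sup>2 * C x = \<mu> + (x + \<beta>)\<^sup>2 * (\<alpha> * (x + \<beta>)\<^sup>2 + \<delta> * (x + \<beta>) + \<gamma>)"
    using assms(3) unfolding special_def special_form_def by blast
  show ?thesis
  proof (cases "\<mu> = 0")
    case False
    have nz: "x + \<beta> \<noteq> 0" if "x \<in> J" for x using f[OF that] False by auto
    then have "C x = \<mu> / (x + \<beta>)\<^sup>2 + \<alpha> * (x + \<beta>)\<^sup>2 + \<gamma>" if "x \<in> J" for x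
      using f[OF that] nz[OF that] d False by (simp add: field_simps)
    then show ?thesis using that(1) False nz by blast
  next
    case True
    have 1: "C x - (\<alpha> * (x + \<beta>)\<^sup>2 + \<delta> * (x + \<beta>) + \<gamma>) = 0" if "x \<in> J" "x \<noteq> - \<beta>" for x
      using f[OF that(1)] that(2) True by (simp add: add_eq_0_iff2)
    have "C x - (\<alpha> * (x + \<beta>)\<^sup>2 + \<delta> * (x + \<beta>) + \<gamma>) = 0" if x: "x \<in> J" for x
    proof (cases "x = - \<beta>")
      case True
      show ?thesis
        by (rule continuous_zero_off_point[OF J _ x]) (use 1 True in \<open>auto intro!: continuous_intros C\<close>)
    qed (use 1 x in blast)
    then have "C x = \<alpha> * x\<^sup>2 + (2 * \<alpha> * \<beta> + \<delta>) * x + (\<alpha> * \<beta>\<^sup>2 + \<delta> * \<beta> + \<gamma>)" if "x \<in> J" for x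
      using that by (simp add: power2_eq_square algebra_simps)
    then show ?thesis using that(2) by blast
  qed
qed

lemma general_not_special:
  assumes "(J, C) \<in> general_potentials"
  shows "\<not> special J C"
proof
  assume sp: "special J C"
  have J: "open J" "continuous_on J C"
    using assms smooth_on_continuous by (auto simp: general_potentials_def)
  from J sp show False
  proof (cases rule: special_cases)
    case (1 \<mu> \<alpha> \<beta> \<gamma>)
    then show False using assms unfolding general_potentials_def by blast
  next
    case (2 \<alpha> \<beta> \<gamma>)
    then show False using assms unfolding general_potentials_def by blast
  qed
qed

text \<open>A substitute for analytic continuation of a merely smooth \<open>C\<close>.
  Cross-multiplying the two cleared forms on \<open>K0\<close> gives an identity of polynomials,
  valid for all x; the form known on \<open>K\<close> then yields the other one away from -\<beta>1,
  and continuity closes that gap.\<close>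

lemma special_form_extend:
  assumes K: "open K" and C: "continuous_on K C" and K0: "open K0" "K0 \<noteq> {}" "K0 \<subseteq> K"
    and f: "special_form \<beta> \<mu> \<alpha> \<delta> \<gamma> K0 C" and f1: "special_form \<beta>1 \<mu>1 \<alpha>1 \<delta>1 \<gamma>1 K C"
  shows "special_form \<beta> \<mu> \<alpha> \<delta> \<gamma> K C"
proof -
  let ?Y = "[:\<beta>, 1:] :: real poly" and ?Y1 = "[:\<beta>1, 1:] :: real poly"
  let ?Q = "[:\<mu>:] + ?Y\<^sup>2 * ([:\<alpha>:] * ?Y\<^sup>2 + [:\<delta>:] * ?Y + [:\<gamma>:])"
  let ?Q1 = "[:\<mu>1:] + ?Y1\<^sup>2 * ([:\<alpha>1:] * ?Y1\<^sup>2 + [:\<delta>1:] * ?Y1 + [:\<gamma>1:])"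
  have Q: "poly ?Q x = \<mu> + (x + \<beta>)\<^sup>2 * (\<alpha> * (x + \<beta>)\<^sup>2 + \<delta> * (x + \<beta>) + \<gamma>)" for x
    by (simp add: algebra_simps)
  have Q1: "poly ?Q1 x = \<mu>1 + (x + \<beta>1)\<^sup>2 * (\<alpha>1 * (x + \<beta>1)\<^sup>2 + \<delta>1 * (x + \<beta>1) + \<gamma>1)" for x
    by (simp add: algebra_simps)
  have Y: "poly ?Y x = x + \<beta>" "poly ?Y1 x = x + \<beta>1" for x by simp_all
  have e: "(x + \<beta>)\<^sup>2 * C x = poly ?Q x" if "x \<in> K0" for x
    using f that unfolding special_form_def Q by blast
  have e1: "(x + \<beta>1)\<^sup>2 * C x = poly ?Q1 x" if "x \<in> K" for x
    using f1 that unfolding special_form_def Q1 by blast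
  have "?Y1\<^sup>2 * ?Q - ?Y\<^sup>2 * ?Q1 = 0"
  proof (rule poly_zero_on_open[OF K0(1,2)])
    fix x assume x: "x \<in> K0"
    then show "poly (?Y1\<^sup>2 * ?Q - ?Y\<^sup>2 * ?Q1) x = 0"
      unfolding poly_diff poly_mult poly_power Y e[OF x, symmetric] e1[OF subsetD[OF K0(3) x], symmetric] by simp
  qed
  then have id: "(x + \<beta>1)\<^sup>2 * poly ?Q x = (x + \<beta>)\<^sup>2 * poly ?Q1 x" for x
    unfolding Y[symmetric] poly_power[symmetric] poly_mult[symmetric] by simp
  have 1: "(x + \<beta>)\<^sup>2 * C x - poly ?Q x = 0" if x: "x \<in> K" "x \<noteq> - \<beta>1" for x
  proof -
    have "(x + \<beta>1)\<^sup>2 * ((x + \<beta>)\<^sup>2 * C x - poly ?Q x) = (x + \<beta>)\<^sup>2 * ((x + \<beta>1)\<^sup>2 * C x) - (x + \<beta>1)\<^sup>2 * poly ?Q x"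
      by (simp only: algebra_simps)
    also have "\<dots> = 0" unfolding e1[OF x(1)] id by simp
    finally have "x + \<beta>1 = 0 \<or> (x + \<beta>)\<^sup>2 * C x - poly ?Q x = 0"
      by (simp only: mult_eq_0_iff power_eq_0_iff) blast
    then show ?thesis using x(2) by (simp add: add_eq_0_iff2)
  qed
  have "(x + \<beta>)\<^sup>2 * C x - poly ?Q x = 0" if x: "x \<in> K" for x
  proof (cases "x = - \<beta>1")
    case True
    show ?thesis
      by (rule continuous_zero_off_point[OF K _ x]) (use 1 True in \<open>auto intro!: continuous_intros C simp del: poly_add poly_mult poly_power\<close>)
  qed (use 1 x in blast)
  then show ?thesis unfolding special_form_def Q by simp
qed

lemma special_glue:
  assumes J: "open J" "connected J" "J \<noteq> {}" and C: "continuous_on J C"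
    and loc: "\<And>x. x \<in> J \<Longrightarrow> \<exists>K. open K \<and> x \<in> K \<and> K \<subseteq> J \<and> special K C"
  shows "special J C"
proof -
  obtain x0 where x0: "x0 \<in> J" using J by blast
  obtain K0 where K0: "open K0" "x0 \<in> K0" "K0 \<subseteq> J" "special K0 C" using loc[OF x0] by blast
  then obtain \<beta> \<mu> \<alpha> \<delta> \<gamma> where d: "\<mu> = 0 \<or> \<delta> = 0" and f: "special_form \<beta> \<mu> \<alpha> \<delta> \<gamma> K0 C"
    unfolding special_def by blast
  let ?P = "\<lambda>K. open K \<and> K \<subseteq> J \<and> special_form \<beta> \<mu> \<alpha> \<delta> \<gamma> K C"
  define D where "D = \<Union>{K. ?P K}"
  have oD: "open D" unfolding D_def by (rule open_Union) auto
  define D' where "D' = \<Union>{K. open K \<and> K \<subseteq> J \<and> K \<inter> D = {}}"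
  have oD': "open D'" unfolding D'_def by (rule open_Union) auto
  have "J \<subseteq> D \<union> D'"
  proof
    fix x assume x: "x \<in> J"
    obtain K where K: "open K" "x \<in> K" "K \<subseteq> J" "special K C" using loc[OF x] by blast
    show "x \<in> D \<union> D'"
    proof (cases "K \<inter> D = {}")
      case False
      then obtain K1 where K1: "?P K1" "K \<inter> K1 \<noteq> {}" unfolding D_def by blast
      obtain \<beta>1 \<mu>1 \<alpha>1 \<delta>1 \<gamma>1 where f1: "special_form \<beta>1 \<mu>1 \<alpha>1 \<delta>1 \<gamma>1 K C"
        using K(4) unfolding special_def by blast
      have "special_form \<beta> \<mu> \<alpha> \<delta> \<gamma> (K \<inter> K1) C" using K1(1) unfolding special_form_def by blast
      from special_form_extend[OF K(1) continuous_on_subset[OF C K(3)] _ K1(2) _ this f1]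
      have "special_form \<beta> \<mu> \<alpha> \<delta> \<gamma> K C" using K(1) K1(1) by blast
      then show ?thesis using K unfolding D_def by blast
    qed (use K in \<open>auto simp: D'_def\<close>)
  qed
  moreover have "D \<inter> D' \<inter> J = {}" unfolding D'_def by blast
  ultimately have "D \<inter> J = {} \<or> D' \<inter> J = {}"
    using connectedD[OF J(2) oD oD'] by blast
  moreover have "x0 \<in> D" unfolding D_def using K0 f by blast
  ultimately have "J \<subseteq> D" using \<open>J \<subseteq> D \<union> D'\<close> x0 by blast
  then have "special_form \<beta> \<mu> \<alpha> \<delta> \<gamma> J C" unfolding D_def special_form_def by blast
  then show ?thesis unfolding special_def using d by blast
qed

text \<open>With y = x + \<beta>, multiplying the condition by y^3 removes the poles of C and C' and
  leaves a polynomial of degree at most five. Its coefficients of y^0, y^5 and y^4 give the three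
  conclusions.\<close>

lemma special_form_coefficients:
  fixes C :: "real \<Rightarrow> real"
  assumes K: "open K" "K \<noteq> {}" and C: "\<And>x. x \<in> K \<Longrightarrow> (C has_real_derivative C' x) (at x)"
    and f: "special_form \<beta> \<mu> \<alpha> \<delta> \<gamma> K C"
    and eq: "\<And>x. x \<in> K \<Longrightarrow> s * C x + (s / 2 * x + c) * C' x + \<epsilon> / 8 * s2 * x\<^sup>2 + \<epsilon> / 2 * c2 * x = \<psi>"
  shows "\<mu> * (c - \<beta> / 2 * s) = 0" "\<epsilon> * s2 = - 16 * \<alpha> * s"
    "\<epsilon> * (c2 - \<beta> / 2 * s2) = - (4 * \<alpha> * (c - \<beta> / 2 * s) + 3 * \<delta> * s)"
proof -
  \<comment> \<open>Centring at the pole turns \<open>s / 2 * x + c\<close> into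
    \<open>s / 2 * y + h\<close>.\<close>
  define h where "h = c - \<beta> / 2 * s"
  let ?p = "[:- 2 * \<mu> * h, 0, 0, s * \<gamma> + h * \<delta> + \<epsilon> / 8 * s2 * \<beta>\<^sup>2 - \<epsilon> / 2 * c2 * \<beta> - \<psi>,
    3 / 2 * s * \<delta> + 2 * \<alpha> * h - \<epsilon> / 4 * s2 * \<beta> + \<epsilon> / 2 * c2, 2 * s * \<alpha> + \<epsilon> / 8 * s2:] :: real poly"
  have "?p = 0"
  proof (rule poly_zero_on_open)
    let ?K = "(\<lambda>x. x + \<beta>) ` K"
    show "open ?K" using open_translation[OF K(1), of \<beta>] by (simp add: add.commute)
    show "?K \<noteq> {}" using K by simp
    fix y assume "y \<in> ?K"
    then obtain x where x: "x \<in> K" "y = x + \<beta>" by blast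
    have d1: "((\<lambda>x. (x + \<beta>)\<^sup>2 * C x) has_real_derivative 2 * y * C x + y\<^sup>2 * C' x) (at x)"
      by (auto intro!: derivative_eq_intros C x simp: x(2) algebra_simps)
    have d2: "((\<lambda>x. \<mu> + (x + \<beta>)\<^sup>2 * (\<alpha> * (x + \<beta>)\<^sup>2 + \<delta> * (x + \<beta>) + \<gamma>)) has_real_derivative
        4 * \<alpha> * y^3 + 3 * \<delta> * y\<^sup>2 + 2 * \<gamma> * y) (at x)"
      by (auto intro!: derivative_eq_intros simp: x(2) algebra_simps power2_eq_square power3_eq_cube)
    have "((\<lambda>x. (x + \<beta>)\<^sup>2 * C x) has_real_derivative 4 * \<alpha> * y^3 + 3 * \<delta> * y\<^sup>2 + 2 * \<gamma> * y) (at x)"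
      by (rule has_field_derivative_transform_within_open[OF d2 K(1) x(1)]) (use f in \<open>auto simp: special_form_def\<close>)
    from DERIV_unique[OF d1 this]
    have 1: "2 * y * C x + y\<^sup>2 * C' x = 4 * \<alpha> * y^3 + 3 * \<delta> * y\<^sup>2 + 2 * \<gamma> * y" .
    have 2: "y\<^sup>2 * C x = \<mu> + y\<^sup>2 * (\<alpha> * y\<^sup>2 + \<delta> * y + \<gamma>)"
      using f x unfolding special_form_def by blast
    have 3: "s * C x + (s / 2 * y + h) * C' x + \<epsilon> / 8 * s2 * (y - \<beta>)\<^sup>2 + \<epsilon> / 2 * c2 * (y - \<beta>) = \<psi>"
    proof -
      have "s / 2 * y + h = s / 2 * x + c" "y - \<beta> = x" by (simp_all add: x(2) h_def field_simps)
      then show ?thesis using eq[OF x(1)] by (simp only:)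
    qed
    have "poly ?p y = - 2 * \<mu> * h + y^3 * (s * \<gamma> + h * \<delta> + \<epsilon> / 8 * s2 * \<beta>\<^sup>2 - \<epsilon> / 2 * c2 * \<beta> - \<psi>)
        + y^4 * (3 / 2 * s * \<delta> + 2 * \<alpha> * h - \<epsilon> / 4 * s2 * \<beta> + \<epsilon> / 2 * c2) + y^5 * (2 * s * \<alpha> + \<epsilon> / 8 * s2)"
      unfolding poly_pCons poly_0 by algebra
    also have "\<dots> = 0" using 1 2 3 by algebra
    finally show "poly ?p y = 0" .
  qed
  then have 0: "- 2 * \<mu> * h = 0" "3 / 2 * s * \<delta> + 2 * \<alpha> * h - \<epsilon> / 4 * s2 * \<beta> + \<epsilon> / 2 * c2 = 0"
    "2 * s * \<alpha> + \<epsilon> / 8 * s2 = 0"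
    by (simp_all only: pCons_eq_0_iff)
  from 0(1) show "\<mu> * (c - \<beta> / 2 * s) = 0" by (simp add: h_def)
  from 0(3) show "\<epsilon> * s2 = - 16 * \<alpha> * s" by algebra
  from 0(2) show "\<epsilon> * (c2 - \<beta> / 2 * s2) = - (4 * \<alpha> * (c - \<beta> / 2 * s) + 3 * \<delta> * s)"
    unfolding h_def[symmetric] by (simp add: algebra_simps)
qed

text \<open>At a fixed time the condition is a linear first-order equation for C in x. For s
  \<noteq> 0 it is solved with the integrating factor x + \<beta>, and \<mu> is the constant of
  integration; for s = 0 it prescribes C' as an affine function of x.\<close>

lemma quadratic_equation_special:
  fixes C :: "real \<Rightarrow> real"
  assumes K: "open K" "connected K" "K \<noteq> {}" and C: "\<And>x. x \<in> K \<Longrightarrow> (C has_real_derivative C' x) (at x)"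
    and ne: "s \<noteq> 0 \<or> s2 = 0 \<and> c \<noteq> 0"
    and eq: "\<And>x. x \<in> K \<Longrightarrow> s * C x + (s / 2 * x + c) * C' x + \<epsilon> / 8 * s2 * x\<^sup>2 + \<epsilon> / 2 * c2 * x = \<psi>"
  obtains \<beta> \<mu> \<alpha> \<delta> \<gamma> where "special_form \<beta> \<mu> \<alpha> \<delta> \<gamma> K C" "\<mu> = 0 \<or> s \<noteq> 0"
proof -
  obtain x0 where x0: "x0 \<in> K" using K by blast
  show ?thesis
  proof (cases "s = 0")
    case False
    \<comment> \<open>Chosen so that \<open>s / 2 * x + c\<close> is a multiple of x +
      \<beta>.\<close>
    define \<beta> where "\<beta> = 2 * c / s"
    have sx: "s / 2 * (x + \<beta>) = s / 2 * x + c" for x using False by (simp add: \<beta>_def field_simps)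
    \<comment> \<open>With y = x + \<beta> the equation becomes 2 C + y C' = e2 y^2 + e1 y + e0;
      multiplied by y, its left-hand side is the derivative of y^2 C.\<close>
    define e0 where "e0 = 2 / s * (\<psi> - \<epsilon> / 8 * s2 * \<beta>\<^sup>2 + \<epsilon> / 2 * c2 * \<beta>)"
    define e1 where "e1 = 2 / s * (\<epsilon> / 4 * s2 * \<beta> - \<epsilon> / 2 * c2)"
    define e2 where "e2 = 2 / s * (- \<epsilon> / 8 * s2)"
    have se: "s * e0 = 2 * (\<psi> - \<epsilon> / 8 * s2 * \<beta>\<^sup>2 + \<epsilon> / 2 * c2 * \<beta>)"
      "s * e1 = 2 * (\<epsilon> / 4 * s2 * \<beta> - \<epsilon> / 2 * c2)" "s * e2 = 2 * (- \<epsilon> / 8 * s2)"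
      using False by (simp_all add: e0_def e1_def e2_def)
    define f where "f x = (x + \<beta>)\<^sup>2 * C x - (x + \<beta>)\<^sup>2 * (e2 / 4 * (x + \<beta>)\<^sup>2 + e1 / 3 * (x + \<beta>) + e0 / 2)" for x
    have "(f has_real_derivative 0) (at x)" if x: "x \<in> K" for x
    proof -
      define y where "y = x + \<beta>"
      have "s / 2 * y * C' x + s * C x + \<epsilon> / 8 * s2 * (y - \<beta>)\<^sup>2 + \<epsilon> / 2 * c2 * (y - \<beta>) = \<psi>"
      proof -
        have "s / 2 * y = s / 2 * x + c" "y - \<beta> = x" using sx[of x] by (simp_all add: y_def)
        then show ?thesis using eq[OF x] by (simp only: add.commute[of "s * C x"])
      qed
      then have e: "s / 2 * y * C' x + s * C x = \<psi> - \<epsilon> / 8 * s2 * (y - \<beta>)\<^sup>2 - \<epsilon> / 2 * c2 * (y - \<beta>)"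
        by simp
      have "s * (2 * C x + y * C' x - (e2 * y\<^sup>2 + e1 * y + e0))
          = 2 * (s / 2 * y * C' x + s * C x) - (s * e2) * y\<^sup>2 - (s * e1) * y - s * e0"
        by (simp add: algebra_simps)
      also have "\<dots> = 0" unfolding e se by (simp add: field_simps power2_eq_square)
      finally have "s * (2 * C x + y * C' x - (e2 * y\<^sup>2 + e1 * y + e0)) = 0" .
      then have "2 * C x + y * C' x - (e2 * y\<^sup>2 + e1 * y + e0) = 0" using False by simp
      then have "y * (2 * C x + y * C' x - (e2 * y\<^sup>2 + e1 * y + e0)) = 0" by simp
      moreover have "(f has_real_derivative y * (2 * C x + y * C' x - (e2 * y\<^sup>2 + e1 * y + e0))) (at x)"
        unfolding f_def[abs_def]
        by (auto intro!: derivative_eq_intros C x simp: y_def field_simps power2_eq_square)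
      ultimately show ?thesis by (simp only:)
    qed
    then have "f x = f x0" if "x \<in> K" for x
      using connected_open_derivative_zero[OF K(2) _ that x0] by blast
    then have "special_form \<beta> (f x0) (e2 / 4) (e1 / 3) (e0 / 2) K C"
      unfolding special_form_def f_def by (simp add: algebra_simps)
    then show ?thesis using that False by blast
  next
    case True
    then have c: "c \<noteq> 0" "s2 = 0" using ne by simp_all
    define f where "f x = C x - (\<psi> / c * x - \<epsilon> * c2 / (4 * c) * x\<^sup>2)" for x
    have "(f has_real_derivative 0) (at x)" if x: "x \<in> K" for x
    proof -
      have "C' x - (\<psi> / c - \<epsilon> * c2 / (2 * c) * x) = 0"
        using eq[OF x] c True by (simp add: field_simps)
      moreover have "(f has_real_derivative C' x - (\<psi> / c - \<epsilon> * c2 / (2 * c) * x)) (at x)"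
        unfolding f_def[abs_def] by (auto intro!: derivative_eq_intros C x simp: field_simps c)
      ultimately show ?thesis by simp
    qed
    then have fx: "f x = f x0" if "x \<in> K" for x
      using connected_open_derivative_zero[OF K(2) _ that x0] by blast
    have e: "C x = f x0 + (\<psi> / c * x - \<epsilon> * c2 / (4 * c) * x\<^sup>2)" if "x \<in> K" for x
      using fx[OF that] unfolding f_def[of x] by (simp add: algebra_simps)
    have "special_form 0 0 (- \<epsilon> * c2 / (4 * c)) (\<psi> / c) (f x0) K C"
      unfolding special_form_def
    proof
      fix x assume x: "x \<in> K"
      show "(x + 0)\<^sup>2 * C x = 0 + (x + 0)\<^sup>2 * (- \<epsilon> * c2 / (4 * c) * (x + 0)\<^sup>2 + \<psi> / c * (x + 0) + f x0)"
        unfolding e[OF x] by simp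
    qed
    then show ?thesis using that by blast
  qed
qed

text \<open>The condition at one time fixes the shape of C. Inserted at all other times, it gives
  linear equations for \<sigma> and for \<open>h\<close>, the value of
  \<open>\<sigma> t / 2 * x + \<rho> t\<close> at the pole. If \<mu> \<noteq> 0, then
  \<open>h\<close> vanishes identically and the remaining equation forces \<delta> = 0. Uniqueness
  for the linear equations excludes a time at which \<sigma>, \<rho> and their first derivatives all
  vanish.\<close>

lemma local_rigidity:
  fixes C \<sigma> \<rho> :: "real \<Rightarrow> real"
  assumes \<epsilon>: "\<epsilon> \<in> {-1, 1}" and N: "open N" "connected N" and K: "open K" "connected K" "K \<noteq> {}"
    and C: "\<And>x. x \<in> K \<Longrightarrow> (C has_real_derivative C' x) (at x)"
    and \<sigma>: "smooth_on N \<sigma>" and \<rho>: "smooth_on N \<rho>"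
    and eq: "\<And>t x. t \<in> N \<Longrightarrow> x \<in> K \<Longrightarrow> \<sigma> t * C x + (\<sigma> t / 2 * x + \<rho> t) * C' x
      + \<epsilon> / 8 * deriv (deriv \<sigma>) t * x\<^sup>2 + \<epsilon> / 2 * deriv (deriv \<rho>) t * x = \<psi> t"
    and ne: "\<exists>t\<in>N. \<sigma> t \<noteq> 0 \<or> \<rho> t \<noteq> 0"
  shows "special K C"
    and "t1 \<in> N \<Longrightarrow> \<not> (\<sigma> t1 = 0 \<and> deriv \<sigma> t1 = 0 \<and> \<rho> t1 = 0 \<and> deriv \<rho> t1 = 0)"
proof -
  note d\<sigma> = smooth_on_deriv[OF N(1) \<sigma>] and d\<rho> = smooth_on_deriv[OF N(1) \<rho>]
  note dd\<sigma> = smooth_on_deriv(1)[OF N(1) d\<sigma>(2)] and dd\<rho> = smooth_on_deriv(1)[OF N(1) d\<rho>(2)]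
  \<comment> \<open>A time with \<sigma> \<noteq> 0 is preferred. If there is none, \<sigma>''
    vanishes as well, as the degenerate case of the equation in x requires.\<close>
  obtain t0 where t0: "t0 \<in> N" "\<sigma> t0 \<noteq> 0 \<or> (\<forall>t\<in>N. \<sigma> t = 0) \<and> \<rho> t0 \<noteq> 0"
    using ne by blast
  have zero_deriv: "deriv f t = 0" if "\<And>t. t \<in> N \<Longrightarrow> f t = 0" "t \<in> N" for f :: "real \<Rightarrow> real" and t
    by (rule DERIV_imp_deriv, rule has_field_derivative_transform_within_open[OF DERIV_const N(1) that(2)])
      (use that in simp)
  have ne0: "\<sigma> t0 \<noteq> 0 \<or> deriv (deriv \<sigma>) t0 = 0 \<and> \<rho> t0 \<noteq> 0"
  proof (cases "\<forall>t\<in>N. \<sigma> t = 0")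
    case True
    then have "deriv \<sigma> t = 0" if "t \<in> N" for t using zero_deriv that by blast
    then have "deriv (deriv \<sigma>) t0 = 0" using zero_deriv t0(1) by blast
    then show ?thesis using t0(2) True by blast
  qed (use t0(2) in blast)
  obtain \<beta> \<mu> \<alpha> \<delta> \<gamma> where f: "special_form \<beta> \<mu> \<alpha> \<delta> \<gamma> K C" and \<mu>: "\<mu> = 0 \<or> \<sigma> t0 \<noteq> 0"
    using quadratic_equation_special[OF K C ne0 eq[OF t0(1)]] by blast
  define h where "h t = \<rho> t - \<beta> / 2 * \<sigma> t" for t
  have co: "\<mu> * h t = 0" "\<epsilon> * deriv (deriv \<sigma>) t = - 16 * \<alpha> * \<sigma> t"
    "\<epsilon> * (deriv (deriv \<rho>) t - \<beta> / 2 * deriv (deriv \<sigma>) t) = - (4 * \<alpha> * h t + 3 * \<delta> * \<sigma> t)"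
    if t: "t \<in> N" for t
    using special_form_coefficients[OF K(1,3) C f eq[OF t]] by (simp_all add: h_def)
  have dh: "(h has_real_derivative deriv \<rho> t - \<beta> / 2 * deriv \<sigma> t) (at t)"
    "((\<lambda>t. deriv \<rho> t - \<beta> / 2 * deriv \<sigma> t) has_real_derivative deriv (deriv \<rho>) t - \<beta> / 2 * deriv (deriv \<sigma>) t) (at t)"
    if t: "t \<in> N" for t
    unfolding h_def[abs_def] by (auto intro!: derivative_eq_intros d\<sigma>(1) d\<rho>(1) dd\<sigma> dd\<rho> t)
  have \<epsilon>2: "\<epsilon> * \<epsilon> = 1" using \<epsilon> by auto
  have "\<mu> = 0 \<or> \<delta> = 0"
  proof (cases "\<mu> = 0")
    case False
    then have h0: "h t = 0" if "t \<in> N" for t using co(1)[OF that] by simp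
    have "deriv \<rho> t - \<beta> / 2 * deriv \<sigma> t = 0" if "t \<in> N" for t
      using zero_deriv[OF h0 that] DERIV_imp_deriv[OF dh(1)[OF that]] by simp
    from zero_deriv[of "\<lambda>t. deriv \<rho> t - \<beta> / 2 * deriv \<sigma> t", OF this t0(1)]
    have e: "deriv (deriv \<rho>) t0 - \<beta> / 2 * deriv (deriv \<sigma>) t0 = 0"
      using DERIV_imp_deriv[OF dh(2)[OF t0(1)]] by simp
    have "3 * \<delta> * \<sigma> t0 = 0" using co(3)[OF t0(1)] unfolding h0[OF t0(1)] e by simp
    then show ?thesis using \<mu> False by simp
  qed simp
  then show "special K C" unfolding special_def using f by blast
  assume t1: "t1 \<in> N"
  show "\<not> (\<sigma> t1 = 0 \<and> deriv \<sigma> t1 = 0 \<and> \<rho> t1 = 0 \<and> deriv \<rho> t1 = 0)"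
  proof
    assume 0: "\<sigma> t1 = 0 \<and> deriv \<sigma> t1 = 0 \<and> \<rho> t1 = 0 \<and> deriv \<rho> t1 = 0"
    have \<sigma>2: "deriv (deriv \<sigma>) t = - 16 * \<epsilon> * \<alpha> * \<sigma> t" if "t \<in> N" for t
      using co(2)[OF that] \<epsilon>2 by algebra
    have \<sigma>0: "\<sigma> t = 0" if "t \<in> N" for t
      by (rule linear_ode_zero[OF N(2) t1 _ _ d\<sigma>(1) _ that, where \<kappa> = "- 16 * \<epsilon> * \<alpha>"])
        (use 0 dd\<sigma> \<sigma>2 in \<open>auto\<close>)
    have h2: "deriv (deriv \<rho>) t - \<beta> / 2 * deriv (deriv \<sigma>) t = - 4 * \<epsilon> * \<alpha> * h t" if "t \<in> N" for t
      using co(3)[OF that] \<sigma>0[OF that] \<epsilon>2 by algebra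
    have "h t = 0" if "t \<in> N" for t
      by (rule linear_ode_zero[OF N(2) t1 _ _ dh(1) _ that, where \<kappa> = "- 4 * \<epsilon> * \<alpha>"])
        (use 0 dh(2) h2 in \<open>auto simp: h_def[of t1]\<close>)
    then have "\<rho> t = 0" if "t \<in> N" for t using that \<sigma>0 by (simp add: h_def)
    then show False using \<sigma>0 ne by blast
  qed
qed

text \<open>Applied with \<sigma> = \<tau>_t. On a small box either \<sigma> and \<rho> vanish, or C
  is special and the one-jet of (\<sigma>, \<rho>) vanishes at no time of the box. Vanishing of the
  one-jet is therefore open and closed in time. Were it to occur nowhere, C would be special near
  every point of the projection, hence globally, contrary to generality.\<close>

lemma general_rigidity:
  fixes C \<sigma> \<rho> :: "real \<Rightarrow> real"
  assumes \<epsilon>: "\<epsilon> \<in> {-1, 1}" and \<Omega>: "is_domain \<Omega>" and gen: "(snd ` \<Omega>, C) \<in> general_potentials"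
    and \<sigma>: "smooth_on (fst ` \<Omega>) \<sigma>" and \<rho>: "smooth_on (fst ` \<Omega>) \<rho>"
    and eq: "\<And>t x. (t, x) \<in> \<Omega> \<Longrightarrow> \<sigma> t * C x + (\<sigma> t / 2 * x + \<rho> t) * deriv C x
      + \<epsilon> / 8 * deriv (deriv \<sigma>) t * x\<^sup>2 + \<epsilon> / 2 * deriv (deriv \<rho>) t * x = \<psi> t"
    and t: "t \<in> fst ` \<Omega>"
  shows "\<sigma> t = 0 \<and> \<rho> t = 0"
proof -
  let ?I = "fst ` \<Omega>" and ?J = "snd ` \<Omega>"
  note dom = is_domainD[OF \<Omega>]
  have J: "open ?J" "connected ?J" "?J \<noteq> {}" and C: "smooth_on ?J C"
    using gen by (auto simp: general_potentials_def)
  note dC = smooth_on_deriv(1)[OF J(1) C]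
  note d\<sigma> = smooth_on_deriv[OF dom(3) \<sigma>] and d\<rho> = smooth_on_deriv[OF dom(3) \<rho>]
  \<comment> \<open>The initial data for which the second-order equations in t have only the zero
    solution.\<close>
  define jet0 where "jet0 t \<longleftrightarrow> \<sigma> t = 0 \<and> deriv \<sigma> t = 0 \<and> \<rho> t = 0 \<and> deriv \<rho> t = 0" for t
  have box: "\<exists>r>0. {t-r<..<t+r} \<times> {x-r<..<x+r} \<subseteq> \<Omega> \<and>
      (special {x-r<..<x+r} C \<and> (\<forall>s\<in>{t-r<..<t+r}. \<not> jet0 s) \<or> (\<forall>s\<in>{t-r<..<t+r}. jet0 s \<and> \<sigma> s = 0 \<and> \<rho> s = 0))"
    if tx: "(t, x) \<in> \<Omega>" for t x
  proof -
    obtain r where r: "r > 0" "{t-r<..<t+r} \<times> {x-r<..<x+r} \<subseteq> \<Omega>"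
      using open_box_in[OF dom(1) tx] by blast
    let ?N = "{t-r<..<t+r}" and ?K = "{x-r<..<x+r}"
    have "(s, x) \<in> \<Omega>" if "s \<in> ?N" for s using that r by (auto dest!: subsetD[where c = "(s, x)"])
    moreover have "(t, y) \<in> \<Omega>" if "y \<in> ?K" for y using that r by (auto dest!: subsetD[where c = "(t, y)"])
    ultimately have sub: "?N \<subseteq> ?I" "?K \<subseteq> ?J" by force+
    have e: "\<sigma> t * C x + (\<sigma> t / 2 * x + \<rho> t) * deriv C x
      + \<epsilon> / 8 * deriv (deriv \<sigma>) t * x\<^sup>2 + \<epsilon> / 2 * deriv (deriv \<rho>) t * x = \<psi> t" if "t \<in> ?N" "x \<in> ?K" for t x
      using eq[of t x] that r(2) by blast
    have K: "open ?K" "connected ?K" "?K \<noteq> {}" and N: "open ?N" "connected ?N" using r(1) by auto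
    have dC': "(C has_real_derivative deriv C x) (at x)" if "x \<in> ?K" for x using dC sub(2) that by blast
    show ?thesis
    proof (cases "\<exists>t\<in>?N. \<sigma> t \<noteq> 0 \<or> \<rho> t \<noteq> 0")
      case True
      note loc = local_rigidity[OF \<epsilon> N K dC' smooth_on_subset[OF \<sigma> sub(1)] smooth_on_subset[OF \<rho> sub(1)] e True]
      show ?thesis using loc r jet0_def by blast
    next
      case False
      have "deriv f s = 0" if "\<And>t. t \<in> ?N \<Longrightarrow> f t = 0" "s \<in> ?N" for f :: "real \<Rightarrow> real" and s
        by (rule DERIV_imp_deriv, rule has_field_derivative_transform_within_open[OF DERIV_const N(1) that(2)])
          (use that in simp)
      then show ?thesis using False r jet0_def by metis
    qed
  qed
  define Z where "Z = {t \<in> ?I. jet0 t}"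
  have oZ: "open Z"
    unfolding open_dist
  proof
    fix t assume "t \<in> Z"
    then obtain x where tx: "(t, x) \<in> \<Omega>" "jet0 t" unfolding Z_def by force
    obtain r where r: "r > 0" "{t-r<..<t+r} \<times> {x-r<..<x+r} \<subseteq> \<Omega>" "\<forall>s\<in>{t-r<..<t+r}. jet0 s"
      using box[OF tx(1)] tx(2) by fastforce
    have "s \<in> Z" if "dist s t < r" for s
    proof -
      have s: "s \<in> {t-r<..<t+r}" using that by (auto simp: dist_real_def abs_less_iff)
      then have "(s, x) \<in> \<Omega>" using r(1,2) by (auto dest!: subsetD[where c = "(s, x)"])
      then show ?thesis using r(3) s unfolding Z_def by force
    qed
    then show "\<exists>e>0. \<forall>s. dist s t < e \<longrightarrow> s \<in> Z" using r(1) by blast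
  qed
  define Z' where "Z' = {t \<in> ?I. \<not> jet0 t}"
  have oZ': "open Z'"
    unfolding open_dist
  proof
    fix t assume "t \<in> Z'"
    then obtain x where tx: "(t, x) \<in> \<Omega>" "\<not> jet0 t" unfolding Z'_def by force
    obtain r where r: "r > 0" "{t-r<..<t+r} \<times> {x-r<..<x+r} \<subseteq> \<Omega>" "\<forall>s\<in>{t-r<..<t+r}. \<not> jet0 s"
      using box[OF tx(1)] tx(2) by fastforce
    have "s \<in> Z'" if "dist s t < r" for s
    proof -
      have s: "s \<in> {t-r<..<t+r}" using that by (auto simp: dist_real_def abs_less_iff)
      then have "(s, x) \<in> \<Omega>" using r(1,2) by (auto dest!: subsetD[where c = "(s, x)"])
      then show ?thesis using r(3) s unfolding Z'_def by force
    qed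
    then show "\<exists>e>0. \<forall>s. dist s t < e \<longrightarrow> s \<in> Z'" using r(1) by blast
  qed
  have "Z \<inter> ?I = {} \<or> Z' \<inter> ?I = {}"
    by (rule connectedD[OF dom(4) oZ oZ']) (auto simp: Z_def Z'_def)
  moreover have "Z \<inter> ?I \<noteq> {}"
  proof
    assume "Z \<inter> ?I = {}"
    then have nj: "\<not> jet0 t" if "(t, x) \<in> \<Omega>" for t x using that unfolding Z_def by force
    have "special ?J C"
    proof (rule special_glue[OF J smooth_on_continuous[OF C]])
      fix x assume "x \<in> ?J"
      then obtain t where tx: "(t, x) \<in> \<Omega>" by force
      obtain r where r: "r > 0" "{t-r<..<t+r} \<times> {x-r<..<x+r} \<subseteq> \<Omega>" "special {x-r<..<x+r} C"
        using box[OF tx] nj[OF tx] by fastforce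
      have "(t, y) \<in> \<Omega>" if "y \<in> {x-r<..<x+r}" for y using that r by (auto dest!: subsetD[where c = "(t, y)"])
      then have "{x-r<..<x+r} \<subseteq> ?J" by force
      then show "\<exists>K. open K \<and> x \<in> K \<and> K \<subseteq> ?J \<and> special K C"
        using r by (intro exI[of _ "{x-r<..<x+r}"]) auto
    qed
    then show False using general_not_special[OF gen] by blast
  qed
  ultimately have "jet0 t" using t unfolding Z'_def by blast
  then show ?thesis by (simp add: jet0_def)
qed

section \<open>Reduction to heat equations with potentials\<close>

definition heat_solution :: "real \<Rightarrow> dom \<Rightarrow> fld \<Rightarrow> fld \<Rightarrow> bool"
  where "heat_solution e \<Omega> c U \<longleftrightarrow> smooth_on \<Omega> U \<and>
    (\<forall>z\<in>\<Omega>. U z \<noteq> 0 \<and> Dt U z = e * Dx (Dx U) z + c z * U z)"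

lemma breve_cases: "breve L = 1 \<or> breve L = -1" by (cases L) auto

lemma heat_solution_smooth_B:
  assumes "open \<Omega>" "heat_solution e \<Omega> c U"
  shows "smooth_on \<Omega> (B_of L \<epsilon> U)"
proof -
  have "smooth_on \<Omega> (\<lambda>z. 2 * \<epsilon> * breve L * (Dx U z / U z))"
    using assms unfolding heat_solution_def
    by (intro smooth_on_mult smooth_on_const smooth_on_divide smooth_on_partials) auto
  then show ?thesis by (simp add: B_of_def)
qed

lemma partials_const: "Dt (\<lambda>_. k) z = 0" "Dx (\<lambda>_. k) z = 0"
  by (simp_all add: Dt_def Dx_def case_prod_unfold)

lemma Dx_const: "Dx (\<lambda>_. k) = (\<lambda>_. 0)"
  using partials_const(2) by blast

text \<open>The gauge factor is U to the power -\<open>breve L\<close>. For Kolmogorov equations u =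
  v / U is a quotient of two solutions of the same heat equation; for Fokker-Planck equations u = U
  v, where U solves the adjoint equation, in which both terms on the right have the opposite sign.
  In either case v satisfies the heat equation with coefficient \<epsilon> and potential
  \<open>c\<close>.\<close>

lemma determining_heat_iff:
  assumes \<epsilon>: "\<epsilon> \<in> {-1, 1}" and \<Omega>: "open \<Omega>" and c: "smooth_on \<Omega> c"
    and U: "heat_solution (\<epsilon> * breve L) \<Omega> (\<lambda>z. breve L * c z) U"
  shows "determining \<Omega> (equation L (case_elements L \<epsilon> U)) \<tau> \<xi> \<eta> \<longleftrightarrow>
    determining \<Omega> (\<lambda>_. \<epsilon>, \<lambda>_. 0, c) \<tau> \<xi> (\<lambda>z. \<eta> z + breve L * (\<tau> (fst z) * Dt U z + \<xi> z * Dx U z) / U z)"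
proof -
  define b where "b = breve L"
  have b2: "b * b = 1" using breve_cases[of L] by (auto simp: b_def)
  have \<epsilon>2: "\<epsilon> * \<epsilon> = 1" using \<epsilon> by auto
  have sU: "smooth_on \<Omega> U" and ne: "\<And>z. z \<in> \<Omega> \<Longrightarrow> U z \<noteq> 0"
    and eq: "\<And>z. z \<in> \<Omega> \<Longrightarrow> Dt U z = \<epsilon> * b * Dx (Dx U) z + b * c z * U z"
    using U by (auto simp: heat_solution_def b_def)
  note sp = smooth_on_partials[OF \<Omega>]
  define N where "N z = - b * (Dx U z / U z)" for z
  define P where "P z = - b * (Dt U z / U z)" for z
  have sN: "smooth_on \<Omega> N"
    unfolding N_def by (intro smooth_on_mult smooth_on_const smooth_on_divide \<Omega> sp sU ne)
  have sP: "smooth_on \<Omega> P"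
    unfolding P_def by (intro smooth_on_mult smooth_on_const smooth_on_divide \<Omega> sp sU ne)
  define B where "B = B_of L \<epsilon> U"
  have sB: "smooth_on \<Omega> B" unfolding B_def by (rule heat_solution_smooth_B[OF \<Omega> U])
  have BN: "B z = - 2 * \<epsilon> * N z" for z by (simp add: B_def B_of_def N_def b_def)
  \<comment> \<open>With A constant, the expanded Fokker-Planck equation has the zeroth-order
    coefficient B_x.\<close>
  have E: "equation L (case_elements L \<epsilon> U) = (\<lambda>_. \<epsilon>, B, \<lambda>z. if b = 1 then 0 else Dx B z)"
    by (cases L) (simp_all add: case_elements_def B_def b_def Dx_const)
  define c0 where "c0 z = (if b = 1 then 0 else Dx B z)" for z
  have sc0: "smooth_on \<Omega> c0"
    unfolding c0_def by (cases "b = 1") (auto intro: smooth_on_const sp sB)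
  have Nx: "Dx N z = - b * (Dx (Dx U) z / U z) + b * (Dx U z / U z)\<^sup>2" if z: "z \<in> \<Omega>" for z
    unfolding N_def[abs_def]
    by (rule partials_imp_eq(2))
      (auto intro!: derivative_eq_intros partial_deriv'(2)[OF sU z] partial_deriv'(2)[OF sp(2)[OF sU] z]
        simp: ne[OF z] field_simps power2_eq_square)
  have Nt: "Dt N z = - b * (Dt (Dx U) z / U z) + b * (Dx U z * Dt U z / (U z)\<^sup>2)" if z: "z \<in> \<Omega>" for z
    unfolding N_def[abs_def]
    by (rule partials_imp_eq(1))
      (auto intro!: derivative_eq_intros partial_deriv'(1)[OF sU z] partial_deriv'(1)[OF sp(2)[OF sU] z]
        simp: ne[OF z] field_simps power2_eq_square)
  have Px: "Dx P z = - b * (Dx (Dt U) z / U z) + b * (Dx U z * Dt U z / (U z)\<^sup>2)" if z: "z \<in> \<Omega>" for z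
    unfolding P_def[abs_def]
    by (rule partials_imp_eq(2))
      (auto intro!: derivative_eq_intros partial_deriv'(2)[OF sU z] partial_deriv'(2)[OF sp(1)[OF sU] z]
        simp: ne[OF z] field_simps power2_eq_square)
  have NP: "Dt N z = Dx P z" if z: "z \<in> \<Omega>" for z
    unfolding Nt[OF z] Px[OF z] mixed_partials[OF \<Omega> sU z] ..
  have Bx: "Dx B z = - 2 * \<epsilon> * Dx N z" if z: "z \<in> \<Omega>" for z
    by (rule partials_eqI(2)[OF \<Omega> BN z]) (auto intro!: derivative_eq_intros partial_deriv'(2)[OF sN z])
  have cc: "c z = \<epsilon> * (Dx N z + (N z)\<^sup>2) + B z * N z + c0 z - P z" if z: "z \<in> \<Omega>" for z
  proof -
    define r where "r = Dx U z / U z"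
    define q where "q = Dx (Dx U) z / U z"
    have P: "P z = - \<epsilon> * q - c z"
      unfolding P_def q_def eq[OF z] using ne[OF z] b2 by (simp add: field_simps) algebra
    have 1: "Dx N z = - b * q + b * r\<^sup>2" "N z = - b * r"
      unfolding Nx[OF z] N_def r_def q_def by auto
    show ?thesis
    proof (cases "b = 1")
      case True
      show ?thesis unfolding P BN 1 c0_def using True by (simp add: algebra_simps power2_eq_square)
    next
      case False
      then have "b = -1" using breve_cases[of L] by (auto simp: b_def)
      then show ?thesis unfolding P BN c0_def Bx[OF z] 1 by (simp add: algebra_simps power2_eq_square)
    qed
  qed
  have g: "(\<lambda>z. \<eta> z - (\<tau> (fst z) * P z + \<xi> z * N z)) = (\<lambda>z. \<eta> z + b * (\<tau> (fst z) * Dt U z + \<xi> z * Dx U z) / U z)"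
    by (simp add: P_def N_def fun_eq_iff algebra_simps add_divide_distrib)
  have s0: "smooth_on \<Omega> (\<lambda>_. \<epsilon>)" "smooth_on \<Omega> (\<lambda>_. 0 :: real)" by (rule smooth_on_const)+
  have sN': "smooth_on \<Omega> (\<lambda>z. - N z)" "smooth_on \<Omega> (\<lambda>z. - P z)" by (intro smooth_intros \<Omega> sN sP)+
  have nx: "Dx (\<lambda>z. - N z) z = - Dx N z" "Dx (\<lambda>z. - P z) z = - Dx P z" "Dt (\<lambda>z. - N z) z = - Dt N z" if "z \<in> \<Omega>" for z
    using DERIV_minus[OF partial_deriv'(2)[OF sN that]] DERIV_minus[OF partial_deriv'(2)[OF sP that]]
      DERIV_minus[OF partial_deriv'(1)[OF sN that]]
    by (auto intro!: partials_imp_eq)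
  show ?thesis
    unfolding E c0_def[symmetric] b_def[symmetric] g[symmetric]
  proof
    assume d: "determining \<Omega> (\<lambda>_. \<epsilon>, B, c0) \<tau> \<xi> \<eta>"
    show "determining \<Omega> (\<lambda>_. \<epsilon>, \<lambda>_. 0, c) \<tau> \<xi> (\<lambda>z. \<eta> z - (\<tau> (fst z) * P z + \<xi> z * N z))"
      by (rule determining_gauge[OF \<Omega> s0(1) sB sc0 sN sP NP _ cc d]) (simp_all add: BN)
  next
    let ?\<eta> = "\<lambda>z. \<eta> z - (\<tau> (fst z) * P z + \<xi> z * N z)"
    assume d: "determining \<Omega> (\<lambda>_. \<epsilon>, \<lambda>_. 0, c) \<tau> \<xi> ?\<eta>"
    have "determining \<Omega> (\<lambda>_. \<epsilon>, B, c0) \<tau> \<xi> (\<lambda>z. ?\<eta> z - (\<tau> (fst z) * - P z + \<xi> z * - N z))"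
      by (rule determining_gauge[OF \<Omega> s0(1,2) c sN' _ _ _ d])
        (use nx NP cc in \<open>simp_all add: BN algebra_simps power2_eq_square\<close>)
    moreover have "(\<lambda>z. ?\<eta> z - (\<tau> (fst z) * - P z + \<xi> z * - N z)) = \<eta>" by (simp add: fun_eq_iff)
    ultimately show "determining \<Omega> (\<lambda>_. \<epsilon>, B, c0) \<tau> \<xi> \<eta>" by simp
  qed
qed

text \<open>\<open>det2\<close> makes \<xi> affine in x and \<open>det1\<close> makes \<eta>
  quadratic in x, each up to a function of t. The last equation is what remains of
  \<open>det0\<close>: the classifying condition on the potential. Since \<epsilon> is its own
  inverse, division by it appears as multiplication.\<close>

lemma determining_heat_form:
  assumes \<epsilon>: "\<epsilon> \<in> {-1, 1}" and \<Omega>: "is_domain \<Omega>" and c: "smooth_on \<Omega> c"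
  shows "determining \<Omega> (\<lambda>_. \<epsilon>, \<lambda>_. 0, c) \<tau> \<xi> \<eta> \<longleftrightarrow> smooth_on (fst ` \<Omega>) \<tau> \<and>
    (\<exists>\<rho> \<zeta>. smooth_on (fst ` \<Omega>) \<rho> \<and> smooth_on (fst ` \<Omega>) \<zeta> \<and>
      (\<forall>t x. (t, x) \<in> \<Omega> \<longrightarrow> \<xi> (t, x) = deriv \<tau> t / 2 * x + \<rho> t \<and>
        \<eta> (t, x) = \<zeta> t - \<epsilon> / 8 * deriv (deriv \<tau>) t * x\<^sup>2 - \<epsilon> / 2 * deriv \<rho> t * x \<and>
        deriv \<tau> t * c (t, x) + \<tau> t * Dt c (t, x) + (deriv \<tau> t / 2 * x + \<rho> t) * Dx c (t, x)
        + \<epsilon> / 8 * deriv (deriv (deriv \<tau>)) t * x\<^sup>2 + \<epsilon> / 2 * deriv (deriv \<rho>) t * x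
        = deriv \<zeta> t + deriv (deriv \<tau>) t / 4))" (is "?l \<longleftrightarrow> ?r")
proof -
  note o = is_domainD(1,3)[OF \<Omega>]
  have \<epsilon>2: "\<epsilon> * \<epsilon> = 1" "\<epsilon> \<noteq> 0" using \<epsilon> by auto
  note sp = smooth_on_partials[OF o(1)]
  \<comment> \<open>The three expressions are evaluated for the explicit form of \<xi> and \<eta>;
    both directions rely on this computation.\<close>
  {
    fix \<rho> \<zeta> assume s: "smooth_on (fst ` \<Omega>) \<tau>" "smooth_on (fst ` \<Omega>) \<rho>" "smooth_on (fst ` \<Omega>) \<zeta>"
      and \<xi>0: "\<forall>t x. (t, x) \<in> \<Omega> \<longrightarrow> \<xi> (t, x) = deriv \<tau> t / 2 * x + \<rho> t"
      and \<eta>0: "\<forall>t x. (t, x) \<in> \<Omega> \<longrightarrow> \<eta> (t, x) = \<zeta> t - \<epsilon> / 8 * deriv (deriv \<tau>) t * x\<^sup>2 - \<epsilon> / 2 * deriv \<rho> t * x"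
    note \<xi> = \<xi>0[rule_format] and \<eta> = \<eta>0[rule_format]
    note d\<tau> = smooth_on_deriv[OF o(2) s(1)] note d2\<tau> = smooth_on_deriv[OF o(2) d\<tau>(2)]
    note d3\<tau> = smooth_on_deriv[OF o(2) d2\<tau>(2)]
    note d\<rho> = smooth_on_deriv[OF o(2) s(2)] note d2\<rho> = smooth_on_deriv[OF o(2) d\<rho>(2)]
    note d\<zeta> = smooth_on_deriv[OF o(2) s(3)]
    have \<xi>': "\<xi> z = deriv \<tau> (fst z) / 2 * snd z + \<rho> (fst z)" if "z \<in> \<Omega>" for z using \<xi>[of "fst z" "snd z"] that by simp
    have \<eta>': "\<eta> z = \<zeta> (fst z) - \<epsilon> / 8 * deriv (deriv \<tau>) (fst z) * (snd z)\<^sup>2 - \<epsilon> / 2 * deriv \<rho> (fst z) * snd z"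
      if "z \<in> \<Omega>" for z using \<eta>[of "fst z" "snd z"] that by simp
    have "smooth_on \<Omega> (\<lambda>z. deriv \<tau> (fst z) / 2 * snd z + \<rho> (fst z))"
      by (intro smooth_intros smooth_on_fst_snd smooth_on_of_time o d\<tau> s) auto
    then have s\<xi>: "smooth_on \<Omega> \<xi>" by (rule smooth_on_cong[OF o(1), rotated]) (simp add: \<xi>')
    have "smooth_on \<Omega> (\<lambda>z. \<zeta> (fst z) - \<epsilon> / 8 * deriv (deriv \<tau>) (fst z) * (snd z)\<^sup>2 - \<epsilon> / 2 * deriv \<rho> (fst z) * snd z)"
      by (intro smooth_intros smooth_on_fst_snd smooth_on_of_time o d2\<tau> d\<rho> s) auto
    then have s\<eta>: "smooth_on \<Omega> \<eta>" by (rule smooth_on_cong[OF o(1), rotated]) (simp add: \<eta>')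
    have p: "Dx \<xi> z = deriv \<tau> (fst z) / 2" "Dt \<xi> z = deriv (deriv \<tau>) (fst z) / 2 * snd z + deriv \<rho> (fst z)"
      "Dx \<eta> z = - \<epsilon> / 4 * deriv (deriv \<tau>) (fst z) * snd z - \<epsilon> / 2 * deriv \<rho> (fst z)"
      "Dt \<eta> z = deriv \<zeta> (fst z) - \<epsilon> / 8 * deriv (deriv (deriv \<tau>)) (fst z) * (snd z)\<^sup>2 - \<epsilon> / 2 * deriv (deriv \<rho>) (fst z) * snd z"
      if z: "z \<in> \<Omega>" for z
    proof -
      have t: "fst z \<in> fst ` \<Omega>" using z by simp
      show "Dx \<xi> z = deriv \<tau> (fst z) / 2"
        by (rule partials_eqI(2)[OF o(1) \<xi>' z]) (auto intro!: derivative_eq_intros)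
      show "Dt \<xi> z = deriv (deriv \<tau>) (fst z) / 2 * snd z + deriv \<rho> (fst z)"
        by (rule partials_eqI(1)[OF o(1) \<xi>' z]) (auto intro!: derivative_eq_intros d2\<tau>(1)[OF t] d\<rho>(1)[OF t])
      show "Dx \<eta> z = - \<epsilon> / 4 * deriv (deriv \<tau>) (fst z) * snd z - \<epsilon> / 2 * deriv \<rho> (fst z)"
        by (rule partials_eqI(2)[OF o(1) \<eta>' z]) (auto intro!: derivative_eq_intros)
      show "Dt \<eta> z = deriv \<zeta> (fst z) - \<epsilon> / 8 * deriv (deriv (deriv \<tau>)) (fst z) * (snd z)\<^sup>2 - \<epsilon> / 2 * deriv (deriv \<rho>) (fst z) * snd z"
        by (rule partials_eqI(1)[OF o(1) \<eta>' z])
          (auto intro!: derivative_eq_intros d3\<tau>(1)[OF t] d2\<rho>(1)[OF t] d\<zeta>(1)[OF t] simp: algebra_simps)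
    qed
    have pp: "Dx (Dx \<xi>) z = 0" "Dx (Dx \<eta>) z = - \<epsilon> / 4 * deriv (deriv \<tau>) (fst z)" if z: "z \<in> \<Omega>" for z
    proof -
      show "Dx (Dx \<xi>) z = 0"
        by (rule partials_eqI(2)[OF o(1) p(1) z]) (auto intro!: derivative_eq_intros)
      show "Dx (Dx \<eta>) z = - \<epsilon> / 4 * deriv (deriv \<tau>) (fst z)"
        by (rule partials_eqI(2)[OF o(1) p(3) z]) (auto intro!: derivative_eq_intros)
    qed
    have "det2 (\<lambda>_. \<epsilon>) \<tau> \<xi> z = 0 \<and> det1 (\<lambda>_. \<epsilon>) (\<lambda>_. 0) \<tau> \<xi> \<eta> z = 0"
      and "det0 (\<lambda>_. \<epsilon>) (\<lambda>_. 0) c \<tau> \<xi> \<eta> z = deriv \<zeta> (fst z) + deriv (deriv \<tau>) (fst z) / 4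
        - (deriv \<tau> (fst z) * c z + \<tau> (fst z) * Dt c z + (deriv \<tau> (fst z) / 2 * snd z + \<rho> (fst z)) * Dx c z
        + \<epsilon> / 8 * deriv (deriv (deriv \<tau>)) (fst z) * (snd z)\<^sup>2 + \<epsilon> / 2 * deriv (deriv \<rho>) (fst z) * snd z)"
      if z: "z \<in> \<Omega>" for z
    proof -
      show "det2 (\<lambda>_. \<epsilon>) \<tau> \<xi> z = 0 \<and> det1 (\<lambda>_. \<epsilon>) (\<lambda>_. 0) \<tau> \<xi> \<eta> z = 0"
        unfolding det2_def det1_def p[OF z] pp[OF z] partials_const using \<epsilon>2(1) by (auto simp: algebra_simps) algebra
      show "det0 (\<lambda>_. \<epsilon>) (\<lambda>_. 0) c \<tau> \<xi> \<eta> z = deriv \<zeta> (fst z) + deriv (deriv \<tau>) (fst z) / 4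
        - (deriv \<tau> (fst z) * c z + \<tau> (fst z) * Dt c z + (deriv \<tau> (fst z) / 2 * snd z + \<rho> (fst z)) * Dx c z
        + \<epsilon> / 8 * deriv (deriv (deriv \<tau>)) (fst z) * (snd z)\<^sup>2 + \<epsilon> / 2 * deriv (deriv \<rho>) (fst z) * snd z)"
        unfolding det0_def p[OF z] pp[OF z] \<xi>'[OF z] using \<epsilon>2(1) by algebra
    qed
    note this s\<xi> s\<eta>
  } note main = this
  show ?thesis
  proof
    assume ?r
    then obtain \<rho> \<zeta> where s: "smooth_on (fst ` \<Omega>) \<tau>" "smooth_on (fst ` \<Omega>) \<rho>" "smooth_on (fst ` \<Omega>) \<zeta>"
      and \<xi>: "\<forall>t x. (t, x) \<in> \<Omega> \<longrightarrow> \<xi> (t, x) = deriv \<tau> t / 2 * x + \<rho> t"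
      and \<eta>: "\<forall>t x. (t, x) \<in> \<Omega> \<longrightarrow> \<eta> (t, x) = \<zeta> t - \<epsilon> / 8 * deriv (deriv \<tau>) t * x\<^sup>2 - \<epsilon> / 2 * deriv \<rho> t * x"
      and eq: "\<And>t x. (t, x) \<in> \<Omega> \<Longrightarrow> deriv \<tau> t * c (t, x) + \<tau> t * Dt c (t, x) + (deriv \<tau> t / 2 * x + \<rho> t) * Dx c (t, x)
        + \<epsilon> / 8 * deriv (deriv (deriv \<tau>)) t * x\<^sup>2 + \<epsilon> / 2 * deriv (deriv \<rho>) t * x
        = deriv \<zeta> t + deriv (deriv \<tau>) t / 4" by blast
    note m = main[OF s \<xi> \<eta>]
    have "det0 (\<lambda>_. \<epsilon>) (\<lambda>_. 0) c \<tau> \<xi> \<eta> z = 0" if z: "z \<in> \<Omega>" for z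
      unfolding m(2)[OF z] using eq[of "fst z" "snd z"] z by simp
    then show ?l unfolding determining.simps using s m by simp
  next
    assume ?l
    then have s: "smooth_on (fst ` \<Omega>) \<tau>" "smooth_on \<Omega> \<xi>" "smooth_on \<Omega> \<eta>"
      and d: "\<And>z. z \<in> \<Omega> \<Longrightarrow> det2 (\<lambda>_. \<epsilon>) \<tau> \<xi> z = 0" "\<And>z. z \<in> \<Omega> \<Longrightarrow> det1 (\<lambda>_. \<epsilon>) (\<lambda>_. 0) \<tau> \<xi> \<eta> z = 0"
        "\<And>z. z \<in> \<Omega> \<Longrightarrow> det0 (\<lambda>_. \<epsilon>) (\<lambda>_. 0) c \<tau> \<xi> \<eta> z = 0" by auto
    note d\<tau> = smooth_on_deriv[OF o(2) s(1)] note d2\<tau> = smooth_on_deriv[OF o(2) d\<tau>(2)]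
    have \<xi>x: "Dx \<xi> z = deriv \<tau> (fst z) / 2" if "z \<in> \<Omega>" for z
      using d(1)[OF that] \<epsilon>2(2) by (simp add: det2_def partials_const)
    have s1: "smooth_on \<Omega> (\<lambda>z. \<xi> z - deriv \<tau> (fst z) / 2 * snd z)"
      by (intro smooth_intros smooth_on_fst_snd smooth_on_of_time o d\<tau> s) auto
    have "Dx (\<lambda>z. \<xi> z - deriv \<tau> (fst z) / 2 * snd z) z = 0" if z: "z \<in> \<Omega>" for z
      by (rule partials_imp_eq(2)) (auto intro!: derivative_eq_intros partial_deriv'(2)[OF s(2) z] simp: \<xi>x[OF z])
    from x_independent[OF \<Omega> s1 this] obtain \<rho> where \<rho>: "smooth_on (fst ` \<Omega>) \<rho>"
      "\<And>t x. (t, x) \<in> \<Omega> \<Longrightarrow> \<xi> (t, x) - deriv \<tau> t / 2 * x = \<rho> t" by auto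
    then have \<xi>: "\<And>t x. (t, x) \<in> \<Omega> \<Longrightarrow> \<xi> (t, x) = deriv \<tau> t / 2 * x + \<rho> t" by (simp add: algebra_simps)
    note d\<rho> = smooth_on_deriv[OF o(2) \<rho>(1)]
    have \<xi>': "\<xi> z = deriv \<tau> (fst z) / 2 * snd z + \<rho> (fst z)" if "z \<in> \<Omega>" for z using \<xi>[of "fst z" "snd z"] that by simp
    have \<eta>x: "Dx \<eta> z = - \<epsilon> / 4 * deriv (deriv \<tau>) (fst z) * snd z - \<epsilon> / 2 * deriv \<rho> (fst z)" if z: "z \<in> \<Omega>" for z
    proof -
      have t: "fst z \<in> fst ` \<Omega>" using z by simp
      have "Dt \<xi> z = deriv (deriv \<tau>) (fst z) / 2 * snd z + deriv \<rho> (fst z)"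
        by (rule partials_eqI(1)[OF o(1) \<xi>' z]) (auto intro!: derivative_eq_intros d2\<tau>(1)[OF t] d\<rho>(1)[OF t])
      moreover have "Dx (Dx \<xi>) z = 0"
        by (rule partials_eqI(2)[OF o(1) \<xi>x z]) (auto intro!: derivative_eq_intros)
      ultimately have "2 * \<epsilon> * Dx \<eta> z = - (deriv (deriv \<tau>) (fst z) / 2 * snd z + deriv \<rho> (fst z))"
        using d(2)[OF z] by (simp add: det1_def partials_const algebra_simps)
      then have "2 * (\<epsilon> * \<epsilon>) * Dx \<eta> z = - \<epsilon> * (deriv (deriv \<tau>) (fst z) / 2 * snd z + deriv \<rho> (fst z))" by algebra
      then show ?thesis using \<epsilon>2(1) by (simp add: algebra_simps)
    qed
    have s2: "smooth_on \<Omega> (\<lambda>z. \<eta> z + \<epsilon> / 8 * deriv (deriv \<tau>) (fst z) * (snd z)\<^sup>2 + \<epsilon> / 2 * deriv \<rho> (fst z) * snd z)"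
      by (intro smooth_intros smooth_on_fst_snd smooth_on_of_time o d2\<tau> d\<rho> s) auto
    have "Dx (\<lambda>z. \<eta> z + \<epsilon> / 8 * deriv (deriv \<tau>) (fst z) * (snd z)\<^sup>2 + \<epsilon> / 2 * deriv \<rho> (fst z) * snd z) z = 0" if z: "z \<in> \<Omega>" for z
      by (rule partials_imp_eq(2)) (auto intro!: derivative_eq_intros partial_deriv'(2)[OF s(3) z] simp: \<eta>x[OF z])
    from x_independent[OF \<Omega> s2 this] obtain \<zeta> where \<zeta>: "smooth_on (fst ` \<Omega>) \<zeta>"
      "\<And>t x. (t, x) \<in> \<Omega> \<Longrightarrow> \<eta> (t, x) + \<epsilon> / 8 * deriv (deriv \<tau>) t * x\<^sup>2 + \<epsilon> / 2 * deriv \<rho> t * x = \<zeta> t" by auto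
    then have \<eta>: "\<forall>t x. (t, x) \<in> \<Omega> \<longrightarrow> \<eta> (t, x) = \<zeta> t - \<epsilon> / 8 * deriv (deriv \<tau>) t * x\<^sup>2 - \<epsilon> / 2 * deriv \<rho> t * x"
      by (simp add: algebra_simps)
    have \<xi>0: "\<forall>t x. (t, x) \<in> \<Omega> \<longrightarrow> \<xi> (t, x) = deriv \<tau> t / 2 * x + \<rho> t" using \<xi> by blast
    note m = main[OF s(1) \<rho>(1) \<zeta>(1) \<xi>0 \<eta>]
    have "deriv \<tau> t * c (t, x) + \<tau> t * Dt c (t, x) + (deriv \<tau> t / 2 * x + \<rho> t) * Dx c (t, x)
        + \<epsilon> / 8 * deriv (deriv (deriv \<tau>)) t * x\<^sup>2 + \<epsilon> / 2 * deriv (deriv \<rho>) t * x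
        = deriv \<zeta> t + deriv (deriv \<tau>) t / 4" if z: "(t, x) \<in> \<Omega>" for t x
      using m(2)[OF z] d(3)[OF z] by simp
    with s(1) \<rho>(1) \<zeta>(1) \<xi> \<eta> show ?r by blast
  qed
qed

section \<open>Bases of the essential algebras\<close>

definition lincomb :: "real list \<Rightarrow> 'a::real_vector list \<Rightarrow> 'a"
  where "lincomb ks vs = (\<Sum>(k, v)\<leftarrow>zip ks vs. k *\<^sub>R v)"

lemma lincomb_simps [simp]:
  "lincomb [] [] = 0" "lincomb (k # ks) (v # vs) = k *\<^sub>R v + lincomb ks vs"
  by (simp_all add: lincomb_def)

lemma span_list: "span (set vs) = {lincomb ks vs | ks. length ks = length vs}"
proof (induction vs)
  case (Cons v vs)
  show ?case
  proof (intro equalityI subsetI)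
    fix x assume "x \<in> span (set (v # vs))"
    then obtain k where "x - k *\<^sub>R v \<in> span (set vs)" using span_breakdown_eq[of x v "set vs"] by auto
    then obtain ks where "x - k *\<^sub>R v = lincomb ks vs" "length ks = length vs" using Cons by blast
    then show "x \<in> {lincomb ks (v # vs) | ks. length ks = length (v # vs)}"
      by (auto intro!: exI[of _ "k # ks"] simp: algebra_simps)
  next
    fix x assume "x \<in> {lincomb ks (v # vs) | ks. length ks = length (v # vs)}"
    then obtain k ks where "x = k *\<^sub>R v + lincomb ks vs" "length ks = length vs"
      by (auto simp: length_Suc_conv)
    then have "x - k *\<^sub>R v \<in> span (set vs)" using Cons by auto
    then show "x \<in> span (set (v # vs))" using span_breakdown_eq[of x v "set vs"] by auto
  qed
qed simp

lemma lincomb_minus: "length ks = length vs \<Longrightarrow> lincomb (map uminus ks) vs = - lincomb ks vs"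
  by (induction ks vs rule: list_induct2) auto

text \<open>Coefficients are attached to list positions, so a repeated vector would already give a
  nontrivial relation; this is why distinctness comes along with independence.\<close>

lemma independent_list:
  assumes "\<And>ks. length ks = length vs \<Longrightarrow> lincomb ks vs = 0 \<Longrightarrow> set ks \<subseteq> {0}"
  shows "distinct vs \<and> independent (set vs)"
  using assms
proof (induction vs)
  case (Cons v vs)
  have "set ks \<subseteq> {0}" if "length ks = length vs" "lincomb ks vs = 0" for ks
    using Cons.prems[of "0 # ks"] that by simp
  then have IH: "distinct vs" "independent (set vs)" using Cons.IH by auto
  have "v \<notin> span (set vs)"
  proof
    assume "v \<in> span (set vs)"
    then obtain ks where "v = lincomb ks vs" "length ks = length vs" unfolding span_list by blast
    then show False using Cons.prems[of "1 # map uminus ks"] by (simp add: lincomb_minus)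
  qed
  then show ?case using IH span_base independent_insertI[of v "set vs"] by auto
qed (simp add: independent_empty)

lemma is_basisI:
  assumes "\<And>ks. length ks = length vs \<Longrightarrow> lincomb ks vs = 0 \<Longrightarrow> set ks \<subseteq> {0}"
    and "V = {lincomb ks vs | ks. length ks = length vs}"
  shows "is_basis vs V"
  unfolding is_basis_def using independent_list[OF assms(1)] span_list[of vs] assms(2) by simp

text \<open>
  The general element of the span of \<open>u \<partial>\<^sub>u\<close> and the fields \<open>P\<^sup>t\<close>, \<open>D\<close>, \<open>\<Pi>\<close>, \<open>P\<^sup>x\<close>, \<open>G\<close>; before the
  gauge transformation by \<open>U\<close> its last component is \<open>heat_eta\<close>.
\<close>
definition heat_tau :: "real \<Rightarrow> real \<Rightarrow> real \<Rightarrow> real \<Rightarrow> real"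
  where "heat_tau k1 k2 k3 t = k1 + 2 * k2 * t + 4 * k3 * t\<^sup>2"

definition heat_xi :: "real \<Rightarrow> real \<Rightarrow> real \<Rightarrow> real \<Rightarrow> fld"
  where "heat_xi k2 k3 k4 k5 = (\<lambda>(t, x). (k2 + 4 * k3 * t) * x + (k4 + 2 * k5 * t))"

definition heat_eta :: "real \<Rightarrow> real \<Rightarrow> real \<Rightarrow> real \<Rightarrow> fld"
  where "heat_eta \<epsilon> k0 k3 k5 = (\<lambda>(t, x). k0 - k3 * (\<epsilon> * x\<^sup>2 + 2 * t) - k5 * \<epsilon> * x)"

definition general_field where
  "general_field L \<epsilon> \<Omega> U k0 k1 k2 k3 k4 k5 = ess_field \<Omega> (heat_tau k1 k2 k3) (heat_xi k2 k3 k4 k5)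
    (\<lambda>z. heat_eta \<epsilon> k0 k3 k5 z
      - breve L * (heat_tau k1 k2 k3 (fst z) * Dt U z + heat_xi k2 k3 k4 k5 z * Dx U z) / U z)"

lemma general_field_eq:
  assumes "\<epsilon> \<in> {-1, 1}"
  shows "general_field L \<epsilon> \<Omega> U k0 k1 k2 k3 k4 k5 =
    k0 *\<^sub>R u_du \<Omega> + k1 *\<^sub>R Pt_hat L \<Omega> U + k2 *\<^sub>R D_hat L \<epsilon> \<Omega> U + k3 *\<^sub>R Pi_hat L \<epsilon> \<Omega> U
    + k4 *\<^sub>R Px_hat L \<epsilon> \<Omega> U + k5 *\<^sub>R G_hat L \<epsilon> \<Omega> U"
proof -
  have "\<epsilon> * \<epsilon> = 1" using assms by auto
  \<comment> \<open>Since \<epsilon>^2 = 1, the terms with B in the basis fields are multiples of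
    \<open>breve L * Dx U z / U z\<close>, the gauge term that belongs to a translation in
    x.\<close>
  then have B: "\<epsilon> * B_of L \<epsilon> U z = 2 * (breve L * Dx U z / U z)" for z
    unfolding B_of_def by (simp add: algebra_simps)
  have B2: "1 / 2 * \<epsilon> * y * B_of L \<epsilon> U z = y * (breve L * Dx U z / U z)"
    "2 * \<epsilon> * t * y * B_of L \<epsilon> U z = 4 * t * y * (breve L * Dx U z / U z)"
    "1 / 2 * \<epsilon> * B_of L \<epsilon> U z = breve L * Dx U z / U z"
    "- \<epsilon> * (y + t * B_of L \<epsilon> U z) = - \<epsilon> * y - 2 * t * (breve L * Dx U z / U z)" for y t z
    using B[of z] by algebra+
  show ?thesis
    unfolding general_field_def u_du_def Pt_hat_def D_hat_def Pi_hat_def Px_hat_def G_hat_def B2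
    by (rule ext) (auto simp: ess_field_def heat_tau_def heat_xi_def heat_eta_def plus_fun_def scaleR_fun_def
        R_of_def zero_prod_def field_simps add_divide_distrib)
qed

lemma general_field_zero:
  assumes \<Omega>: "is_domain \<Omega>" and 0: "general_field L \<epsilon> \<Omega> U k0 k1 k2 k3 k4 k5 = 0"
  shows "k0 = 0" "k1 = 0" "k2 = 0" "k3 = 0" "k4 = 0" "k5 = 0"
proof -
  note o = is_domainD(3,5)[OF \<Omega>]
  have "(0 :: vfield) = ess_field \<Omega> (\<lambda>_. 0) (\<lambda>_. 0) (\<lambda>_. 0)"
    by (auto simp: ess_field_def fun_eq_iff zero_prod_def)
  note d = ess_field_eqD[OF 0[unfolded general_field_def this]]
  have "[:k1, 2 * k2, 4 * k3:] = 0"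
  proof (rule poly_zero_on_open[OF o])
    fix t assume "t \<in> fst ` \<Omega>"
    then obtain x where "(t, x) \<in> \<Omega>" by force
    from d(1)[OF this] show "poly [:k1, 2 * k2, 4 * k3:] t = 0"
      by (simp add: heat_tau_def algebra_simps power2_eq_square)
  qed
  then show k: "k1 = 0" "k2 = 0" "k3 = 0" by auto
  have "[:k4, 2 * k5:] = 0"
  proof (rule poly_zero_on_open[OF o])
    fix t assume "t \<in> fst ` \<Omega>"
    then obtain x where "(t, x) \<in> \<Omega>" by force
    from d(2)[OF this] show "poly [:k4, 2 * k5:] t = 0"
      by (simp add: heat_xi_def k algebra_simps)
  qed
  then show k': "k4 = 0" "k5 = 0" by auto
  obtain t x where "(t, x) \<in> \<Omega>" using is_domainD(9)[OF \<Omega>] by auto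
  from d(3)[OF this] show "k0 = 0"
    by (simp add: heat_eta_def heat_tau_def heat_xi_def k k')
qed

fun valid_potential :: "potential \<Rightarrow> bool"
  where "valid_potential (General J C) \<longleftrightarrow> (J, C) \<in> general_potentials"
  | "valid_potential (Inv_Square \<mu>) \<longleftrightarrow> \<mu> \<noteq> 0"
  | "valid_potential Zero \<longleftrightarrow> True"

lemma nonzero_solutionsD:
  assumes "(\<Omega>, U) \<in> nonzero_solutions L \<epsilon> p"
  shows "is_domain \<Omega>" "admissible_domain p \<Omega>"
    "heat_solution (\<epsilon> * breve L) \<Omega> (\<lambda>z. breve L * pot p (snd z)) U"
  using assms by (auto simp: nonzero_solutions_def heat_solution_def heat_with_potential_def case_prod_unfold)

lemma nonzero_solutionsI:
  assumes "is_domain \<Omega>" "admissible_domain p \<Omega>"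
    "heat_solution (\<epsilon> * breve L) \<Omega> (\<lambda>z. breve L * pot p (snd z)) U"
  shows "(\<Omega>, U) \<in> nonzero_solutions L \<epsilon> p"
  using assms by (auto simp: nonzero_solutions_def heat_solution_def heat_with_potential_def case_prod_unfold)

lemma pot_smooth:
  assumes \<Omega>: "is_domain \<Omega>" and p: "valid_potential p" and adm: "admissible_domain p \<Omega>"
  shows "smooth_on (snd ` \<Omega>) (pot p)" "smooth_on \<Omega> (\<lambda>z. pot p (snd z))"
    and "z \<in> \<Omega> \<Longrightarrow> Dt (\<lambda>z. pot p (snd z)) z = 0" "z \<in> \<Omega> \<Longrightarrow> Dx (\<lambda>z. pot p (snd z)) z = deriv (pot p) (snd z)"
proof -
  note o = is_domainD(1,6)[OF \<Omega>]
  show s: "smooth_on (snd ` \<Omega>) (pot p)"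
  proof (cases p)
    case (General J C)
    then show ?thesis using p adm smooth_on_cong[OF o(2), of C] by (auto simp: general_potentials_def)
  next
    case (Inv_Square \<mu>)
    have "smooth_on (snd ` \<Omega>) (\<lambda>x. \<mu> / x\<^sup>2)"
      using adm Inv_Square by (intro smooth_intros o) auto
    then show ?thesis by (rule smooth_on_cong[OF o(2), rotated]) (simp add: Inv_Square)
  next
    case Zero
    then have "pot p = (\<lambda>_. 0)" by auto
    then show ?thesis using smooth_on_const by simp
  qed
  show "smooth_on \<Omega> (\<lambda>z. pot p (snd z))" by (rule smooth_on_of_space[OF o(1) s])
  assume z: "z \<in> \<Omega>"
  show "Dt (\<lambda>z. pot p (snd z)) z = 0" by (rule partials_imp_eq(1)) simp
  show "Dx (\<lambda>z. pot p (snd z)) z = deriv (pot p) (snd z)"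
    by (rule partials_imp_eq(2)) (use smooth_on_deriv(1)[OF o(2) s, of "snd z"] z in simp)
qed

lemma primitive_of_quadratic:
  fixes f :: "real \<Rightarrow> real"
  assumes "connected I" "\<And>t. t \<in> I \<Longrightarrow> (f has_real_derivative a + b * t) (at t)"
  shows "\<exists>c. \<forall>t\<in>I. f t = c + a * t + b / 2 * t\<^sup>2"
proof (cases "I = {}")
  case False
  then obtain t0 where t0: "t0 \<in> I" by blast
  define g where "g t = f t - (a * t + b / 2 * t\<^sup>2)" for t
  have "(g has_real_derivative 0) (at t)" if "t \<in> I" for t
    unfolding g_def[abs_def] by (auto intro!: derivative_eq_intros assms(2)[OF that])
  then have "g t = g t0" if "t \<in> I" for t
    using connected_open_derivative_zero[OF assms(1) _ that t0] by blast
  then show ?thesis by (intro exI[of _ "g t0"]) (simp add: g_def algebra_simps)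
qed simp

text \<open>\<open>k2\<close> to \<open>k5\<close> are the coefficients of D, \<Pi>, P^x and G. One
  six-parameter family serves all potentials, and this predicate switches off the fields that a
  given potential does not admit.\<close>

definition admissible_coefficients :: "potential \<Rightarrow> real \<Rightarrow> real \<Rightarrow> real \<Rightarrow> real \<Rightarrow> bool"
  where "admissible_coefficients p k2 k3 k4 k5 \<longleftrightarrow> (p \<noteq> Zero \<longrightarrow> k4 = 0 \<and> k5 = 0) \<and>
    (\<forall>J C. p = General J C \<longrightarrow> k2 = 0 \<and> k3 = 0)"

text \<open>In every case the classifying condition splits into \<tau>_ttt = 0, \<rho>_tt = 0 and
  \<zeta>_t = -\<tau>_tt / 4: by rigidity for a general potential, by comparing coefficients in x
  for the other two. Integration over the connected time projection then produces the constants
  \<open>k0\<close> to \<open>k5\<close>.\<close>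

lemma heat_potential_symmetries:
  assumes \<epsilon>: "\<epsilon> \<in> {-1, 1}" and \<Omega>: "is_domain \<Omega>" and p: "valid_potential p" and adm: "admissible_domain p \<Omega>"
    and det: "determining \<Omega> (\<lambda>_. \<epsilon>, \<lambda>_. 0, \<lambda>z. pot p (snd z)) \<tau> \<xi> \<eta>"
  obtains k0 k1 k2 k3 k4 k5 where "admissible_coefficients p k2 k3 k4 k5"
    "\<And>t x. (t, x) \<in> \<Omega> \<Longrightarrow> \<tau> t = heat_tau k1 k2 k3 t \<and> \<xi> (t, x) = heat_xi k2 k3 k4 k5 (t, x)
      \<and> \<eta> (t, x) = heat_eta \<epsilon> k0 k3 k5 (t, x)"
proof -
  note P = pot_smooth[OF \<Omega> p adm]
  note o = is_domainD(1,3,4)[OF \<Omega>]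
  obtain \<rho> \<zeta> where s: "smooth_on (fst ` \<Omega>) \<tau>" "smooth_on (fst ` \<Omega>) \<rho>" "smooth_on (fst ` \<Omega>) \<zeta>"
    and \<xi>: "\<And>t x. (t, x) \<in> \<Omega> \<Longrightarrow> \<xi> (t, x) = deriv \<tau> t / 2 * x + \<rho> t"
    and \<eta>: "\<And>t x. (t, x) \<in> \<Omega> \<Longrightarrow> \<eta> (t, x) = \<zeta> t - \<epsilon> / 8 * deriv (deriv \<tau>) t * x\<^sup>2 - \<epsilon> / 2 * deriv \<rho> t * x"
    and eq0: "\<And>t x. (t, x) \<in> \<Omega> \<Longrightarrow> deriv \<tau> t * pot p (snd (t, x)) + \<tau> t * Dt (\<lambda>z. pot p (snd z)) (t, x)
        + (deriv \<tau> t / 2 * x + \<rho> t) * Dx (\<lambda>z. pot p (snd z)) (t, x)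
        + \<epsilon> / 8 * deriv (deriv (deriv \<tau>)) t * x\<^sup>2 + \<epsilon> / 2 * deriv (deriv \<rho>) t * x
        = deriv \<zeta> t + deriv (deriv \<tau>) t / 4"
    using det unfolding determining_heat_form[OF \<epsilon> \<Omega> P(2)] by blast
  have eq: "deriv \<tau> t * pot p x + (deriv \<tau> t / 2 * x + \<rho> t) * deriv (pot p) x
        + \<epsilon> / 8 * deriv (deriv (deriv \<tau>)) t * x\<^sup>2 + \<epsilon> / 2 * deriv (deriv \<rho>) t * x
        = deriv \<zeta> t + deriv (deriv \<tau>) t / 4" if "(t, x) \<in> \<Omega>" for t x
    using eq0[OF that] P(3,4)[OF that] by simp
  note d\<tau> = smooth_on_deriv[OF o(2) s(1)] note d2\<tau> = smooth_on_deriv[OF o(2) d\<tau>(2)]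
  note d3\<tau> = smooth_on_deriv[OF o(2) d2\<tau>(2)]
  note d\<rho> = smooth_on_deriv[OF o(2) s(2)] note d2\<rho> = smooth_on_deriv[OF o(2) d\<rho>(2)]
  note d\<zeta> = smooth_on_deriv[OF o(2) s(3)]
  have \<epsilon>0: "\<epsilon> \<noteq> 0" using \<epsilon> by auto
  have zero_deriv: "deriv f t = 0" if "\<And>t. t \<in> fst ` \<Omega> \<Longrightarrow> f t = 0" "t \<in> fst ` \<Omega>" for f :: "real \<Rightarrow> real" and t
    by (rule DERIV_imp_deriv, rule has_field_derivative_transform_within_open[OF DERIV_const o(2) that(2)])
      (use that in simp)
  have key: "deriv (deriv (deriv \<tau>)) t = 0 \<and> deriv (deriv \<rho>) t = 0 \<and> deriv \<zeta> t = - deriv (deriv \<tau>) t / 4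
      \<and> (p \<noteq> Zero \<longrightarrow> \<rho> t = 0) \<and> (\<forall>J C. p = General J C \<longrightarrow> deriv \<tau> t = 0)" if t: "t \<in> fst ` \<Omega>" for t
  proof -
    obtain x0 where x0: "(t, x0) \<in> \<Omega>" using t by force
    let ?K = "{x. (t, x) \<in> \<Omega>}"
    have K: "open ?K" "?K \<noteq> {}" using open_slices(1)[OF o(1)] x0 by auto
    show ?thesis
    proof (cases p)
      case (General J C)
      then have J: "snd ` \<Omega> = J" "(snd ` \<Omega>, C) \<in> general_potentials" using adm p by auto
      have "pot p = C" by (simp add: General fun_eq_iff)
      note r = general_rigidity[OF \<epsilon> \<Omega> J(2) d\<tau>(2) s(2) eq[unfolded this]]
      have \<tau>0: "deriv \<tau> t = 0" and \<rho>0: "\<rho> t = 0" if "t \<in> fst ` \<Omega>" for t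
        using r[OF _ that] by simp_all
      have \<tau>1: "deriv (deriv \<tau>) t = 0" and \<rho>1: "deriv \<rho> t = 0" if "t \<in> fst ` \<Omega>" for t
        using zero_deriv[OF \<tau>0 that] zero_deriv[OF \<rho>0 that] by auto
      have \<tau>2: "deriv (deriv (deriv \<tau>)) t = 0" and \<rho>2: "deriv (deriv \<rho>) t = 0"
        using zero_deriv[OF \<tau>1 t] zero_deriv[OF \<rho>1 t] by auto
      show ?thesis using eq[OF x0] \<tau>0[OF t] \<tau>1[OF t] \<tau>2 \<rho>0[OF t] \<rho>1[OF t] \<rho>2 by simp
    next
      case (Inv_Square \<mu>)
      \<comment> \<open>The condition for \<mu> / x^2 multiplied by x^3; the terms with \<tau>_t
        cancel by homogeneity of the potential.\<close>
      let ?p = "[:- 2 * \<mu> * \<rho> t, 0, 0, - (deriv \<zeta> t + deriv (deriv \<tau>) t / 4), \<epsilon> / 2 * deriv (deriv \<rho>) t,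
        \<epsilon> / 8 * deriv (deriv (deriv \<tau>)) t:]"
      have "?p = 0"
      proof (rule poly_zero_on_open[OF K])
        fix x assume "x \<in> ?K"
        then have x: "(t, x) \<in> \<Omega>" by simp
        have x0: "x \<noteq> 0" using adm x Inv_Square by force
        have "(pot p has_real_derivative - 2 * \<mu> / x ^ 3) (at x)"
        proof (rule has_field_derivative_transform_within_open[where f = "\<lambda>x. \<mu> / x\<^sup>2" and S = UNIV])
          show "((\<lambda>x. \<mu> / x\<^sup>2) has_real_derivative - 2 * \<mu> / x ^ 3) (at x)"
            using x0 by (auto intro!: derivative_eq_intros simp: field_simps eval_nat_numeral)
        qed (auto simp: Inv_Square)
        then have d: "deriv (pot p) x * x ^ 3 = - 2 * \<mu>" using DERIV_imp_deriv x0 by fastforce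
        have c: "pot p x * x\<^sup>2 = \<mu>" using x0 by (simp add: Inv_Square)
        show "poly ?p x = 0" unfolding poly_pCons poly_0 using eq[OF x] c d by algebra
      qed
      then have "- 2 * \<mu> * \<rho> t = 0" "- (deriv \<zeta> t + deriv (deriv \<tau>) t / 4) = 0" "\<epsilon> / 2 * deriv (deriv \<rho>) t = 0"
        "\<epsilon> / 8 * deriv (deriv (deriv \<tau>)) t = 0"
        by (simp_all only: pCons_eq_0_iff)
      then show ?thesis using \<epsilon>0 p Inv_Square by simp
    next
      case Zero
      have pz: "pot p = (\<lambda>_. 0)" by (simp add: Zero fun_eq_iff)
      let ?p = "[:- (deriv \<zeta> t + deriv (deriv \<tau>) t / 4), \<epsilon> / 2 * deriv (deriv \<rho>) t, \<epsilon> / 8 * deriv (deriv (deriv \<tau>)) t:]"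
      have "?p = 0"
      proof (rule poly_zero_on_open[OF K])
        fix x assume "x \<in> ?K"
        then have x: "(t, x) \<in> \<Omega>" by simp
        show "poly ?p x = 0" using eq[OF x] unfolding pz by (simp add: algebra_simps power2_eq_square)
      qed
      then have "- (deriv \<zeta> t + deriv (deriv \<tau>) t / 4) = 0" "\<epsilon> / 2 * deriv (deriv \<rho>) t = 0"
        "\<epsilon> / 8 * deriv (deriv (deriv \<tau>)) t = 0"
        by (simp_all only: pCons_eq_0_iff)
      then show ?thesis using \<epsilon>0 Zero by simp
    qed
  qed
  define I where "I = fst ` \<Omega>"
  note conn = o(3)[folded I_def] and key' = key[folded I_def]
  note D = d\<tau>(1)[folded I_def] d2\<tau>(1)[folded I_def] d3\<tau>(1)[folded I_def] d\<rho>(1)[folded I_def]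
    d2\<rho>(1)[folded I_def] d\<zeta>(1)[folded I_def]
  obtain c2 where c2: "\<And>t. t \<in> I \<Longrightarrow> deriv (deriv \<tau>) t = c2"
    using primitive_of_quadratic[OF conn, of "deriv (deriv \<tau>)" 0 0] D key' by auto
  obtain c1 where c1: "\<And>t. t \<in> I \<Longrightarrow> deriv \<tau> t = c1 + c2 * t"
    using primitive_of_quadratic[OF conn, of "deriv \<tau>" c2 0] D c2 by auto
  obtain c0 where c0: "\<And>t. t \<in> I \<Longrightarrow> \<tau> t = c0 + c1 * t + c2 / 2 * t\<^sup>2"
    using primitive_of_quadratic[OF conn, of \<tau> c1 c2] D c1 by auto
  obtain r1 where r1: "\<And>t. t \<in> I \<Longrightarrow> deriv \<rho> t = r1"
    using primitive_of_quadratic[OF conn, of "deriv \<rho>" 0 0] D key' by auto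
  obtain r0 where r0: "\<And>t. t \<in> I \<Longrightarrow> \<rho> t = r0 + r1 * t"
    using primitive_of_quadratic[OF conn, of \<rho> r1 0] D r1 by auto
  obtain z0 where z0: "\<And>t. t \<in> I \<Longrightarrow> \<zeta> t = z0 - c2 / 4 * t"
    using primitive_of_quadratic[OF conn, of \<zeta> "- c2 / 4" 0] D key' c2 by auto
  have I: "open I" "I \<noteq> {}" using is_domainD[OF \<Omega>] by (auto simp: I_def)
  show ?thesis
  \<comment> \<open>The normalisations match \<tau> = k1 + 2 k2 t + 4 k3 t^2 and \<rho> = k4 + 2 k5
    t.\<close>
  proof (rule that[of "c1 / 2" "c2 / 8" r0 "r1 / 2" c0 z0])
    have "[:r0, r1:] = 0" if "p \<noteq> Zero"
      by (rule poly_zero_on_open[OF I]) (use key' that r0 in \<open>auto simp: algebra_simps\<close>)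
    moreover have "[:c1, c2:] = 0" if "p = General J C" for J C
      by (rule poly_zero_on_open[OF I]) (use key' that c1 in \<open>auto simp: algebra_simps\<close>)
    ultimately show "admissible_coefficients p (c1 / 2) (c2 / 8) r0 (r1 / 2)"
      unfolding admissible_coefficients_def by auto
  next
    fix t x assume tx: "(t, x) \<in> \<Omega>"
    then have t: "t \<in> I" unfolding I_def by force
    show "\<tau> t = heat_tau c0 (c1 / 2) (c2 / 8) t \<and> \<xi> (t, x) = heat_xi (c1 / 2) (c2 / 8) r0 (r1 / 2) (t, x)
      \<and> \<eta> (t, x) = heat_eta \<epsilon> z0 (c2 / 8) (r1 / 2) (t, x)"
      using \<xi>[OF tx] \<eta>[OF tx] c0[OF t] c1[OF t] c2[OF t] r0[OF t] r1[OF t] z0[OF t]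
      by (simp add: heat_tau_def heat_xi_def heat_eta_def field_simps)
  qed
qed

lemma heat_potential_symmetries_converse:
  assumes \<epsilon>: "\<epsilon> \<in> {-1, 1}" and \<Omega>: "is_domain \<Omega>" and p: "valid_potential p" and adm: "admissible_domain p \<Omega>"
    and k: "admissible_coefficients p k2 k3 k4 k5"
  shows "determining \<Omega> (\<lambda>_. \<epsilon>, \<lambda>_. 0, \<lambda>z. pot p (snd z)) (heat_tau k1 k2 k3) (heat_xi k2 k3 k4 k5) (heat_eta \<epsilon> k0 k3 k5)"
proof -
  note P = pot_smooth[OF \<Omega> p adm]
  note o = is_domainD(1,3,4)[OF \<Omega>]
  have d: "deriv (heat_tau k1 k2 k3) = (\<lambda>t. 2 * k2 + 8 * k3 * t)"
    unfolding heat_tau_def[abs_def] by (rule ext, rule DERIV_imp_deriv) (auto intro!: derivative_eq_intros)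
  have d2: "deriv (\<lambda>t. 2 * k2 + 8 * k3 * t) = (\<lambda>t. 8 * k3)"
    by (rule ext, rule DERIV_imp_deriv) (auto intro!: derivative_eq_intros)
  have d3: "deriv (\<lambda>t. 8 * k3) = (\<lambda>t. 0)" by simp
  have r: "deriv (\<lambda>t. k4 + 2 * k5 * t) = (\<lambda>t. 2 * k5)"
    by (rule ext, rule DERIV_imp_deriv) (auto intro!: derivative_eq_intros)
  have z: "deriv (\<lambda>t. k0 - 2 * k3 * t) = (\<lambda>t. - 2 * k3)"
    by (rule ext, rule DERIV_imp_deriv) (auto intro!: derivative_eq_intros)
  have key: "(2 * k2 + 8 * k3 * t) * pot p x + (k2 * x + 4 * k3 * t * x + (k4 + 2 * k5 * t)) * deriv (pot p) x = 0"
    if tx: "(t, x) \<in> \<Omega>" for t x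
  proof (cases p)
    case (General J C)
    then show ?thesis using k by (simp add: admissible_coefficients_def)
  next
    case (Inv_Square \<mu>)
    have x0: "x \<noteq> 0" using adm tx Inv_Square by force
    have "(pot p has_real_derivative - 2 * \<mu> / x ^ 3) (at x)"
    proof (rule has_field_derivative_transform_within_open[where f = "\<lambda>x. \<mu> / x\<^sup>2" and S = UNIV])
      show "((\<lambda>x. \<mu> / x\<^sup>2) has_real_derivative - 2 * \<mu> / x ^ 3) (at x)"
        using x0 by (auto intro!: derivative_eq_intros simp: field_simps eval_nat_numeral)
    qed (auto simp: Inv_Square)
    then have dp: "deriv (pot p) x = - 2 * \<mu> / x ^ 3" by (rule DERIV_imp_deriv)
    show ?thesis
      unfolding dp using k Inv_Square x0
      by (simp add: admissible_coefficients_def field_simps eval_nat_numeral)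
  next
    case Zero
    have "pot p = (\<lambda>_. 0)" by (simp add: Zero fun_eq_iff)
    then show ?thesis by simp
  qed
  show ?thesis
    unfolding determining_heat_form[OF \<epsilon> \<Omega> P(2)]
  proof (intro conjI exI allI impI)
    show "smooth_on (fst ` \<Omega>) (heat_tau k1 k2 k3)" unfolding heat_tau_def by (intro smooth_intros o)
    show "smooth_on (fst ` \<Omega>) (\<lambda>t. k4 + 2 * k5 * t)" "smooth_on (fst ` \<Omega>) (\<lambda>t. k0 - 2 * k3 * t)"
      by (intro smooth_intros o)+
    fix t x assume tx: "(t, x) \<in> \<Omega>"
    show "heat_xi k2 k3 k4 k5 (t, x) = deriv (heat_tau k1 k2 k3) t / 2 * x + (k4 + 2 * k5 * t)"
      unfolding d by (simp add: heat_xi_def algebra_simps add_divide_distrib)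
    show "heat_eta \<epsilon> k0 k3 k5 (t, x) = k0 - 2 * k3 * t - \<epsilon> / 8 * deriv (deriv (heat_tau k1 k2 k3)) t * x\<^sup>2
        - \<epsilon> / 2 * deriv (\<lambda>t. k4 + 2 * k5 * t) t * x"
      unfolding d d2 r by (simp add: heat_eta_def algebra_simps)
    show "deriv (heat_tau k1 k2 k3) t * pot p (snd (t, x)) + heat_tau k1 k2 k3 t * Dt (\<lambda>z. pot p (snd z)) (t, x) +
        (deriv (heat_tau k1 k2 k3) t / 2 * x + (k4 + 2 * k5 * t)) * Dx (\<lambda>z. pot p (snd z)) (t, x) +
        \<epsilon> / 8 * deriv (deriv (deriv (heat_tau k1 k2 k3))) t * x\<^sup>2 +
        \<epsilon> / 2 * deriv (deriv (\<lambda>t. k4 + 2 * k5 * t)) t * x =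
        deriv (\<lambda>t. k0 - 2 * k3 * t) t + deriv (deriv (heat_tau k1 k2 k3)) t / 4"
      unfolding P(3,4)[OF tx] d d2 d3 r z using key[OF tx] by (simp add: field_simps)
  qed
qed

lemma case_algebra:
  assumes \<epsilon>: "\<epsilon> \<in> {-1, 1}" and U: "(\<Omega>, U) \<in> nonzero_solutions L \<epsilon> p" and p: "valid_potential p"
  shows "ess_algebra \<Omega> (equation L (case_elements L \<epsilon> U)) =
    {general_field L \<epsilon> \<Omega> U k0 k1 k2 k3 k4 k5 | k0 k1 k2 k3 k4 k5. admissible_coefficients p k2 k3 k4 k5}" (is "?l = ?r")
proof -
  note U' = nonzero_solutionsD[OF U]
  note o = is_domainD(1)[OF U'(1)]
  note iff = determining_heat_iff[OF \<epsilon> o pot_smooth(2)[OF U'(1) p U'(2)] U'(3)]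
  show ?thesis
  proof (intro equalityI subsetI)
    fix Q assume "Q \<in> ?l"
    then obtain \<tau> \<xi> \<eta> where Q: "Q = ess_field \<Omega> \<tau> \<xi> \<eta>" and "determining \<Omega> (equation L (case_elements L \<epsilon> U)) \<tau> \<xi> \<eta>"
      unfolding ess_algebra_eq[OF o] by blast
    then have det: "determining \<Omega> (\<lambda>_. \<epsilon>, \<lambda>_. 0, \<lambda>z. pot p (snd z)) \<tau> \<xi> (\<lambda>z. \<eta> z + breve L * (\<tau> (fst z) * Dt U z + \<xi> z * Dx U z) / U z)"
      unfolding iff by blast
    obtain k0 k1 k2 k3 k4 k5
      where k: "admissible_coefficients p k2 k3 k4 k5"
      and eq: "\<And>t x. (t, x) \<in> \<Omega> \<Longrightarrow> \<tau> t = heat_tau k1 k2 k3 t \<and> \<xi> (t, x) = heat_xi k2 k3 k4 k5 (t, x)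
        \<and> \<eta> (t, x) + breve L * (\<tau> (fst (t, x)) * Dt U (t, x) + \<xi> (t, x) * Dx U (t, x)) / U (t, x) = heat_eta \<epsilon> k0 k3 k5 (t, x)"
      by (rule heat_potential_symmetries[OF \<epsilon> U'(1) p U'(2) det], rule that, assumption) blast
    have "Q = general_field L \<epsilon> \<Omega> U k0 k1 k2 k3 k4 k5"
      unfolding Q general_field_def
    proof (rule ess_field_cong)
      fix t x assume tx: "(t, x) \<in> \<Omega>"
      then show "\<tau> t = heat_tau k1 k2 k3 t \<and> \<xi> (t, x) = heat_xi k2 k3 k4 k5 (t, x) \<and> \<eta> (t, x) = heat_eta \<epsilon> k0 k3 k5 (t, x)
        - breve L * (heat_tau k1 k2 k3 (fst (t, x)) * Dt U (t, x) + heat_xi k2 k3 k4 k5 (t, x) * Dx U (t, x)) / U (t, x)"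
        using eq[OF tx] by (auto simp: eq_diff_eq)
    qed
    then show "Q \<in> ?r" using k by blast
  next
    fix Q assume "Q \<in> ?r"
    then obtain k0 k1 k2 k3 k4 k5 where Q: "Q = general_field L \<epsilon> \<Omega> U k0 k1 k2 k3 k4 k5" and k: "admissible_coefficients p k2 k3 k4 k5"
      by blast
    let ?\<tau> = "heat_tau k1 k2 k3" and ?\<xi> = "heat_xi k2 k3 k4 k5" and ?\<eta> = "heat_eta \<epsilon> k0 k3 k5"
    have "determining \<Omega> (equation L (case_elements L \<epsilon> U)) ?\<tau> ?\<xi>
      (\<lambda>z. ?\<eta> z - breve L * (?\<tau> (fst z) * Dt U z + ?\<xi> z * Dx U z) / U z)"
      unfolding iff using heat_potential_symmetries_converse[OF \<epsilon> U'(1) p U'(2) k, of k1 k0] by simp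
    then show "Q \<in> ?l" unfolding ess_algebra_eq[OF o] Q general_field_def by blast
  qed
qed

text \<open>Spanning and independence are both inherited from the six-parameter family by padding
  the coefficient lists with zeros.\<close>

lemma case_basis:
  assumes \<epsilon>: "\<epsilon> \<in> {-1, 1}" and U: "(\<Omega>, U) \<in> nonzero_solutions L \<epsilon> p" and p: "valid_potential p"
  shows "is_basis (u_du \<Omega> # case_fields L \<epsilon> \<Omega> U p) (ess_algebra \<Omega> (equation L (case_elements L \<epsilon> U)))"
proof -
  note gf = general_field_eq[OF \<epsilon>] and z = general_field_zero[OF nonzero_solutionsD(1)[OF U]]
  let ?vs = "u_du \<Omega> # case_fields L \<epsilon> \<Omega> U p"
  have lin: "\<exists>k0 k1 k2 k3 k4 k5. admissible_coefficients p k2 k3 k4 k5 \<and> lincomb ks ?vs = general_field L \<epsilon> \<Omega> U k0 k1 k2 k3 k4 k5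
      \<and> set ks \<subseteq> {k0, k1, k2, k3, k4, k5}" if len: "length ks = length ?vs" for ks
  proof (cases p)
    case (General J C)
    then obtain k0 k1 where ks: "ks = [k0, k1]" using len by (auto simp: length_Suc_conv)
    show ?thesis
      by (rule exI[of _ k0], rule exI[of _ k1], rule exI[of _ 0], rule exI[of _ 0], rule exI[of _ 0], rule exI[of _ 0])
        (simp add: gf ks General admissible_coefficients_def)
  next
    case (Inv_Square \<mu>)
    then obtain k0 k1 k2 k3 where ks: "ks = [k0, k1, k2, k3]" using len by (auto simp: length_Suc_conv)
    show ?thesis
      by (rule exI[of _ k0], rule exI[of _ k1], rule exI[of _ k2], rule exI[of _ k3], rule exI[of _ 0], rule exI[of _ 0])
        (simp add: gf ks Inv_Square admissible_coefficients_def add.assoc)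
  next
    case Zero
    then obtain k0 k1 k2 k3 k4 k5 where ks: "ks = [k0, k1, k2, k3, k4, k5]" using len by (auto simp: length_Suc_conv)
    show ?thesis
      by (rule exI[of _ k0], rule exI[of _ k1], rule exI[of _ k2], rule exI[of _ k3], rule exI[of _ k4], rule exI[of _ k5])
        (simp add: gf ks Zero admissible_coefficients_def add.assoc)
  qed
  have lin': "\<exists>ks. length ks = length ?vs \<and> lincomb ks ?vs = general_field L \<epsilon> \<Omega> U k0 k1 k2 k3 k4 k5"
    if k: "admissible_coefficients p k2 k3 k4 k5" for k0 k1 k2 k3 k4 k5
  proof (cases p)
    case (General J C)
    show ?thesis by (rule exI[of _ "[k0, k1]"]) (use k in \<open>simp add: gf General admissible_coefficients_def\<close>)
  next
    case (Inv_Square \<mu>)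
    show ?thesis by (rule exI[of _ "[k0, k1, k2, k3]"]) (use k in \<open>simp add: gf Inv_Square admissible_coefficients_def add.assoc\<close>)
  next
    case Zero
    show ?thesis by (rule exI[of _ "[k0, k1, k2, k3, k4, k5]"]) (use k in \<open>simp add: gf Zero admissible_coefficients_def add.assoc\<close>)
  qed
  show ?thesis
  proof (rule is_basisI)
    fix ks assume ks: "length ks = length ?vs" "lincomb ks ?vs = 0"
    obtain k0 k1 k2 k3 k4 k5 where k: "general_field L \<epsilon> \<Omega> U k0 k1 k2 k3 k4 k5 = 0" "set ks \<subseteq> {k0, k1, k2, k3, k4, k5}"
      using lin[OF ks(1)] unfolding ks(2) by force
    then show "set ks \<subseteq> {0}" using z[OF k(1)] by simp
  next
    show "ess_algebra \<Omega> (equation L (case_elements L \<epsilon> U)) = {lincomb ks ?vs | ks. length ks = length ?vs}"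
      unfolding case_algebra[OF assms]
    proof (intro equalityI subsetI)
      fix Q assume "Q \<in> {general_field L \<epsilon> \<Omega> U k0 k1 k2 k3 k4 k5 | k0 k1 k2 k3 k4 k5. admissible_coefficients p k2 k3 k4 k5}"
      then obtain k0 k1 k2 k3 k4 k5 where Q: "Q = general_field L \<epsilon> \<Omega> U k0 k1 k2 k3 k4 k5" and k: "admissible_coefficients p k2 k3 k4 k5"
        by blast
      show "Q \<in> {lincomb ks ?vs | ks. length ks = length ?vs}" unfolding Q using lin'[OF k, of k0 k1] by force
    next
      fix Q assume "Q \<in> {lincomb ks ?vs | ks. length ks = length ?vs}"
      then obtain ks where Q: "Q = lincomb ks ?vs" and ks: "length ks = length ?vs" by blast
      show "Q \<in> {general_field L \<epsilon> \<Omega> U k0 k1 k2 k3 k4 k5 | k0 k1 k2 k3 k4 k5. admissible_coefficients p k2 k3 k4 k5}"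
        unfolding Q using lin[OF ks] by blast
    qed
  qed
qed

section \<open>The essential kernel algebra\<close>

lemma partials_zero_constant:
  fixes f :: fld
  assumes \<Omega>: "open \<Omega>" "connected \<Omega>" and f: "smooth_on \<Omega> f"
    and 0: "\<And>z. z \<in> \<Omega> \<Longrightarrow> Dt f z = 0" "\<And>z. z \<in> \<Omega> \<Longrightarrow> Dx f z = 0" and z: "z \<in> \<Omega>" "w \<in> \<Omega>"
  shows "f z = f w"
proof -
  have "(f has_derivative (\<lambda>h. 0)) (at z)" if "z \<in> \<Omega>" for z
  proof -
    have "(f has_derivative (\<lambda>(v, w). Dt f z * v + Dx f z * w)) (at z)"
      by (rule has_derivative_of_partials[OF \<Omega>(1) that partial_deriv[OF f] smooth_on_continuous[OF smooth_on_partials(2)[OF \<Omega>(1) f]]])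
    then show ?thesis using 0[OF that] by (simp add: case_prod_unfold)
  qed
  then show ?thesis
    using has_derivative_zero_unique_connected[OF \<Omega> _ z, of f] by blast
qed

text \<open>With \<tau> = \<xi> = 0 the determining equations reduce to a \<eta>_x = 0 and \<eta>_t
  = a \<eta>_xx + b \<eta>_x, so \<eta> is constant on the connected domain.\<close>

lemma trivial_symmetry_constant:
  assumes \<Omega>: "is_domain \<Omega>" and det: "determining \<Omega> (a, b, c) \<tau> \<xi> \<eta>" and a: "\<And>z. z \<in> \<Omega> \<Longrightarrow> a z \<noteq> 0"
    and \<tau>: "\<And>t. t \<in> fst ` \<Omega> \<Longrightarrow> \<tau> t = 0" and \<xi>: "\<And>z. z \<in> \<Omega> \<Longrightarrow> \<xi> z = 0"
  obtains k where "ess_field \<Omega> \<tau> \<xi> \<eta> = k *\<^sub>R u_du \<Omega>"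
proof -
  note o = is_domainD(1,3,8,9)[OF \<Omega>]
  have s: "smooth_on \<Omega> \<eta>" using det by simp
  have \<tau>': "deriv \<tau> (fst z) = 0" if "z \<in> \<Omega>" for z
    by (rule DERIV_imp_deriv, rule has_field_derivative_transform_within_open[OF DERIV_const o(2)])
      (use that \<tau> in auto)
  have \<xi>': "Dx \<xi> z = 0" "Dt \<xi> z = 0" if "z \<in> \<Omega>" for z
    using partials_cong[OF o(1) \<xi> that] by (simp_all add: partials_const)
  have \<xi>'': "Dx (Dx \<xi>) z = 0" if "z \<in> \<Omega>" for z
    using partials_cong(2)[OF o(1) \<xi>'(1) that] by (simp add: partials_const)
  have \<eta>x: "Dx \<eta> z = 0" if "z \<in> \<Omega>" for z
  proof -
    have "det1 a b \<tau> \<xi> \<eta> z = 0" using det that by simp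
    then show ?thesis
      using that \<tau>[of "fst z"] \<tau>'[OF that] \<xi>[OF that] \<xi>'[OF that] \<xi>''[OF that] a[OF that] by (simp add: det1_def)
  qed
  have "Dx (Dx \<eta>) z = 0" if "z \<in> \<Omega>" for z
    using partials_cong(2)[OF o(1) \<eta>x that] by (simp add: partials_const)
  then have \<eta>t: "Dt \<eta> z = 0" if "z \<in> \<Omega>" for z
  proof -
    have "det0 a b c \<tau> \<xi> \<eta> z = 0" using det that by simp
    then show ?thesis
      using that \<tau>[of "fst z"] \<tau>'[OF that] \<xi>[OF that] \<eta>x[OF that] \<open>\<And>z. z \<in> \<Omega> \<Longrightarrow> Dx (Dx \<eta>) z = 0\<close>[OF that]
      by (simp add: det0_def)
  qed
  obtain w where w: "w \<in> \<Omega>" using o(4) by blast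
  have c: "\<eta> z = \<eta> w" if "z \<in> \<Omega>" for z
    by (rule partials_zero_constant[OF o(1,3) s \<eta>t \<eta>x that w])
  have "ess_field \<Omega> \<tau> \<xi> \<eta> = \<eta> w *\<^sub>R u_du \<Omega>"
  proof
    fix q :: "real \<times> real \<times> real"
    obtain t x u where q: "q = (t, x, u)" by (rule prod_cases3)
    show "ess_field \<Omega> \<tau> \<xi> \<eta> q = (\<eta> w *\<^sub>R u_du \<Omega>) q"
      using \<tau>[of t] \<xi>[of "(t, x)"] c[of "(t, x)"] unfolding q
      by (force simp: ess_field_def u_du_def scaleR_fun_def zero_prod_def)
  qed
  then show ?thesis using that by blast
qed

lemma u_du_symmetry:
  assumes \<Omega>: "open \<Omega>"
  shows "k *\<^sub>R u_du \<Omega> \<in> ess_algebra \<Omega> E"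
proof -
  obtain a b c where E: "E = (a, b, c)" by (rule prod_cases3)
  have "k *\<^sub>R u_du \<Omega> = ess_field \<Omega> (\<lambda>_. 0) (\<lambda>_. 0) (\<lambda>_. k)"
    by (auto simp: fun_eq_iff ess_field_def u_du_def scaleR_fun_def zero_prod_def)
  moreover have "determining \<Omega> E (\<lambda>_. 0) (\<lambda>_. 0) (\<lambda>_. k)"
    by (simp add: E det2_def det1_def det0_def Dx_const partials_const smooth_on_const)
  ultimately show ?thesis unfolding ess_algebra_eq[OF \<Omega>] by blast
qed

lemma equation_constant_A:
  "equation L (\<lambda>_. \<epsilon>, B) = (\<lambda>_. \<epsilon>, B, \<lambda>z. if breve L = 1 then 0 else Dx B z)"
  by (cases L) (simp_all add: Dx_const)

lemma constant_A_member:
  assumes "\<epsilon> \<in> {-1, 1}" "smooth_on \<Omega> B"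
  shows "(\<lambda>_. \<epsilon>, B) \<in> members L \<epsilon> \<Omega>"
  using assms by (cases L) (auto intro: smooth_on_const)

text \<open>Equations with A = \<epsilon> and arbitrary B lie in all four classes. Subtracting the
  condition \<open>det1\<close> for B = 0 from the one for B leaves a relation without \<eta>; the
  test functions B = 1, t and x give in turn \<xi>_x = \<tau>_t, \<tau> = 0 and \<xi> = 0.\<close>

lemma ess_kernel_eq:
  assumes \<epsilon>: "\<epsilon> \<in> {-1, 1}" and \<Omega>: "is_domain \<Omega>"
  shows "ess_kernel L \<epsilon> \<Omega> = span {u_du \<Omega>}"
proof
  note o = is_domainD(1,3)[OF \<Omega>]
  show "span {u_du \<Omega>} \<subseteq> ess_kernel L \<epsilon> \<Omega>"
    unfolding span_singleton ess_kernel_def using u_du_symmetry[OF o(1)] by blast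
  show "ess_kernel L \<epsilon> \<Omega> \<subseteq> span {u_du \<Omega>}"
  proof
    fix Q assume Q: "Q \<in> ess_kernel L \<epsilon> \<Omega>"
    have mem: "Q \<in> ess_algebra \<Omega> (equation L (\<lambda>_. \<epsilon>, B))" if "smooth_on \<Omega> B" for B
      using Q constant_A_member[OF \<epsilon> that] unfolding ess_kernel_def by blast
    obtain \<tau> \<xi> \<eta> where Q': "Q = ess_field \<Omega> \<tau> \<xi> \<eta>"
      using mem[OF smooth_on_const[of \<Omega> 0]] unfolding ess_algebra_def by blast
    have det: "determining \<Omega> (\<lambda>_. \<epsilon>, B, \<lambda>z. if breve L = 1 then 0 else Dx B z) \<tau> \<xi> \<eta>" if "smooth_on \<Omega> B" for B
      using mem[OF that] unfolding ess_algebra_def equation_constant_A Q' using ess_field_in_lie_algebra[OF o(1)] by blast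
    have d: "B z * (Dx \<xi> z - deriv \<tau> (fst z)) = \<tau> (fst z) * Dt B z + \<xi> z * Dx B z"
      if B: "smooth_on \<Omega> B" and z: "z \<in> \<Omega>" for B z
    proof -
      have "det1 (\<lambda>_. \<epsilon>) B \<tau> \<xi> \<eta> z = 0" "det1 (\<lambda>_. \<epsilon>) (\<lambda>_. 0) \<tau> \<xi> \<eta> z = 0"
        using det[OF B] det[OF smooth_on_const[of \<Omega> 0]] z by auto
      then show ?thesis by (simp add: det1_def partials_const)
    qed
    have p: "Dt fst z = 1" "Dx fst z = 0" "Dt snd z = 0" "Dx snd z = 1" for z :: "real \<times> real"
      by (simp_all add: Dt_def Dx_def case_prod_unfold)
    have 1: "Dx \<xi> z - deriv \<tau> (fst z) = 0" if "z \<in> \<Omega>" for z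
      using d[OF smooth_on_const[of \<Omega> 1] that] by (simp add: partials_const)
    have 2: "\<tau> t = 0" if t: "t \<in> fst ` \<Omega>" for t
    proof -
      obtain z where z: "z \<in> \<Omega>" "t = fst z" using t by blast
      show ?thesis using d[OF smooth_on_fst_snd(1)[OF o(1)] z(1)] 1[OF z(1)] p z(2) by simp
    qed
    have 3: "\<xi> z = 0" if "z \<in> \<Omega>" for z
      using d[OF smooth_on_fst_snd(2)[OF o(1)] that] 1[OF that] p by simp
    obtain k where "ess_field \<Omega> \<tau> \<xi> \<eta> = k *\<^sub>R u_du \<Omega>"
      by (rule trivial_symmetry_constant[OF \<Omega> det[OF smooth_on_const[of \<Omega> 0]] _ 2 3]) (use \<epsilon> in auto)
    then have "Q = k *\<^sub>R u_du \<Omega>" using Q' by simp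
    then show "Q \<in> span {u_du \<Omega>}" unfolding span_singleton by blast
  qed
qed

section \<open>Equivalence of arbitrary elements\<close>

lemma in_arb_graph: "(t, x, u, a, b) \<in> arb_graph \<Omega> (A, B) \<longleftrightarrow> (t, x) \<in> \<Omega> \<and> a = A (t, x) \<and> b = B (t, x)"
  by auto

text \<open>The graph contains the whole u-line over each point, and an affine map of that line with
  nonzero slope is onto. Equality of the graphs thus becomes equality of the base domains and of the
  transformed values of A and B.\<close>

lemma arb_graph_image:
  fixes \<Phi> :: arb_trafo and k :: fld
  assumes \<Phi>: "\<And>t x u. (t, x) \<in> \<Omega> \<Longrightarrow> \<Phi> (t, x, u, A (t, x), B (t, x)) = (T t, X (t, x), k (t, x) * u + l, A1 (t, x), B1 (t, x))"
    and k: "\<And>z. z \<in> \<Omega> \<Longrightarrow> k z \<noteq> 0"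
  shows "\<Phi> ` arb_graph \<Omega> (A, B) = arb_graph \<Omega>' (A', B') \<longleftrightarrow>
    \<Omega>' = fibre_map T X ` \<Omega> \<and> (\<forall>z\<in>\<Omega>. A' (fibre_map T X z) = A1 z \<and> B' (fibre_map T X z) = B1 z)"
proof -
  have img: "\<Phi> ` arb_graph \<Omega> (A, B) = {(T t, X (t, x), u, A1 (t, x), B1 (t, x)) | t x u. (t, x) \<in> \<Omega>}"
  proof (intro equalityI subsetI)
    fix q assume "q \<in> \<Phi> ` arb_graph \<Omega> (A, B)"
    then obtain t x u where "q = \<Phi> (t, x, u, A (t, x), B (t, x))" and tx: "(t, x) \<in> \<Omega>" by auto
    then have "q = (T t, X (t, x), k (t, x) * u + l, A1 (t, x), B1 (t, x))" using \<Phi> by simp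
    then show "q \<in> {(T t, X (t, x), u, A1 (t, x), B1 (t, x)) | t x u. (t, x) \<in> \<Omega>}" using tx by blast
  next
    fix q :: "real \<times> real \<times> real \<times> real \<times> real" assume "q \<in> {(T t, X (t, x), u, A1 (t, x), B1 (t, x)) | t x u. (t, x) \<in> \<Omega>}"
    then obtain t x u where q: "q = (T t, X (t, x), u, A1 (t, x), B1 (t, x))" "(t, x) \<in> \<Omega>" by blast
    have "q = \<Phi> (t, x, (u - l) / k (t, x), A (t, x), B (t, x))"
      using q k[OF q(2)] by (simp add: \<Phi>)
    then show "q \<in> \<Phi> ` arb_graph \<Omega> (A, B)" using q(2) by (auto simp del: split_paired_All)
  qed
  show ?thesis
  proof
    assume eq: "\<Phi> ` arb_graph \<Omega> (A, B) = arb_graph \<Omega>' (A', B')"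
    have g: "(T t, X (t, x), 0, A1 (t, x), B1 (t, x)) \<in> arb_graph \<Omega>' (A', B')" if "(t, x) \<in> \<Omega>" for t x
      using that unfolding eq[symmetric] img by blast
    have "z' \<in> fibre_map T X ` \<Omega>" if "z' \<in> \<Omega>'" for z'
    proof -
      have "(fst z', snd z', 0, A' z', B' z') \<in> \<Phi> ` arb_graph \<Omega> (A, B)" unfolding eq using that by simp
      then obtain t x where "fst z' = T t" "snd z' = X (t, x)" and tx: "(t, x) \<in> \<Omega>" unfolding img by blast
      then have "z' = fibre_map T X (t, x)" by (simp add: prod_eq_iff)
      then show ?thesis using tx by blast
    qed
    moreover have "fibre_map T X z \<in> \<Omega>' \<and> A' (fibre_map T X z) = A1 z \<and> B' (fibre_map T X z) = B1 z" if "z \<in> \<Omega>" for z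
      using g[of "fst z" "snd z"] that by (simp add: case_prod_unfold)
    ultimately show "\<Omega>' = fibre_map T X ` \<Omega> \<and> (\<forall>z\<in>\<Omega>. A' (fibre_map T X z) = A1 z \<and> B' (fibre_map T X z) = B1 z)"
      by blast
  next
    assume *: "\<Omega>' = fibre_map T X ` \<Omega> \<and> (\<forall>z\<in>\<Omega>. A' (fibre_map T X z) = A1 z \<and> B' (fibre_map T X z) = B1 z)"
    show "\<Phi> ` arb_graph \<Omega> (A, B) = arb_graph \<Omega>' (A', B')"
      unfolding img
    proof (intro equalityI subsetI)
      fix q :: "real \<times> real \<times> real \<times> real \<times> real"
      assume "q \<in> {(T t, X (t, x), u, A1 (t, x), B1 (t, x)) | t x u. (t, x) \<in> \<Omega>}"
      then obtain t x u where q: "q = (T t, X (t, x), u, A1 (t, x), B1 (t, x))" and tx: "(t, x) \<in> \<Omega>" by blast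
      have "(T t, X (t, x)) \<in> \<Omega>'" using * tx by force
      moreover have "A' (T t, X (t, x)) = A1 (t, x)" "B' (T t, X (t, x)) = B1 (t, x)" using * tx by fastforce+
      ultimately show "q \<in> arb_graph \<Omega>' (A', B')" unfolding q in_arb_graph by simp
    next
      fix q :: "real \<times> real \<times> real \<times> real \<times> real"
      assume "q \<in> arb_graph \<Omega>' (A', B')"
      then obtain z u where q: "q = (fst z, snd z, u, A' z, B' z)" and z: "z \<in> \<Omega>'" by auto
      from * z have "z \<in> fibre_map T X ` \<Omega>" by simp
      then obtain t x where tx: "(t, x) \<in> \<Omega>" "z = fibre_map T X (t, x)" by (metis (no_types, lifting) imageE surj_pair)
      have "q = (T t, X (t, x), u, A1 (t, x), B1 (t, x))" unfolding q using * tx by fastforce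
      then show "q \<in> {(T t, X (t, x), u, A1 (t, x), B1 (t, x)) | t x u. (t, x) \<in> \<Omega>}" using tx(1) by blast
    qed
  qed
qed

lemma members_smooth:
  assumes "open \<Omega>" "(A, B) \<in> members L \<epsilon> \<Omega>"
  shows "smooth_on \<Omega> A" "smooth_on \<Omega> B"
proof -
  have "smooth_on \<Omega> A" if "\<forall>z\<in>\<Omega>. A z = \<epsilon>"
    by (rule smooth_on_cong[OF assms(1) _ smooth_on_const[of \<Omega> \<epsilon>]]) (use that in simp)
  then show "smooth_on \<Omega> A" using assms(2) by (cases L) auto
  show "smooth_on \<Omega> B" using assms(2) by (cases L) auto
qed

lemma members_nonzero:
  assumes "\<epsilon> \<in> {-1, 1}" "(A, B) \<in> members L \<epsilon> \<Omega>" "z \<in> \<Omega>"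
  shows "A z \<noteq> 0"
  using assms by (cases L) auto

text \<open>Constancy of A on both sides gives (X_x)^2 = T_t, which depends on t only; hence 2 X_x
  X_xx = 0, and integration in x yields the affine form.\<close>

lemma affine_arb_map:
  assumes \<epsilon>: "\<epsilon> \<in> {-1, 1}" and map: "arb_map b \<Omega> (A, B) \<Omega>' (A', B') T X"
    and A: "\<And>z. z \<in> \<Omega> \<Longrightarrow> A z = \<epsilon>" and A': "\<And>z. z \<in> \<Omega>' \<Longrightarrow> A' z = \<epsilon>"
  obtains X1 X0 where "smooth_on (fst ` \<Omega>) X1" "smooth_on (fst ` \<Omega>) X0"
    "\<And>t x. (t, x) \<in> \<Omega> \<Longrightarrow> X (t, x) = X1 t * x + X0 t" "\<And>t. t \<in> fst ` \<Omega> \<Longrightarrow> X1 t \<noteq> 0 \<and> deriv T t = (X1 t)\<^sup>2"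
proof -
  interpret fibre_diffeo \<Omega> T X using map by simp
  note sx = smooth_on_partials(2)[OF opens(1) X]
  have X2: "deriv T (fst z) = (Dx X z)\<^sup>2" if z: "z \<in> \<Omega>" for z
  proof -
    have "fibre_map T X z \<in> \<Omega>'" using map z by auto
    then have "\<epsilon> * deriv T (fst z) = (Dx X z)\<^sup>2 * \<epsilon>" using map z A[OF z] A' by auto
    then show ?thesis using \<epsilon> by auto
  qed
  have "Dx (Dx X) z = 0" if z: "z \<in> \<Omega>" for z
  proof -
    have "Dx (\<lambda>z. (Dx X z)\<^sup>2) z = 2 * Dx X z * Dx (Dx X) z"
      by (rule partials_imp_eq(2)) (auto intro!: derivative_eq_intros partial_deriv'(2)[OF sx z])
    moreover have "Dx (\<lambda>z. (Dx X z)\<^sup>2) z = 0"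
      by (rule partials_eqI(2)[OF opens(1) X2[symmetric] z]) (auto intro!: derivative_eq_intros)
    ultimately show ?thesis using X_ne[OF z] by simp
  qed
  from x_independent[OF dom sx this] obtain X1 where X1: "smooth_on (fst ` \<Omega>) X1"
    "\<And>t x. (t, x) \<in> \<Omega> \<Longrightarrow> Dx X (t, x) = X1 t" by blast
  have X1': "Dx X z = X1 (fst z)" if "z \<in> \<Omega>" for z using X1(2)[of "fst z" "snd z"] that by simp
  have s0: "smooth_on \<Omega> (\<lambda>z. X z - X1 (fst z) * snd z)"
    by (intro smooth_intros smooth_on_fst_snd smooth_on_of_time opens X X1)
  have "Dx (\<lambda>z. X z - X1 (fst z) * snd z) z = 0" if z: "z \<in> \<Omega>" for z
    by (rule partials_imp_eq(2)) (auto intro!: derivative_eq_intros partial_deriv'(2)[OF X z] simp: X1'[OF z])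
  from x_independent[OF dom s0 this] obtain X0 where X0: "smooth_on (fst ` \<Omega>) X0"
    "\<And>t x. (t, x) \<in> \<Omega> \<Longrightarrow> X (t, x) - X1 t * x = X0 t" by auto
  show ?thesis
  proof (rule that[OF X1(1) X0(1)])
    show "X (t, x) = X1 t * x + X0 t" if "(t, x) \<in> \<Omega>" for t x using X0(2)[OF that] by simp
    fix t assume "t \<in> fst ` \<Omega>"
    then obtain z where z: "z \<in> \<Omega>" "t = fst z" by blast
    show "X1 t \<noteq> 0 \<and> deriv T t = (X1 t)\<^sup>2" using X_ne[OF z(1)] X2[OF z(1)] X1'[OF z(1)] z(2) by simp
  qed
qed

lemma affine_partials:
  assumes \<Omega>: "open \<Omega>" and s: "smooth_on (fst ` \<Omega>) X1" "smooth_on (fst ` \<Omega>) X0"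
    and X: "\<forall>t x. (t, x) \<in> \<Omega> \<longrightarrow> X (t, x) = X1 t * x + X0 t" and z: "(t, x) \<in> \<Omega>"
  shows "Dx X (t, x) = X1 t" "Dt X (t, x) = deriv X1 t * x + deriv X0 t" "Dx (Dx X) (t, x) = 0"
proof -
  have o: "open (fst ` \<Omega>)" by (rule open_image_fst[OF \<Omega>])
  have X': "X z = X1 (fst z) * snd z + X0 (fst z)" if "z \<in> \<Omega>" for z using X[rule_format, of "fst z" "snd z"] that by simp
  have x: "Dx X z = X1 (fst z)" if "z \<in> \<Omega>" for z
    by (rule partials_eqI(2)[OF \<Omega> X' that]) (auto intro!: derivative_eq_intros)
  show "Dx X (t, x) = X1 t" using x[OF z] by simp
  have "t \<in> fst ` \<Omega>" using z by force
  note d = smooth_on_deriv(1)[OF o s(1) this] smooth_on_deriv(1)[OF o s(2) this]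
  show "Dt X (t, x) = deriv X1 t * x + deriv X0 t"
    by (rule partials_eqI(1)[OF \<Omega> X' z]) (use d in \<open>auto intro!: derivative_eq_intros\<close>)
  show "Dx (Dx X) (t, x) = 0"
    by (rule partials_eqI(2)[OF \<Omega> x z]) (auto intro!: derivative_eq_intros)
qed

text \<open>The constants of the u-component are taken as c1 = 1 and c2 = 0. In the narrower classes
  the affine form of X has to be recovered before an element of the group can be written
  down.\<close>

lemma arb_map_imp_equiv:
  assumes \<epsilon>: "\<epsilon> \<in> {-1, 1}" and mem: "(A, B) \<in> members L \<epsilon> \<Omega>" "(A', B') \<in> members L \<epsilon> \<Omega>'"
    and map: "arb_map (breve L) \<Omega> (A, B) \<Omega>' (A', B') T X"
  shows "arb_equiv L \<Omega> (A, B) \<Omega>' (A', B')"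
proof -
  interpret fibre_diffeo \<Omega> T X using map by simp
  have ne: "Dx X (t, x) \<noteq> 0" "deriv T t \<noteq> 0" if "(t, x) \<in> \<Omega>" for t x using X_ne[OF that] T_ne[of t] that by force+
  define A1 where "A1 z = (Dx X z)\<^sup>2 / deriv T (fst z) * A z" for z
  define B1 where "B1 z = (Dx X z * B z - Dt X z + breve L * Dx (Dx X) z * A z) / deriv T (fst z)" for z
  have 1: "\<Omega>' = fibre_map T X ` \<Omega> \<and> (\<forall>z\<in>\<Omega>. A' (fibre_map T X z) = A1 z \<and> B' (fibre_map T X z) = B1 z)"
  proof (intro conjI ballI)
    fix z assume z: "z \<in> \<Omega>"
    have n: "deriv T (fst z) \<noteq> 0" using ne(2)[of "fst z" "snd z"] z by simp
    show "A' (fibre_map T X z) = A1 z" "B' (fibre_map T X z) = B1 z"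
      using map z n unfolding arb_map.simps A1_def B1_def by (simp_all add: eq_divide_eq)
  qed (use map in auto)
  define k where "k z = (if breve L = 1 then 1 else 1 / Dx X z)" for z
  have k: "k z \<noteq> 0" if "z \<in> \<Omega>" for z using X_ne[OF that] by (simp add: k_def)
  have wide: ?thesis if L: "L = Kbar \<or> L = Fbar"
  proof -
    let ?\<Phi> = "\<lambda>(t, x, u, a, b). (T t, X (t, x), k (t, x) * u + 0, (Dx X (t, x))\<^sup>2 / deriv T t * a,
      Dx X (t, x) / deriv T t * b - (Dt X (t, x) - breve L * Dx (Dx X) (t, x) * a) / deriv T t)"
    have "?\<Phi> ` arb_graph \<Omega> (A, B) = arb_graph \<Omega>' (A', B')"
      by (subst arb_graph_image[where T = T and X = X and k = k and l = 0 and ?A1.0 = A1 and ?B1.0 = B1])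
        (use 1 k ne in \<open>auto simp: A1_def B1_def field_simps\<close>)
    moreover have "?\<Phi> \<in> equiv_group L \<Omega>"
      using L
    proof
      assume L: "L = Kbar"
      show ?thesis unfolding L equiv_group.simps mem_Collect_eq
        by (rule exI[of _ T], rule exI[of _ X], rule exI[of _ 1], rule exI[of _ 0]) (use T X ne in \<open>simp add: k_def L\<close>)
    next
      assume L: "L = Fbar"
      show ?thesis unfolding L equiv_group.simps mem_Collect_eq
        by (rule exI[of _ T], rule exI[of _ X], rule exI[of _ 1]) (use T X ne in \<open>simp add: k_def L\<close>)
    qed
    ultimately show ?thesis unfolding arb_equiv_def by blast
  qed
  have narrow: ?thesis if L: "L = Keps \<or> L = Feps"
  proof -
    have A: "\<And>z. z \<in> \<Omega> \<Longrightarrow> A z = \<epsilon>" "\<And>z. z \<in> \<Omega>' \<Longrightarrow> A' z = \<epsilon>" using mem L by auto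
    obtain X1 X0 where s: "smooth_on (fst ` \<Omega>) X1" "smooth_on (fst ` \<Omega>) X0"
      and X': "\<And>t x. (t, x) \<in> \<Omega> \<Longrightarrow> X (t, x) = X1 t * x + X0 t" and t: "\<And>t. t \<in> fst ` \<Omega> \<Longrightarrow> X1 t \<noteq> 0 \<and> deriv T t = (X1 t)\<^sup>2"
      using affine_arb_map[OF \<epsilon> map A] by blast
    have "\<forall>t x. (t, x) \<in> \<Omega> \<longrightarrow> X (t, x) = X1 t * x + X0 t" using X' by blast
    note p = affine_partials[OF opens(1) s this]
    have t': "X1 t \<noteq> 0 \<and> deriv T t = (X1 t)\<^sup>2" if "(t, x) \<in> \<Omega>" for t x using t[of t] that by force
    let ?\<Phi> = "\<lambda>(t, x, u, a, b). (T t, X1 t * x + X0 t, (if breve L = 1 then 1 else 1 / X1 t) * u + 0, a :: real,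
      1 / X1 t * b - (deriv X1 t * x + deriv X0 t) / (X1 t)\<^sup>2)"
    have "?\<Phi> ` arb_graph \<Omega> (A, B) = arb_graph \<Omega>' (A', B')"
    proof (subst arb_graph_image[where T = T and X = X and k = k and l = 0 and ?A1.0 = A1 and ?B1.0 = B1])
      fix t x u assume tx: "(t, x) \<in> \<Omega>"
      show "?\<Phi> (t, x, u, A (t, x), B (t, x)) = (T t, X (t, x), k (t, x) * u + 0, A1 (t, x), B1 (t, x))"
        using t'[OF tx] p[OF tx] X'[OF tx] by (simp add: k_def A1_def B1_def field_simps power2_eq_square)
    qed (use 1 k in auto)
    moreover have "?\<Phi> \<in> equiv_group L \<Omega>"
      using L
    proof
      assume L: "L = Keps"
      show ?thesis unfolding L equiv_group.simps mem_Collect_eq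
        by (rule exI[of _ T], rule exI[of _ X1], rule exI[of _ X0], rule exI[of _ 1], rule exI[of _ 0])
          (use T s t' in \<open>simp add: L\<close>)
    next
      assume L: "L = Feps"
      show ?thesis unfolding L equiv_group.simps mem_Collect_eq
        by (rule exI[of _ T], rule exI[of _ X1], rule exI[of _ X0], rule exI[of _ 1]) (use T s t' in \<open>simp add: L\<close>)
    qed
    ultimately show ?thesis unfolding arb_equiv_def by blast
  qed
  show ?thesis using wide narrow by (cases L) auto
qed

text \<open>In the narrower classes X_xx = 0 and (X_x)^2 = T_t, so their transformation laws are
  instances of the wider ones.\<close>

lemma arb_equiv_imp_map:
  assumes \<epsilon>: "\<epsilon> \<in> {-1, 1}" and \<Omega>: "is_domain \<Omega>" and mem: "(A, B) \<in> members L \<epsilon> \<Omega>" "(A', B') \<in> members L \<epsilon> \<Omega>'"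
    and eq: "arb_equiv L \<Omega> (A, B) \<Omega>' (A', B')"
  obtains T X where "arb_map (breve L) \<Omega> (A, B) \<Omega>' (A', B') T X"
proof -
  note o = is_domainD(1,3)[OF \<Omega>]
  obtain \<Phi> where \<Phi>: "\<Phi> \<in> equiv_group L \<Omega>" "\<Phi> ` arb_graph \<Omega> (A, B) = arb_graph \<Omega>' (A', B')"
    using eq unfolding arb_equiv_def by blast
  have build: "arb_map (breve L) \<Omega> (A, B) \<Omega>' (A', B') T X"
    if sm: "smooth_on (fst ` \<Omega>) T" "smooth_on \<Omega> X"
      and ne: "\<And>t x. (t, x) \<in> \<Omega> \<Longrightarrow> deriv T t \<noteq> 0 \<and> Dx X (t, x) \<noteq> 0"
      and k: "\<And>z. z \<in> \<Omega> \<Longrightarrow> k z \<noteq> 0"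
      and f: "\<And>t x u. (t, x) \<in> \<Omega> \<Longrightarrow> \<Phi> (t, x, u, A (t, x), B (t, x)) = (T t, X (t, x), k (t, x) * u + l,
        (Dx X (t, x))\<^sup>2 / deriv T t * A (t, x),
        (Dx X (t, x) * B (t, x) - Dt X (t, x) + breve L * Dx (Dx X) (t, x) * A (t, x)) / deriv T t)" for T X k l
  proof -
    let ?A1 = "\<lambda>z. (Dx X z)\<^sup>2 / deriv T (fst z) * A z"
    let ?B1 = "\<lambda>z. (Dx X z * B z - Dt X z + breve L * Dx (Dx X) z * A z) / deriv T (fst z)"
    have f': "\<Phi> (t, x, u, A (t, x), B (t, x)) = (T t, X (t, x), k (t, x) * u + l, ?A1 (t, x), ?B1 (t, x))"
      if "(t, x) \<in> \<Omega>" for t x u using f[OF that] by simp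
    have 1: "\<Omega>' = fibre_map T X ` \<Omega>" "\<And>z. z \<in> \<Omega> \<Longrightarrow> A' (fibre_map T X z) = ?A1 z \<and> B' (fibre_map T X z) = ?B1 z"
    proof -
      have "\<Phi> ` arb_graph \<Omega> (A, B) = arb_graph \<Omega>' (A', B') \<longleftrightarrow>
          \<Omega>' = fibre_map T X ` \<Omega> \<and> (\<forall>z\<in>\<Omega>. A' (fibre_map T X z) = ?A1 z \<and> B' (fibre_map T X z) = ?B1 z)"
        by (rule arb_graph_image[where k = k and l = l]) (use f' k in blast)+
      then show "\<Omega>' = fibre_map T X ` \<Omega>" "\<And>z. z \<in> \<Omega> \<Longrightarrow> A' (fibre_map T X z) = ?A1 z \<and> B' (fibre_map T X z) = ?B1 z"
        using \<Phi>(2) by blast+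
    qed
    have d: "deriv T (fst z) \<noteq> 0" "Dx X z \<noteq> 0" if "z \<in> \<Omega>" for z using ne[of "fst z" "snd z"] that by simp_all
    have "fibre_diffeo \<Omega> T X" by unfold_locales (use \<Omega> sm d in auto)
    then show ?thesis using 1 d by (auto simp: eq_divide_eq)
  qed
  show ?thesis
  proof (cases L)
    case Kbar
    then obtain T X c\<^sub>1 c\<^sub>2 where 1: "smooth_on (fst ` \<Omega>) T" "smooth_on \<Omega> X" "c\<^sub>1 \<noteq> 0"
      and 2: "\<And>t x. (t, x) \<in> \<Omega> \<Longrightarrow> deriv T t \<noteq> 0 \<and> Dx X (t, x) \<noteq> 0 \<and>
         (\<forall>u a b. \<Phi> (t, x, u, a, b) = (T t, X (t, x), c\<^sub>1 * u + c\<^sub>2, (Dx X (t, x))\<^sup>2 / deriv T t * a,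
            Dx X (t, x) / deriv T t * b - (Dt X (t, x) - Dx (Dx X) (t, x) * a) / deriv T t))"
      using \<Phi>(1) by auto
    show ?thesis
      by (rule that, rule build[OF 1(1,2), where k = "\<lambda>_. c\<^sub>1" and l = c\<^sub>2]) (use 1(3) 2 Kbar in \<open>auto simp: field_simps\<close>)
  next
    case Fbar
    then obtain T X c\<^sub>1 where 1: "smooth_on (fst ` \<Omega>) T" "smooth_on \<Omega> X" "c\<^sub>1 \<noteq> 0"
      and 2: "\<And>t x. (t, x) \<in> \<Omega> \<Longrightarrow> deriv T t \<noteq> 0 \<and> Dx X (t, x) \<noteq> 0 \<and>
         (\<forall>u a b. \<Phi> (t, x, u, a, b) = (T t, X (t, x), c\<^sub>1 / Dx X (t, x) * u, (Dx X (t, x))\<^sup>2 / deriv T t * a,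
            Dx X (t, x) / deriv T t * b - (Dt X (t, x) + Dx (Dx X) (t, x) * a) / deriv T t))"
      using \<Phi>(1) by auto
    show ?thesis
      by (rule that, rule build[OF 1(1,2), where k = "\<lambda>z. c\<^sub>1 / Dx X z" and l = 0]) (use 1(3) 2 Fbar in \<open>auto simp: field_simps\<close>)
  next
    case Keps
    then obtain T X1 X0 c\<^sub>1 c\<^sub>2 where 1: "smooth_on (fst ` \<Omega>) T" "smooth_on (fst ` \<Omega>) X1" "smooth_on (fst ` \<Omega>) X0" "c\<^sub>1 \<noteq> 0"
      and 2: "\<And>t x. (t, x) \<in> \<Omega> \<Longrightarrow> X1 t \<noteq> 0 \<and> deriv T t = (X1 t)\<^sup>2 \<and>
         (\<forall>u a b. \<Phi> (t, x, u, a, b) = (T t, X1 t * x + X0 t, c\<^sub>1 * u + c\<^sub>2, a,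
            1 / X1 t * b - (deriv X1 t * x + deriv X0 t) / (X1 t)\<^sup>2))"
      using \<Phi>(1) by auto
    define X where "X z = X1 (fst z) * snd z + X0 (fst z)" for z
    have sX: "smooth_on \<Omega> X" unfolding X_def by (intro smooth_intros smooth_on_fst_snd smooth_on_of_time o 1)
    have X': "X (t, x) = X1 t * x + X0 t" for t x by (simp add: X_def)
    have "\<forall>t x. (t, x) \<in> \<Omega> \<longrightarrow> X (t, x) = X1 t * x + X0 t" using X' by blast
    note p = affine_partials[OF o(1) 1(2,3) this]
    show ?thesis
      by (rule that, rule build[OF 1(1) sX, where k = "\<lambda>_. c\<^sub>1" and l = c\<^sub>2])
        (use 1(4) 2 Keps p X' in \<open>auto simp: field_simps power2_eq_square\<close>)
  next
    case Feps
    then obtain T X1 X0 c\<^sub>1 where 1: "smooth_on (fst ` \<Omega>) T" "smooth_on (fst ` \<Omega>) X1" "smooth_on (fst ` \<Omega>) X0" "c\<^sub>1 \<noteq> 0"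
      and 2: "\<And>t x. (t, x) \<in> \<Omega> \<Longrightarrow> X1 t \<noteq> 0 \<and> deriv T t = (X1 t)\<^sup>2 \<and>
         (\<forall>u a b. \<Phi> (t, x, u, a, b) = (T t, X1 t * x + X0 t, c\<^sub>1 / X1 t * u, a,
            1 / X1 t * b - (deriv X1 t * x + deriv X0 t) / (X1 t)\<^sup>2))"
      using \<Phi>(1) by auto
    define X where "X z = X1 (fst z) * snd z + X0 (fst z)" for z
    have sX: "smooth_on \<Omega> X" unfolding X_def by (intro smooth_intros smooth_on_fst_snd smooth_on_of_time o 1)
    have X': "X (t, x) = X1 t * x + X0 t" for t x by (simp add: X_def)
    have "\<forall>t x. (t, x) \<in> \<Omega> \<longrightarrow> X (t, x) = X1 t * x + X0 t" using X' by blast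
    note p = affine_partials[OF o(1) 1(2,3) this]
    have ne: "X1 (fst z) \<noteq> 0" if "z \<in> \<Omega>" for z using 2[of "fst z" "snd z"] that by simp
    show ?thesis
      by (rule that, rule build[OF 1(1) sX, where k = "\<lambda>z. c\<^sub>1 / X1 (fst z)" and l = 0])
        (use 1(4) 2 Feps p X' ne in \<open>auto simp: field_simps power2_eq_square\<close>)
  qed
qed

section \<open>Restriction and composition of equivalence maps\<close>

lemma is_domain_preimage:
  assumes "fibre_diffeo \<Omega> T X" and \<Omega>1: "is_domain \<Omega>1" "\<Omega>1 \<subseteq> fibre_map T X ` \<Omega>"
  shows "is_domain {z \<in> \<Omega>. fibre_map T X z \<in> \<Omega>1}" (is "is_domain ?P")
    and "fibre_map T X ` {z \<in> \<Omega>. fibre_map T X z \<in> \<Omega>1} = \<Omega>1"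
proof -
  interpret fibre_diffeo \<Omega> T X by fact
  have P: "?P = \<Omega> \<inter> fibre_map T X -` \<Omega>1" by auto
  have PG: "?P = G ` \<Omega>1"
  proof (intro equalityI subsetI)
    fix z assume "z \<in> ?P"
    then show "z \<in> G ` \<Omega>1" using GF[of z] by (metis (no_types, lifting) imageI mem_Collect_eq)
  next
    fix z assume "z \<in> G ` \<Omega>1"
    then obtain y where "y \<in> \<Omega>1" "z = G y" by blast
    moreover from this have "fibre_map T X (G y) = y" "G y \<in> \<Omega>" using FG[of y] \<Omega>1(2) by blast+
    ultimately show "z \<in> ?P" by simp
  qed
  have cG: "continuous_on \<Omega>1 G" using continuous_on_subset[OF smooth_on_continuous[OF G_smooth] \<Omega>1(2)] .
  have "open ?P"
    unfolding P by (rule continuous_open_preimage[OF smooth_on_continuous[OF F_smooth] opens(1) is_domainD(1)[OF \<Omega>1(1)]])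
  moreover have "connected ?P"
    unfolding PG by (rule connected_continuous_image[OF cG is_domainD(8)[OF \<Omega>1(1)]])
  moreover have "?P \<noteq> {}" unfolding PG using is_domainD(9)[OF \<Omega>1(1)] by simp
  moreover have "connected {x. (t, x) \<in> ?P}" for t
  proof (cases "t \<in> fst ` \<Omega>")
    case True
    have e: "{x. (t, x) \<in> ?P} = (\<lambda>y. snd (G (T t, y))) ` {y. (T t, y) \<in> \<Omega>1}"
    proof (intro equalityI subsetI)
      fix x assume "x \<in> {x. (t, x) \<in> ?P}"
      then have x: "(t, x) \<in> \<Omega>" "(T t, X (t, x)) \<in> \<Omega>1" by auto
      have "snd (G (T t, X (t, x))) = x" using GF[OF x(1)] by simp
      then show "x \<in> (\<lambda>y. snd (G (T t, y))) ` {y. (T t, y) \<in> \<Omega>1}" using x(2) by force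
    next
      fix x assume "x \<in> (\<lambda>y. snd (G (T t, y))) ` {y. (T t, y) \<in> \<Omega>1}"
      then obtain y where y: "(T t, y) \<in> \<Omega>1" "x = snd (G (T t, y))" by blast
      have im: "(T t, y) \<in> fibre_map T X ` \<Omega>" using y(1) \<Omega>1(2) by blast
      have "fst (G (T t, y)) = t" using G_time[OF im] time_inverse(2)[OF True] by simp
      then have "G (T t, y) = (t, x)" using y(2) by (simp add: prod_eq_iff)
      then show "x \<in> {x. (t, x) \<in> ?P}" using FG[OF im] y(1) by auto
    qed
    have "continuous_on {y. (T t, y) \<in> \<Omega>1} (\<lambda>y. snd (G (T t, y)))"
      by (intro continuous_on_snd continuous_on_compose2[OF cG]) (auto intro!: continuous_intros)
    then show ?thesis
      unfolding e by (rule connected_continuous_image[OF _ is_domainD(2)[OF \<Omega>1(1)]])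
  next
    case False
    then have "{x. (t, x) \<in> ?P} = {}" by force
    then show ?thesis by (simp only: connected_empty)
  qed
  ultimately show "is_domain ?P" by (simp add: is_domain_def)
  show "fibre_map T X ` ?P = \<Omega>1" using \<Omega>1(2) by auto
qed

lemma fibre_diffeo_subset:
  assumes "fibre_diffeo \<Omega> T X" "is_domain \<Omega>1" "\<Omega>1 \<subseteq> \<Omega>"
  shows "fibre_diffeo \<Omega>1 T X"
proof -
  interpret fibre_diffeo \<Omega> T X by fact
  show ?thesis
  proof
    show "is_domain \<Omega>1" by fact
    show "smooth_on (fst ` \<Omega>1) T" using smooth_on_subset[OF T] assms(3) by blast
    show "smooth_on \<Omega>1 X" using smooth_on_subset[OF X] assms(3) by blast
  qed (use assms(3) T_ne X_ne in auto)
qed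

lemma arb_map_subset:
  assumes "arb_map b \<Omega> AB \<Omega>' AB' T X" "is_domain \<Omega>1" "\<Omega>1 \<subseteq> \<Omega>"
  shows "arb_map b \<Omega>1 AB (fibre_map T X ` \<Omega>1) AB' T X"
  using assms fibre_diffeo_subset[of \<Omega> T X \<Omega>1] by (cases AB; cases AB') auto

text \<open>Transitivity of equivalence, obtained for maps of (t, x) instead of transformations in
  five variables; the laws for A and B compose by the chain rules of first and second order.\<close>

lemma arb_map_compose:
  assumes m1: "arb_map b \<Omega> AB \<Omega>' AB' T X" and m2: "arb_map b \<Omega>' AB' \<Omega>'' AB'' S Y"
  shows "arb_map b \<Omega> AB \<Omega>'' AB'' (\<lambda>t. S (T t)) (\<lambda>z. Y (fibre_map T X z))"
proof -
  obtain A B A' B' A'' B'' where AB: "AB = (A, B)" "AB' = (A', B')" "AB'' = (A'', B'')" by (metis surj_pair)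
  interpret F: fibre_diffeo \<Omega> T X using m1 AB by simp
  have \<Omega>': "\<Omega>' = fibre_map T X ` \<Omega>" using m1 AB by simp
  interpret G: fibre_diffeo \<Omega>' S Y using m2 AB by simp
  have st: "fst ` \<Omega>' = T ` fst ` \<Omega>" unfolding \<Omega>' by (rule F.time_image)
  have sT: "smooth_on (fst ` \<Omega>) (\<lambda>t. S (T t))"
    by (rule smooth_on_compose[OF G.T F.opens(2) G.opens(2) _ F.T]) (simp add: st)
  note Y = G.X[unfolded \<Omega>']
  have dT: "deriv (\<lambda>t. S (T t)) t = deriv S (T t) * deriv T t" if "t \<in> fst ` \<Omega>" for t
  proof (rule DERIV_imp_deriv, rule DERIV_chain2[OF G.T_deriv F.T_deriv[OF that]])
    show "T t \<in> fst ` \<Omega>'" using that st by blast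
  qed
  have comp: "fibre_map (\<lambda>t. S (T t)) (\<lambda>z. Y (fibre_map T X z)) z = fibre_map S Y (fibre_map T X z)" for z
    by (simp add: case_prod_unfold)
  have in': "fibre_map T X z \<in> \<Omega>'" if "z \<in> \<Omega>" for z using that \<Omega>' by blast
  have "fibre_diffeo \<Omega> (\<lambda>t. S (T t)) (\<lambda>z. Y (fibre_map T X z))"
  proof
    show "deriv (\<lambda>t. S (T t)) t \<noteq> 0" if t: "t \<in> fst ` \<Omega>" for t
      using dT[OF t] F.T_ne[OF t] G.T_ne[of "T t"] t st by auto
    show "Dx (\<lambda>z. Y (fibre_map T X z)) z \<noteq> 0" if z: "z \<in> \<Omega>" for z
      using F.pull_partials(2)[OF Y z] F.X_ne[OF z] G.X_ne[OF in'[OF z]] by simp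
  qed (use F.dom sT F.pull_smooth'[OF Y] in auto)
  moreover have "\<Omega>'' = fibre_map (\<lambda>t. S (T t)) (\<lambda>z. Y (fibre_map T X z)) ` \<Omega>"
  proof -
    have f: "fibre_map (\<lambda>t. S (T t)) (\<lambda>z. Y (fibre_map T X z)) = (\<lambda>z. fibre_map S Y (fibre_map T X z))"
      by (rule ext) (rule comp)
    have "\<Omega>'' = fibre_map S Y ` \<Omega>'" using m2 AB by simp
    then show ?thesis unfolding f \<Omega>' by (simp only: image_image)
  qed
  moreover have "A'' (fibre_map (\<lambda>t. S (T t)) (\<lambda>z. Y (fibre_map T X z)) z) * deriv (\<lambda>t. S (T t)) (fst z)
        = (Dx (\<lambda>z. Y (fibre_map T X z)) z)\<^sup>2 * A z \<and>
      B'' (fibre_map (\<lambda>t. S (T t)) (\<lambda>z. Y (fibre_map T X z)) z) * deriv (\<lambda>t. S (T t)) (fst z)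
        = Dx (\<lambda>z. Y (fibre_map T X z)) z * B z - Dt (\<lambda>z. Y (fibre_map T X z)) z
          + b * Dx (Dx (\<lambda>z. Y (fibre_map T X z))) z * A z" if z: "z \<in> \<Omega>" for z
  proof -
    have t: "fst z \<in> fst ` \<Omega>" using z by simp
    have f: "fst (fibre_map T X z) = T (fst z)" by (simp add: case_prod_unfold)
    have 1: "A' (fibre_map T X z) * deriv T (fst z) = (Dx X z)\<^sup>2 * A z"
      "B' (fibre_map T X z) * deriv T (fst z) = Dx X z * B z - Dt X z + b * Dx (Dx X) z * A z"
      using m1 AB z by auto
    have 2: "A'' (fibre_map S Y (fibre_map T X z)) * deriv S (T (fst z)) = (Dx Y (fibre_map T X z))\<^sup>2 * A' (fibre_map T X z)"
      "B'' (fibre_map S Y (fibre_map T X z)) * deriv S (T (fst z)) = Dx Y (fibre_map T X z) * B' (fibre_map T X z)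
        - Dt Y (fibre_map T X z) + b * Dx (Dx Y) (fibre_map T X z) * A' (fibre_map T X z)"
      using m2 AB in'[OF z] f by auto
    show ?thesis
      unfolding comp dT[OF t] F.pull_partials[OF Y z] F.pull_partials_xx[OF Y z]
    proof
      show "A'' (fibre_map S Y (fibre_map T X z)) * (deriv S (T (fst z)) * deriv T (fst z))
          = (Dx Y (fibre_map T X z) * Dx X z)\<^sup>2 * A z"
        using 1(1) 2(1) by algebra
      show "B'' (fibre_map S Y (fibre_map T X z)) * (deriv S (T (fst z)) * deriv T (fst z))
          = Dx Y (fibre_map T X z) * Dx X z * B z
          - (Dt Y (fibre_map T X z) * deriv T (fst z) + Dx Y (fibre_map T X z) * Dt X z)
          + b * (Dx (Dx Y) (fibre_map T X z) * (Dx X z)\<^sup>2 + Dx Y (fibre_map T X z) * Dx (Dx X) z) * A z"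
        using 1 2(2) by algebra
    qed
  qed
  ultimately show ?thesis unfolding AB arb_map.simps by blast
qed

section \<open>Affine transformations of heat equations with potentials\<close>

text \<open>The transformations that keep the form of a heat equation with potential. The potential
  itself may change, so symmetries are the instances with the same potential on both sides.\<close>

locale heat_map =
  fixes \<Omega> :: dom and T X1 X0 V :: "real \<Rightarrow> real" and e :: real
  assumes \<Omega>: "is_domain \<Omega>" and smooth: "smooth_on (fst ` \<Omega>) T" "smooth_on (fst ` \<Omega>) X1"
      "smooth_on (fst ` \<Omega>) X0" "smooth_on (fst ` \<Omega>) V"
    and T_deriv_eq: "\<And>t. t \<in> fst ` \<Omega> \<Longrightarrow> deriv T t = (X1 t)\<^sup>2"
    and nonzero: "\<And>t. t \<in> fst ` \<Omega> \<Longrightarrow> X1 t \<noteq> 0" "\<And>t. t \<in> fst ` \<Omega> \<Longrightarrow> V t \<noteq> 0"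
    and e: "e \<in> {-1, 1}"
begin

definition X :: fld
  where "X z = X1 (fst z) * snd z + X0 (fst z)"

text \<open>The multiplier is forced: a moving frame produces a first-order term proportional to
  X_t, which cancels when M_x / M = -(e / 2) X_t / X_x. The factor V(t) remains free.\<close>

definition M :: fld
  where "M z = V (fst z) * exp (- (e * deriv X1 (fst z) / (4 * X1 (fst z))) * (snd z)\<^sup>2
    - e * deriv X0 (fst z) / (2 * X1 (fst z)) * snd z)"

definition p :: "real \<Rightarrow> real" where "p t = deriv X1 t / X1 t"
definition r :: "real \<Rightarrow> real" where "r t = deriv X0 t / X1 t"

text \<open>The transformation maps the potential \<open>c\<close> to \<open>(c + Q) / T\<^sub>t\<close>.\<close>
definition Q :: fld
  where "Q z = e / 4 * ((p (fst z))\<^sup>2 - deriv p (fst z)) * (snd z)\<^sup>2 + e / 2 * (p (fst z) * r (fst z) - deriv r (fst z)) * snd z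
    + (deriv V (fst z) / V (fst z) + p (fst z) / 2 + e / 4 * (r (fst z))\<^sup>2)"

lemma o: "open \<Omega>" "open (fst ` \<Omega>)"
  using is_domainD[OF \<Omega>] by auto

lemma X_partials:
  assumes "z \<in> \<Omega>"
  shows "Dx X z = X1 (fst z)" "Dt X z = deriv X1 (fst z) * snd z + deriv X0 (fst z)" "Dx (Dx X) z = 0"
proof -
  have "\<forall>t x. (t, x) \<in> \<Omega> \<longrightarrow> X (t, x) = X1 t * x + X0 t" by (simp add: X_def)
  from affine_partials[OF o(1) smooth(2,3) this, of "fst z" "snd z"] assms
  show "Dx X z = X1 (fst z)" "Dt X z = deriv X1 (fst z) * snd z + deriv X0 (fst z)" "Dx (Dx X) z = 0" by auto
qed

sublocale fibre_diffeo \<Omega> T X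
proof
  show "smooth_on \<Omega> X"
    unfolding X_def by (intro smooth_intros smooth_on_fst_snd smooth_on_of_time o smooth)
qed (use \<Omega> smooth T_deriv_eq nonzero X_partials in auto)

lemma pr_smooth: "smooth_on (fst ` \<Omega>) p" "smooth_on (fst ` \<Omega>) r"
  unfolding p_def[abs_def] r_def[abs_def]
  by (rule smooth_on_divide[OF o(2) smooth_on_deriv(2)[OF o(2) smooth(2)] smooth(2) nonzero(1)], assumption,
      rule smooth_on_divide[OF o(2) smooth_on_deriv(2)[OF o(2) smooth(3)] smooth(2) nonzero(1)], assumption)

lemma M_alt: "M z = V (fst z) * exp (- (e / 4) * p (fst z) * (snd z)\<^sup>2 - e / 2 * r (fst z) * snd z)"
  by (simp add: M_def p_def r_def field_simps)

lemma M_nonzero: "z \<in> \<Omega> \<Longrightarrow> M z \<noteq> 0"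
  using nonzero by (simp add: M_def)

lemma M_smooth: "smooth_on \<Omega> M"
  unfolding M_alt by (intro smooth_intros smooth_on_fst_snd smooth_on_of_time o smooth pr_smooth)

text \<open>The logarithmic derivative M_x / M.\<close>

definition m :: fld where "m z = - (e / 2) * (p (fst z) * snd z + r (fst z))"

lemma M_partials:
  assumes z: "z \<in> \<Omega>"
  shows "Dx M z = M z * m z"
    and "Dt M z = M z * (deriv V (fst z) / V (fst z) - e / 4 * deriv p (fst z) * (snd z)\<^sup>2 - e / 2 * deriv r (fst z) * snd z)"
proof -
  have t: "fst z \<in> fst ` \<Omega>" using z by simp
  note d = smooth_on_deriv(1)[OF o(2) pr_smooth(1) t] smooth_on_deriv(1)[OF o(2) pr_smooth(2) t]
    smooth_on_deriv(1)[OF o(2) smooth(4) t]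
  have nV: "V (fst z) \<noteq> 0" using nonzero(2)[OF t] .
  show "Dx M z = M z * m z"
    unfolding M_alt[abs_def] m_def by (rule partials_imp_eq(2)) (auto intro!: derivative_eq_intros simp: algebra_simps)
  show "Dt M z = M z * (deriv V (fst z) / V (fst z) - e / 4 * deriv p (fst z) * (snd z)\<^sup>2 - e / 2 * deriv r (fst z) * snd z)"
    using d unfolding M_alt[abs_def]
    by (intro partials_imp_eq(1)) (auto intro!: derivative_eq_intros simp: nV field_simps)
qed

text \<open>An identity of operators, with an arbitrary function \<open>w\<close> and an arbitrary
  number \<open>k\<close> in place of the potential. It thus applies to functions that solve no
  equation, as the notion of point symmetry demands, as well as to solutions.\<close>

lemma potential_law:
  assumes w: "smooth_on \<Omega> w" and w': "smooth_on (fibre_map T X ` \<Omega>) w'"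
    and eq: "\<And>z. z \<in> \<Omega> \<Longrightarrow> w' (fibre_map T X z) = M z * w z" and z: "z \<in> \<Omega>"
  shows "(X1 (fst z))\<^sup>2 * (Dt w' (fibre_map T X z) - e * Dx (Dx w') (fibre_map T X z) - k * w' (fibre_map T X z))
    = M z * (Dt w z - e * Dx (Dx w) z - ((X1 (fst z))\<^sup>2 * k - Q z) * w z)"
proof -
  have t: "fst z \<in> fst ` \<Omega>" using z by simp
  have e2: "e * e = 1" using e by auto
  note sx = smooth_on_partials(2)[OF o(1) w]
  have Mx: "Dx (\<lambda>z. M z * w z) y = M y * (m y * w y + Dx w y)" if y: "y \<in> \<Omega>" for y
    using DERIV_mult[OF partial_deriv'(2)[OF M_smooth y] partial_deriv'(2)[OF w y]] M_partials(1)[OF y]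
    by (intro partials_imp_eq(2)) (simp add: algebra_simps)
  have Mt: "Dt (\<lambda>z. M z * w z) z = Dt M z * w z + M z * Dt w z"
    using DERIV_mult[OF partial_deriv'(1)[OF M_smooth z] partial_deriv'(1)[OF w z]]
    by (intro partials_imp_eq(1)) (simp add: algebra_simps)
  have dm: "((\<lambda>y. m (fst z, y)) has_real_derivative - (e / 2) * p (fst z)) (at (snd z))"
    unfolding m_def by (auto intro!: derivative_eq_intros)
  have mxx: "((\<lambda>y. M (fst z, y) * (m (fst z, y) * w (fst z, y) + Dx w (fst z, y))) has_real_derivative
      M z * ((m z)\<^sup>2 * w z + 2 * m z * Dx w z - e / 2 * p (fst z) * w z + Dx (Dx w) z)) (at (snd z))"
    using M_partials(1)[OF z]
    by (auto intro!: derivative_eq_intros dm partial_deriv'(2)[OF M_smooth z] partial_deriv'(2)[OF w z] partial_deriv'(2)[OF sx z]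
        simp: algebra_simps power2_eq_square)
  have Mxx: "Dx (Dx (\<lambda>z. M z * w z)) z = M z * ((m z)\<^sup>2 * w z + 2 * m z * Dx w z - e / 2 * p (fst z) * w z + Dx (Dx w) z)"
    by (rule partials_eqI(2)[OF o(1) Mx z]) (assumption, rule mxx)
  have px: "Dx (pull w') y = Dx (\<lambda>z. M z * w z) y" if "y \<in> \<Omega>" for y
    by (rule partials_cong(2)[OF o(1) eq that])
  have 1: "Dx w' (fibre_map T X z) * X1 (fst z) = M z * (m z * w z + Dx w z)"
    using pull_partials(2)[OF w' z] px[OF z] Mx[OF z] X_partials(1)[OF z] by simp
  have 2: "Dt w' (fibre_map T X z) * (X1 (fst z))\<^sup>2 + Dx w' (fibre_map T X z) * (deriv X1 (fst z) * snd z + deriv X0 (fst z))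
      = Dt M z * w z + M z * Dt w z"
    using pull_partials(1)[OF w' z] partials_cong(1)[OF o(1) eq z] Mt X_partials(2)[OF z] T_deriv_eq[OF t] by simp
  have 3: "Dx (Dx w') (fibre_map T X z) * (X1 (fst z))\<^sup>2
      = M z * ((m z)\<^sup>2 * w z + 2 * m z * Dx w z - e / 2 * p (fst z) * w z + Dx (Dx w) z)"
    using pull_partials_xx[OF w' z] partials_cong(2)[OF o(1) px z] Mxx X_partials(1,3)[OF z] by simp
  have 4: "deriv X1 (fst z) * snd z + deriv X0 (fst z) = X1 (fst z) * (- 2 * e * m z)"
    using nonzero(1)[OF t] e2 by (simp add: m_def p_def r_def field_simps) algebra
  have 5: "Dx w' (fibre_map T X z) * (deriv X1 (fst z) * snd z + deriv X0 (fst z)) = - 2 * e * m z * (M z * (m z * w z + Dx w z))"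
    unfolding 4 1[symmetric] by simp
  have Qm: "Q z = deriv V (fst z) / V (fst z) - e / 4 * deriv p (fst z) * (snd z)\<^sup>2 - e / 2 * deriv r (fst z) * snd z
      + e * (m z)\<^sup>2 + p (fst z) / 2"
  proof -
    have "e * (m z)\<^sup>2 = (e * e) * e / 4 * (p (fst z) * snd z + r (fst z))\<^sup>2" by (simp add: m_def power2_eq_square)
    then have "e * (m z)\<^sup>2 = e / 4 * (p (fst z) * snd z + r (fst z))\<^sup>2" unfolding e2 by simp
    then show ?thesis unfolding Q_def by (simp add: algebra_simps power2_eq_square add_divide_distrib)
  qed
  define P where "P = deriv V (fst z) / V (fst z) - e / 4 * deriv p (fst z) * (snd z)\<^sup>2 - e / 2 * deriv r (fst z) * snd z"
  have Mt': "Dt M z = M z * P" using M_partials(2)[OF z] by (simp add: P_def)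
  have Q': "Q z = P + e * (m z)\<^sup>2 + p (fst z) / 2" using Qm by (simp add: P_def)
  have "(X1 (fst z))\<^sup>2 * (Dt w' (fibre_map T X z) - e * Dx (Dx w') (fibre_map T X z) - k * w' (fibre_map T X z))
      = (Dt w' (fibre_map T X z) * (X1 (fst z))\<^sup>2) - e * (Dx (Dx w') (fibre_map T X z) * (X1 (fst z))\<^sup>2)
        - (X1 (fst z))\<^sup>2 * k * (M z * w z)"
    unfolding eq[OF z] by (simp add: algebra_simps)
  also have "Dt w' (fibre_map T X z) * (X1 (fst z))\<^sup>2 = Dt M z * w z + M z * Dt w z + 2 * e * m z * (M z * (m z * w z + Dx w z))"
    using 2 5 by simp
  also have "\<dots> - e * (Dx (Dx w') (fibre_map T X z) * (X1 (fst z))\<^sup>2) - (X1 (fst z))\<^sup>2 * k * (M z * w z)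
    = M z * (Dt w z - e * Dx (Dx w) z - ((X1 (fst z))\<^sup>2 * k - Q z) * w z)"
    unfolding 3 Mt' Q' using e2 by algebra
  finally show ?thesis .
qed

lemma heat_solution_push:
  assumes U: "heat_solution e \<Omega> c U"
    and c': "\<And>z. z \<in> \<Omega> \<Longrightarrow> (X1 (fst z))\<^sup>2 * c' (fibre_map T X z) = c z + Q z"
  shows "heat_solution e (fibre_map T X ` \<Omega>) c' (\<lambda>z. M (G z) * U (G z))"
proof -
  let ?U = "\<lambda>z. M (G z) * U (G z)"
  have sU: "smooth_on \<Omega> U" using U by (simp add: heat_solution_def)
  have s: "smooth_on (fibre_map T X ` \<Omega>) ?U"
    using push_smooth[OF smooth_on_mult[OF o(1) M_smooth sU]] .
  have eq: "?U (fibre_map T X z) = M z * U z" if "z \<in> \<Omega>" for z by (simp only: GF[OF that])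
  have "?U y \<noteq> 0 \<and> Dt ?U y = e * Dx (Dx ?U) y + c' y * ?U y" if y: "y \<in> fibre_map T X ` \<Omega>" for y
  proof -
    obtain z where z: "z \<in> \<Omega>" "y = fibre_map T X z" using y by blast
    have t: "fst z \<in> fst ` \<Omega>" using z(1) by simp
    have "(X1 (fst z))\<^sup>2 * c' y - Q z = c z" using c'[OF z(1)] z(2) by simp
    then have "(X1 (fst z))\<^sup>2 * (Dt ?U y - e * Dx (Dx ?U) y - c' y * ?U y) = M z * (Dt U z - e * Dx (Dx U) z - c z * U z)"
      using potential_law[OF sU s eq z(1), of "c' y"] z(2) by simp
    also have "\<dots> = 0" using U z(1) by (simp add: heat_solution_def)
    finally have "Dt ?U y - e * Dx (Dx ?U) y - c' y * ?U y = 0" using nonzero(1)[OF t] by simp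
    moreover have "?U y \<noteq> 0" using eq[OF z(1)] z M_nonzero[OF z(1)] U by (simp add: heat_solution_def)
    ultimately show ?thesis by simp
  qed
  then show ?thesis using s by (simp add: heat_solution_def)
qed

text \<open>A solution without zeros determines its potential as (U_t - e U_xx) / U, so a relation
  between the solutions entails one between the potentials.\<close>

lemma heat_potential_relation:
  assumes U: "heat_solution e \<Omega> c U" and U': "heat_solution e (fibre_map T X ` \<Omega>) c' U'"
    and eq: "\<And>z. z \<in> \<Omega> \<Longrightarrow> U' (fibre_map T X z) = M z * U z" and z: "z \<in> \<Omega>"
  shows "(X1 (fst z))\<^sup>2 * c' (fibre_map T X z) = c z + Q z"
proof -
  have s: "smooth_on \<Omega> U" "smooth_on (fibre_map T X ` \<Omega>) U'" using U U' by (auto simp: heat_solution_def)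
  have "M z * (Dt U z - e * Dx (Dx U) z - ((X1 (fst z))\<^sup>2 * c' (fibre_map T X z) - Q z) * U z) = 0"
    using potential_law[OF s eq z, of "c' (fibre_map T X z)"] U' z by (auto simp: heat_solution_def)
  moreover have "Dt U z - e * Dx (Dx U) z = c z * U z" "U z \<noteq> 0" using U z by (auto simp: heat_solution_def)
  ultimately have "M z * ((c z - ((X1 (fst z))\<^sup>2 * c' (fibre_map T X z) - Q z)) * U z) = 0"
    by (simp only: left_diff_distrib)
  then have "(c z - ((X1 (fst z))\<^sup>2 * c' (fibre_map T X z) - Q z)) * U z = 0"
    using M_nonzero[OF z] by (simp only: mult_eq_0_iff) blast
  then show ?thesis using \<open>U z \<noteq> 0\<close> by simp
qed

text \<open>B is 2 e U_x / U, so multiplying U by M adds 2 e M_x / M = -X_t / X_x to it, which is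
  the inhomogeneous term in the transformation of B.\<close>

lemma heat_arb_map:
  assumes \<epsilon>: "\<epsilon> \<in> {-1, 1}" and e_eq: "e = \<epsilon> * breve L"
    and U: "heat_solution e \<Omega> c U" and U': "heat_solution e (fibre_map T X ` \<Omega>) c' U'"
    and eq: "\<And>z. z \<in> \<Omega> \<Longrightarrow> U' (fibre_map T X z) = M z * U z"
  shows "arb_map (breve L) \<Omega> (case_elements L \<epsilon> U) (fibre_map T X ` \<Omega>) (case_elements L \<epsilon> U') T X"
  unfolding case_elements_def arb_map.simps
proof (intro conjI ballI)
  show "fibre_diffeo \<Omega> T X" by unfold_locales
  fix z assume z: "z \<in> \<Omega>"
  have t: "fst z \<in> fst ` \<Omega>" using z by simp
  have e2: "e * e = 1" using e by auto
  show "\<epsilon> * deriv T (fst z) = (Dx X z)\<^sup>2 * \<epsilon>" using T_deriv_eq[OF t] X_partials(1)[OF z] by simp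
  have sU: "smooth_on \<Omega> U" "smooth_on (fibre_map T X ` \<Omega>) U'" and ne: "U z \<noteq> 0" using U U' z by (auto simp: heat_solution_def)
  have "Dx (pull U') z = Dx (\<lambda>z. M z * U z) z" by (rule partials_cong(2)[OF o(1) eq z])
  also have "\<dots> = M z * (m z * U z + Dx U z)"
    using DERIV_mult[OF partial_deriv'(2)[OF M_smooth z] partial_deriv'(2)[OF sU(1) z]] M_partials(1)[OF z]
    by (intro partials_imp_eq(2)) (simp add: algebra_simps)
  finally have 1: "Dx U' (fibre_map T X z) * X1 (fst z) = M z * (m z * U z + Dx U z)"
    unfolding pull_partials(2)[OF sU(2) z] X_partials(1)[OF z] .
  have "Dx U' (fibre_map T X z) / U' (fibre_map T X z) * X1 (fst z) = m z + Dx U z / U z"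
    unfolding eq[OF z] using 1 ne M_nonzero[OF z] by (simp add: field_simps)
  then have 2: "2 * e * (Dx U' (fibre_map T X z) / U' (fibre_map T X z)) * (X1 (fst z))\<^sup>2
      = X1 (fst z) * (2 * e * m z) + X1 (fst z) * (2 * e * (Dx U z / U z))"
    by algebra
  have "2 * e * m z = - (e * e) * (p (fst z) * snd z + r (fst z))" by (simp add: m_def)
  then have "X1 (fst z) * (2 * e * m z) = - (deriv X1 (fst z) * snd z + deriv X0 (fst z))"
    unfolding e2 using nonzero(1)[OF t] by (simp add: p_def r_def field_simps)
  with 2 show "B_of L \<epsilon> U' (fibre_map T X z) * deriv T (fst z)
      = Dx X z * B_of L \<epsilon> U z - Dt X z + breve L * Dx (Dx X) z * \<epsilon>"
    unfolding B_of_def X_partials[OF z] T_deriv_eq[OF t] e_eq by (simp add: algebra_simps)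
qed simp

end

section \<open>Inequivalence of the listed cases\<close>

lemma case_elements_member:
  assumes "\<epsilon> \<in> {-1, 1}" "open \<Omega>" "heat_solution e \<Omega> c U"
  shows "case_elements L \<epsilon> U \<in> members L \<epsilon> \<Omega>"
  unfolding case_elements_def by (rule constant_A_member[OF assms(1) heat_solution_smooth_B[OF assms(2,3)]])

text \<open>The relation between the two functions B prescribes the logarithmic x-derivative of U'
  in terms of that of U. It agrees with the one of M U, so the quotient depends on t only and
  supplies V.\<close>

lemma heat_map_of_arb_map:
  assumes \<epsilon>: "\<epsilon> \<in> {-1, 1}" and e: "e = \<epsilon> * breve L"
    and U: "heat_solution e \<Omega> c U" and U': "heat_solution e \<Omega>' c' U'"
    and map: "arb_map (breve L) \<Omega> (case_elements L \<epsilon> U) \<Omega>' (case_elements L \<epsilon> U') T X"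
  obtains X1 X0 V where "heat_map \<Omega> T X1 X0 V e" "\<And>z. z \<in> \<Omega> \<Longrightarrow> X z = heat_map.X X1 X0 z"
    "\<Omega>' = fibre_map T (heat_map.X X1 X0) ` \<Omega>"
    "\<And>z. z \<in> \<Omega> \<Longrightarrow> U' (fibre_map T (heat_map.X X1 X0) z) = heat_map.M X1 X0 V e z * U z"
proof -
  interpret F: fibre_diffeo \<Omega> T X using map by (simp add: case_elements_def)
  have e1: "e \<in> {-1, 1}" using \<epsilon> breve_cases[of L] e by auto
  obtain X1 X0 where s: "smooth_on (fst ` \<Omega>) X1" "smooth_on (fst ` \<Omega>) X0"
    and X': "\<And>t x. (t, x) \<in> \<Omega> \<Longrightarrow> X (t, x) = X1 t * x + X0 t" and t: "\<And>t. t \<in> fst ` \<Omega> \<Longrightarrow> X1 t \<noteq> 0 \<and> deriv T t = (X1 t)\<^sup>2"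
    using affine_arb_map[OF \<epsilon> map[unfolded case_elements_def]] by blast
  have hm: "heat_map \<Omega> T X1 X0 V e" if "smooth_on (fst ` \<Omega>) V" "\<And>t. t \<in> fst ` \<Omega> \<Longrightarrow> V t \<noteq> 0" for V
    by unfold_locales (use F.dom F.T s t that e1 in auto)
  \<comment> \<open>V is not known yet; the multiplier with V = 1 already has the right dependence
    on x.\<close>
  interpret H: heat_map \<Omega> T X1 X0 "\<lambda>_. 1" e by (rule hm) (auto intro: smooth_on_const)
  have XX: "X z = H.X z" if "z \<in> \<Omega>" for z using X'[of "fst z" "snd z"] that by (simp add: H.X_def)
  have F: "fibre_map T X z = fibre_map T H.X z" if "z \<in> \<Omega>" for z using XX[OF that] by (simp add: case_prod_unfold)
  have \<Omega>': "\<Omega>' = fibre_map T H.X ` \<Omega>" using map F by (auto simp: case_elements_def intro!: image_cong)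
  have sU: "smooth_on \<Omega> U" "smooth_on (fibre_map T H.X ` \<Omega>) U'"
    and ne: "\<And>z. z \<in> \<Omega> \<Longrightarrow> U z \<noteq> 0" "\<And>z. z \<in> \<Omega> \<Longrightarrow> U' (fibre_map T H.X z) \<noteq> 0"
    using U U' \<Omega>' by (auto simp: heat_solution_def)
  define W where "W z = H.pull U' z / (H.M z * U z)" for z
  have sMU: "smooth_on \<Omega> (\<lambda>z. H.M z * U z)" by (intro smooth_intros H.o H.M_smooth sU)
  have MU: "H.M z * U z \<noteq> 0" if "z \<in> \<Omega>" for z using H.M_nonzero[OF that] ne(1)[OF that] by simp
  have sW: "smooth_on \<Omega> W"
    unfolding W_def by (rule smooth_on_divide[OF H.o(1) H.pull_smooth'[OF sU(2)] sMU MU])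
  have "Dx W z = 0" if z: "z \<in> \<Omega>" for z
  proof -
    have tz: "fst z \<in> fst ` \<Omega>" using z by simp
    have "\<forall>t x. (t, x) \<in> \<Omega> \<longrightarrow> X (t, x) = X1 t * x + X0 t" using X' by blast
    from affine_partials[OF H.o(1) s this, of "fst z" "snd z"] z
    have p: "Dx X z = X1 (fst z)" "Dt X z = deriv X1 (fst z) * snd z + deriv X0 (fst z)" "Dx (Dx X) z = 0" by auto
    have "B_of L \<epsilon> U' (fibre_map T X z) * deriv T (fst z) = Dx X z * B_of L \<epsilon> U z - Dt X z + breve L * Dx (Dx X) z * \<epsilon>"
      using map z by (simp add: case_elements_def)
    then have "2 * e * (Dx U' (fibre_map T H.X z) / U' (fibre_map T H.X z)) * (X1 (fst z))\<^sup>2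
        = X1 (fst z) * (2 * e * (Dx U z / U z)) - (deriv X1 (fst z) * snd z + deriv X0 (fst z))"
      using t[OF tz] unfolding F[OF z] p B_of_def e by (simp add: algebra_simps)
    moreover have "deriv X1 (fst z) * snd z + deriv X0 (fst z) = X1 (fst z) * (- 2 * e * H.m z)"
    proof -
      have "e * e = 1" using e1 by auto
      then show ?thesis using t[OF tz] by (simp add: H.m_def H.p_def H.r_def field_simps) algebra
    qed
    ultimately have "2 * e * X1 (fst z) * (Dx U' (fibre_map T H.X z) / U' (fibre_map T H.X z) * X1 (fst z)) =
        2 * e * X1 (fst z) * (Dx U z / U z + H.m z)" by algebra
    moreover have "2 * e * X1 (fst z) \<noteq> 0" using e1 t[OF tz] by auto
    ultimately have "Dx U' (fibre_map T H.X z) / U' (fibre_map T H.X z) * X1 (fst z) = Dx U z / U z + H.m z"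
      by (simp only: mult_cancel_left) simp
    then have d1: "Dx (H.pull U') z = H.pull U' z * (Dx U z / U z + H.m z)"
      unfolding H.pull_partials(2)[OF sU(2) z] H.X_partials(1)[OF z] using ne(2)[OF z] by (simp add: field_simps)
    have d2: "Dx (\<lambda>z. H.M z * U z) z = (H.M z * U z) * (Dx U z / U z + H.m z)"
    proof -
      have "Dx (\<lambda>z. H.M z * U z) z = Dx H.M z * U z + Dx U z * H.M z"
        using DERIV_mult[OF partial_deriv'(2)[OF H.M_smooth z] partial_deriv'(2)[OF sU(1) z]]
        by (intro partials_imp_eq(2)) simp
      then show ?thesis unfolding H.M_partials(1)[OF z] using ne(1)[OF z] by (simp add: field_simps)
    qed
    have "Dx W z = (Dx (H.pull U') z * (H.M z * U z) - H.pull U' z * Dx (\<lambda>z. H.M z * U z) z) / ((H.M z * U z) * (H.M z * U z))"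
      unfolding W_def[abs_def]
      by (rule partials_imp_eq(2))
        (use DERIV_divide[OF partial_deriv'(2)[OF H.pull_smooth'[OF sU(2)] z] partial_deriv'(2)[OF sMU z]] MU[OF z] in simp)
    then show ?thesis unfolding d1 d2 by simp
  qed
  from x_independent[OF F.dom sW this] obtain V where V: "smooth_on (fst ` \<Omega>) V" "\<And>t x. (t, x) \<in> \<Omega> \<Longrightarrow> W (t, x) = V t"
    by blast
  have WV: "W z = V (fst z)" if "z \<in> \<Omega>" for z using V(2)[of "fst z" "snd z"] that by simp
  have W0: "W z \<noteq> 0" if "z \<in> \<Omega>" for z using ne(2)[OF that] MU[OF that] by (simp add: W_def)
  have V0: "V t \<noteq> 0" if "t \<in> fst ` \<Omega>" for t using that W0 WV by auto
  interpret K: heat_map \<Omega> T X1 X0 V e by (rule hm[OF V(1) V0])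
  have "K.M z = V (fst z) * H.M z" for z by (simp add: K.M_def H.M_def)
  then have "U' (fibre_map T H.X z) = K.M z * U z" if "z \<in> \<Omega>" for z
    using WV[OF that] MU[OF that] unfolding W_def by (simp add: field_simps)
  with K.heat_map_axioms XX \<Omega>' show ?thesis by (rule that)
qed

lemma Pt_symmetry:
  assumes \<epsilon>: "\<epsilon> \<in> {-1, 1}" and U: "(\<Omega>, U) \<in> nonzero_solutions L \<epsilon> p" and p: "valid_potential p"
  obtains \<eta> where "determining \<Omega> (equation L (case_elements L \<epsilon> U)) (\<lambda>_. 1) (\<lambda>_. 0) \<eta>"
proof -
  note U' = nonzero_solutionsD[OF U]
  have k: "admissible_coefficients p 0 0 0 0" by (simp add: admissible_coefficients_def)
  have e: "heat_tau 1 0 0 = (\<lambda>_. 1)" "heat_xi 0 0 0 0 = (\<lambda>_. 0)" by (auto simp: heat_tau_def heat_xi_def)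
  have "determining \<Omega> (\<lambda>_. \<epsilon>, \<lambda>_. 0, \<lambda>z. pot p (snd z)) (\<lambda>_. 1) (\<lambda>_. 0) (heat_eta \<epsilon> 0 0 0)"
    using heat_potential_symmetries_converse[OF \<epsilon> U'(1) p U'(2) k, of 1 0] unfolding e .
  then have "determining \<Omega> (equation L (case_elements L \<epsilon> U)) (\<lambda>_. 1) (\<lambda>_. 0)
      (\<lambda>z. heat_eta \<epsilon> 0 0 0 z - breve L * (1 * Dt U z + 0 * Dx U z) / U z)"
    unfolding determining_heat_iff[OF \<epsilon> is_domainD(1)[OF U'(1)] pot_smooth(2)[OF U'(1) p U'(2)] U'(3)] by simp
  then show ?thesis by (rule that)
qed

lemma general_symmetry:
  assumes \<epsilon>: "\<epsilon> \<in> {-1, 1}" and U: "(\<Omega>, U) \<in> nonzero_solutions L \<epsilon> (General J C)" and p: "valid_potential (General J C)"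
    and det: "determining \<Omega> (equation L (case_elements L \<epsilon> U)) \<tau> \<xi> \<eta>"
  obtains k where "\<And>t. t \<in> fst ` \<Omega> \<Longrightarrow> \<tau> t = k" "\<And>z. z \<in> \<Omega> \<Longrightarrow> \<xi> z = 0"
proof -
  note o = is_domainD(1)[OF nonzero_solutionsD(1)[OF U]]
  have "ess_field \<Omega> \<tau> \<xi> \<eta> \<in> ess_algebra \<Omega> (equation L (case_elements L \<epsilon> U))"
    unfolding ess_algebra_eq[OF o] using det by blast
  then obtain k0 k1 k2 k3 k4 k5 where eq: "ess_field \<Omega> \<tau> \<xi> \<eta> = general_field L \<epsilon> \<Omega> U k0 k1 k2 k3 k4 k5"
    and k: "admissible_coefficients (General J C) k2 k3 k4 k5"
    unfolding case_algebra[OF \<epsilon> U p] by blast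
  have k': "k2 = 0" "k3 = 0" "k4 = 0" "k5 = 0" using k by (auto simp: admissible_coefficients_def)
  note d = ess_field_eqD[OF eq[unfolded general_field_def]]
  show ?thesis
  proof (rule that[of k1])
    show "\<tau> t = k1" if t: "t \<in> fst ` \<Omega>" for t
    proof -
      obtain x where "(t, x) \<in> \<Omega>" using t by force
      from d(1)[OF this] show ?thesis by (simp add: heat_tau_def k')
    qed
    show "\<xi> z = 0" if "z \<in> \<Omega>" for z using d(2)[of "fst z" "snd z"] that by (simp add: heat_xi_def k')
  qed
qed

text \<open>On an open slice the equation X_t = 0 splits into vanishing derivatives of X1 and X0;
  all terms of Q with p or r then disappear.\<close>

lemma affine_time_independent:
  assumes hm: "heat_map \<Omega> T X1 X0 V e" and k: "\<And>t. t \<in> fst ` \<Omega> \<Longrightarrow> deriv T t = k"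
    and X_stationary: "\<And>z. z \<in> \<Omega> \<Longrightarrow> Dt (heat_map.X X1 X0) z = 0"
  obtains c1 c3 where "c1 \<noteq> 0" "\<And>t. t \<in> fst ` \<Omega> \<Longrightarrow> X1 t = c1 \<and> X0 t = c3"
    "\<And>z. z \<in> \<Omega> \<Longrightarrow> heat_map.Q X1 X0 V e z = deriv V (fst z) / V (fst z)"
proof -
  interpret heat_map \<Omega> T X1 X0 V e by fact
  have z: "deriv X1 t = 0 \<and> deriv X0 t = 0" if t: "t \<in> fst ` \<Omega>" for t
  proof -
    obtain x0 where "(t, x0) \<in> \<Omega>" using t by force
    then have ne: "{x. (t, x) \<in> \<Omega>} \<noteq> {}" by blast
    have "[:deriv X0 t, deriv X1 t:] = 0"
    proof (rule poly_zero_on_open[OF open_slices(1)[OF o(1)] ne])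
      fix x assume "x \<in> {x. (t, x) \<in> \<Omega>}"
      then have x: "(t, x) \<in> \<Omega>" by simp
      show "poly [:deriv X0 t, deriv X1 t:] x = 0" using X_partials(2)[OF x] X_stationary[OF x] by (simp add: algebra_simps)
    qed
    then show ?thesis by simp
  qed
  obtain t0 where t0: "t0 \<in> fst ` \<Omega>" using is_domainD(5)[OF \<Omega>] by blast
  have c: "X1 t = X1 t0 \<and> X0 t = X0 t0" if t: "t \<in> fst ` \<Omega>" for t
  proof
    have d: "(X1 has_real_derivative 0) (at t)" "(X0 has_real_derivative 0) (at t)" if "t \<in> fst ` \<Omega>" for t
      using smooth_on_deriv(1)[OF o(2) smooth(2) that] smooth_on_deriv(1)[OF o(2) smooth(3) that] z[OF that] by simp_all
    show "X1 t = X1 t0" by (rule connected_open_derivative_zero[OF is_domainD(4)[OF \<Omega>] d(1) t t0])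
    show "X0 t = X0 t0" by (rule connected_open_derivative_zero[OF is_domainD(4)[OF \<Omega>] d(2) t t0])
  qed
  have pr: "p t = 0" "r t = 0" if "t \<in> fst ` \<Omega>" for t using z[OF that] by (simp_all add: p_def r_def)
  have dpr: "deriv p t = 0" "deriv r t = 0" if t: "t \<in> fst ` \<Omega>" for t
    by (rule DERIV_imp_deriv, rule has_field_derivative_transform_within_open[OF DERIV_const o(2) t], simp add: pr)+
  have "Q z = deriv V (fst z) / V (fst z)" if "z \<in> \<Omega>" for z
    using pr[of "fst z"] dpr[of "fst z"] that by (simp add: Q_def)
  then show ?thesis using that[of "X1 t0" "X0 t0"] nonzero(1)[OF t0] c by blast
qed

text \<open>Up to its u-component, time translation is a symmetry for every potential considered,
  and for a general one it spans the possible actions on (t, x). Transporting it to the general side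
  forces T_t to be constant and X_t = 0, so X is affine with constant coefficients. The relation
  between the potentials then separates the variables, which leaves one constant.\<close>

lemma general_case_relation:
  assumes \<epsilon>: "\<epsilon> \<in> {-1, 1}" and p: "valid_potential p" "valid_potential p'"
    and U: "(\<Omega>, U) \<in> nonzero_solutions L \<epsilon> p" and U': "(\<Omega>', U') \<in> nonzero_solutions L \<epsilon> p'"
    and map: "arb_map (breve L) \<Omega> (case_elements L \<epsilon> U) \<Omega>' (case_elements L \<epsilon> U') T X"
    and gen: "(\<exists>J C. p = General J C) \<or> (\<exists>J C. p' = General J C)"
  obtains c1 c3 c5 where "c1 \<noteq> 0" "snd ` \<Omega>' = (\<lambda>x. c1 * x + c3) ` snd ` \<Omega>"
    "\<And>x. x \<in> snd ` \<Omega> \<Longrightarrow> pot p' (c1 * x + c3) = (pot p x + c5) / c1\<^sup>2"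
proof -
  note S = nonzero_solutionsD[OF U] and S' = nonzero_solutionsD[OF U']
  define e where "e = \<epsilon> * breve L"
  have h: "heat_solution e \<Omega> (\<lambda>z. breve L * pot p (snd z)) U" "heat_solution e \<Omega>' (\<lambda>z. breve L * pot p' (snd z)) U'"
    using S(3) S'(3) by (simp_all add: e_def)
  obtain X1 X0 V where hm: "heat_map \<Omega> T X1 X0 V e" and XX: "\<And>z. z \<in> \<Omega> \<Longrightarrow> X z = heat_map.X X1 X0 z"
    and \<Omega>': "\<Omega>' = fibre_map T (heat_map.X X1 X0) ` \<Omega>"
    and UU: "\<And>z. z \<in> \<Omega> \<Longrightarrow> U' (fibre_map T (heat_map.X X1 X0) z) = heat_map.M X1 X0 V e z * U z"
    using heat_map_of_arb_map[OF \<epsilon> e_def h map] by blast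
  interpret H: heat_map \<Omega> T X1 X0 V e by fact
  have sm: "smooth_on \<Omega> (\<lambda>_. \<epsilon>)" "smooth_on \<Omega> (B_of L \<epsilon> U)" "smooth_on \<Omega>' (\<lambda>_. \<epsilon>)" "smooth_on \<Omega>' (B_of L \<epsilon> U')"
    using heat_solution_smooth_B[OF is_domainD(1)[OF S(1)] h(1)] heat_solution_smooth_B[OF is_domainD(1)[OF S'(1)] h(2)]
    by (simp_all add: smooth_on_const)
  have DtX: "Dt X z = Dt H.X z" if "z \<in> \<Omega>" for z by (rule partials_cong(1)[OF H.o(1) XX that])
  have Xne: "Dx X z \<noteq> 0" if "z \<in> \<Omega>" for z using partials_cong(2)[OF H.o(1) XX that] H.X_ne[OF that] by simp
  have "\<exists>k. (\<forall>t\<in>fst ` \<Omega>. deriv T t = k) \<and> (\<forall>z\<in>\<Omega>. Dt H.X z = 0)"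
    using gen
  proof
    assume "\<exists>J C. p' = General J C"
    then obtain J C where G: "p' = General J C" by blast
    obtain \<eta> where det: "determining \<Omega> (equation L (case_elements L \<epsilon> U)) (\<lambda>_. 1) (\<lambda>_. 0) \<eta>"
      by (rule Pt_symmetry[OF \<epsilon> U p(1)])
    obtain \<tau>' \<xi>' \<eta>' where d': "determining \<Omega>' (equation L (case_elements L \<epsilon> U')) \<tau>' \<xi>' \<eta>'"
      and \<tau>': "\<And>t. t \<in> fst ` \<Omega> \<Longrightarrow> \<tau>' (T t) = deriv T t * 1"
      and \<xi>': "\<And>z. z \<in> \<Omega> \<Longrightarrow> \<xi>' (fibre_map T X z) = 1 * Dt X z + 0 * Dx X z"
      using push_symmetry[OF map[unfolded case_elements_def] sm det[unfolded case_elements_def]] unfolding case_elements_def by blast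
    obtain k where k: "\<And>t. t \<in> fst ` \<Omega>' \<Longrightarrow> \<tau>' t = k" "\<And>z. z \<in> \<Omega>' \<Longrightarrow> \<xi>' z = 0"
      by (rule general_symmetry[OF \<epsilon> U'[unfolded G] p(2)[unfolded G] d']) blast
    have "deriv T t = k" if "t \<in> fst ` \<Omega>" for t
      using \<tau>'[OF that] k(1)[of "T t"] H.in_image(2)[OF that] \<Omega>' by simp
    moreover have "Dt H.X z = 0" if "z \<in> \<Omega>" for z
    proof -
      have "fibre_map T X z \<in> \<Omega>'" using map that by (auto simp: case_elements_def)
      then show ?thesis using \<xi>'[OF that] k(2) DtX[OF that] by simp
    qed
    ultimately show ?thesis by blast
  next
    \<comment> \<open>The general potential is on the source side here, so the time translation is
      pulled back from the target.\<close>
    assume "\<exists>J C. p = General J C"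
    then obtain J C where G: "p = General J C" by blast
    obtain \<eta>' where det: "determining \<Omega>' (equation L (case_elements L \<epsilon> U')) (\<lambda>_. 1) (\<lambda>_. 0) \<eta>'"
      by (rule Pt_symmetry[OF \<epsilon> U' p(2)])
    obtain \<eta> where d: "determining \<Omega> (equation L (case_elements L \<epsilon> U)) (\<lambda>t. 1 / deriv T t) (\<lambda>z. (0 - 1 / deriv T (fst z) * Dt X z) / Dx X z) \<eta>"
      using pull_symmetry[OF map[unfolded case_elements_def] sm det[unfolded case_elements_def]] unfolding case_elements_def by blast
    obtain k where k: "\<And>t. t \<in> fst ` \<Omega> \<Longrightarrow> 1 / deriv T t = k" "\<And>z. z \<in> \<Omega> \<Longrightarrow> (0 - 1 / deriv T (fst z) * Dt X z) / Dx X z = 0"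
      by (rule general_symmetry[OF \<epsilon> U[unfolded G] p(1)[unfolded G] d]) blast
    have "deriv T t = 1 / k" if "t \<in> fst ` \<Omega>" for t
      using k(1)[OF that] by auto
    moreover have "Dt H.X z = 0" if z: "z \<in> \<Omega>" for z
      using k(2)[OF z] DtX[OF z] Xne[OF z] H.T_ne[of "fst z"] z by simp
    ultimately show ?thesis by blast
  qed
  then obtain k where "\<And>t. t \<in> fst ` \<Omega> \<Longrightarrow> deriv T t = k" "\<And>z. z \<in> \<Omega> \<Longrightarrow> Dt H.X z = 0" by blast
  from affine_time_independent[OF hm this] obtain c1 c3 where c1: "c1 \<noteq> 0" and c: "\<And>t. t \<in> fst ` \<Omega> \<Longrightarrow> X1 t = c1 \<and> X0 t = c3"
    and Q: "\<And>z. z \<in> \<Omega> \<Longrightarrow> H.Q z = deriv V (fst z) / V (fst z)" by blast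
  have F: "fibre_map T H.X z = (T (fst z), c1 * snd z + c3)" if "z \<in> \<Omega>" for z
    using c[of "fst z"] that by (simp add: H.X_def case_prod_unfold)
  define v where "v t = breve L * (deriv V t / V t)" for t
  have b2: "breve L * breve L = 1" using breve_cases[of L] by auto
  have rel: "v (fst z) = c1\<^sup>2 * pot p' (c1 * snd z + c3) - pot p (snd z)" if z: "z \<in> \<Omega>" for z
  proof -
    have "c1\<^sup>2 * (breve L * pot p' (c1 * snd z + c3)) = breve L * pot p (snd z) + deriv V (fst z) / V (fst z)"
      using H.heat_potential_relation[OF h(1) h(2)[unfolded \<Omega>'] UU z] c[of "fst z"] z F[OF z] Q[OF z] by simp
    then have "(breve L * breve L) * (c1\<^sup>2 * pot p' (c1 * snd z + c3)) = (breve L * breve L) * pot p (snd z) + v (fst z)"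
      unfolding v_def by algebra
    then show ?thesis unfolding b2 by simp
  qed
  have sv: "smooth_on (fst ` \<Omega>) v"
    unfolding v_def
    by (intro smooth_on_mult smooth_on_const smooth_on_divide smooth_on_deriv(2)[OF H.o(2)] H.smooth H.o H.nonzero)
  obtain z0 where z0: "z0 \<in> \<Omega>" using is_domainD(9)[OF H.\<Omega>] by blast
  \<comment> \<open>\<open>rel\<close> equates a function of t with an expression in x alone, so its
    t-derivative vanishes.\<close>
  have v0: "v t = v (fst z0)" if t: "t \<in> fst ` \<Omega>" for t
  proof (rule connected_open_derivative_zero[OF is_domainD(4)[OF H.\<Omega>] _ t])
    show "fst z0 \<in> fst ` \<Omega>" using z0 by simp
    fix t assume t: "t \<in> fst ` \<Omega>"
    then obtain z where z: "z \<in> \<Omega>" "t = fst z" by blast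
    have "Dt (\<lambda>z. v (fst z)) z = Dt (\<lambda>z. c1\<^sup>2 * pot p' (c1 * snd z + c3) - pot p (snd z)) z"
      by (rule partials_cong(1)[OF H.o(1) rel z(1)])
    also have "\<dots> = 0" by (rule partials_imp_eq(1)) simp
    finally have "deriv v t = 0" using z(2) by (simp add: Dt_def case_prod_unfold)
    then show "(v has_real_derivative 0) (at t)" using smooth_on_deriv(1)[OF H.o(2) sv t] by simp
  qed
  show ?thesis
  proof (rule that[OF c1])
    show "snd ` \<Omega>' = (\<lambda>x. c1 * x + c3) ` snd ` \<Omega>"
      unfolding \<Omega>' image_image by (rule image_cong[OF refl]) (simp add: F)
    fix x assume "x \<in> snd ` \<Omega>"
    then obtain z where z: "z \<in> \<Omega>" "x = snd z" by blast
    show "pot p' (c1 * x + c3) = (pot p x + v (fst z0)) / c1\<^sup>2"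
      using rel[OF z(1)] v0[of "fst z"] z c1 by (simp add: field_simps)
  qed
qed

text \<open>Up to additive constants, an affine change of x takes \<mu> / x^2 and 0 to forms that
  the definition of a general potential excludes, so both potentials have to be general.\<close>

lemma general_inequivalent:
  assumes \<epsilon>: "\<epsilon> \<in> {-1, 1}" and p: "valid_potential p" "valid_potential p'"
    and U: "(\<Omega>, U) \<in> nonzero_solutions L \<epsilon> p" and U': "(\<Omega>', U') \<in> nonzero_solutions L \<epsilon> p'"
    and map: "arb_map (breve L) \<Omega> (case_elements L \<epsilon> U) \<Omega>' (case_elements L \<epsilon> U') T X"
    and gen: "(\<exists>J C. p = General J C) \<or> (\<exists>J C. p' = General J C)"
  obtains J C J' C' where "p = General J C" "p' = General J' C'" "potential_equiv (J, C) (J', C')"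
proof -
  note S = nonzero_solutionsD[OF U] and S' = nonzero_solutionsD[OF U']
  obtain c1 c3 c5 where c1: "c1 \<noteq> 0" and im: "snd ` \<Omega>' = (\<lambda>x. c1 * x + c3) ` snd ` \<Omega>"
    and rel: "\<And>x. x \<in> snd ` \<Omega> \<Longrightarrow> pot p' (c1 * x + c3) = (pot p x + c5) / c1\<^sup>2"
    by (rule general_case_relation[OF assms]) blast
  have a1: "c1 * x + c3 = c1 * (x + c3 / c1)" for x using c1 by (simp add: field_simps)
  show ?thesis
  proof (cases p)
    case p1: (General J C)
    have J: "snd ` \<Omega> = J" "(J, C) \<in> general_potentials" using S(2) p(1) p1 by auto
    have noinv: "\<not> (\<forall>x\<in>J. C x = \<mu> / (x + \<beta>)\<^sup>2 + \<alpha> * (x + \<beta>)\<^sup>2 + \<gamma>)" if "\<mu> \<noteq> 0" for \<alpha> \<beta> \<gamma> \<mu>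
      using J(2) that unfolding general_potentials_def by blast
    have nozero: "\<not> (\<forall>x\<in>J. C x = \<alpha> * x\<^sup>2 + \<beta> * x + \<gamma>)" for \<alpha> \<beta> \<gamma>
      using J(2) unfolding general_potentials_def by blast
    have Cx: "C x = c1\<^sup>2 * pot p' (c1 * x + c3) - c5" if "x \<in> J" for x
      using rel[of x] that J(1) p1 c1 by (simp add: field_simps)
    show ?thesis
    proof (cases p')
      case p2: (General J' C')
      have "potential_equiv (J, C) (J', C')"
        unfolding potential_equiv.simps
        by (rule exI[of _ c1], rule exI[of _ c3], rule exI[of _ c5]) (use c1 im rel J S'(2) p1 p2 in auto)
      then show ?thesis using that p1 p2 by blast
    next
      case (Inv_Square \<mu>)
      have "C x = \<mu> / (x + c3 / c1)\<^sup>2 + 0 * (x + c3 / c1)\<^sup>2 + (- c5)" if "x \<in> J" for x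
        unfolding Cx[OF that] Inv_Square pot.simps a1 using c1 by (simp add: power_mult_distrib)
      moreover have "\<mu> \<noteq> 0" using p(2) Inv_Square by simp
      ultimately show ?thesis using noinv by blast
    next
      case Zero
      have "C x = 0 * x\<^sup>2 + 0 * x + (- c5)" if "x \<in> J" for x using Cx[OF that] Zero by simp
      then show ?thesis using nozero by blast
    qed
  next
    case (Inv_Square \<mu>)
    then obtain J' C' where p2: "p' = General J' C'" using gen by auto
    have J: "snd ` \<Omega>' = J'" "(J', C') \<in> general_potentials" using S'(2) p(2) p2 by auto
    have "C' y = \<mu> / (y + (- c3))\<^sup>2 + 0 * (y + (- c3))\<^sup>2 + c5 / c1\<^sup>2" if "y \<in> J'" for y
    proof -
      have "y \<in> (\<lambda>x. c1 * x + c3) ` snd ` \<Omega>" using im J(1) that by simp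
      then obtain x where x: "x \<in> snd ` \<Omega>" "y = c1 * x + c3" by blast
      have "C' y = (\<mu> / x\<^sup>2 + c5) / c1\<^sup>2" using rel[OF x(1)] x(2) p2 Inv_Square by simp
      moreover have "(y + (- c3))\<^sup>2 = c1\<^sup>2 * x\<^sup>2" using x(2) by (simp add: power_mult_distrib)
      ultimately show ?thesis by (simp add: add_divide_distrib mult.commute)
    qed
    moreover have "\<mu> \<noteq> 0" using p(1) Inv_Square by simp
    ultimately show ?thesis using J(2) unfolding general_potentials_def by blast
  next
    case Zero
    then obtain J' C' where p2: "p' = General J' C'" using gen by auto
    have J: "snd ` \<Omega>' = J'" "(J', C') \<in> general_potentials" using S'(2) p(2) p2 by auto
    have "C' y = 0 * y\<^sup>2 + 0 * y + c5 / c1\<^sup>2" if "y \<in> J'" for y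
    proof -
      have "y \<in> (\<lambda>x. c1 * x + c3) ` snd ` \<Omega>" using im J(1) that by simp
      then obtain x where x: "x \<in> snd ` \<Omega>" "y = c1 * x + c3" by blast
      then show ?thesis using rel[OF x(1)] p2 Zero by simp
    qed
    then show ?thesis using J(2) unfolding general_potentials_def by blast
  qed
qed

text \<open>At a single time the potentials are related up to a quadratic polynomial in x, which can
  neither create nor remove a double pole nor change its coefficient. Clearing denominators makes
  this a comparison of polynomials.\<close>

lemma nongeneral_inequivalent:
  assumes \<epsilon>: "\<epsilon> \<in> {-1, 1}" and p: "valid_potential p" "valid_potential p'"
    and U: "(\<Omega>, U) \<in> nonzero_solutions L \<epsilon> p" and U': "(\<Omega>', U') \<in> nonzero_solutions L \<epsilon> p'"
    and map: "arb_map (breve L) \<Omega> (case_elements L \<epsilon> U) \<Omega>' (case_elements L \<epsilon> U') T X"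
    and ng: "\<And>J C. p \<noteq> General J C" "\<And>J C. p' \<noteq> General J C"
  shows "p = p'"
proof -
  note S = nonzero_solutionsD[OF U] and S' = nonzero_solutionsD[OF U']
  define e where "e = \<epsilon> * breve L"
  define b where "b = breve L"
  have b0: "b \<noteq> 0" using breve_cases[of L] by (auto simp: b_def)
  have h: "heat_solution e \<Omega> (\<lambda>z. b * pot p (snd z)) U" "heat_solution e \<Omega>' (\<lambda>z. b * pot p' (snd z)) U'"
    using S(3) S'(3) by (simp_all add: e_def b_def)
  obtain X1 X0 V where hm: "heat_map \<Omega> T X1 X0 V e" and "\<And>z. z \<in> \<Omega> \<Longrightarrow> X z = heat_map.X X1 X0 z"
    and \<Omega>': "\<Omega>' = fibre_map T (heat_map.X X1 X0) ` \<Omega>"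
    and UU: "\<And>z. z \<in> \<Omega> \<Longrightarrow> U' (fibre_map T (heat_map.X X1 X0) z) = heat_map.M X1 X0 V e z * U z"
    using heat_map_of_arb_map[OF \<epsilon> e_def h map] by blast
  interpret H: heat_map \<Omega> T X1 X0 V e by fact
  obtain t x0 where tx: "(t, x0) \<in> \<Omega>" using is_domainD(9)[OF H.\<Omega>] by auto
  have t: "t \<in> fst ` \<Omega>" using tx by force
  let ?K = "{x. (t, x) \<in> \<Omega>}"
  have K: "open ?K" "?K \<noteq> {}" using open_slices(1)[OF H.o(1)] tx by auto
  define q2 where "q2 = e / 4 * ((H.p t)\<^sup>2 - deriv H.p t)"
  define q1 where "q1 = e / 2 * (H.p t * H.r t - deriv H.r t)"
  define q0 where "q0 = deriv V t / V t + H.p t / 2 + e / 4 * (H.r t)\<^sup>2"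
  \<comment> \<open>In the source coordinate the pole of an inverse-square target potential sits at
    -\<beta>.\<close>
  define \<beta> where "\<beta> = X0 t / X1 t"
  note X1 = H.nonzero(1)[OF t]
  have sh: "X1 t * x + X0 t = X1 t * (x + \<beta>)" for x using X1 by (simp add: \<beta>_def field_simps)
  have rel: "(X1 t)\<^sup>2 * (b * pot p' (X1 t * x + X0 t)) = b * pot p x + (q2 * x\<^sup>2 + q1 * x + q0)" if "x \<in> ?K" for x
    using H.heat_potential_relation[OF h(1) h(2)[unfolded \<Omega>'] UU, of "(t, x)"] that
    by (simp add: H.X_def H.Q_def q2_def q1_def q0_def)
  have x0: "x \<noteq> 0" if "p = Inv_Square \<mu>" "x \<in> ?K" for \<mu> x
    using S(2) that by force
  have x0': "x + \<beta> \<noteq> 0" if "p' = Inv_Square \<mu>" "x \<in> ?K" for \<mu> x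
  proof -
    have "(T t, X1 t * x + X0 t) \<in> \<Omega>'" using that(2) unfolding \<Omega>' by (force simp: H.X_def image_iff)
    then have "X1 t * x + X0 t \<noteq> 0" using S'(2) that(1) by force
    then show ?thesis unfolding sh by simp
  qed
  have inv': "(X1 t)\<^sup>2 * (b * pot (Inv_Square \<mu>) (X1 t * x + X0 t)) = b * \<mu> / (x + \<beta>)\<^sup>2" for \<mu> x
    unfolding sh using X1 by (simp add: power_mult_distrib)
  show ?thesis
  proof (cases p)
    case (General J C) then show ?thesis using ng by blast
  next
    case p1: (Inv_Square \<mu>)
    have \<mu>: "\<mu> \<noteq> 0" using p(1) p1 by simp
    show ?thesis
    proof (cases p')
      case (General J C) then show ?thesis using ng by blast
    next
      case p2: (Inv_Square \<mu>')
      \<comment> \<open>The constant coefficient gives \<beta> = 0, and the coefficient of x^2 then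
        gives \<mu>' = \<mu>.\<close>
      let ?p = "[:- b * \<mu> * \<beta>\<^sup>2, - 2 * b * \<mu> * \<beta>, b * (\<mu>' - \<mu>):] - [:q0, q1, q2:] * [:0, 0, \<beta>\<^sup>2, 2 * \<beta>, 1:]"
      have "?p = 0"
      proof (rule poly_zero_on_open[OF K])
        fix x assume x: "x \<in> ?K"
        define y where "y = x + \<beta>"
        have y: "y \<noteq> 0" using x0'[OF p2 x] by (simp add: y_def)
        have "b * \<mu>' / y\<^sup>2 = b * (\<mu> / x\<^sup>2) + (q2 * x\<^sup>2 + q1 * x + q0)"
          using rel[OF x] unfolding p2 inv' p1 by (simp add: y_def)
        then have "b * \<mu>' * x\<^sup>2 = b * \<mu> * y\<^sup>2 + (q2 * x\<^sup>2 + q1 * x + q0) * x\<^sup>2 * y\<^sup>2"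
          using y x0[OF p1 x] by (simp add: field_simps)
        then show "poly ?p x = 0"
          unfolding y_def poly_diff poly_mult poly_pCons poly_0 by algebra
      qed
      then have "b = 0 \<or> \<mu> = 0 \<or> \<beta> = 0" and 2: "b * (\<mu>' - \<mu>) = \<beta>\<^sup>2 * q0" by simp_all
      then have "\<beta> = 0" using b0 \<mu> by simp
      with 2 have "\<mu>' = \<mu>" using b0 by simp
      then show ?thesis using p1 p2 by simp
    next
      case p2: Zero
      let ?p = "[:b * \<mu>:] + [:q0, q1, q2:] * [:0, 0, 1:]"
      have "?p = 0"
      proof (rule poly_zero_on_open[OF K])
        fix x assume x: "x \<in> ?K"
        have "0 = b * (\<mu> / x\<^sup>2) + (q2 * x\<^sup>2 + q1 * x + q0)" using rel[OF x] unfolding p1 p2 by simp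
        then have "0 = b * \<mu> + (q2 * x\<^sup>2 + q1 * x + q0) * x\<^sup>2" using x0[OF p1 x] by (simp add: field_simps)
        then show "poly ?p x = 0" unfolding poly_add poly_mult poly_pCons poly_0 by algebra
      qed
      \<comment> \<open>Evaluation at the pole, which lies outside the slice, isolates the
        coefficient of the pole.\<close>
      then have "poly ?p 0 = 0" by (metis poly_0)
      then show ?thesis using b0 \<mu> by simp
    qed
  next
    case p1: Zero
    show ?thesis
    proof (cases p')
      case (General J C) then show ?thesis using ng by blast
    next
      case p2: (Inv_Square \<mu>')
      have \<mu>: "\<mu>' \<noteq> 0" using p(2) p2 by simp
      let ?p = "[:b * \<mu>':] - [:q0, q1, q2:] * [:\<beta>, 1:]\<^sup>2"
      have "?p = 0"
      proof (rule poly_zero_on_open[OF K])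
        fix x assume x: "x \<in> ?K"
        define y where "y = x + \<beta>"
        have y: "y \<noteq> 0" using x0'[OF p2 x] by (simp add: y_def)
        have "b * \<mu>' / y\<^sup>2 = q2 * x\<^sup>2 + q1 * x + q0" using rel[OF x] unfolding p2 inv' p1 by (simp add: y_def)
        then have "b * \<mu>' = (q2 * x\<^sup>2 + q1 * x + q0) * y\<^sup>2" using y by (simp add: field_simps)
        then show "poly ?p x = 0" unfolding y_def poly_diff poly_mult poly_power poly_pCons poly_0 by algebra
      qed
      then have "poly ?p (- \<beta>) = 0" by (metis poly_0)
      then have "b * \<mu>' = 0" unfolding poly_diff poly_mult poly_power poly_pCons poly_0 by simp
      then show ?thesis using b0 \<mu> by simp
    next
      case Zero then show ?thesis using p1 by simp
    qed
  qed
qed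

lemma heat_holds_at:
  "holds_at (heat_with_potential e C) w z \<longleftrightarrow> Dt w z - e * Dx (Dx w) z - C (snd z) * w z = 0"
  by (simp add: heat_with_potential_def case_prod_unfold algebra_simps)

text \<open>The map between the arbitrary elements lifts to a transformation of (t, x, u) with
  multiplier M. Both potentials being the same, \<open>potential_law\<close> identifies the two
  equations point by point for arbitrary functions, so the lift is a point symmetry.\<close>

lemma same_potential_solution_equiv:
  assumes \<epsilon>: "\<epsilon> \<in> {-1, 1}" and U: "(\<Omega>, U) \<in> nonzero_solutions L \<epsilon> p" and U': "(\<Omega>', U') \<in> nonzero_solutions L \<epsilon> p"
    and map: "arb_map (breve L) \<Omega> (case_elements L \<epsilon> U) \<Omega>' (case_elements L \<epsilon> U') T X"
  shows "solution_equiv L \<epsilon> p (\<Omega>, U) (\<Omega>', U')"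
proof -
  note S = nonzero_solutionsD[OF U] and S' = nonzero_solutionsD[OF U']
  define e where "e = \<epsilon> * breve L"
  define c where "c x = breve L * pot p x" for x
  have h: "heat_solution e \<Omega> (\<lambda>z. c (snd z)) U" "heat_solution e \<Omega>' (\<lambda>z. c (snd z)) U'"
    using S(3) S'(3) by (simp_all add: e_def c_def)
  obtain X1 X0 V where hm: "heat_map \<Omega> T X1 X0 V e" and "\<And>z. z \<in> \<Omega> \<Longrightarrow> X z = heat_map.X X1 X0 z"
    and \<Omega>': "\<Omega>' = fibre_map T (heat_map.X X1 X0) ` \<Omega>"
    and UU: "\<And>z. z \<in> \<Omega> \<Longrightarrow> U' (fibre_map T (heat_map.X X1 X0) z) = heat_map.M X1 X0 V e z * U z"
    using heat_map_of_arb_map[OF \<epsilon> e_def h map] by blast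
  interpret H: heat_map \<Omega> T X1 X0 V e by fact
  define \<Phi> :: point_trafo where "\<Phi> = (\<lambda>(t, x, u). (T t, X1 t * x + X0 t, H.M (t, x) * u))"
  have rel: "(X1 (fst z))\<^sup>2 * c (snd (fibre_map T H.X z)) = c (snd z) + H.Q z" if "z \<in> \<Omega>" for z
    by (rule H.heat_potential_relation[OF h(1) h(2)[unfolded \<Omega>'] UU that])
  have graph: "\<Phi> (t, x, w (t, x)) = (T t, H.X (t, x), H.M (t, x) * w (t, x))" for t x and w :: fld
    by (simp add: \<Phi>_def H.X_def)
  have "point_symmetry (heat_with_potential e c) \<Omega> \<Omega>' \<Phi>"
    unfolding point_symmetry_def
  proof (intro allI impI, elim conjE)
    fix w w' :: fld and t x t' x' u'
    assume w: "smooth_on \<Omega> w" and w': "smooth_on \<Omega>' w'" and g: "\<Phi> ` graph_of \<Omega> w = graph_of \<Omega>' w'"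
      and z: "(t, x) \<in> \<Omega>" and \<Phi>: "\<Phi> (t, x, w (t, x)) = (t', x', u')"
    have eq: "w' (fibre_map T H.X z) = H.M z * w z" if z: "z \<in> \<Omega>" for z
    proof -
      obtain t x where tx: "z = (t, x)" by force
      have "(t, x, w (t, x)) \<in> graph_of \<Omega> w" using z tx by (auto simp: graph_of_def)
      then have "(T t, H.X (t, x), H.M (t, x) * w (t, x)) \<in> graph_of \<Omega>' w'"
        unfolding g[symmetric] graph[symmetric] by blast
      then show ?thesis unfolding graph_of_def tx by auto
    qed
    have tx': "(t', x') = fibre_map T H.X (t, x)" using \<Phi> unfolding graph by simp
    have t: "t \<in> fst ` \<Omega>" using z by force
    have "(X1 t)\<^sup>2 * (Dt w' (t', x') - e * Dx (Dx w') (t', x') - c x' * w' (t', x'))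
        = H.M (t, x) * (Dt w (t, x) - e * Dx (Dx w) (t, x) - ((X1 t)\<^sup>2 * c x' - H.Q (t, x)) * w (t, x))"
      unfolding tx' using H.potential_law[OF w w'[unfolded \<Omega>'] eq z, of "c x'"] by simp
    also have "(X1 t)\<^sup>2 * c x' - H.Q (t, x) = c x"
    proof -
      have "snd (fibre_map T H.X (t, x)) = x'" using tx' by (metis snd_conv)
      then show ?thesis using rel[OF z] by simp
    qed
    finally show "holds_at (heat_with_potential e c) w (t, x) = holds_at (heat_with_potential e c) w' (t', x')"
      unfolding heat_holds_at snd_conv using H.nonzero(1)[OF t] H.M_nonzero[OF z]
      by (metis mult_eq_0_iff power_eq_0_iff)
  qed
  moreover have "\<exists>T X\<^sub>1 X\<^sub>0 V. smooth_on (fst ` \<Omega>) T \<and> smooth_on (fst ` \<Omega>) X\<^sub>1 \<and> smooth_on (fst ` \<Omega>) X\<^sub>0 \<and> smooth_on (fst ` \<Omega>) V \<and>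
       (\<forall>t x. (t, x) \<in> \<Omega> \<longrightarrow> deriv T t = (X\<^sub>1 t)\<^sup>2 \<and> X\<^sub>1 t \<noteq> 0 \<and> V t \<noteq> 0 \<and>
         (\<forall>u. \<Phi> (t, x, u) = (T t, X\<^sub>1 t * x + X\<^sub>0 t,
            V t * exp (- (e * deriv X\<^sub>1 t / (4 * X\<^sub>1 t)) * x\<^sup>2 - e * deriv X\<^sub>0 t / (2 * X\<^sub>1 t) * x) * u)))"
    by (rule exI[of _ T], rule exI[of _ X1], rule exI[of _ X0], rule exI[of _ V])
      (use H.smooth H.T_deriv_eq H.nonzero in \<open>force simp: \<Phi>_def H.M_def\<close>)
  ultimately have "\<Phi> \<in> ess_symmetry_group e c \<Omega> \<Omega>'" unfolding ess_symmetry_group_def by blast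
  moreover have "\<Phi> ` graph_of \<Omega> U = graph_of \<Omega>' U'"
  proof (intro equalityI subsetI)
    fix q assume "q \<in> \<Phi> ` graph_of \<Omega> U"
    then obtain t x where tx: "(t, x) \<in> \<Omega>" "q = \<Phi> (t, x, U (t, x))" unfolding graph_of_def by blast
    have "q = (T t, H.X (t, x), U' (T t, H.X (t, x)))" unfolding tx(2) graph using UU[OF tx(1)] by simp
    moreover have "(T t, H.X (t, x)) \<in> \<Omega>'" unfolding \<Omega>' using tx(1) by force
    ultimately show "q \<in> graph_of \<Omega>' U'" unfolding graph_of_def by blast
  next
    fix q assume "q \<in> graph_of \<Omega>' U'"
    then obtain y where y: "y \<in> \<Omega>'" "q = (fst y, snd y, U' y)" unfolding graph_of_def by force
    then obtain t x where tx: "(t, x) \<in> \<Omega>" "y = (T t, H.X (t, x))" unfolding \<Omega>' by force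
    have "q = \<Phi> (t, x, U (t, x))" unfolding graph y(2) tx(2) using UU[OF tx(1)] by simp
    then show "q \<in> \<Phi> ` graph_of \<Omega> U" using tx(1) unfolding graph_of_def by blast
  qed
  ultimately show ?thesis unfolding solution_equiv.simps e_def c_def by blast
qed

section \<open>Completeness of the list\<close>

lemma box_domain:
  fixes a b c d :: real
  assumes "a < b" "c < d"
  shows "is_domain ({a<..<b} \<times> {c<..<d})" "fst ` ({a<..<b} \<times> {c<..<d}) = {a<..<b}"
    "snd ` ({a<..<b} \<times> {c<..<d}) = {c<..<d}"
proof -
  have "{x. (t, x) \<in> {a<..<b} \<times> {c<..<d}} = (if t \<in> {a<..<b} then {c<..<d} else {})" for t
    by auto
  then have "connected {x. (t, x) \<in> {a<..<b} \<times> {c<..<d}}" for t by simp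
  then show "is_domain ({a<..<b} \<times> {c<..<d})"
    using assms unfolding is_domain_def
    by (auto intro!: open_Times connected_Times)
qed (use assms in auto)

lemma members_subset: "(A, B) \<in> members L \<epsilon> \<Omega> \<Longrightarrow> \<Omega>1 \<subseteq> \<Omega> \<Longrightarrow> (A, B) \<in> members L \<epsilon> \<Omega>1"
  by (cases L) (auto intro: smooth_on_subset)

lemma heat_solution_subset: "heat_solution e \<Omega> c U \<Longrightarrow> \<Omega>1 \<subseteq> \<Omega> \<Longrightarrow> heat_solution e \<Omega>1 c U"
  by (auto simp: heat_solution_def intro: smooth_on_subset)

lemma determining_subset:
  "determining \<Omega> E \<tau> \<xi> \<eta> \<Longrightarrow> \<Omega>1 \<subseteq> \<Omega> \<Longrightarrow> determining \<Omega>1 E \<tau> \<xi> \<eta>"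
  by (cases E) (auto intro: smooth_on_subset)

lemma determining_constant_A_cong:
  assumes \<Omega>: "open \<Omega>" and B: "\<And>z. z \<in> \<Omega> \<Longrightarrow> B z = B' z"
    and det: "determining \<Omega> (equation L (\<lambda>_. \<epsilon>, B)) \<tau> \<xi> \<eta>"
  shows "determining \<Omega> (equation L (\<lambda>_. \<epsilon>, B')) \<tau> \<xi> \<eta>"
proof -
  define c where "c z = (if breve L = 1 then 0 else Dx B z)" for z
  define c' where "c' z = (if breve L = 1 then 0 else Dx B' z)" for z
  have c: "c z = c' z" if "z \<in> \<Omega>" for z
    using partials_cong(2)[OF \<Omega> B that] by (simp add: c_def c'_def)
  have "det1 (\<lambda>_. \<epsilon>) B' \<tau> \<xi> \<eta> z = det1 (\<lambda>_. \<epsilon>) B \<tau> \<xi> \<eta> z"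
    "det0 (\<lambda>_. \<epsilon>) B' c' \<tau> \<xi> \<eta> z = det0 (\<lambda>_. \<epsilon>) B c \<tau> \<xi> \<eta> z" if "z \<in> \<Omega>" for z
    unfolding det1_def det0_def using partials_cong[OF \<Omega> B that] partials_cong[OF \<Omega> c that] B[OF that] c[OF that]
    by simp_all
  then show ?thesis
    using det unfolding equation_constant_A c_def[symmetric] c'_def[symmetric] by simp
qed

text \<open>Normalises \<open>A\<close> to \<open>\<epsilon>\<close> provided that \<open>X\<^sub>x\<^sup>2 A = \<epsilon> T\<^sub>t\<close>.\<close>
lemma arb_map_construct:
  assumes F: "fibre_diffeo \<Omega> T X" and AB: "smooth_on \<Omega> A" "smooth_on \<Omega> B"
    and A: "\<And>z. z \<in> \<Omega> \<Longrightarrow> (Dx X z)\<^sup>2 * A z = \<epsilon> * deriv T (fst z)"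
  obtains B' where "smooth_on (fibre_map T X ` \<Omega>) B'"
    "arb_map b \<Omega> (A, B) (fibre_map T X ` \<Omega>) (\<lambda>_. \<epsilon>, B') T X"
proof -
  interpret fibre_diffeo \<Omega> T X by fact
  define B1 where "B1 z = (Dx X z * B z - Dt X z + b * Dx (Dx X) z * A z) / deriv T (fst z)" for z
  note sp = smooth_on_partials[OF opens(1)]
  have "smooth_on \<Omega> (\<lambda>z. deriv T (fst z))"
    by (rule smooth_on_of_time[OF opens(1) smooth_on_deriv(2)[OF opens(2) T]])
  then have s: "smooth_on \<Omega> B1"
    unfolding B1_def
    by (intro smooth_on_divide smooth_on_add smooth_on_diff smooth_on_mult smooth_on_const opens sp X AB T_ne) auto
  show ?thesis
  proof (rule that[of "\<lambda>z. B1 (G z)"])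
    show "smooth_on (fibre_map T X ` \<Omega>) (\<lambda>z. B1 (G z))" by (rule push_smooth[OF s])
    have "B1 (G (fibre_map T X z)) * deriv T (fst z) = Dx X z * B z - Dt X z + b * Dx (Dx X) z * A z" if "z \<in> \<Omega>" for z
      using T_ne[of "fst z"] that by (simp only: GF[OF that]) (simp add: B1_def)
    then show "arb_map b \<Omega> (A, B) (fibre_map T X ` \<Omega>) (\<lambda>_. \<epsilon>, \<lambda>z. B1 (G z)) T X"
      using F A by simp
  qed
qed

text \<open>An exponential for \<kappa> \<ge> 0 and, for \<kappa> < 0, a cosine within a quarter
  period of its maximum. Such a y serves as 1 / X1 in order to remove the quadratic part of a
  potential.\<close>

lemma oscillator_solution:
  fixes \<kappa> t0 :: real
  obtains r y where "r > 0" "smooth_on {t0-r<..<t0+r} y" "\<And>t. t \<in> {t0-r<..<t0+r} \<Longrightarrow> y t > 0"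
    "\<And>t. deriv (deriv y) t = \<kappa> * y t"
proof (cases "\<kappa> \<ge> 0")
  case True
  define w where "w = sqrt \<kappa>"
  define y where "y t = exp (w * t)" for t
  have d: "deriv (\<lambda>t. k * exp (w * t)) = (\<lambda>t. (k * w) * exp (w * t))" for k
    by (rule ext, rule DERIV_imp_deriv) (auto intro!: derivative_eq_intros)
  have "deriv y = (\<lambda>t. w * exp (w * t))" using d[of 1] by (simp add: y_def[abs_def])
  then have "deriv (deriv y) = (\<lambda>t. (w * w) * exp (w * t))" by (simp only: d)
  moreover have "w * w = \<kappa>" using True by (simp add: w_def)
  ultimately have "deriv (deriv y) t = \<kappa> * y t" for t by (simp only: y_def)
  moreover have "smooth_on {t0-1<..<t0+1} y"
    unfolding y_def by (intro smooth_on_exp_compose smooth_on_mult smooth_on_const smooth_on_id) auto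
  ultimately show ?thesis using that[of 1 y] by (simp add: y_def)
next
  case False
  define w where "w = sqrt (- \<kappa>)"
  have w: "w > 0" "w * w = - \<kappa>" using False by (simp_all add: w_def)
  define r where "r = pi / (2 * w)"
  define y where "y t = cos (w * (t - t0))" for t
  have "deriv y = (\<lambda>t. - w * sin (w * (t - t0)))"
    unfolding y_def[abs_def] by (rule ext, rule DERIV_imp_deriv) (auto intro!: derivative_eq_intros)
  moreover have "deriv (\<lambda>t. - w * sin (w * (t - t0))) = (\<lambda>t. - (w * w) * cos (w * (t - t0)))"
    by (rule ext, rule DERIV_imp_deriv) (auto intro!: derivative_eq_intros)
  ultimately have "deriv (deriv y) t = \<kappa> * y t" for t unfolding y_def using w(2) by simp
  moreover have "smooth_on {t0-r<..<t0+r} y"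
    unfolding y_def
    by (rule smooth_on_compose[OF smooth_on_sin_cos(2)]) (auto intro!: smooth_on_mult smooth_on_diff smooth_on_const smooth_on_id)
  moreover have "y t > 0" if "t \<in> {t0-r<..<t0+r}" for t
  proof -
    have "\<bar>t - t0\<bar> < r" using that by auto
    then have "w * \<bar>t - t0\<bar> < w * r" using w(1) by simp
    then have "\<bar>w * (t - t0)\<bar> < pi / 2" using w(1) by (simp add: abs_mult r_def)
    then show ?thesis unfolding y_def by (intro cos_gt_zero_pi) auto
  qed
  moreover have "r > 0" using w(1) by (simp add: r_def)
  ultimately show ?thesis using that by blast
qed

text \<open>Every \<open>x\<close>-free part of \<open>Q\<close> can be achieved by the choice of \<open>V\<close>.\<close>
lemma heat_map_construct:
  fixes y z g :: "real \<Rightarrow> real"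
  assumes ab: "a < b" "c < d" and e: "e \<in> {-1, 1}"
    and sm: "smooth_on {a<..<b} y" "smooth_on {a<..<b} z" "smooth_on {a<..<b} g" and y: "\<And>t. t \<in> {a<..<b} \<Longrightarrow> y t \<noteq> 0"
  obtains T V where "heat_map ({a<..<b} \<times> {c<..<d}) T (\<lambda>t. 1 / y t) (\<lambda>t. z t / y t) V e"
    "\<forall>t x. (t, x) \<in> {a<..<b} \<times> {c<..<d} \<longrightarrow> heat_map.Q (\<lambda>t. 1 / y t) (\<lambda>t. z t / y t) V e (t, x)
      = e / 4 * (deriv (deriv y) t / y t) * x\<^sup>2 + e / 2 * (z t * deriv (deriv y) t / y t - deriv (deriv z) t) * x + g t"
proof -
  let ?N = "{a<..<b}" and ?\<Omega> = "{a<..<b} \<times> {c<..<d}"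
  let ?X1 = "\<lambda>t. 1 / y t" and ?X0 = "\<lambda>t. z t / y t"
  have N: "open ?N" by simp
  note dy = smooth_on_deriv[OF N sm(1)] note d2y = smooth_on_deriv[OF N dy(2)]
  note dz = smooth_on_deriv[OF N sm(2)] note d2z = smooth_on_deriv[OF N dz(2)]
  have sX: "smooth_on ?N ?X1" "smooth_on ?N ?X0" by (intro smooth_on_divide smooth_on_const N sm y; assumption)+
  have dX: "deriv ?X1 t = - deriv y t / (y t)\<^sup>2" "deriv ?X0 t = (deriv z t * y t - z t * deriv y t) / (y t)\<^sup>2" if t: "t \<in> ?N" for t
    by (rule DERIV_imp_deriv, use dy(1)[OF t] y[OF t] in \<open>auto intro!: derivative_eq_intros simp: power2_eq_square\<close>,
        rule DERIV_imp_deriv, use dy(1)[OF t] dz(1)[OF t] y[OF t] in \<open>auto intro!: derivative_eq_intros simp: power2_eq_square\<close>)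
  define p where "p t = deriv ?X1 t / ?X1 t" for t
  define r where "r t = deriv ?X0 t / ?X1 t" for t
  have p: "p t = - deriv y t / y t" and r: "r t = deriv z t - z t * deriv y t / y t" if t: "t \<in> ?N" for t
    unfolding p_def r_def dX[OF t] using y[OF t] by (simp_all add: field_simps power2_eq_square)
  have transfer: "deriv f t = D" if "\<And>t. t \<in> ?N \<Longrightarrow> f t = h t" "t \<in> ?N" "(h has_real_derivative D) (at t)" for f h :: "real \<Rightarrow> real" and t D
    by (rule DERIV_imp_deriv, rule has_field_derivative_transform_within_open[OF that(3) N that(2)]) (simp add: that(1))
  have p': "deriv p t = - (deriv (deriv y) t * y t - (deriv y t)\<^sup>2) / (y t)\<^sup>2" if t: "t \<in> ?N" for t
    by (rule transfer[OF p t])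
      (use dy(1)[OF t] d2y(1)[OF t] y[OF t] in \<open>auto intro!: derivative_eq_intros simp: field_simps power2_eq_square\<close>)
  have r': "deriv r t = deriv (deriv z) t - ((deriv z t * deriv y t + z t * deriv (deriv y) t) * y t - z t * (deriv y t)\<^sup>2) / (y t)\<^sup>2"
    if t: "t \<in> ?N" for t
    by (rule transfer[OF r t])
      (use dy(1)[OF t] d2y(1)[OF t] dz(1)[OF t] d2z(1)[OF t] y[OF t] in
        \<open>auto intro!: derivative_eq_intros simp: field_simps power2_eq_square\<close>)
  have sp: "smooth_on ?N p" "smooth_on ?N r"
    unfolding p_def[abs_def] r_def[abs_def]
    by (rule smooth_on_divide[OF N _ sX(1)], rule smooth_on_deriv(2)[OF N sX(1)], simp add: y,
        rule smooth_on_divide[OF N _ sX(1)], rule smooth_on_deriv(2)[OF N sX(2)], simp add: y)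
  have "smooth_on ?N (\<lambda>t. (1 / y t)\<^sup>2)" by (intro smooth_on_power sX N)
  then obtain T where T: "smooth_on ?N T" "\<And>t. t \<in> ?N \<Longrightarrow> (T has_real_derivative (1 / y t)\<^sup>2) (at t)"
    by (rule antiderivative) blast
  have "smooth_on ?N (\<lambda>t. g t - (p t / 2 + e / 4 * (r t)\<^sup>2))"
    by (intro smooth_on_diff smooth_on_add smooth_on_mult smooth_on_power smooth_on_divide smooth_on_const sp sm N) auto
  then obtain A where A: "smooth_on ?N A" "\<And>t. t \<in> ?N \<Longrightarrow> (A has_real_derivative g t - (p t / 2 + e / 4 * (r t)\<^sup>2)) (at t)"
    by (rule antiderivative) blast
  \<comment> \<open>An exponential realises any prescribed logarithmic derivative without zeros;
    this one makes the x-free part of Q equal to \<open>g\<close>.\<close>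
  define V where "V t = exp (A t)" for t
  have V: "deriv V t / V t = g t - (p t / 2 + e / 4 * (r t)\<^sup>2)" if t: "t \<in> ?N" for t
  proof -
    have "(V has_real_derivative V t * (g t - (p t / 2 + e / 4 * (r t)\<^sup>2))) (at t)"
      unfolding V_def[abs_def] by (auto intro!: derivative_eq_intros A(2)[OF t])
    from DERIV_imp_deriv[OF this] show ?thesis by (simp add: V_def)
  qed
  note box = box_domain[OF ab]
  have hm: "heat_map ?\<Omega> T ?X1 ?X0 V e"
  proof
    show "deriv T t = (1 / y t)\<^sup>2" if "t \<in> fst ` ?\<Omega>" for t using DERIV_imp_deriv[OF T(2)] that box(2) by simp
    show "smooth_on (fst ` ?\<Omega>) V" unfolding box(2) V_def by (rule smooth_on_exp_compose[OF N A(1)])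
  qed (use box T(1) sX y e in \<open>auto simp: V_def\<close>)
  interpret H: heat_map ?\<Omega> T ?X1 ?X0 V e by (rule hm)
  have pr: "H.p = p" "H.r = r" by (simp_all add: fun_eq_iff H.p_def H.r_def p_def r_def)
  have "H.Q (t, x) = e / 4 * (deriv (deriv y) t / y t) * x\<^sup>2 + e / 2 * (z t * deriv (deriv y) t / y t - deriv (deriv z) t) * x + g t"
    if "(t, x) \<in> ?\<Omega>" for t x
  proof -
    have t: "t \<in> ?N" using that by auto
    \<comment> \<open>The reason for the parameters y = 1 / X1 and z = X0 / X1: the Riccati
      expression in p becomes y'' / y, so cancelling a quadratic term amounts to a linear equation
      for y.\<close>
    have 1: "(p t)\<^sup>2 - deriv p t = deriv (deriv y) t / y t"
      unfolding p[OF t] p'[OF t] using y[OF t] by (simp add: field_simps power2_eq_square)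
    have 2: "p t * r t - deriv r t = z t * deriv (deriv y) t / y t - deriv (deriv z) t"
      unfolding p[OF t] r[OF t] r'[OF t] using y[OF t] by (simp add: field_simps power2_eq_square)
    show ?thesis unfolding H.Q_def pr fst_conv snd_conv 1 2 V[OF t] by simp
  qed
  then show ?thesis by (intro that[OF hm] allI impI)
qed

section \<open>Reachability of a listed case after shrinking the domain\<close>

locale classification =
  fixes L :: eqclass and \<epsilon> :: real and \<C> :: "(real set \<times> (real \<Rightarrow> real)) set" and \<U> :: "potential \<Rightarrow> (dom \<times> fld) set"
  assumes \<epsilon>: "\<epsilon> \<in> {-1, 1}" and C_complete: "complete_inequivalent potential_equiv general_potentials \<C>"
    and U_complete: "\<And>p. p \<in> listed_potentials \<C> \<Longrightarrow>
      complete_inequivalent (solution_equiv L \<epsilon> p) (nonzero_solutions L \<epsilon> p) (\<U> p)"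
begin

lemma listed_valid: "p \<in> listed_potentials \<C> \<Longrightarrow> valid_potential p"
  using C_complete by (auto simp: listed_potentials_def complete_inequivalent_def)

lemma listed_solution: "p \<in> listed_potentials \<C> \<Longrightarrow> z \<in> \<U> p \<Longrightarrow> z \<in> nonzero_solutions L \<epsilon> p"
  using U_complete unfolding complete_inequivalent_def by blast

definition e :: real where "e = \<epsilon> * breve L"

lemma e: "e \<in> {-1, 1}" "e * e = 1" "\<epsilon> * \<epsilon> = 1" "breve L * breve L = 1"
  using \<epsilon> breve_cases[of L] by (auto simp: e_def)

text \<open>The assertion of completeness for one equation. The classification is local, so the
  equivalence is asked for on a subdomain.\<close>

definition reachable :: "dom \<Rightarrow> arb \<Rightarrow> bool"
  where "reachable \<Omega> AB \<longleftrightarrow> (\<exists>\<Omega>1 p \<Omega>2 U. is_domain \<Omega>1 \<and> \<Omega>1 \<subseteq> \<Omega> \<and> p \<in> listed_potentials \<C> \<and> (\<Omega>2, U) \<in> \<U> p \<and>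
    arb_equiv L \<Omega>1 AB \<Omega>2 (case_elements L \<epsilon> U))"

lemma reachable_mono: "reachable \<Omega>1 AB \<Longrightarrow> \<Omega>1 \<subseteq> \<Omega> \<Longrightarrow> reachable \<Omega> AB"
  unfolding reachable_def by blast

lemma listed_member:
  assumes "p \<in> listed_potentials \<C>" "(\<Omega>, U) \<in> \<U> p"
  shows "case_elements L \<epsilon> U \<in> members L \<epsilon> \<Omega>"
  using nonzero_solutionsD[OF listed_solution[OF assms]] is_domainD(1) case_elements_member[OF \<epsilon>] by blast

lemma reachable_cong:
  assumes "\<And>z. z \<in> \<Omega> \<Longrightarrow> A z = A' z \<and> B z = B' z" "reachable \<Omega> (A, B)"
  shows "reachable \<Omega> (A', B')"
proof -
  have "arb_graph \<Omega>1 (A, B) = arb_graph \<Omega>1 (A', B')" if "\<Omega>1 \<subseteq> \<Omega>" for \<Omega>1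
    using assms(1) that by (auto 0 3)
  then have "arb_equiv L \<Omega>1 (A, B) \<Omega>2 X = arb_equiv L \<Omega>1 (A', B') \<Omega>2 X" if "\<Omega>1 \<subseteq> \<Omega>" for \<Omega>1 \<Omega>2 X
    using that by (simp only: arb_equiv_def)
  then show ?thesis using assms(2) unfolding reachable_def by blast
qed

text \<open>The subdomain found in the image is pulled back along the map, and the two maps are
  composed.\<close>

lemma reachable_transport:
  assumes map: "arb_map (breve L) \<Omega> (A, B) \<Omega>' (A', B') T X"
    and mem: "(A, B) \<in> members L \<epsilon> \<Omega>" "(A', B') \<in> members L \<epsilon> \<Omega>'" and r: "reachable \<Omega>' (A', B')"
  shows "reachable \<Omega> (A, B)"
proof -
  obtain \<Omega>1 p \<Omega>2 U where \<Omega>1: "is_domain \<Omega>1" "\<Omega>1 \<subseteq> \<Omega>'" and p: "p \<in> listed_potentials \<C>" "(\<Omega>2, U) \<in> \<U> p"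
    and eq: "arb_equiv L \<Omega>1 (A', B') \<Omega>2 (case_elements L \<epsilon> U)"
    using r unfolding reachable_def by blast
  have F: "fibre_diffeo \<Omega> T X" and \<Omega>': "\<Omega>' = fibre_map T X ` \<Omega>" using map by auto
  let ?P = "{z \<in> \<Omega>. fibre_map T X z \<in> \<Omega>1}"
  note P = is_domain_preimage[OF F \<Omega>1(1) \<Omega>1(2)[unfolded \<Omega>']]
  have m1: "arb_map (breve L) ?P (A, B) \<Omega>1 (A', B') T X"
    using arb_map_subset[OF map P(1)] unfolding P(2) by blast
  note mU = listed_member[OF p]
  obtain A2 B2 where AB2: "case_elements L \<epsilon> U = (A2, B2)" by (metis surj_pair)
  obtain S Y where m2: "arb_map (breve L) \<Omega>1 (A', B') \<Omega>2 (A2, B2) S Y"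
    using arb_equiv_imp_map[OF \<epsilon> \<Omega>1(1) members_subset[OF mem(2) \<Omega>1(2)] mU[unfolded AB2] eq[unfolded AB2]] by blast
  have "arb_equiv L ?P (A, B) \<Omega>2 (A2, B2)"
    by (rule arb_map_imp_equiv[OF \<epsilon> members_subset[OF mem(1)] mU[unfolded AB2] arb_map_compose[OF m1 m2]]) blast
  then show ?thesis unfolding reachable_def AB2[symmetric] using P(1) p by blast
qed

text \<open>\<open>U\<close> need not be the chosen representative of its orbit. The essential point
  symmetry that leads to the representative has the shape of a \<open>heat_map\<close>, so it
  induces an equivalence of the arbitrary elements.\<close>

lemma reachable_solution:
  assumes p: "p \<in> listed_potentials \<C>" and U: "(\<Omega>, U) \<in> nonzero_solutions L \<epsilon> p"
  shows "reachable \<Omega> (case_elements L \<epsilon> U)"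
proof -
  obtain \<Omega>2 U2 where U2: "(\<Omega>2, U2) \<in> \<U> p" and eq: "solution_equiv L \<epsilon> p (\<Omega>, U) (\<Omega>2, U2)"
    using U_complete[OF p] U unfolding complete_inequivalent_def by fast
  note S = nonzero_solutionsD[OF U, folded e_def] and S2 = nonzero_solutionsD[OF listed_solution[OF p U2], folded e_def]
  obtain \<Phi> where \<Phi>: "\<Phi> \<in> ess_symmetry_group e (\<lambda>x. breve L * pot p x) \<Omega> \<Omega>2" "\<Phi> ` graph_of \<Omega> U = graph_of \<Omega>2 U2"
    using eq by (auto simp: e_def)
  obtain T X1 X0 V where sm: "smooth_on (fst ` \<Omega>) T" "smooth_on (fst ` \<Omega>) X1" "smooth_on (fst ` \<Omega>) X0" "smooth_on (fst ` \<Omega>) V"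
    and f: "\<And>t x. (t, x) \<in> \<Omega> \<Longrightarrow> deriv T t = (X1 t)\<^sup>2 \<and> X1 t \<noteq> 0 \<and> V t \<noteq> 0 \<and> (\<forall>u. \<Phi> (t, x, u) = (T t, X1 t * x + X0 t,
            V t * exp (- (e * deriv X1 t / (4 * X1 t)) * x\<^sup>2 - e * deriv X0 t / (2 * X1 t) * x) * u))"
    using \<Phi>(1) unfolding ess_symmetry_group_def by blast
  interpret H: heat_map \<Omega> T X1 X0 V e
  proof
    have "deriv T t = (X1 t)\<^sup>2 \<and> X1 t \<noteq> 0 \<and> V t \<noteq> 0" if t: "t \<in> fst ` \<Omega>" for t
    proof -
      obtain x where "(t, x) \<in> \<Omega>" using t by force
      then show ?thesis using f by blast
    qed
    then show "\<And>t. t \<in> fst ` \<Omega> \<Longrightarrow> deriv T t = (X1 t)\<^sup>2" "\<And>t. t \<in> fst ` \<Omega> \<Longrightarrow> X1 t \<noteq> 0" "\<And>t. t \<in> fst ` \<Omega> \<Longrightarrow> V t \<noteq> 0" by blast+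
  qed (use S(1) sm e in auto)
  have g: "\<Phi> (t, x, u) = (T t, H.X (t, x), H.M (t, x) * u)" if "(t, x) \<in> \<Omega>" for t x u
    using f[OF that] by (simp add: H.X_def H.M_def)
  have 1: "(T t, H.X (t, x)) \<in> \<Omega>2 \<and> U2 (T t, H.X (t, x)) = H.M (t, x) * U (t, x)" if tx: "(t, x) \<in> \<Omega>" for t x
  proof -
    have "(t, x, U (t, x)) \<in> graph_of \<Omega> U" unfolding graph_of_def using tx by blast
    then have "\<Phi> (t, x, U (t, x)) \<in> graph_of \<Omega>2 U2" unfolding \<Phi>(2)[symmetric] by (rule imageI)
    then show ?thesis unfolding g[OF tx] graph_of_def by auto
  qed
  have \<Omega>2: "\<Omega>2 = fibre_map T H.X ` \<Omega>"
  proof (intro equalityI subsetI)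
    fix y assume "y \<in> \<Omega>2"
    then have "(fst y, snd y, U2 y) \<in> graph_of \<Omega>2 U2" unfolding graph_of_def by simp
    then have "(fst y, snd y, U2 y) \<in> \<Phi> ` graph_of \<Omega> U" unfolding \<Phi>(2) .
    then obtain t x where tx: "(t, x) \<in> \<Omega>" "(fst y, snd y, U2 y) = \<Phi> (t, x, U (t, x))" unfolding graph_of_def by blast
    then have "y = fibre_map T H.X (t, x)" unfolding g[OF tx(1)] by (simp add: prod_eq_iff)
    then show "y \<in> fibre_map T H.X ` \<Omega>" using tx(1) by blast
  qed (use 1 in auto)
  have UU: "U2 (fibre_map T H.X z) = H.M z * U z" if "z \<in> \<Omega>" for z using 1[of "fst z" "snd z"] that by (simp add: case_prod_unfold)
  have "arb_map (breve L) \<Omega> (case_elements L \<epsilon> U) \<Omega>2 (case_elements L \<epsilon> U2) T H.X"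
    unfolding \<Omega>2 by (rule H.heat_arb_map[OF \<epsilon> e_def S(3) S2(3)[unfolded \<Omega>2] UU])
  then have "arb_equiv L \<Omega> (case_elements L \<epsilon> U) \<Omega>2 (case_elements L \<epsilon> U2)"
    using arb_map_imp_equiv[OF \<epsilon>, of "\<lambda>_. \<epsilon>" "B_of L \<epsilon> U" L \<Omega> "\<lambda>_. \<epsilon>" "B_of L \<epsilon> U2" \<Omega>2 T H.X]
      case_elements_member[OF \<epsilon> is_domainD(1)[OF S(1)] S(3)] listed_member[OF p U2]
    unfolding case_elements_def by blast
  then show ?thesis unfolding reachable_def using S(1) p U2 by blast
qed

text \<open>Reduces reachability to choosing X1, X0 and V such that the transformed potential is a
  listed one; the solution itself is carried along by the multiplier.\<close>

lemma reachable_heat_map: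
  assumes hm: "heat_map \<Omega> T X1 X0 V e" and U: "heat_solution e \<Omega> c U" and p: "p \<in> listed_potentials \<C>"
    and adm: "admissible_domain p (fibre_map T (heat_map.X X1 X0) ` \<Omega>)"
    and c: "\<And>t x. (t, x) \<in> \<Omega> \<Longrightarrow> (X1 t)\<^sup>2 * (breve L * pot p (X1 t * x + X0 t)) = c (t, x) + heat_map.Q X1 X0 V e (t, x)"
  shows "reachable \<Omega> (case_elements L \<epsilon> U)"
proof -
  interpret H: heat_map \<Omega> T X1 X0 V e by fact
  let ?\<Omega>' = "fibre_map T H.X ` \<Omega>" and ?U' = "\<lambda>z. H.M (H.G z) * U (H.G z)"
  have "(X1 (fst z))\<^sup>2 * (\<lambda>z. breve L * pot p (snd z)) (fibre_map T H.X z) = c z + H.Q z" if "z \<in> \<Omega>" for z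
    using c[of "fst z" "snd z"] that by (simp add: H.X_def case_prod_unfold)
  from H.heat_solution_push[OF U this]
  have U': "heat_solution e ?\<Omega>' (\<lambda>z. breve L * pot p (snd z)) ?U'" .
  have r: "reachable ?\<Omega>' (case_elements L \<epsilon> ?U')"
    by (rule reachable_solution[OF p nonzero_solutionsI[where L = L and \<epsilon> = \<epsilon>, OF H.image_domain adm, folded e_def, OF U']])
  have m: "arb_map (breve L) \<Omega> (case_elements L \<epsilon> U) ?\<Omega>' (case_elements L \<epsilon> ?U') T H.X"
    by (rule H.heat_arb_map[OF \<epsilon> e_def U U']) (simp only: H.GF)
  show ?thesis
    using reachable_transport[OF m[unfolded case_elements_def]] case_elements_member[OF \<epsilon> H.o(1) U]
      case_elements_member[OF \<epsilon> H.image_open U'] r unfolding case_elements_def by blast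
qed

text \<open>A solution y of y'' = \<kappa> y used as 1 / X1 cancels the harmonic term, X0 = \<beta>
  / y moves the pole to the origin, and V absorbs the part that depends on t. The coefficient of the
  double pole is kept because T_t = (X1)^2. The value \<mu> = 0 leads to the zero potential.\<close>

lemma reachable_inverse_square:
  assumes \<Omega>: "is_domain \<Omega>" and U: "heat_solution e \<Omega> c U" and \<gamma>: "smooth_on (fst ` \<Omega>) \<gamma>"
    and c: "\<And>t x. (t, x) \<in> \<Omega> \<Longrightarrow> c (t, x) = breve L * (\<mu> / (x + \<beta>)\<^sup>2 + \<alpha> * (x + \<beta>)\<^sup>2 + \<gamma> t)"
  shows "reachable \<Omega> (case_elements L \<epsilon> U)"
proof -
  note o = is_domainD(1)[OF \<Omega>]
  \<comment> \<open>At x = -\<beta> the quotient \<mu> / 0 has the value 0, so this line is taken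
    out of the domain before the form of \<open>c\<close> is used.\<close>
  define \<Omega>b where "\<Omega>b = \<Omega> \<inter> {z. snd z \<noteq> - \<beta>}"
  have "open {z :: real \<times> real. snd z \<noteq> - \<beta>}" by (intro open_Collect_neq continuous_intros)
  then have ob: "open \<Omega>b" unfolding \<Omega>b_def using o by blast
  obtain t0 x1 where tx1: "(t0, x1) \<in> \<Omega>" using is_domainD(9)[OF \<Omega>] by auto
  obtain r1 where r1: "r1 > 0" "{t0-r1<..<t0+r1} \<times> {x1-r1<..<x1+r1} \<subseteq> \<Omega>" using open_box_in[OF o tx1] by blast
  have "\<exists>x0. (t0, x0) \<in> \<Omega>b"
  proof (cases "x1 = - \<beta>")
    case True
    have "(t0, x1 + r1 / 2) \<in> \<Omega>" using r1 by auto
    then show ?thesis using True r1(1) unfolding \<Omega>b_def by (intro exI[of _ "x1 + r1 / 2"]) auto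
  next
    case False
    then show ?thesis using tx1 unfolding \<Omega>b_def by (intro exI[of _ x1]) auto
  qed
  then obtain x0 where tx0: "(t0, x0) \<in> \<Omega>b" by blast
  obtain r2 where r2: "r2 > 0" "{t0-r2<..<t0+r2} \<times> {x0-r2<..<x0+r2} \<subseteq> \<Omega>b" using open_box_in[OF ob tx0] by blast
  \<comment> \<open>Solves (e / 4) \<kappa> = -\<open>breve L\<close> \<alpha>, the condition for
    the quadratic terms to cancel.\<close>
  define \<kappa> where "\<kappa> = - 4 * \<epsilon> * \<alpha>"
  obtain r3 y where y: "r3 > 0" "smooth_on {t0-r3<..<t0+r3} y" "\<And>t. t \<in> {t0-r3<..<t0+r3} \<Longrightarrow> y t > 0"
    "\<And>t. deriv (deriv y) t = \<kappa> * y t" using oscillator_solution[of t0 \<kappa>] by blast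
  define r where "r = min r2 r3"
  have r: "r > 0" "r \<le> r2" "r \<le> r3" using r2 y by (auto simp: r_def)
  let ?N = "{t0-r<..<t0+r}" and ?K = "{x0-r<..<x0+r}"
  have sub: "?N \<times> ?K \<subseteq> \<Omega>b" by (rule order_trans[OF _ r2(2)]) (use r in auto)
  then have sub': "?N \<times> ?K \<subseteq> \<Omega>" unfolding \<Omega>b_def by blast
  have lt: "t0 - r < t0 + r" "x0 - r < x0 + r" using r by auto
  have NI: "?N \<subseteq> fst ` \<Omega>"
  proof
    fix t assume "t \<in> ?N"
    then have "(t, x0) \<in> \<Omega>" using sub' r(1) by (auto dest!: subsetD[where c = "(t, x0)"])
    then show "t \<in> fst ` \<Omega>" by force
  qed
  have ypos: "y t > 0" if "t \<in> ?N" for t using y(3)[of t] that r by auto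
  have sm: "smooth_on ?N y" "smooth_on ?N (\<lambda>_. \<beta>)" "smooth_on ?N (\<lambda>t. - breve L * (\<alpha> * \<beta>\<^sup>2 + \<gamma> t))"
  proof -
    show "smooth_on ?N y" by (rule smooth_on_subset[OF y(2)]) (use r in auto)
    show "smooth_on ?N (\<lambda>t. - breve L * (\<alpha> * \<beta>\<^sup>2 + \<gamma> t))"
      by (intro smooth_on_mult smooth_on_add smooth_on_const smooth_on_subset[OF \<gamma> NI]) auto
  qed (rule smooth_on_const)
  have yne: "y t \<noteq> 0" if "t \<in> ?N" for t using ypos[OF that] by simp
  obtain T V where hm: "heat_map (?N \<times> ?K) T (\<lambda>t. 1 / y t) (\<lambda>t. \<beta> / y t) V e"
    and Q: "\<forall>t x. (t, x) \<in> ?N \<times> ?K \<longrightarrow> heat_map.Q (\<lambda>t. 1 / y t) (\<lambda>t. \<beta> / y t) V e (t, x)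
      = e / 4 * (deriv (deriv y) t / y t) * x\<^sup>2 + e / 2 * (\<beta> * deriv (deriv y) t / y t - deriv (deriv (\<lambda>_. \<beta>)) t) * x
        + - breve L * (\<alpha> * \<beta>\<^sup>2 + \<gamma> t)"
    by (rule heat_map_construct[OF lt e(1) sm yne], assumption) (rule that)
  interpret H: heat_map "?N \<times> ?K" T "\<lambda>t. 1 / y t" "\<lambda>t. \<beta> / y t" V e by (rule hm)
  define p where "p = (if \<mu> = 0 then Zero else Inv_Square \<mu>)"
  have "reachable (?N \<times> ?K) (case_elements L \<epsilon> U)"
  proof (rule reachable_heat_map[OF hm heat_solution_subset[OF U sub']])
    show "p \<in> listed_potentials \<C>" by (auto simp: p_def listed_potentials_def)
    show "admissible_domain p (fibre_map T H.X ` (?N \<times> ?K))"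
    proof (cases "\<mu> = 0")
      case False
      have "1 / y t * x + \<beta> / y t \<noteq> 0" if "(t, x) \<in> ?N \<times> ?K" for t x
      proof -
        have "(t, x) \<in> \<Omega>b" using sub that by blast
        then have "x + \<beta> \<noteq> 0" unfolding \<Omega>b_def by auto
        then show ?thesis using yne[of t] that by (simp add: add_divide_distrib[symmetric])
      qed
      then have "0 \<notin> snd ` fibre_map T H.X ` (?N \<times> ?K)" unfolding H.X_def by fastforce
      then show ?thesis using False by (simp add: p_def)
    qed (simp add: p_def)
    fix t x assume tx: "(t, x) \<in> ?N \<times> ?K"
    then have t: "t \<in> ?N" by auto
    have "(t, x) \<in> \<Omega>b" using sub tx by blast
    then have xb: "x + \<beta> \<noteq> 0" and tx\<Omega>: "(t, x) \<in> \<Omega>" unfolding \<Omega>b_def by auto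
    have l: "(1 / y t)\<^sup>2 * (breve L * pot p (1 / y t * x + \<beta> / y t)) = breve L * (\<mu> / (x + \<beta>)\<^sup>2)"
    proof (cases "\<mu> = 0")
      case False
      have "1 / y t * x + \<beta> / y t = (x + \<beta>) / y t" by (simp add: add_divide_distrib)
      then show ?thesis using False yne[OF t] xb by (simp add: p_def power_divide)
    qed (simp add: p_def)
    have k: "e * \<kappa> = - 4 * breve L * \<alpha>" unfolding \<kappa>_def e_def using e(3) by algebra
    have "H.Q (t, x) = e / 4 * \<kappa> * x\<^sup>2 + e / 2 * (\<beta> * \<kappa>) * x - breve L * (\<alpha> * \<beta>\<^sup>2 + \<gamma> t)"
      unfolding Q[rule_format, OF tx] y(4) using yne[OF t] by simp
    then have "H.Q (t, x) = e * \<kappa> * (x\<^sup>2 / 4 + \<beta> * x / 2) - breve L * (\<alpha> * \<beta>\<^sup>2 + \<gamma> t)" by (simp add: algebra_simps)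
    also have "\<dots> = - breve L * (\<alpha> * (x + \<beta>)\<^sup>2 + \<gamma> t)" unfolding k by (simp add: algebra_simps power2_eq_square)
    finally show "(1 / y t)\<^sup>2 * (breve L * pot p (1 / y t * x + \<beta> / y t)) = c (t, x) + H.Q (t, x)"
      unfolding l c[OF tx\<Omega>] by (simp add: algebra_simps)
  qed
  then show ?thesis using reachable_mono sub' by blast
qed

text \<open>A moving frame X = x + z(t) changes the potential by a term linear in x with coefficient
  proportional to z''; the choice z'' = 2 \<epsilon> \<delta> cancels the given one.\<close>

lemma reachable_linear:
  assumes ab: "a < b" "k < d" and U: "heat_solution e ({a<..<b} \<times> {k<..<d}) c U"
    and s: "smooth_on {a<..<b} \<delta>" "smooth_on {a<..<b} \<gamma>"
    and c: "\<And>t x. (t, x) \<in> {a<..<b} \<times> {k<..<d} \<Longrightarrow> c (t, x) = breve L * (\<delta> t * x + \<gamma> t)"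
  shows "reachable ({a<..<b} \<times> {k<..<d}) (case_elements L \<epsilon> U)"
proof -
  let ?N = "{a<..<b}" and ?\<Omega> = "{a<..<b} \<times> {k<..<d}"
  have "smooth_on ?N (\<lambda>t. 2 * \<epsilon> * \<delta> t)" by (intro smooth_on_mult smooth_on_const s) auto
  then obtain z1 where z1: "smooth_on ?N z1" "\<And>t. t \<in> ?N \<Longrightarrow> (z1 has_real_derivative 2 * \<epsilon> * \<delta> t) (at t)"
    by (rule antiderivative) blast
  obtain z where z: "smooth_on ?N z" "\<And>t. t \<in> ?N \<Longrightarrow> (z has_real_derivative z1 t) (at t)"
    using antiderivative[OF z1(1)] by blast
  have z2: "deriv (deriv z) t = 2 * \<epsilon> * \<delta> t" if t: "t \<in> ?N" for t
  proof (rule DERIV_imp_deriv, rule has_field_derivative_transform_within_open[OF z1(2)[OF t] _ t])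
    show "z1 s = deriv z s" if "s \<in> ?N" for s using DERIV_imp_deriv[OF z(2)[OF that]] by simp
  qed simp
  have g: "smooth_on ?N (\<lambda>t. - breve L * \<gamma> t)" by (intro smooth_on_mult smooth_on_const s) auto
  obtain T V where hm: "heat_map ?\<Omega> T (\<lambda>t. 1 / 1) (\<lambda>t. z t / 1) V e"
    and Q: "\<forall>t x. (t, x) \<in> ?\<Omega> \<longrightarrow> heat_map.Q (\<lambda>t. 1 / 1) (\<lambda>t. z t / 1) V e (t, x)
      = e / 4 * (deriv (deriv (\<lambda>_. 1)) t / 1) * x\<^sup>2 + e / 2 * (z t * deriv (deriv (\<lambda>_. 1)) t / 1 - deriv (deriv z) t) * x
        + - breve L * \<gamma> t"
    by (rule heat_map_construct[where y = "\<lambda>_. 1", OF ab e(1) smooth_on_const z(1) g], simp) (rule that)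
  show ?thesis
  proof (rule reachable_heat_map[OF hm U, of Zero])
    show "Zero \<in> listed_potentials \<C>" by (auto simp: listed_potentials_def)
    fix t x assume tx: "(t, x) \<in> ?\<Omega>"
    have "e * \<epsilon> = breve L" unfolding e_def using e(3) by algebra
    then have "e / 2 * (- (2 * \<epsilon> * \<delta> t)) * x = - breve L * (\<delta> t * x)" by (simp add: mult.assoc[symmetric])
    then show "(1 / 1)\<^sup>2 * (breve L * pot Zero (1 / 1 * x + z t / 1)) = c (t, x) + heat_map.Q (\<lambda>t. 1 / 1) (\<lambda>t. z t / 1) V e (t, x)"
      unfolding Q[rule_format, OF tx] c[OF tx] using z2[of t] tx by (simp add: algebra_simps)
  qed simp
qed

text \<open>By definition, a potential that is not general has an excluded form, which falls under
  the two preceding reductions. A general one is brought to its representative by constant X1 and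
  X0. In every case V absorbs the summand in t.\<close>

lemma reachable_stationary:
  assumes ab: "a < b" "k < d" and U: "heat_solution e ({a<..<b} \<times> {k<..<d}) c U"
    and s: "smooth_on {k<..<d} C" "smooth_on {a<..<b} \<gamma>"
    and c: "\<And>t x. (t, x) \<in> {a<..<b} \<times> {k<..<d} \<Longrightarrow> c (t, x) = breve L * (C x + \<gamma> t)"
  shows "reachable ({a<..<b} \<times> {k<..<d}) (case_elements L \<epsilon> U)"
proof -
  let ?N = "{a<..<b}" and ?K = "{k<..<d}" and ?\<Omega> = "{a<..<b} \<times> {k<..<d}"
  note box = box_domain[OF ab]
  consider (general) "(?K, C) \<in> general_potentials"
    | (inv) \<mu> \<alpha> \<beta> \<gamma>' where "\<forall>x\<in>?K. C x = \<mu> / (x + \<beta>)\<^sup>2 + \<alpha> * (x + \<beta>)\<^sup>2 + \<gamma>'"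
    | (quad) \<alpha> \<beta> \<gamma>' where "\<forall>x\<in>?K. C x = \<alpha> * x\<^sup>2 + \<beta> * x + \<gamma>'"
  proof -
    have "open ?K" "connected ?K" "?K \<noteq> {}" using ab by auto
    then show thesis using general inv quad s(1) unfolding general_potentials_def mem_Collect_eq prod.case by metis
  qed
  then show ?thesis
  proof cases
    case inv
    show ?thesis
    proof (rule reachable_inverse_square[OF box(1) U])
      show "smooth_on (fst ` ?\<Omega>) (\<lambda>t. \<gamma>' + \<gamma> t)" unfolding box(2) by (intro smooth_on_add smooth_on_const s) simp
      show "c (t, x) = breve L * (\<mu> / (x + \<beta>)\<^sup>2 + \<alpha> * (x + \<beta>)\<^sup>2 + (\<gamma>' + \<gamma> t))" if "(t, x) \<in> ?\<Omega>" for t x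
        using c[OF that] inv that by (auto simp: algebra_simps)
    qed
  next
    case quad
    show ?thesis
    proof (cases "\<alpha> = 0")
      case True
      show ?thesis
      proof (rule reachable_linear[OF ab U])
        show "smooth_on ?N (\<lambda>_. \<beta>)" by (rule smooth_on_const)
        show "smooth_on ?N (\<lambda>t. \<gamma>' + \<gamma> t)" by (intro smooth_on_add smooth_on_const s) simp
        show "c (t, x) = breve L * (\<beta> * x + (\<gamma>' + \<gamma> t))" if "(t, x) \<in> ?\<Omega>" for t x
          using c[OF that] quad that True by (auto simp: algebra_simps)
      qed
    next
      case False
      \<comment> \<open>Completing the square gives an inverse-square form with \<mu> = 0.\<close>
      define h where "h = \<beta> / (2 * \<alpha>)"
      have h: "\<beta> = 2 * \<alpha> * h" using False by (simp add: h_def)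
      show ?thesis
      proof (rule reachable_inverse_square[OF box(1) U])
        show "smooth_on (fst ` ?\<Omega>) (\<lambda>t. \<gamma>' - \<alpha> * h\<^sup>2 + \<gamma> t)" unfolding box(2) by (intro smooth_on_add smooth_on_const s) simp
        show "c (t, x) = breve L * (0 / (x + h)\<^sup>2 + \<alpha> * (x + h)\<^sup>2 + (\<gamma>' - \<alpha> * h\<^sup>2 + \<gamma> t))" if "(t, x) \<in> ?\<Omega>" for t x
          using c[OF that] quad that by (auto simp: h algebra_simps power2_eq_square)
      qed
    qed
  next
    case general
    then obtain J' C' where JC: "(J', C') \<in> \<C>" "potential_equiv (?K, C) (J', C')"
      using C_complete unfolding complete_inequivalent_def by fast
    then obtain c1 c3 c5 where c1: "c1 \<noteq> 0" "(\<lambda>x. c1 * x + c3) ` ?K = J'" "\<And>x. x \<in> ?K \<Longrightarrow> C' (c1 * x + c3) = (C x + c5) / c1\<^sup>2"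
      by auto
    \<comment> \<open>These parameters give X = c1 x + c3.\<close>
    let ?y = "\<lambda>_ :: real. 1 / c1" and ?z = "\<lambda>_ :: real. c3 / c1"
    have g: "smooth_on ?N (\<lambda>t. breve L * (c5 - \<gamma> t))" by (intro smooth_on_mult smooth_on_diff smooth_on_const s) auto
    obtain T V where hm: "heat_map ?\<Omega> T (\<lambda>t. 1 / (1 / c1)) (\<lambda>t. (c3 / c1) / (1 / c1)) V e"
      and Q: "\<forall>t x. (t, x) \<in> ?\<Omega> \<longrightarrow> heat_map.Q (\<lambda>t. 1 / (1 / c1)) (\<lambda>t. (c3 / c1) / (1 / c1)) V e (t, x)
        = e / 4 * (deriv (deriv ?y) t / (1 / c1)) * x\<^sup>2 + e / 2 * ((c3 / c1) * deriv (deriv ?y) t / (1 / c1) - deriv (deriv ?z) t) * x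
          + breve L * (c5 - \<gamma> t)"
      by (rule heat_map_construct[where y = ?y and z = ?z, OF ab e(1) smooth_on_const smooth_on_const g], simp add: c1(1)) (rule that)
    interpret H: heat_map ?\<Omega> T "\<lambda>t. 1 / (1 / c1)" "\<lambda>t. (c3 / c1) / (1 / c1)" V e by (rule hm)
    have X: "H.X z = c1 * snd z + c3" for z unfolding H.X_def using c1(1) by simp
    show ?thesis
    proof (rule reachable_heat_map[OF hm U, of "General J' C'"])
      show "General J' C' \<in> listed_potentials \<C>" using JC(1) by (auto simp: listed_potentials_def)
      have sX: "snd (fibre_map T H.X z) = c1 * snd z + c3" for z using X[of z] by (simp add: case_prod_unfold)
      have "snd ` fibre_map T H.X ` ?\<Omega> = (\<lambda>x. c1 * x + c3) ` snd ` ?\<Omega>"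
        unfolding image_image by (rule image_cong[OF refl sX])
      then show "admissible_domain (General J' C') (fibre_map T H.X ` ?\<Omega>)" using c1(2) box(3) by simp
      fix t x assume tx: "(t, x) \<in> ?\<Omega>"
      then have "c1\<^sup>2 * C' (c1 * x + c3) = C x + c5" using c1(1,3) by auto
      then have "c1\<^sup>2 * (breve L * C' (c1 * x + c3)) = breve L * (C x + c5)" by algebra
      then show "(1 / (1 / c1))\<^sup>2 * (breve L * pot (General J' C') (1 / (1 / c1) * x + c3 / c1 / (1 / c1))) = c (t, x) + H.Q (t, x)"
        unfolding Q[rule_format, OF tx] c[OF tx] using c1(1) by (simp add: algebra_simps)
    qed
  qed
qed

text \<open>U is obtained from B by integration in x on a box, and C is read off U. For a
  translation the classifying condition is k1 C_t + k2 C_x = \<zeta>_t: either C differs from a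
  stationary potential by \<zeta> / k, or C_x is a function of t.\<close>

lemma reachable_straightened:
  assumes \<Omega>: "is_domain \<Omega>" and B: "smooth_on \<Omega> B" and det: "determining \<Omega> (equation L (\<lambda>_. \<epsilon>, B)) \<tau> \<xi> \<eta>"
    and k: "k \<noteq> 0" and st: "(\<forall>t\<in>fst ` \<Omega>. \<tau> t = k) \<and> (\<forall>z\<in>\<Omega>. \<xi> z = 0) \<or> (\<forall>t\<in>fst ` \<Omega>. \<tau> t = 0) \<and> (\<forall>z\<in>\<Omega>. \<xi> z = k)"
  shows "reachable \<Omega> (\<lambda>_. \<epsilon>, B)"
proof -
  note o = is_domainD(1)[OF \<Omega>]
  obtain t0 x0 where tx0: "(t0, x0) \<in> \<Omega>" using is_domainD(9)[OF \<Omega>] by auto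
  obtain r where r: "r > 0" "{t0-r<..<t0+r} \<times> {x0-r<..<x0+r} \<subseteq> \<Omega>" using open_box_in[OF o tx0] by blast
  let ?N = "{t0-r<..<t0+r}" and ?K = "{x0-r<..<x0+r}" and ?\<Omega> = "{t0-r<..<t0+r} \<times> {x0-r<..<x0+r}"
  have lt: "t0 - r < t0 + r" "x0 - r < x0 + r" using r by auto
  note box = box_domain[OF lt]
  note ob = is_domainD(1)[OF box(1)] and sp = smooth_on_partials[OF is_domainD(1)[OF box(1)]]
  have e0: "e \<noteq> 0" using e by auto
  have "smooth_on ?\<Omega> (\<lambda>z. B z / (2 * e))"
    by (intro smooth_on_divide smooth_on_const smooth_on_subset[OF B r(2)] ob) (use e0 in auto)
  then obtain Y where Y: "smooth_on ?\<Omega> Y" "\<And>z. z \<in> ?\<Omega> \<Longrightarrow> Dx Y z = B z / (2 * e)"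
    by (rule x_antiderivative[where ?x0.0 = x0]) (use r in auto)
  define U where "U z = exp (Y z)" for z
  have sU: "smooth_on ?\<Omega> U" unfolding U_def by (rule smooth_on_exp_compose[OF ob Y(1)])
  have U0: "U z \<noteq> 0" for z by (simp add: U_def)
  have Ux: "Dx U z = U z * (B z / (2 * e))" if "z \<in> ?\<Omega>" for z
    unfolding U_def[abs_def] by (rule partials_imp_eq(2)) (auto intro!: derivative_eq_intros partial_deriv'(2)[OF Y(1) that] simp: Y(2)[OF that])
  have B': "B_of L \<epsilon> U z = B z" if "z \<in> ?\<Omega>" for z
    unfolding B_of_def Ux[OF that] using U0[of z] e0 by (simp add: e_def)
  \<comment> \<open>The potential for which \<open>U\<close> is a solution by construction;
    \<open>breve L\<close> is its own inverse.\<close>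
  define C where "C z = breve L * ((Dt U z - e * Dx (Dx U) z) / U z)" for z
  have sC: "smooth_on ?\<Omega> C"
    unfolding C_def
    by (intro smooth_on_mult smooth_on_diff smooth_on_const smooth_on_divide sp sU U0 ob)
  have hU: "heat_solution e ?\<Omega> (\<lambda>z. breve L * C z) U"
    unfolding heat_solution_def
  proof (intro conjI ballI sU U0)
    fix z
    have "breve L * C z = (breve L * breve L) * ((Dt U z - e * Dx (Dx U) z) / U z)" by (simp add: C_def)
    then have "breve L * C z * U z = Dt U z - e * Dx (Dx U) z" unfolding e(4) using U0[of z] by simp
    then show "Dt U z = e * Dx (Dx U) z + breve L * C z * U z" by simp
  qed
  have "determining ?\<Omega> (equation L (case_elements L \<epsilon> U)) \<tau> \<xi> \<eta>"
    unfolding case_elements_def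
    by (rule determining_constant_A_cong[OF ob _ determining_subset[OF det r(2)]]) (simp add: B')
  from this[unfolded determining_heat_iff[OF \<epsilon> ob sC hU[unfolded e_def]] determining_heat_form[OF \<epsilon> box(1) sC] box(2)]
  obtain \<rho> \<zeta> where s: "smooth_on ?N \<tau>" "smooth_on ?N \<rho>" "smooth_on ?N \<zeta>"
    and f: "\<And>t x. (t, x) \<in> ?\<Omega> \<Longrightarrow> \<xi> (t, x) = deriv \<tau> t / 2 * x + \<rho> t \<and>
        deriv \<tau> t * C (t, x) + \<tau> t * Dt C (t, x) + (deriv \<tau> t / 2 * x + \<rho> t) * Dx C (t, x)
        + \<epsilon> / 8 * deriv (deriv (deriv \<tau>)) t * x\<^sup>2 + \<epsilon> / 2 * deriv (deriv \<rho>) t * x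
        = deriv \<zeta> t + deriv (deriv \<tau>) t / 4" by blast
  have cd: "deriv f t = 0" if "\<And>t. t \<in> ?N \<Longrightarrow> f t = q" "t \<in> ?N" for f :: "real \<Rightarrow> real" and q t
    by (rule DERIV_imp_deriv, rule has_field_derivative_transform_within_open[OF DERIV_const _ that(2)]) (simp_all add: that(1))
  have NI: "t \<in> fst ` \<Omega>" if "t \<in> ?N" for t
  proof -
    have "(t, x0) \<in> \<Omega>" using r that by (auto dest!: subsetD[where c = "(t, x0)"])
    then show ?thesis by force
  qed
  obtain k1 k2 where \<tau>: "\<And>t. t \<in> ?N \<Longrightarrow> \<tau> t = k1" and \<xi>: "\<And>z. z \<in> ?\<Omega> \<Longrightarrow> \<xi> z = k2"
    and k12: "k1 = k \<and> k2 = 0 \<or> k1 = 0 \<and> k2 = k"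
    using st
  proof (elim disjE conjE)
    assume "\<forall>t\<in>fst ` \<Omega>. \<tau> t = k" "\<forall>z\<in>\<Omega>. \<xi> z = 0"
    then show thesis using NI r(2) by (intro that[of k 0]) blast+
  next
    assume "\<forall>t\<in>fst ` \<Omega>. \<tau> t = 0" "\<forall>z\<in>\<Omega>. \<xi> z = k"
    then show thesis using NI r(2) by (intro that[of 0 k]) blast+
  qed
  have \<tau>1: "deriv \<tau> t = 0" if "t \<in> ?N" for t using cd[OF \<tau> that] .
  have \<tau>2: "deriv (deriv \<tau>) t = 0" if "t \<in> ?N" for t using cd[OF \<tau>1 that] .
  have \<tau>3: "deriv (deriv (deriv \<tau>)) t = 0" if "t \<in> ?N" for t using cd[OF \<tau>2 that] .
  have \<rho>: "\<rho> t = k2" if "t \<in> ?N" for t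
    using f[of t x0] \<xi>[of "(t, x0)"] \<tau>1[OF that] that r(1) by auto
  have \<rho>1: "deriv \<rho> t = 0" if "t \<in> ?N" for t using cd[OF \<rho> that] .
  have \<rho>2: "deriv (deriv \<rho>) t = 0" if "t \<in> ?N" for t using cd[OF \<rho>1 that] .
  have eq: "k1 * Dt C z + k2 * Dx C z = deriv \<zeta> (fst z)" if z: "z \<in> ?\<Omega>" for z
  proof -
    have t: "fst z \<in> ?N" using z by auto
    have z': "(fst z, snd z) \<in> ?\<Omega>" using z by simp
    show ?thesis using f[OF z'] \<tau>[OF t] \<tau>1[OF t] \<tau>2[OF t] \<tau>3[OF t] \<rho>[OF t] \<rho>2[OF t] by simp
  qed
  have N: "open ?N" "connected ?N" and K: "open ?K" by auto
  note d\<zeta> = smooth_on_deriv[OF N(1) s(3)]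
  have "reachable ?\<Omega> (case_elements L \<epsilon> U)"
    using k12
  proof
    assume *: "k1 = k \<and> k2 = 0"
    \<comment> \<open>By \<open>eq\<close>, the difference of C and \<zeta> / k does not depend on
      t, so its value at t0 serves for all times of the box.\<close>
    define C0 where "C0 x = C (t0, x) - \<zeta> t0 / k" for x
    have "smooth_on ?K (\<lambda>x. C (t0, x))"
      by (rule smooth_on_compose[OF sC K ob]) (use r in \<open>auto intro!: smooth_on_Pair smooth_on_const smooth_on_id\<close>)
    then have sC0: "smooth_on ?K C0" unfolding C0_def by (intro smooth_on_diff smooth_on_const K)
    have CC: "C (t, x) = C0 x + \<zeta> t / k" if tx: "(t, x) \<in> ?\<Omega>" for t x
    proof -
      have "C (t, x) - \<zeta> t / k = C (t0, x) - \<zeta> t0 / k"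
      proof (rule connected_open_derivative_zero[OF N(2), where f = "\<lambda>t. C (t, x) - \<zeta> t / k"])
        show "t \<in> ?N" "t0 \<in> ?N" using tx r by auto
        fix s assume s: "s \<in> ?N"
        then have sx: "(s, x) \<in> ?\<Omega>" using tx by auto
        have "Dt C (s, x) = deriv \<zeta> s / k" using eq[OF sx] * k by (simp add: field_simps)
        moreover have "((\<lambda>s. C (s, x) - \<zeta> s / k) has_real_derivative Dt C (s, x) - deriv \<zeta> s / k) (at s)"
          by (intro DERIV_diff partial_deriv(1)[OF sC sx] DERIV_cdivide d\<zeta>(1) s)
        ultimately show "((\<lambda>s. C (s, x) - \<zeta> s / k) has_real_derivative 0) (at s)" by simp
      qed
      then show ?thesis by (simp add: C0_def)
    qed
    show ?thesis
    proof (rule reachable_stationary[OF lt hU sC0])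
      show "smooth_on ?N (\<lambda>t. \<zeta> t / k)" by (intro smooth_on_divide smooth_on_const s N) (use k in auto)
    qed (simp only: CC)
  next
    assume *: "k1 = 0 \<and> k2 = k"
    have Cx: "Dx C z = deriv \<zeta> (fst z) / k" if "z \<in> ?\<Omega>" for z using eq[OF that] * k by (simp add: field_simps)
    have s\<delta>: "smooth_on ?N (\<lambda>t. deriv \<zeta> t / k)" by (intro smooth_on_divide smooth_on_const d\<zeta>(2) N) (use k in auto)
    have s\<gamma>: "smooth_on ?\<Omega> (\<lambda>z. C z - deriv \<zeta> (fst z) / k * snd z)"
      by (intro smooth_on_diff smooth_on_mult sC smooth_on_fst_snd ob smooth_on_of_time[OF ob, unfolded box(2), OF s\<delta>])
    have "Dx (\<lambda>z. C z - deriv \<zeta> (fst z) / k * snd z) z = 0" if z: "z \<in> ?\<Omega>" for z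
      by (rule partials_imp_eq(2)) (auto intro!: derivative_eq_intros partial_deriv'(2)[OF sC z] simp: Cx[OF z] k)
    from x_independent[OF box(1) s\<gamma> this, unfolded box(2)] obtain \<gamma> where \<gamma>: "smooth_on ?N \<gamma>"
      "\<And>t x. (t, x) \<in> ?\<Omega> \<Longrightarrow> C (t, x) - deriv \<zeta> t / k * x = \<gamma> t" by auto
    show ?thesis
    proof (rule reachable_linear[OF lt hU s\<delta> \<gamma>(1)])
      show "breve L * C (t, x) = breve L * (deriv \<zeta> t / k * x + \<gamma> t)" if "(t, x) \<in> ?\<Omega>" for t x
        using \<gamma>(2)[OF that] by (simp add: algebra_simps)
    qed
  qed
  then have "reachable ?\<Omega> (\<lambda>_. \<epsilon>, B)"
    unfolding case_elements_def by (rule reachable_cong[rotated]) (simp add: B')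
  then show ?thesis using reachable_mono r(2) by blast
qed

text \<open>Where \<tau> \<noteq> 0, the choice T_t = 1 / |\<tau>| turns the symmetry into a time
  translation up to sign, with X0 chosen to cancel the rest of \<xi>. If \<tau> vanishes
  identically, \<xi> is a function \<rho> of t and X1 = 1 / \<rho> turns it into 1. Both choices
  keep A = \<epsilon>.\<close>

lemma reachable_constant_A:
  assumes \<Omega>: "is_domain \<Omega>" and B: "smooth_on \<Omega> B" and det: "determining \<Omega> (equation L (\<lambda>_. \<epsilon>, B)) \<tau> \<xi> \<eta>"
    and z0: "z0 \<in> \<Omega>" "\<tau> (fst z0) \<noteq> 0 \<or> \<xi> z0 \<noteq> 0"
  shows "reachable \<Omega> (\<lambda>_. \<epsilon>, B)"
proof -
  note o = is_domainD(1,3)[OF \<Omega>]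
  have \<epsilon>0: "\<epsilon> \<noteq> 0" using \<epsilon> by auto
  have s: "smooth_on (fst ` \<Omega>) \<tau>" "smooth_on \<Omega> \<xi>" and d2: "\<And>z. z \<in> \<Omega> \<Longrightarrow> det2 (\<lambda>_. \<epsilon>) \<tau> \<xi> z = 0"
    using det unfolding equation_constant_A by auto
  note d\<tau> = smooth_on_deriv[OF o(2) s(1)]
  have \<xi>x: "Dx \<xi> z = deriv \<tau> (fst z) / 2" if "z \<in> \<Omega>" for z
    using d2[OF that] \<epsilon>0 by (simp add: det2_def partials_const)
  have s1: "smooth_on \<Omega> (\<lambda>z. \<xi> z - deriv \<tau> (fst z) / 2 * snd z)"
    by (intro smooth_intros smooth_on_fst_snd smooth_on_of_time o d\<tau> s) auto
  have "Dx (\<lambda>z. \<xi> z - deriv \<tau> (fst z) / 2 * snd z) z = 0" if z: "z \<in> \<Omega>" for z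
    by (rule partials_imp_eq(2)) (auto intro!: derivative_eq_intros partial_deriv'(2)[OF s(2) z] simp: \<xi>x[OF z])
  from x_independent[OF \<Omega> s1 this] obtain \<rho> where \<rho>: "smooth_on (fst ` \<Omega>) \<rho>"
    "\<And>t x. (t, x) \<in> \<Omega> \<Longrightarrow> \<xi> (t, x) - deriv \<tau> t / 2 * x = \<rho> t" by auto
  have \<xi>: "\<xi> (t, x) = deriv \<tau> t / 2 * x + \<rho> t" if "(t, x) \<in> \<Omega>" for t x using \<rho>(2)[OF that] by simp
  text \<open>A transformation \<open>X = x / y + w\<close>, \<open>T\<^sub>t = 1 / y\<^sup>2\<close> on a box that straightens the symmetry suffices.\<close>
  have straighten: "reachable \<Omega> (\<lambda>_. \<epsilon>, B)"
    if ab: "a < b" "c < d" and sub: "{a<..<b} \<times> {c<..<d} \<subseteq> \<Omega>"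
      and sm: "smooth_on {a<..<b} y" "smooth_on {a<..<b} w" and y: "\<And>t. t \<in> {a<..<b} \<Longrightarrow> y t \<noteq> 0"
      and k: "k \<noteq> 0"
      and st: "(\<forall>t\<in>{a<..<b}. \<tau> t / (y t)\<^sup>2 = k \<and>
          (\<forall>x. (t, x) \<in> {a<..<b} \<times> {c<..<d} \<longrightarrow> \<tau> t * (deriv (\<lambda>t. 1 / y t) t * x + deriv w t) + \<xi> (t, x) / y t = 0))
        \<or> (\<forall>t\<in>{a<..<b}. \<tau> t = 0 \<and> (\<forall>x. (t, x) \<in> {a<..<b} \<times> {c<..<d} \<longrightarrow> \<xi> (t, x) / y t = k))"
    for a b c d y w k
  proof -
    let ?N = "{a<..<b}" and ?\<Omega> = "{a<..<b} \<times> {c<..<d}"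
    note box = box_domain[OF ab]
    have N: "open ?N" by simp
    have sX1: "smooth_on ?N (\<lambda>t. 1 / y t)" by (intro smooth_on_divide smooth_on_const sm y N)
    have "smooth_on ?N (\<lambda>t. (1 / y t)\<^sup>2)" by (intro smooth_on_power sX1 N)
    then obtain T where T: "smooth_on ?N T" "\<And>t. t \<in> ?N \<Longrightarrow> (T has_real_derivative (1 / y t)\<^sup>2) (at t)"
      by (rule antiderivative) blast
    interpret H: heat_map ?\<Omega> T "\<lambda>t. 1 / y t" w "\<lambda>_. 1" e
    proof
      show "deriv T t = (1 / y t)\<^sup>2" if "t \<in> fst ` ?\<Omega>" for t using DERIV_imp_deriv[OF T(2)] that box(2) by simp
    qed (use box T(1) sX1 sm y e in \<open>auto intro: smooth_on_const\<close>)
    let ?\<Omega>' = "fibre_map T H.X ` ?\<Omega>"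
    have t: "fst z \<in> fst ` ?\<Omega>" if "z \<in> ?\<Omega>" for z using that by auto
    have "(Dx H.X z)\<^sup>2 * \<epsilon> = \<epsilon> * deriv T (fst z)" if "z \<in> ?\<Omega>" for z
      unfolding H.X_partials(1)[OF that] H.T_deriv_eq[OF t[OF that]] by simp
    then obtain B' where B': "smooth_on ?\<Omega>' B'" and map: "arb_map (breve L) ?\<Omega> (\<lambda>_. \<epsilon>, B) ?\<Omega>' (\<lambda>_. \<epsilon>, B') T H.X"
      using arb_map_construct[OF H.fibre_diffeo_axioms smooth_on_const smooth_on_subset[OF B sub]] by blast
    obtain \<tau>' \<xi>' \<eta>' where det': "determining ?\<Omega>' (equation L (\<lambda>_. \<epsilon>, B')) \<tau>' \<xi>' \<eta>'"
      and \<tau>': "\<And>t. t \<in> fst ` ?\<Omega> \<Longrightarrow> \<tau>' (T t) = deriv T t * \<tau> t"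
      and \<xi>': "\<And>z. z \<in> ?\<Omega> \<Longrightarrow> \<xi>' (fibre_map T H.X z) = \<tau> (fst z) * Dt H.X z + \<xi> z * Dx H.X z"
      using push_symmetry[OF map smooth_on_const smooth_on_subset[OF B sub] smooth_on_const B' determining_subset[OF det sub]] by blast
    have \<tau>'': "\<tau>' (T t) = \<tau> t / (y t)\<^sup>2" if "t \<in> ?N" for t
      using \<tau>'[of t] H.T_deriv_eq[of t] that box(2) by (simp add: power_divide)
    have \<xi>'': "\<xi>' (fibre_map T H.X (t, x)) = \<tau> t * (deriv (\<lambda>t. 1 / y t) t * x + deriv w t) + \<xi> (t, x) / y t" if "(t, x) \<in> ?\<Omega>" for t x
      using \<xi>'[OF that] H.X_partials[OF that] by simp
    have im: "fst ` ?\<Omega>' = T ` ?N" using H.time_image box(2) by simp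
    have "reachable ?\<Omega>' (\<lambda>_. \<epsilon>, B')"
    proof (rule reachable_straightened[OF H.image_domain B' det' k])
      show "(\<forall>t\<in>fst ` ?\<Omega>'. \<tau>' t = k) \<and> (\<forall>z\<in>?\<Omega>'. \<xi>' z = 0) \<or> (\<forall>t\<in>fst ` ?\<Omega>'. \<tau>' t = 0) \<and> (\<forall>z\<in>?\<Omega>'. \<xi>' z = k)"
        using st
      proof (elim disjE)
        assume *: "\<forall>t\<in>?N. \<tau> t / (y t)\<^sup>2 = k \<and> (\<forall>x. (t, x) \<in> ?\<Omega> \<longrightarrow> \<tau> t * (deriv (\<lambda>t. 1 / y t) t * x + deriv w t) + \<xi> (t, x) / y t = 0)"
        have "\<xi>' (fibre_map T H.X (t, x)) = 0" if "(t, x) \<in> ?\<Omega>" for t x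
          unfolding \<xi>''[OF that] using * that by blast
        then have "\<forall>z\<in>?\<Omega>'. \<xi>' z = 0" by fast
        moreover have "\<forall>t\<in>fst ` ?\<Omega>'. \<tau>' t = k" unfolding im using \<tau>'' * by simp
        ultimately show ?thesis by blast
      next
        assume *: "\<forall>t\<in>?N. \<tau> t = 0 \<and> (\<forall>x. (t, x) \<in> ?\<Omega> \<longrightarrow> \<xi> (t, x) / y t = k)"
        have "\<xi>' (fibre_map T H.X (t, x)) = k" if "(t, x) \<in> ?\<Omega>" for t x
        proof -
          have "t \<in> ?N" using that by blast
          then show ?thesis unfolding \<xi>''[OF that] using * that by simp
        qed
        then have "\<forall>z\<in>?\<Omega>'. \<xi>' z = k" by fast
        moreover have "\<forall>t\<in>fst ` ?\<Omega>'. \<tau>' t = 0" unfolding im using \<tau>'' * by simp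
        ultimately show ?thesis by blast
      qed
    qed
    then have "reachable ?\<Omega> (\<lambda>_. \<epsilon>, B)"
      by (rule reachable_transport[OF map constant_A_member[OF \<epsilon> smooth_on_subset[OF B sub]] constant_A_member[OF \<epsilon> B']])
    then show ?thesis using reachable_mono sub by blast
  qed
  have near: "\<exists>r>0. {t0-r<..<t0+r} \<times> {x0-r<..<x0+r} \<subseteq> \<Omega> \<and> (\<forall>t\<in>{t0-r<..<t0+r}. h t * h t0 > 0)"
    if tx: "(t0, x0) \<in> \<Omega>" and h: "smooth_on (fst ` \<Omega>) h" "h t0 \<noteq> 0" for t0 x0 and h :: "real \<Rightarrow> real"
  proof -
    have "open (fst ` \<Omega> \<inter> (\<lambda>t. h t * h t0) -` {0<..})"
      by (rule continuous_open_preimage[OF _ o(2)]) (intro continuous_on_mult continuous_on_const smooth_on_continuous[OF h(1)], simp)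
    moreover have "t0 \<in> fst ` \<Omega> \<inter> (\<lambda>t. h t * h t0) -` {0<..}" using tx h(2) by (force simp: zero_less_mult_iff)
    ultimately obtain r1 where r1: "r1 > 0" "ball t0 r1 \<subseteq> fst ` \<Omega> \<inter> (\<lambda>t. h t * h t0) -` {0<..}"
      using open_contains_ball by blast
    obtain r2 where r2: "r2 > 0" "{t0-r2<..<t0+r2} \<times> {x0-r2<..<x0+r2} \<subseteq> \<Omega>" using open_box_in[OF o(1) tx] by blast
    define r where "r = min r1 r2"
    have "{t0-r<..<t0+r} \<times> {x0-r<..<x0+r} \<subseteq> \<Omega>" by (rule order_trans[OF _ r2(2)]) (auto simp: r_def)
    moreover have "h t * h t0 > 0" if "t \<in> {t0-r<..<t0+r}" for t
    proof -
      have "t \<in> ball t0 r1" using that by (auto simp: r_def dist_real_def)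
      then show ?thesis using r1(2) by blast
    qed
    moreover have "r > 0" using r1(1) r2(1) by (simp add: r_def)
    ultimately show ?thesis by blast
  qed
  show ?thesis
  proof (cases "\<exists>t\<in>fst ` \<Omega>. \<tau> t \<noteq> 0")
    case True
    then obtain t0 x0 where tx0: "(t0, x0) \<in> \<Omega>" "\<tau> t0 \<noteq> 0" by force
    obtain r where r: "r > 0" "{t0-r<..<t0+r} \<times> {x0-r<..<x0+r} \<subseteq> \<Omega>" "\<And>t. t \<in> {t0-r<..<t0+r} \<Longrightarrow> \<tau> t * \<tau> t0 > 0"
      using near[OF tx0(1) s(1) tx0(2)] by blast
    let ?N = "{t0-r<..<t0+r}" and ?\<Omega> = "{t0-r<..<t0+r} \<times> {x0-r<..<x0+r}"
    have lt: "t0 - r < t0 + r" "x0 - r < x0 + r" using r(1) by auto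
    have NI: "?N \<subseteq> fst ` \<Omega>"
    proof
      fix t assume "t \<in> ?N"
      then have "(t, x0) \<in> \<Omega>" using r(1,2) by (auto dest!: subsetD[where c = "(t, x0)"])
      then show "t \<in> fst ` \<Omega>" by force
    qed
    \<comment> \<open>T_t is a square, so the sign of \<tau> survives as the constant time component
      of the straightened field.\<close>
    define \<sigma> where "\<sigma> = sgn (\<tau> t0)"
    have \<sigma>: "\<sigma> * \<sigma> = 1" "\<sigma> \<noteq> 0" using tx0(2) by (auto simp: \<sigma>_def sgn_if)
    have pos: "\<sigma> * \<tau> t > 0" if "t \<in> ?N" for t
      using r(3)[OF that] tx0(2) by (auto simp: \<sigma>_def sgn_if zero_less_mult_iff split: if_splits)
    define y where "y t = sqrt (\<sigma> * \<tau> t)" for t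
    have N: "open ?N" by simp
    note s\<tau> = smooth_on_subset[OF s(1) NI] and s\<rho> = smooth_on_subset[OF \<rho>(1) NI]
    have sy: "smooth_on ?N y"
      unfolding y_def by (rule smooth_on_sqrt[OF N _ pos]) (intro smooth_on_mult smooth_on_const s\<tau> N, assumption)
    have y0: "y t > 0" and y2: "(y t)\<^sup>2 = \<sigma> * \<tau> t" if "t \<in> ?N" for t using pos[OF that] by (simp_all add: y_def)
    have yne: "y t \<noteq> 0" if "t \<in> ?N" for t using y0[OF that] by simp
    have \<tau>ne: "\<tau> t \<noteq> 0" if "t \<in> ?N" for t using pos[OF that] by auto
    \<comment> \<open>X0 = w is to solve \<tau> w' + \<rho> / y = 0, the x-free part of the
      condition that the new \<xi> vanishes.\<close>
    have "smooth_on ?N (\<lambda>t. - (\<rho> t / (\<tau> t * y t)))"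
      by (rule smooth_on_minus[OF N smooth_on_divide[OF N s\<rho> smooth_on_mult[OF N s\<tau> sy]]]) (use yne \<tau>ne in auto)
    then obtain w where w: "smooth_on ?N w" "\<And>t. t \<in> ?N \<Longrightarrow> (w has_real_derivative - (\<rho> t / (\<tau> t * y t))) (at t)"
      by (rule antiderivative) blast
    have \<tau>y: "\<tau> t / (y t)\<^sup>2 = \<sigma>" if "t \<in> ?N" for t
      unfolding y2[OF that] using \<tau>ne[OF that] \<sigma> by (simp add: field_simps)
    have \<xi>y: "\<tau> t * (deriv (\<lambda>t. 1 / y t) t * x + deriv w t) + \<xi> (t, x) / y t = 0" if tx: "(t, x) \<in> ?\<Omega>" for t x
    proof -
      have t: "t \<in> ?N" and tI: "t \<in> fst ` \<Omega>" using tx NI by auto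
      note dy = smooth_on_deriv(1)[OF N sy t]
      have y1: "2 * y t * deriv y t = \<sigma> * deriv \<tau> t"
      proof -
        have "((\<lambda>t. (y t)\<^sup>2) has_real_derivative 2 * y t * deriv y t) (at t)" using dy by (auto intro!: derivative_eq_intros)
        moreover have "((\<lambda>t. (y t)\<^sup>2) has_real_derivative \<sigma> * deriv \<tau> t) (at t)"
          by (rule has_field_derivative_transform_within_open[OF DERIV_cmult[OF d\<tau>(1)[OF tI]] N t]) (simp add: y2)
        ultimately show ?thesis by (rule DERIV_unique)
      qed
      have "deriv (\<lambda>t. 1 / y t) t = - deriv y t / (y t)\<^sup>2"
        by (rule DERIV_imp_deriv) (use dy yne[OF t] in \<open>auto intro!: derivative_eq_intros simp: power2_eq_square\<close>)
      then have "\<tau> t * deriv (\<lambda>t. 1 / y t) t = - (\<tau> t / (y t)\<^sup>2) * deriv y t" by simp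
      also have "\<dots> = - \<sigma> * deriv y t" unfolding \<tau>y[OF t] ..
      also have "\<dots> = - deriv \<tau> t / 2 / y t"
      proof -
        have "\<sigma> * deriv y t * (2 * y t) = deriv \<tau> t" using y1 \<sigma>(1) by algebra
        then show ?thesis using yne[OF t] by (simp add: field_simps)
      qed
      finally have 1: "\<tau> t * deriv (\<lambda>t. 1 / y t) t = - deriv \<tau> t / 2 / y t" .
      have 2: "\<tau> t * deriv w t = - \<rho> t / y t"
        unfolding DERIV_imp_deriv[OF w(2)[OF t]] using \<tau>ne[OF t] yne[OF t] by (simp add: field_simps)
      have "\<tau> t * (deriv (\<lambda>t. 1 / y t) t * x + deriv w t) = (\<tau> t * deriv (\<lambda>t. 1 / y t) t) * x + \<tau> t * deriv w t"
        by (simp only: distrib_left mult.assoc)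
      also have "\<dots> = - (deriv \<tau> t / 2 * x + \<rho> t) / y t" unfolding 1 2 by (simp add: add_divide_distrib diff_divide_distrib)
      finally show ?thesis using \<xi>[OF subsetD[OF r(2) tx]] by (simp add: add_divide_distrib[symmetric])
    qed
    show ?thesis
      by (rule straighten[OF lt r(2) sy w(1) yne \<sigma>(2)], assumption, intro disjI1 ballI conjI allI impI, rule \<tau>y, assumption, rule \<xi>y)
  next
    case False
    then have \<tau>0: "\<tau> t = 0" if "t \<in> fst ` \<Omega>" for t using that by blast
    have \<tau>1: "deriv \<tau> t = 0" if "t \<in> fst ` \<Omega>" for t
      by (rule DERIV_imp_deriv, rule has_field_derivative_transform_within_open[OF DERIV_const o(2) that]) (simp add: \<tau>0)
    have \<xi>0: "\<xi> (t, x) = \<rho> t" if "(t, x) \<in> \<Omega>" for t x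
    proof -
      have "t \<in> fst ` \<Omega>" using that by force
      then show ?thesis using \<xi>[OF that] \<tau>1 by simp
    qed
    obtain t0 x0 where tx: "z0 = (t0, x0)" by force
    have tx0: "(t0, x0) \<in> \<Omega>" using z0(1) tx by simp
    then have "t0 \<in> fst ` \<Omega>" by force
    then have \<rho>t0: "\<rho> t0 \<noteq> 0" using z0(2) \<tau>0[of t0] \<xi>0[OF tx0] tx by simp
    obtain r where r: "r > 0" "{t0-r<..<t0+r} \<times> {x0-r<..<x0+r} \<subseteq> \<Omega>" "\<And>t. t \<in> {t0-r<..<t0+r} \<Longrightarrow> \<rho> t * \<rho> t0 > 0"
      using near[OF tx0 \<rho>(1) \<rho>t0] by blast
    let ?N = "{t0-r<..<t0+r}" and ?\<Omega> = "{t0-r<..<t0+r} \<times> {x0-r<..<x0+r}"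
    have lt: "t0 - r < t0 + r" "x0 - r < x0 + r" using r(1) by auto
    have NI: "?N \<subseteq> fst ` \<Omega>"
    proof
      fix t assume "t \<in> ?N"
      then have "(t, x0) \<in> \<Omega>" using r(1,2) by (auto dest!: subsetD[where c = "(t, x0)"])
      then show "t \<in> fst ` \<Omega>" by force
    qed
    have \<rho>ne: "\<rho> t \<noteq> 0" if "t \<in> ?N" for t using r(3)[OF that] by auto
    have *: "\<forall>t\<in>?N. \<tau> t = 0 \<and> (\<forall>x. (t, x) \<in> ?\<Omega> \<longrightarrow> \<xi> (t, x) / \<rho> t = 1)"
    proof (intro ballI conjI allI impI)
      fix t x assume t: "t \<in> ?N"
      show "\<tau> t = 0" using \<tau>0 t NI by blast
      assume "(t, x) \<in> ?\<Omega>"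
      then have "\<xi> (t, x) = \<rho> t" using \<xi>0 r(2) by blast
      then show "\<xi> (t, x) / \<rho> t = 1" using \<rho>ne[OF t] by simp
    qed
    show ?thesis
      by (rule straighten[OF lt r(2) smooth_on_subset[OF \<rho>(1) NI] smooth_on_const[of _ 0] \<rho>ne one_neq_zero disjI2[OF *]])
  qed
qed

text \<open>An extension has a symmetry outside the span of the scaling of u, hence one with \<tau>
  or \<xi> nonzero at some point \<open>z0\<close>. The normalisation of A takes place on a box
  around \<open>z0\<close>, so that the image of this point witnesses that the transported symmetry
  is still nontrivial.\<close>

lemma reachable_extension:
  assumes \<Omega>: "is_domain \<Omega>" and ext: "is_ess_extension L \<epsilon> \<Omega> (A, B)"
  shows "reachable \<Omega> (A, B)"
proof -
  note o = is_domainD(1)[OF \<Omega>]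
  have mem: "(A, B) \<in> members L \<epsilon> \<Omega>" using ext by (simp add: is_ess_extension_def)
  note sAB = members_smooth[OF o mem] and A0 = members_nonzero[OF \<epsilon> mem]
  obtain Q where Q: "Q \<in> ess_algebra \<Omega> (equation L (A, B))" "Q \<notin> span {u_du \<Omega>}"
    using ext ess_kernel_eq[OF \<epsilon> \<Omega>, of L] by (auto simp: is_ess_extension_def)
  obtain \<tau> \<xi> \<eta> where Q': "Q = ess_field \<Omega> \<tau> \<xi> \<eta>" and det: "determining \<Omega> (equation L (A, B)) \<tau> \<xi> \<eta>"
    using Q(1) unfolding ess_algebra_eq[OF o] by blast
  have "\<exists>z\<in>\<Omega>. \<tau> (fst z) \<noteq> 0 \<or> \<xi> z \<noteq> 0"
  proof (rule ccontr)
    assume n: "\<not> (\<exists>z\<in>\<Omega>. \<tau> (fst z) \<noteq> 0 \<or> \<xi> z \<noteq> 0)"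
    obtain a b c where E: "equation L (A, B) = (a, b, c)" by (rule prod_cases3)
    have a: "a = A" using equation_smooth(1)[OF o sAB E] .
    obtain k where "ess_field \<Omega> \<tau> \<xi> \<eta> = k *\<^sub>R u_du \<Omega>"
      by (rule trivial_symmetry_constant[OF \<Omega> det[unfolded E]]) (use n A0 a in auto)
    then show False using Q(2) Q' unfolding span_singleton by blast
  qed
  then obtain z0 where z0: "z0 \<in> \<Omega>" "\<tau> (fst z0) \<noteq> 0 \<or> \<xi> z0 \<noteq> 0" by blast
  define s where "s = sgn (A z0)"
  have s: "s * s = 1" "s \<noteq> 0" "s * A z0 > 0" using A0[OF z0(1)] by (auto simp: s_def sgn_if)
  have "open (\<Omega> \<inter> (\<lambda>z. s * A z) -` {0<..})"
    by (rule continuous_open_preimage[OF _ o]) (intro continuous_on_mult continuous_on_const smooth_on_continuous[OF sAB(1)], simp)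
  moreover have "(fst z0, snd z0) \<in> \<Omega> \<inter> (\<lambda>z. s * A z) -` {0<..}" using z0(1) s(3) by simp
  ultimately obtain r where r: "r > 0" "{fst z0-r<..<fst z0+r} \<times> {snd z0-r<..<snd z0+r} \<subseteq> \<Omega> \<inter> (\<lambda>z. s * A z) -` {0<..}"
    using open_box_in by blast
  let ?\<Omega> = "{fst z0-r<..<fst z0+r} \<times> {snd z0-r<..<snd z0+r}"
  have sub: "?\<Omega> \<subseteq> \<Omega>" and pos: "\<And>z. z \<in> ?\<Omega> \<Longrightarrow> s * A z > 0" using r(2) by auto
  have lt: "fst z0 - r < fst z0 + r" "snd z0 - r < snd z0 + r" using r(1) by auto
  note box = box_domain[OF lt] note ob = is_domainD(1)[OF box(1)]
  note sAB' = smooth_on_subset[OF sAB(1) sub] smooth_on_subset[OF sAB(2) sub]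
  have "smooth_on ?\<Omega> (\<lambda>z. s * A z)" by (intro smooth_on_mult smooth_on_const sAB' ob)
  then have sq: "smooth_on ?\<Omega> (\<lambda>z. sqrt (s * A z))" by (rule smooth_on_sqrt[OF ob _ pos])
  have sf: "smooth_on ?\<Omega> (\<lambda>z. 1 / sqrt (s * A z))"
    by (rule smooth_on_divide[OF ob smooth_on_const sq]) (use pos in force)
  obtain X where X: "smooth_on ?\<Omega> X" "\<And>z. z \<in> ?\<Omega> \<Longrightarrow> Dx X z = 1 / sqrt (s * A z)"
    by (rule x_antiderivative[OF sf, where ?x0.0 = "snd z0"]) (use r(1) in auto)
  \<comment> \<open>X_x is chosen to give (X_x)^2 A = s, and the slope s \<epsilon> of T then turns
    A into \<epsilon>. Time is reversed when A and \<epsilon> differ in sign.\<close>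
  define T where "T t = s * \<epsilon> * t" for t
  have dT: "deriv T t = s * \<epsilon>" for t
    unfolding T_def[abs_def] by (rule DERIV_imp_deriv) (auto intro!: derivative_eq_intros)
  have inv_sqrt: "1 / sqrt q \<noteq> 0" "(1 / sqrt q)\<^sup>2 * q = 1" if "q > 0" for q :: real
    using that by (simp_all add: power_divide)
  have Xx: "Dx X z \<noteq> 0" "(Dx X z)\<^sup>2 * (s * A z) = 1" if "z \<in> ?\<Omega>" for z
    unfolding X(2)[OF that] by (rule inv_sqrt[OF pos[OF that]])+
  have F: "fibre_diffeo ?\<Omega> T X"
  proof
    show "smooth_on (fst ` ?\<Omega>) T" unfolding T_def box(2) by (intro smooth_on_mult smooth_on_const smooth_on_id) auto
    show "deriv T t \<noteq> 0" for t unfolding dT using s(2) \<epsilon> by auto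
  qed (use box(1) X Xx in auto)
  have "(Dx X z)\<^sup>2 * A z = \<epsilon> * deriv T (fst z)" if "z \<in> ?\<Omega>" for z
    unfolding dT using Xx(2)[OF that] s(1) e(3) by algebra
  from arb_map_construct[OF F sAB' this] obtain B' where B': "smooth_on (fibre_map T X ` ?\<Omega>) B'"
    and map: "arb_map (breve L) ?\<Omega> (A, B) (fibre_map T X ` ?\<Omega>) (\<lambda>_. \<epsilon>, B') T X" by blast
  obtain \<tau>' \<xi>' \<eta>' where det': "determining (fibre_map T X ` ?\<Omega>) (equation L (\<lambda>_. \<epsilon>, B')) \<tau>' \<xi>' \<eta>'"
    and \<tau>': "\<And>t. t \<in> fst ` ?\<Omega> \<Longrightarrow> \<tau>' (T t) = deriv T t * \<tau> t"
    and \<xi>': "\<And>z. z \<in> ?\<Omega> \<Longrightarrow> \<xi>' (fibre_map T X z) = \<tau> (fst z) * Dt X z + \<xi> z * Dx X z"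
    using push_symmetry[OF map sAB' smooth_on_const B' determining_subset[OF det sub]] by blast
  interpret F: fibre_diffeo ?\<Omega> T X by (rule F)
  have zb: "z0 \<in> ?\<Omega>" using r(1) by (cases z0) auto
  have "\<tau>' (fst (fibre_map T X z0)) \<noteq> 0 \<or> \<xi>' (fibre_map T X z0) \<noteq> 0"
  proof (cases "\<tau> (fst z0) = 0")
    case False
    have "fst z0 \<in> fst ` ?\<Omega>" using zb by blast
    then have "\<tau>' (T (fst z0)) \<noteq> 0" using \<tau>' F.T_ne False by simp
    then show ?thesis by (simp add: case_prod_unfold)
  next
    case True
    then show ?thesis using \<xi>'[OF zb] Xx(1)[OF zb] z0(2) by simp
  qed
  then have "reachable (fibre_map T X ` ?\<Omega>) (\<lambda>_. \<epsilon>, B')"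
    using reachable_constant_A[OF F.image_domain B' det'] zb by blast
  then have "reachable ?\<Omega> (A, B)"
    by (rule reachable_transport[OF map members_subset[OF mem sub] constant_A_member[OF \<epsilon> B']])
  then show ?thesis using reachable_mono sub by blast
qed

text \<open>The witness is the field with \<open>k1\<close> = 1, the gauged time translation; linear
  independence of the basic fields keeps it out of the kernel.\<close>

lemma case_extension:
  assumes p: "p \<in> listed_potentials \<C>" and U: "(\<Omega>, U) \<in> \<U> p"
  shows "is_ess_extension L \<epsilon> \<Omega> (case_elements L \<epsilon> U)"
proof -
  note U' = listed_solution[OF p U] and v = listed_valid[OF p]
  note \<Omega> = nonzero_solutionsD(1)[OF U']
  let ?Q = "general_field L \<epsilon> \<Omega> U 0 1 0 0 0 0"
  have "?Q \<in> ess_algebra \<Omega> (equation L (case_elements L \<epsilon> U))"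
  proof -
    have "admissible_coefficients p 0 0 0 0" by (simp add: admissible_coefficients_def)
    then show ?thesis unfolding case_algebra[OF \<epsilon> U' v] by blast
  qed
  moreover have "?Q \<notin> ess_kernel L \<epsilon> \<Omega>"
  proof
    assume "?Q \<in> ess_kernel L \<epsilon> \<Omega>"
    then obtain k where "?Q = k *\<^sub>R u_du \<Omega>" unfolding ess_kernel_eq[OF \<epsilon> \<Omega>] span_singleton by blast
    moreover have "general_field L \<epsilon> \<Omega> U (- k) 1 0 0 0 0 = ?Q - k *\<^sub>R u_du \<Omega>"
      unfolding general_field_eq[OF \<epsilon>] by simp
    ultimately have "general_field L \<epsilon> \<Omega> U (- k) 1 0 0 0 0 = 0" by simp
    from general_field_zero(2)[OF \<Omega> this] show False by simp
  qed
  moreover have "ess_kernel L \<epsilon> \<Omega> \<subseteq> ess_algebra \<Omega> (equation L (case_elements L \<epsilon> U))"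
    using listed_member[OF p U] unfolding ess_kernel_def by blast
  ultimately show ?thesis unfolding is_ess_extension_def using listed_member[OF p U] by blast
qed

text \<open>The potentials are identified before the solutions, because equivalence of solutions is
  defined for one fixed potential.\<close>

lemma cases_inequivalent:
  assumes p: "p \<in> listed_potentials \<C>" and U: "(\<Omega>, U) \<in> \<U> p" and p': "p' \<in> listed_potentials \<C>" and U': "(\<Omega>', U') \<in> \<U> p'"
    and eq: "arb_equiv L \<Omega> (case_elements L \<epsilon> U) \<Omega>' (case_elements L \<epsilon> U')"
  shows "p = p' \<and> \<Omega> = \<Omega>' \<and> U = U'"
proof -
  note S = listed_solution[OF p U] and S' = listed_solution[OF p' U']
  obtain T X where map: "arb_map (breve L) \<Omega> (case_elements L \<epsilon> U) \<Omega>' (case_elements L \<epsilon> U') T X"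
    using arb_equiv_imp_map[OF \<epsilon> nonzero_solutionsD(1)[OF S] listed_member[OF p U, unfolded case_elements_def]
        listed_member[OF p' U', unfolded case_elements_def] eq[unfolded case_elements_def]]
    unfolding case_elements_def by blast
  have pp: "p = p'"
  proof (cases "(\<exists>J C. p = General J C) \<or> (\<exists>J C. p' = General J C)")
    case True
    obtain J C J' C' where g: "p = General J C" "p' = General J' C'" "potential_equiv (J, C) (J', C')"
      by (rule general_inequivalent[OF \<epsilon> listed_valid[OF p] listed_valid[OF p'] S S' map True])
    then have "(J, C) \<in> \<C>" "(J', C') \<in> \<C>" using p p' by (auto simp: listed_potentials_def)
    then have "(J, C) = (J', C')" using g(3) C_complete unfolding complete_inequivalent_def by blast
    then show ?thesis using g by simp
  next
    case False
    show ?thesis by (rule nongeneral_inequivalent[OF \<epsilon> listed_valid[OF p] listed_valid[OF p'] S S' map]) (use False in blast)+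
  qed
  have "solution_equiv L \<epsilon> p (\<Omega>, U) (\<Omega>', U')"
    by (rule same_potential_solution_equiv[OF \<epsilon> S S'[folded pp] map])
  then have "(\<Omega>, U) = (\<Omega>', U')"
    using U_complete[OF p] U U'[folded pp] unfolding complete_inequivalent_def by blast
  then show ?thesis using pp by simp
qed

end

theorem theorem46:
  fixes L :: eqclass and \<epsilon> :: real
    and \<C> :: "(real set \<times> (real \<Rightarrow> real)) set"
    and \<U> :: "potential \<Rightarrow> (dom \<times> fld) set"
  assumes "\<epsilon> \<in> {-1, 1}"
    and "complete_inequivalent potential_equiv general_potentials \<C>"
    and "\<And>p. p \<in> listed_potentials \<C> \<Longrightarrow>
           complete_inequivalent (solution_equiv L \<epsilon> p) (nonzero_solutions L \<epsilon> p) (\<U> p)"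
  shows
    "(\<forall>\<Omega>. is_domain \<Omega> \<longrightarrow> ess_kernel L \<epsilon> \<Omega> = span {u_du \<Omega>}) \<and>
     (\<forall>p \<Omega> U. p \<in> listed_potentials \<C> \<and> (\<Omega>, U) \<in> \<U> p \<longrightarrow>
        is_ess_extension L \<epsilon> \<Omega> (case_elements L \<epsilon> U) \<and>
        is_basis (u_du \<Omega> # case_fields L \<epsilon> \<Omega> U p)
          (ess_algebra \<Omega> (equation L (case_elements L \<epsilon> U)))) \<and>
     (\<forall>\<Omega> A B. is_domain \<Omega> \<and> is_ess_extension L \<epsilon> \<Omega> (A, B) \<longrightarrow>
        (\<exists>\<Omega>\<^sub>1 p \<Omega>\<^sub>2 U. is_domain \<Omega>\<^sub>1 \<and> \<Omega>\<^sub>1 \<subseteq> \<Omega> \<and>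
           p \<in> listed_potentials \<C> \<and> (\<Omega>\<^sub>2, U) \<in> \<U> p \<and>
           arb_equiv L \<Omega>\<^sub>1 (A, B) \<Omega>\<^sub>2 (case_elements L \<epsilon> U))) \<and>
     (\<forall>p \<Omega> U p' \<Omega>' U'. p \<in> listed_potentials \<C> \<and> (\<Omega>, U) \<in> \<U> p \<and>
        p' \<in> listed_potentials \<C> \<and> (\<Omega>', U') \<in> \<U> p' \<and>
        arb_equiv L \<Omega> (case_elements L \<epsilon> U) \<Omega>' (case_elements L \<epsilon> U') \<longrightarrow>
        p = p' \<and> \<Omega> = \<Omega>' \<and> U = U')"
proof -
  interpret classification L \<epsilon> \<C> \<U> by unfold_locales (use assms in auto)
  show ?thesis
    using ess_kernel_eq[OF \<epsilon>] case_extension case_basis[OF \<epsilon> listed_solution listed_valid]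
      reachable_extension[unfolded reachable_def] cases_inequivalent
    by blast
qed

end
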